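(* Let $G$ be a virtual spatial graph, let $D$ be a diagram of $G$, and let $\overline{R}(G;\alpha,x)=(-\alpha)^{-m}R(D;\alpha,x)$, where $m$ is the minimum degree of $\alpha$ in the generalized Yamada polynomial $R(D;\alpha,x)$. Then $\overline{R}(G;\alpha,x)$ is a rigid vertex isotopy invariant. Moreover, when the maximum degree of $G$ is at most $3$, $\overline{R}(G;\alpha,x)$ is a pliable vertex isotopy invariant.
   Context: **Diagrams.** A virtual spatial graph diagram is a finite graph (loops, multiple edges and circle components without vertices allowed) generically immersed in $\mathbb{R}^2$ whose transverse double points are each labeled as a classical crossing (with over/under information) or a virtual crossing (drawn encircled; no over/under information). **Moves.** (I), (II), (III): the classical Reidemeister moves. (IV): a strand is passed over, or under, a vertex (crossing classically all half-edges on one side of it versus all those on the other side). (V): rigid vertex flip: the $n$ half-edges at a vertex, drawn as a parallel bundle leaving the vertex to one side, receive a positive or negative classical half-twist of the whole bundle. (VI): two cyclically adjacent half-edges at a vertex are interchanged by introducing a classical crossing between them near the vertex. (I* ), (II* ), (III* ): the analogues of (I)–(III) with all crossings virtual. (IV* ): the mixed Reidemeister III move in which a strand having two virtual crossings is moved across a classical crossing. (V* ): a strand crossing virtually is passed across a vertex. Rigid vertex isotopy is generated by (I)–(V) and (I* )–(V* ); pliable vertex isotopy by (I)–(VI) and (I* )–(V* ). A virtual spatial graph is here a rigid vertex (respectively pliable vertex) isotopy class of diagrams. A quantity defined from a diagram is an invariant if it is unchanged under these moves. **Generalized Yamada polynomial.** A cyclic graph is an abstract graph with a cyclic ordering of the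 half-edges at each vertex; it determines an orientable ribbon graph (a disk for each vertex, with untwisted bands attached in the given cyclic orders). A diagram without classical crossings is regarded as a cyclic graph, with cyclic orders given by the orientation of the plane and virtual crossings ignored. Let $k$ be the number of connected components and $bc$ the number of boundary components of the associated ribbon graph. At a classical crossing, $s_+$ is the A-smoothing (joining the two regions swept out by rotating the over-strand counterclockwise until it meets the under-strand), $s_-$ is the other smoothing, and $s_0$ is the replacement of the crossing by a 4-valent vertex. The polynomial $R(D)=R(D;\alpha,x)\in\mathbb{Z}[\alpha^{\pm1},x^{\pm1}]$ is determined by: (1) absorbing or inserting degree-2 vertices on edges or circle components does not change $R$; (2) $R(D)=\alpha R(D_{s_+})+\alpha^{-1}R(D_{s_-})+x^{-1}R(D_{s_0})$ for the three replacements at any classical crossing; (3) for an unmarked edge $e$ carrying no classical crossings, $R(D)=x\,R(D-e)+R(D(\overline e))$, where $D-e$ is deletion of $e$ and $D(\overline e)$ is $D$ with $e$ kept and marked; (4) if $D$ is a cyclic graph all of whose edges are marked, then $R(D)=(-x)^{bc(D)-2k(D)}(\alpha+\alpha^{-1}+2)^{bc(D)-k(D)}$; in particular $n$ isolated vertices have value $(-x)^{-n}$, and $R(\emptyset)=1$. The minimum degree of $\alpha$ in $R(D;\alpha,x)$ is the lowest exponent of $\alpha$ when $R$ is viewed as a Laurent polynomial in $\alpha$ with coefficients in $\mathbb{Z}[x^{\pm1}]$. Convention: if $R(D;\alpha,x)=0$ then $\overline R(G;\alpha,x)=0$. *)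

theory Defs
  imports "HOL-Library.Poly_Mapping" "HOL-Library.Product_Plus"
begin

section \<open>Diagrams\<close>

text \<open>
  A diagram in the plane is recorded in general position with respect to the height function: it is
  read from bottom to top as a list of layers, each containing one elementary piece, while all other
  strands run vertically. The first number of a piece is the number of strands passing to its left;
  strands at every height are numbered from left to right, starting with 0.

  In \<open>Vertex i m n\<close> the vertex has \<open>m\<close> half-edges leaving downwards and \<open>n\<close> leaving upwards.
  \<open>Mark i\<close> is not part of a diagram as such; it is a dot on a strand, recording that the edge
  containing this strand is marked.

  The over-strand runs from lower left to upper right at a \<open>Rising\<close> crossing and from lower right
  to upper left at a \<open>Falling\<close> crossing.
\<close>

datatype crossing = Rising | Falling | Virtual

datatype layer =
    Cup nat
  | Cap nat
  | Cross crossing nat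
  | Vertex nat nat nat
  | Mark nat

fun offset :: "layer \<Rightarrow> nat" where
  "offset (Cup i) = i"
| "offset (Cap i) = i"
| "offset (Cross c i) = i"
| "offset (Vertex i m n) = i"
| "offset (Mark i) = i"

fun ins :: "layer \<Rightarrow> nat" where
  "ins (Cup i) = 0"
| "ins (Cap i) = 2"
| "ins (Cross c i) = 2"
| "ins (Vertex i m n) = m"
| "ins (Mark i) = 1"

fun outs :: "layer \<Rightarrow> nat" where
  "outs (Cup i) = 2"
| "outs (Cap i) = 0"
| "outs (Cross c i) = 2"
| "outs (Vertex i m n) = n"
| "outs (Mark i) = 1"

fun place :: "nat \<Rightarrow> layer \<Rightarrow> layer" where
  "place j (Cup i) = Cup j"
| "place j (Cap i) = Cap j"
| "place j (Cross c i) = Cross c j"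
| "place j (Vertex i m n) = Vertex j m n"
| "place j (Mark i) = Mark j"

definition shift :: "nat \<Rightarrow> layer list \<Rightarrow> layer list" where
  "shift d = map (\<lambda>l. place (d + offset l) l)"

definition width :: "layer list \<Rightarrow> nat" where
  "width w = foldl (\<lambda>n l. n - ins l + outs l) 0 w"

definition planar_word :: "layer list \<Rightarrow> bool" where
  "planar_word D \<longleftrightarrow>
     (\<forall>t<length D. offset (D ! t) + ins (D ! t) \<le> width (take t D)) \<and> width D = 0"

definition diagram :: "layer list \<Rightarrow> bool" where
  "diagram D \<longleftrightarrow> planar_word D \<and> (\<forall>i. Mark i \<notin> set D)"

definition max_degree :: "layer list \<Rightarrow> nat" where
  "max_degree D = Max (insert 0 {m + n | i m n. Vertex i m n \<in> set D})"


section \<open>Moves\<close>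

text \<open>
  A quarter turn of the plane exchanges the two classical crossing types; at the same time, for
  classical \<open>c\<close>, the crossing \<open>turn c\<close> is \<open>c\<close> with over and under exchanged.
\<close>

fun turn :: "crossing \<Rightarrow> crossing" where
  "turn Rising = Falling"
| "turn Falling = Rising"
| "turn Virtual = Virtual"

text \<open>
  \<open>sweep_right c n\<close> moves the leftmost strand across the \<open>n\<close> strands to its right, with all crossings
  of type \<open>c\<close> (so it is over all of them, under all of them, or virtual); \<open>sweep_left c n\<close> moves
  strand number \<open>n\<close> across the \<open>n\<close> strands to its left. In \<open>half_twist c n\<close> any two of the \<open>n\<close> strands
  cross exactly once.
\<close>

definition sweep_right :: "crossing \<Rightarrow> nat \<Rightarrow> layer list" where
  "sweep_right c n = map (Cross c) [0..<n]"

definition sweep_left :: "crossing \<Rightarrow> nat \<Rightarrow> layer list" where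
  "sweep_left c n = map (Cross c) (rev [0..<n])"

fun half_twist :: "crossing \<Rightarrow> nat \<Rightarrow> layer list" where
  "half_twist c 0 = []"
| "half_twist c (Suc n) = sweep_right c n @ half_twist c n"

text \<open>
  Planar isotopy: the changes of the list of layers while a plane diagram moves by an isotopy are an
  exchange of the heights of two distant pieces, the birth or death of a maximum together with a
  minimum, and the passage of a strand at a crossing, or of a half-edge at a vertex, through the
  horizontal direction.
\<close>

inductive planar_move :: "layer list \<Rightarrow> layer list \<Rightarrow> bool" where
  heights: "offset A + outs A \<le> offset B \<Longrightarrow>
    planar_move [A, B] [place (offset B - outs A + ins A) B, A]"
| zigzag_left: "planar_move [Cup 0, Cap 1] []"
| zigzag_right: "planar_move [Cup 1, Cap 0] []"
| turn_crossing_left: "planar_move [Cup 0, Cross c 1, Cap 2] [Cross (turn c) 0]"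
| turn_crossing_right: "planar_move [Cup 2, Cross c 1, Cap 0] [Cross (turn c) 0]"
| turn_half_edge_left: "planar_move [Cup 0, Vertex 1 (Suc m) n] [Vertex 0 m (Suc n)]"
| turn_half_edge_right: "planar_move [Cup m, Vertex 0 (Suc m) n] [Vertex 0 m (Suc n)]"

text \<open>
  In the third Reidemeister move the strands \<open>1, 2, 3\<close>, numbered from the left at the bottom, cross
  in the order \<open>12, 13, 23\<close> on one side and \<open>23, 13, 12\<close> on the other. The side condition of
  \<open>III\<close> excludes precisely the two triples in which the strands lie cyclically above each other.
\<close>

inductive rigid_move :: "layer list \<Rightarrow> layer list \<Rightarrow> bool" where
  planar: "planar_move T T' \<Longrightarrow> rigid_move T T'"
| I_right: "c \<noteq> Virtual \<Longrightarrow> rigid_move [Cup 1, Cross c 0, Cap 1] []"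
| I_left: "c \<noteq> Virtual \<Longrightarrow> rigid_move [Cup 0, Cross c 1, Cap 0] []"
| II: "c \<noteq> Virtual \<Longrightarrow> rigid_move [Cross c 0, Cross (turn c) 0] []"
| III: "\<lbrakk>a \<noteq> Virtual; b \<noteq> Virtual; c \<noteq> Virtual; a = b \<or> b = c\<rbrakk> \<Longrightarrow>
    rigid_move [Cross a 0, Cross b 1, Cross c 0] [Cross c 1, Cross b 0, Cross a 1]"
| IV_right: "c \<noteq> Virtual \<Longrightarrow>
    rigid_move (sweep_right c m @ [Vertex 0 m n]) (Vertex 1 m n # sweep_right c n)"
| IV_left: "c \<noteq> Virtual \<Longrightarrow>
    rigid_move (sweep_left c m @ [Vertex 1 m n]) (Vertex 0 m n # sweep_left c n)"
| V: "c \<noteq> Virtual \<Longrightarrow> rigid_move (Vertex 0 0 n # half_twist c n) [Vertex 0 0 n]"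
| I_star_right: "rigid_move [Cup 1, Cross Virtual 0, Cap 1] []"
| I_star_left: "rigid_move [Cup 0, Cross Virtual 1, Cap 0] []"
| II_star: "rigid_move [Cross Virtual 0, Cross Virtual 0] []"
| III_star: "rigid_move [Cross Virtual 0, Cross Virtual 1, Cross Virtual 0]
    [Cross Virtual 1, Cross Virtual 0, Cross Virtual 1]"
| IV_star_1: "c \<noteq> Virtual \<Longrightarrow> rigid_move [Cross Virtual 0, Cross Virtual 1, Cross c 0]
    [Cross c 1, Cross Virtual 0, Cross Virtual 1]"
| IV_star_2: "c \<noteq> Virtual \<Longrightarrow> rigid_move [Cross Virtual 0, Cross c 1, Cross Virtual 0]
    [Cross Virtual 1, Cross c 0, Cross Virtual 1]"
| IV_star_3: "c \<noteq> Virtual \<Longrightarrow> rigid_move [Cross c 0, Cross Virtual 1, Cross Virtual 0]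
    [Cross Virtual 1, Cross Virtual 0, Cross c 1]"
| V_star_right: "rigid_move (sweep_right Virtual m @ [Vertex 0 m n])
    (Vertex 1 m n # sweep_right Virtual n)"
| V_star_left: "rigid_move (sweep_left Virtual m @ [Vertex 1 m n])
    (Vertex 0 m n # sweep_left Virtual n)"

inductive pliable_move :: "layer list \<Rightarrow> layer list \<Rightarrow> bool" where
  rigid: "rigid_move T T' \<Longrightarrow> pliable_move T T'"
| VI: "\<lbrakk>c \<noteq> Virtual; Suc j < n\<rbrakk> \<Longrightarrow> pliable_move [Vertex 0 m n, Cross c j] [Vertex 0 m n]"

definition locally ::
  "(layer list \<Rightarrow> layer list \<Rightarrow> bool) \<Rightarrow> layer list \<Rightarrow> layer list \<Rightarrow> bool" where
  "locally r D D' \<longleftrightarrow> diagram D \<and> diagram D' \<and>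
     (\<exists>u v d T T'. r T T' \<and> D = u @ shift d T @ v \<and> D' = u @ shift d T' @ v)"

definition rigid_isotopic :: "layer list \<Rightarrow> layer list \<Rightarrow> bool" where
  "rigid_isotopic = equivclp (locally rigid_move)"

definition pliable_isotopic :: "layer list \<Rightarrow> layer list \<Rightarrow> bool" where
  "pliable_isotopic = equivclp (locally pliable_move)"

definition rigid_virtual_spatial_graphs :: "layer list set set" where
  "rigid_virtual_spatial_graphs = Collect diagram // {(D, D'). rigid_isotopic D D'}"

definition pliable_virtual_spatial_graphs :: "layer list set set" where
  "pliable_virtual_spatial_graphs = Collect diagram // {(D, D'). pliable_isotopic D D'}"


section \<open>Cyclic graphs\<close>

text \<open>
  The half-edges at \<open>v\<close> are \<open>(v, 0), \<dots>, (v, degree G v - 1)\<close> in counterclockwise order, and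
  \<open>joined\<close> relates the two half-edges of each edge.
\<close>

record cyclic_graph =
  vertices :: "nat set"
  degree :: "nat \<Rightarrow> nat"
  joined :: "nat \<times> nat \<Rightarrow> nat \<times> nat \<Rightarrow> bool"

definition half_edges :: "cyclic_graph \<Rightarrow> (nat \<times> nat) set" where
  "half_edges G = {(v, j). v \<in> vertices G \<and> j < degree G v}"

definition num_classes :: "'a set \<Rightarrow> ('a \<Rightarrow> 'a \<Rightarrow> bool) \<Rightarrow> nat" where
  "num_classes A r = card ((\<lambda>x. Collect (equivclp r x)) ` A)"

definition components :: "cyclic_graph \<Rightarrow> nat" where
  "components G = num_classes (vertices G) (\<lambda>v v'. \<exists>j j'. joined G (v, j) (v', j'))"

text \<open>
  The boundary of the ribbon graph, followed along one side of the band that leaves through the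
  half-edge \<open>h\<close>, comes to a vertex disk at the other half-edge of that band, runs along this disk to
  the next half-edge in the cyclic order, and leaves through it. The disk of an isolated vertex has
  one boundary component.
\<close>

inductive boundary_step :: "cyclic_graph \<Rightarrow> nat \<times> nat \<Rightarrow> nat \<times> nat \<Rightarrow> bool" for G where
  "joined G h (v, j) \<Longrightarrow> boundary_step G h (v, Suc j mod degree G v)"

definition boundary_components :: "cyclic_graph \<Rightarrow> nat" where
  "boundary_components G =
     num_classes (half_edges G) (boundary_step G) + card {v \<in> vertices G. degree G v = 0}"


section \<open>Edges of a diagram\<close>

text \<open>
  The point \<open>(t, p)\<close> is strand number \<open>p\<close> at the height between layers \<open>t - 1\<close> and \<open>t\<close>. The edges
  (and circle components) are the classes of points under running along strands, straight through
  crossings and up to the vertices.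
\<close>

definition points :: "layer list \<Rightarrow> (nat \<times> nat) set" where
  "points D = {(t, p). t \<le> length D \<and> p < width (take t D)}"

inductive strand :: "layer list \<Rightarrow> nat \<times> nat \<Rightarrow> nat \<times> nat \<Rightarrow> bool" for D where
  left: "\<lbrakk>t < length D; p < offset (D ! t)\<rbrakk> \<Longrightarrow> strand D (t, p) (Suc t, p)"
| right: "\<lbrakk>t < length D; offset (D ! t) + ins (D ! t) \<le> p; p < width (take t D)\<rbrakk> \<Longrightarrow>
    strand D (t, p) (Suc t, p - ins (D ! t) + outs (D ! t))"
| cup: "\<lbrakk>t < length D; D ! t = Cup i\<rbrakk> \<Longrightarrow> strand D (Suc t, i) (Suc t, Suc i)"
| cap: "\<lbrakk>t < length D; D ! t = Cap i\<rbrakk> \<Longrightarrow> strand D (t, i) (t, Suc i)"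
| cross_rising: "\<lbrakk>t < length D; D ! t = Cross c i\<rbrakk> \<Longrightarrow> strand D (t, i) (Suc t, Suc i)"
| cross_falling: "\<lbrakk>t < length D; D ! t = Cross c i\<rbrakk> \<Longrightarrow> strand D (t, Suc i) (Suc t, i)"
| mark: "\<lbrakk>t < length D; D ! t = Mark i\<rbrakk> \<Longrightarrow> strand D (t, i) (Suc t, i)"

definition same_edge :: "layer list \<Rightarrow> nat \<times> nat \<Rightarrow> nat \<times> nat \<Rightarrow> bool" where
  "same_edge D = equivclp (strand D)"

text \<open>
  A vertex is named by the number of its layer. Its half-edges are numbered counterclockwise: those
  leaving downwards from left to right, then those leaving upwards from right to left.
\<close>

definition leg :: "layer list \<Rightarrow> nat \<times> nat \<Rightarrow> nat \<times> nat" where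
  "leg D = (\<lambda>(t, j). if j < ins (D ! t) then (t, offset (D ! t) + j)
     else (Suc t, offset (D ! t) + (ins (D ! t) + outs (D ! t) - 1 - j)))"

definition diagram_vertices :: "layer list \<Rightarrow> nat set" where
  "diagram_vertices D = {t. t < length D \<and> (\<exists>i m n. D ! t = Vertex i m n)}"

definition diagram_half_edges :: "layer list \<Rightarrow> (nat \<times> nat) set" where
  "diagram_half_edges D = {(t, j). t \<in> diagram_vertices D \<and> j < ins (D ! t) + outs (D ! t)}"

definition cyclic_graph_of :: "layer list \<Rightarrow> cyclic_graph" where
  "cyclic_graph_of D =
     \<lparr>vertices = diagram_vertices D,
      degree = (\<lambda>t. ins (D ! t) + outs (D ! t)),
      joined = (\<lambda>h h'. h \<in> diagram_half_edges D \<and> h' \<in> diagram_half_edges D \<and> h \<noteq> h' \<and>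
        same_edge D (leg D h) (leg D h'))\<rparr>"

definition on_circle :: "layer list \<Rightarrow> nat \<times> nat \<Rightarrow> bool" where
  "on_circle D P \<longleftrightarrow> (\<forall>h \<in> diagram_half_edges D. \<not> same_edge D P (leg D h))"

definition marked :: "layer list \<Rightarrow> nat \<times> nat \<Rightarrow> bool" where
  "marked D P \<longleftrightarrow> (\<exists>t i. t < length D \<and> D ! t = Mark i \<and> same_edge D P (t, i))"

definition carries_classical :: "layer list \<Rightarrow> nat \<times> nat \<Rightarrow> bool" where
  "carries_classical D P \<longleftrightarrow> (\<exists>t c i. t < length D \<and> D ! t = Cross c i \<and> c \<noteq> Virtual \<and>
     (same_edge D P (t, i) \<or> same_edge D P (t, Suc i)))"

definition marked_diagram :: "layer list \<Rightarrow> bool" where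
  "marked_diagram D \<longleftrightarrow>
     planar_word D \<and> (\<forall>P \<in> points D. marked D P \<longrightarrow> \<not> carries_classical D P)"

text \<open>
  \<open>delete_layers S t w\<close> erases the points in \<open>S\<close> from the layers \<open>w\<close>, the first of which has number
  \<open>t\<close>. A crossing disappears as soon as one of its strands is erased.
\<close>

definition surviving :: "(nat \<times> nat) set \<Rightarrow> nat \<Rightarrow> nat set \<Rightarrow> nat" where
  "surviving S t A = card {p \<in> A. (t, p) \<notin> S}"

fun delete_layer :: "(nat \<times> nat) set \<Rightarrow> nat \<Rightarrow> layer \<Rightarrow> layer list" where
  "delete_layer S t (Cup i) = (if (Suc t, i) \<in> S then [] else [Cup (surviving S t {..<i})])"
| "delete_layer S t (Cap i) = (if (t, i) \<in> S then [] else [Cap (surviving S t {..<i})])"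
| "delete_layer S t (Cross c i) =
     (if (t, i) \<in> S \<or> (t, Suc i) \<in> S then [] else [Cross c (surviving S t {..<i})])"
| "delete_layer S t (Vertex i m n) =
     [Vertex (surviving S t {..<i}) (surviving S t {i..<i + m}) (surviving S (Suc t) {i..<i + n})]"
| "delete_layer S t (Mark i) = (if (t, i) \<in> S then [] else [Mark (surviving S t {..<i})])"

fun delete_layers :: "(nat \<times> nat) set \<Rightarrow> nat \<Rightarrow> layer list \<Rightarrow> layer list" where
  "delete_layers S t [] = []"
| "delete_layers S t (l # w) = delete_layer S t l @ delete_layers S (Suc t) w"

definition delete_edge :: "nat \<times> nat \<Rightarrow> layer list \<Rightarrow> layer list" where
  "delete_edge P D = delete_layers (Collect (same_edge D P)) 0 D"


section \<open>The generalized Yamada polynomial\<close>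

text \<open>
  Laurent polynomials in \<open>\<alpha>\<close> and \<open>x\<close> with integer coefficients are the group ring of
  \<open>\<int> \<times> \<int>\<close>; the exponent pair \<open>(a, b)\<close> stands for \<open>\<alpha>\<^sup>a x\<^sup>b\<close>.
\<close>

type_synonym laurent = "(int \<times> int) \<Rightarrow>\<^sub>0 int"

definition monomial :: "int \<Rightarrow> int \<Rightarrow> laurent" where
  "monomial a b = Poly_Mapping.single (a, b) 1"

definition neg_alpha_power :: "int \<Rightarrow> laurent" where
  "neg_alpha_power a = (if even a then monomial a 0 else - monomial a 0)"

definition neg_x_power :: "int \<Rightarrow> laurent" where
  "neg_x_power b = (if even b then monomial 0 b else - monomial 0 b)"

text \<open>
  Rotating the over-strand of a rising crossing counterclockwise sweeps out the regions above and
  below the crossing, so that the A-smoothing consists of two vertical strands. At a falling crossing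
  the regions to the left and to the right are swept out.
\<close>

fun A_smoothing :: "crossing \<Rightarrow> nat \<Rightarrow> layer list" where
  "A_smoothing Rising i = []"
| "A_smoothing Falling i = [Cap i, Cup i]"
| "A_smoothing Virtual i = [Cross Virtual i]"

fun B_smoothing :: "crossing \<Rightarrow> nat \<Rightarrow> layer list" where
  "B_smoothing Rising i = [Cap i, Cup i]"
| "B_smoothing Falling i = []"
| "B_smoothing Virtual i = [Cross Virtual i]"

text \<open>
  The four rules below are required on diagrams with marked edges; marked edges carry no classical
  crossings. A vertex of degree 2 is absorbed when the two half-edges at it are both marked or both
  unmarked. The rules for edges are not applied to circle components (without vertices), which are
  turned into loops by the first rule. In the last rule the number of boundary components is at least
  the number of components, so that the subtraction of natural numbers is not truncated.

  The last condition only fixes the (irrelevant) value on lists of layers that are not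
  diagrams.
\<close>

definition yamada_rules :: "(layer list \<Rightarrow> laurent) \<Rightarrow> bool" where
  "yamada_rules R \<longleftrightarrow>
     (\<forall>u v i T T'.
        (T, T') \<in> {([Vertex i 1 1], []), ([Vertex i 0 2], [Cup i]), ([Vertex i 2 0], [Cap i])} \<longrightarrow>
        marked_diagram (u @ T @ v) \<longrightarrow> marked_diagram (u @ T' @ v) \<longrightarrow>
        marked (u @ T @ v) (leg (u @ T @ v) (length u, 0)) =
          marked (u @ T @ v) (leg (u @ T @ v) (length u, 1)) \<longrightarrow>
        R (u @ T @ v) = R (u @ T' @ v)) \<and>
     (\<forall>u v c i.
        c \<noteq> Virtual \<longrightarrow> marked_diagram (u @ [Cross c i] @ v) \<longrightarrow>
        R (u @ [Cross c i] @ v) =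
          monomial 1 0 * R (u @ A_smoothing c i @ v)
          + monomial (- 1) 0 * R (u @ B_smoothing c i @ v)
          + monomial 0 (- 1) * R (u @ [Vertex i 2 2] @ v)) \<and>
     (\<forall>u v i.
        marked_diagram (u @ v) \<longrightarrow> (length u, i) \<in> points (u @ v) \<longrightarrow>
        \<not> on_circle (u @ v) (length u, i) \<longrightarrow>
        \<not> marked (u @ v) (length u, i) \<longrightarrow> \<not> carries_classical (u @ v) (length u, i) \<longrightarrow>
        R (u @ v) =
          monomial 0 1 * R (delete_edge (length u, i) (u @ v)) + R (u @ [Mark i] @ v)) \<and>
     (\<forall>D bc k.
        marked_diagram D \<longrightarrow> (\<forall>c i. Cross c i \<in> set D \<longrightarrow> c = Virtual) \<longrightarrow>
        (\<forall>P \<in> points D. marked D P \<and> \<not> on_circle D P) \<longrightarrow>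
        bc = boundary_components (cyclic_graph_of D) \<longrightarrow> k = components (cyclic_graph_of D) \<longrightarrow>
        R D = neg_x_power (int bc - 2 * int k)
          * (monomial 1 0 + monomial (- 1) 0 + 2) ^ (bc - k)) \<and>
     (\<forall>D. \<not> marked_diagram D \<longrightarrow> R D = 0)"

definition yamada :: "layer list \<Rightarrow> laurent" where
  "yamada = (THE R. yamada_rules R)"

definition min_degree :: "laurent \<Rightarrow> int" where
  "min_degree p = Min (fst ` Poly_Mapping.keys p)"

definition normalized_yamada :: "layer list \<Rightarrow> laurent" where
  "normalized_yamada D =
     (if yamada D = 0 then 0
      else neg_alpha_power (- min_degree (yamada D)) * yamada D)"

end

theory Submission
  imports Complex_Main "HOL-Library.FuncSet" Defs
begin

text \<open>
  Up to powers of \<open>- \<alpha>\<close> the polynomial is unchanged under the moves because, at infinitely many values of its variables, it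
  is a sum over colourings of the edges for which the moves are identities between traces.

  Let \<open>A\<close> be a direct sum of \<open>q\<close> algebras of matrices of size \<open>n\<close>, with an orthonormal basis for its trace form that
  contains the element \<open>e = \<kappa> * 1\<close>; such a basis exists by \<open>matrix_model_exists\<close>. An unmarked edge is coloured by
  the basis elements other than \<open>e\<close>, a marked edge by all of them. A vertex has as weight the trace of the product of the colours
  around it, a virtual crossing exchanges colours, and the weight of a classical crossing is the combination of its three replacements
  in the skein relation. For \<open>x = - 1 / (q * n) = - \<kappa>\<^sup>2\<close> and
  \<open>\<alpha> + 1 / \<alpha> + 2 = q * n\<^sup>2\<close> the sum \<open>F D\<close> of the weights of all colourings satisfies the rules. The skein
  relation holds by definition (\<open>F_skein\<close>), a vertex of degree two by orthonormality, and the rule for an edge because the colour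
  \<open>e\<close> can be taken out of the traces at both ends (\<open>F_delete\<close>). If all edges are marked, expanding the traces
  in matrix entries gives a factor \<open>n\<close> for each boundary component and a factor \<open>q\<close> for each component of the ribbon graph
  (\<open>F_cyclic_graph\<close>).

  The rules reduce every diagram to such diagrams (\<open>marked_diagram_induct\<close>), so there is at most one polynomial obeying them, and
  each \<open>F D\<close> is the value of some Laurent polynomial. A Laurent polynomial is determined by its values for all \<open>n\<close> and
  \<open>q\<close> (\<open>laurent_eqI\<close>). Hence this polynomial does not depend on the way in which it was computed, it obeys the rules, and
  it is \<open>yamada D\<close> (\<open>yamada_represents\<close>).

  The moves now concern \<open>F\<close> only. The central computation is \<open>X_step\<close>: sweeping a strand across one half-edge of a vertex
  preserves a certain combination \<open>Psi\<close> of traces. Since \<open>Psi\<close> does not distinguish the two sides of the vertex, a strand may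
  pass a vertex, and applied to the vertex and the two smoothings into which a crossing expands, this gives the third Reidemeister
  move. A kink and a half-twist of the half-edges at a vertex multiply \<open>F\<close> by a power of \<open>- \<alpha>\<close>, and so does a crossing between
  two neighbouring half-edges if the vertex has degree at most three (\<open>VI_proportional\<close>). The exponent is the same in all models.
  So every move multiplies \<open>yamada\<close> by a power of \<open>- \<alpha>\<close> (\<open>scales_yamada\<close>), and the normalization removes this
  power (\<open>normalized_yamada_eqI\<close>).
\<close>

section \<open>Traces of words and the weight of a crossing\<close>

text \<open>
  The identity behind \<open>X_step\<close>, with the traces that occur replaced by indeterminates; here \<open>L\<close> is \<open>\<kappa>\<^sup>2\<close>.
\<close>

lemma X_step_algebra:
  fixes a b tl lw K L N :: complex
  assumes "a * b = 1" "K * N = a + b + 2" "K * L = 1"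
  shows "a * (a * zpu * lw + b * pl * zwu - K * zplwu + tl * zpwu + zu * plw)
      + b * d * (a * (N - L) * u * lw + b * (lwu - L * tl * wu)
          - K * ((N - L) * lwu) + tl * ((N - L) * wu) + (lwu - L * u * lw))
      - K * (a * lw * ((N - 2 * L) * zpu + L * L * d * u)
          + b * (zplwu - L * zpwu * tl - L * wu * zpl + L * L * d * tl * wu)
          - K * ((N - 2 * L) * zplwu + L * L * d * lwu)
          + tl * ((N - 2 * L) * zpwu + L * L * d * wu)
          + (zplwu - L * zpu * lw - L * u * zplw + L * L * d * lw * u))
     = a * zu * plw + b * zpl * wu - K * zplwu + pl * zwu + u * zplw"
proof -
  have N: "N = (a + b + 2) * L"
    using assms(2,3) by (metis mult.assoc mult.commute mult.right_neutral)
  have r: "K * (L * t) = t" "a * (b * t) = t" for t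
    using assms by (simp_all add: mult.assoc[symmetric])
  show ?thesis
    by (simp add: N algebra_simps r assms)
qed

text \<open>
  The axioms of a symmetric algebra, read off an orthonormal basis \<open>insert e B0\<close> for its trace form: \<open>tr [b1, ..., bm]\<close> is the
  trace of the product of basis elements, \<open>e\<close> is \<open>\<kappa>\<close> times the unit, \<open>tr_fusion\<close> is completeness of the basis, and \<open>tr_casimir\<close>
  says that the sum of the squares of the basis elements is the scalar \<open>N\<close>. Edges of a diagram are coloured by \<open>B0\<close>; leaving out \<open>e\<close>
  is what turns the deletion of an edge into a relation between partition functions.
\<close>

locale trace_colouring =
  fixes B0 :: "'c set" and e :: 'c and tr :: "'c list \<Rightarrow> complex" and \<kappa> N K :: complex
  assumes finite_B0: "finite B0" and e_notin: "e \<notin> B0"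
    and tr_rotate: "tr (a @ b) = tr (b @ a)"
    and tr_pair: "\<lbrakk>x \<in> insert e B0; y \<in> insert e B0\<rbrakk> \<Longrightarrow> tr [x, y] = of_bool (x = y)"
    and tr_unit: "tr (e # l) = \<kappa> * tr l"
    and tr_fusion: "(\<Sum>b\<in>insert e B0. tr (u @ [b]) * tr (b # v)) = tr (u @ v)"
    and tr_casimir: "(\<Sum>b\<in>insert e B0. tr (b # b # u)) = N * tr u"
    and tr_Nil: "tr [] = K"
    and kappa_K: "\<kappa>\<^sup>2 * K = 1"
begin

lemma kappa_nonzero: "\<kappa> \<noteq> 0"
  using kappa_K by auto

lemma tr_move: "tr (b # a) = tr (a @ [b])"
  using tr_rotate[of "[b]" a] by simp

lemma tr_pair0: "\<lbrakk>a \<in> B0; b \<in> B0\<rbrakk> \<Longrightarrow> tr [a, b] = of_bool (a = b)"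
  using tr_pair by simp

lemma tr_single: "y \<in> B0 \<Longrightarrow> tr [y] = 0"
  using tr_pair[of e y] tr_unit[of "[y]"] kappa_nonzero e_notin by (cases "e = y") auto

lemma fuse: "(\<Sum>y\<in>B0. tr (u @ [y]) * tr (y # v)) = tr (u @ v) - \<kappa>\<^sup>2 * tr u * tr v"
proof -
  have "tr (u @ [e]) = \<kappa> * tr u"
    using tr_unit[of u] tr_move[of e u] by simp
  then show ?thesis
    using tr_fusion[of u v] finite_B0 e_notin tr_unit[of v]
    by (simp add: power2_eq_square algebra_simps)
qed

lemma fuse': "(\<Sum>y\<in>B0. tr (y # u) * tr (v @ [y])) = tr (u @ v) - \<kappa>\<^sup>2 * tr u * tr v"
proof -
  have "(\<Sum>y\<in>B0. tr (y # u) * tr (v @ [y])) = (\<Sum>y\<in>B0. tr (v @ [y]) * tr (y # u))"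
    by (simp add: mult.commute)
  then show ?thesis
    using fuse[of v u] tr_rotate[of u v] by simp
qed

lemma loop: "(\<Sum>y\<in>B0. tr (y # y # u)) = (N - \<kappa>\<^sup>2) * tr u"
  using tr_casimir[of u] finite_B0 e_notin tr_unit[of "e # u"] tr_unit[of u]
  by (simp add: power2_eq_square algebra_simps)

lemma loop': "(\<Sum>y\<in>B0. tr (y # u @ [y])) = (N - \<kappa>\<^sup>2) * tr u"
proof -
  have "tr (y # u @ [y]) = tr (y # y # u)" for y
    using tr_move[of y "y # u"] by simp
  then show ?thesis using loop[of u] by simp
qed

lemma card_B0: "(\<Sum>y\<in>B0. 1) = N * K - 1"
proof -
  have "(\<Sum>y\<in>B0. tr [y, y]) = (\<Sum>y\<in>B0. 1)"
    by (intro sum.cong) (auto simp: tr_pair0)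
  then show ?thesis
    using loop[of "[]"] kappa_K tr_Nil by (simp add: algebra_simps)
qed

lemma sum_B0_delta: "p \<in> B0 \<Longrightarrow> (\<Sum>y\<in>B0. of_bool (p = y) * f y) = (f p :: complex)"
  "p \<in> B0 \<Longrightarrow> (\<Sum>y\<in>B0. of_bool (y = p) * f y) = (f p :: complex)"
  using finite_B0 by (auto simp: of_bool_def if_distrib[of "\<lambda>c. c * _"] cong: if_cong)

text \<open>
  The skein relation read as the weight of a crossing with incoming colours \<open>p, q\<close> and outgoing colours \<open>r, s\<close>; \<open>- K\<close>
  is the value of the inverse of the second variable.
\<close>

definition X :: "complex \<Rightarrow> 'c \<Rightarrow> 'c \<Rightarrow> 'c \<Rightarrow> 'c \<Rightarrow> complex" where
  "X a p q r s = a * of_bool (p = r) * of_bool (q = s) + (1 / a) * of_bool (p = q) * of_bool (r = s)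
     - K * tr [p, q, s, r]"

text \<open>
  The vertex with half-edges \<open>l\<close> and \<open>u\<close> after a strand with end colours \<open>z\<close> and \<open>w\<close> has been swept across the half-edges \<open>l\<close>.
  The formula has a symmetry that exchanges the two sides of the vertex.
\<close>

definition Psi :: "complex \<Rightarrow> 'c \<Rightarrow> 'c list \<Rightarrow> 'c \<Rightarrow> 'c list \<Rightarrow> complex" where
  "Psi a z l w u = a * tr (z # u) * tr (l @ [w]) + (1 / a) * tr (z # l) * tr (w # u)
     - K * tr (z # l @ w # u) + tr l * tr (z # w # u) + tr u * tr (z # l @ [w])"

lemma Psi_swap: "Psi a z l w u = Psi a w u z l"
proof -
  have "tr (l @ [w]) = tr (w # l)" "tr (u @ [z]) = tr (z # u)"
    "tr (z # l @ w # u) = tr (w # u @ z # l)"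
    "tr (z # w # u) = tr (w # u @ [z])" "tr (z # l @ [w]) = tr (w # z # l)"
    using tr_rotate[of "z # l" "w # u"] tr_rotate[of "[z]" "w # u"] tr_rotate[of "z # l" "[w]"]
    by (simp_all add: tr_move[symmetric])
  then show ?thesis by (simp add: Psi_def)
qed

lemma double1: "(\<Sum>p'\<in>B0. \<Sum>z1\<in>B0. tr [z, p, z1, p'] * tr (z1 # v @ [p']))
   = (N - 2 * \<kappa>\<^sup>2) * tr (z # p # v) + \<kappa>^4 * tr [z, p] * tr v"
proof -
  have 1: "(\<Sum>p'\<in>B0. tr [z, p, z1, p'] * tr (z1 # v @ [p']))
     = tr (z1 # z1 # v @ [z, p]) - \<kappa>\<^sup>2 * (tr ([z, p] @ [z1]) * tr (z1 # v))" for z1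
    using fuse[of "[z, p, z1]" "z1 # v"] tr_rotate[of "[z, p]" "z1 # z1 # v"]
    by (simp add: tr_move[of _ "z1 # v"])
  have "(\<Sum>p'\<in>B0. \<Sum>z1\<in>B0. tr [z, p, z1, p'] * tr (z1 # v @ [p']))
     = (\<Sum>z1\<in>B0. tr (z1 # z1 # v @ [z, p]) - \<kappa>\<^sup>2 * (tr ([z, p] @ [z1]) * tr (z1 # v)))"
    by (subst sum.swap) (simp only: 1)
  also have "\<dots> = (N - \<kappa>\<^sup>2) * tr (v @ [z, p]) - \<kappa>\<^sup>2 * (tr ([z, p] @ v) - \<kappa>\<^sup>2 * tr [z, p] * tr v)"
    by (simp only: sum_subtractf sum_distrib_left[symmetric] loop fuse)
  finally show ?thesis
    using tr_rotate[of v "[z, p]"] by (simp add: algebra_simps power2_eq_square power4_eq_xxxx)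
qed

lemma double2: "(\<Sum>p'\<in>B0. \<Sum>z1\<in>B0. tr [z, p, z1, p'] * (tr (z1 # v) * tr (v' @ [p'])))
   = tr (z # p # v @ v') - \<kappa>\<^sup>2 * tr (z # p # v') * tr v - \<kappa>\<^sup>2 * tr v' * tr (z # p # v)
     + \<kappa>^4 * tr [z, p] * tr v * tr v'"
proof -
  have 1: "(\<Sum>p'\<in>B0. tr [z, p, z1, p'] * (tr (z1 # v) * tr (v' @ [p'])))
     = tr ((v' @ [z, p]) @ [z1]) * tr (z1 # v) - \<kappa>\<^sup>2 * tr v' * (tr ([z, p] @ [z1]) * tr (z1 # v))" for z1
  proof -
    have "(\<Sum>p'\<in>B0. tr [z, p, z1, p'] * (tr (z1 # v) * tr (v' @ [p'])))
      = tr (z1 # v) * (\<Sum>p'\<in>B0. tr ([z, p, z1] @ [p']) * tr (p' # v'))"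
      by (simp add: sum_distrib_left tr_move[symmetric] mult_ac)
    then show ?thesis
      using tr_rotate[of v' "[z, p, z1]"] unfolding fuse by (simp add: algebra_simps)
  qed
  have "(\<Sum>p'\<in>B0. \<Sum>z1\<in>B0. tr [z, p, z1, p'] * (tr (z1 # v) * tr (v' @ [p'])))
     = (\<Sum>z1\<in>B0. tr ((v' @ [z, p]) @ [z1]) * tr (z1 # v) - \<kappa>\<^sup>2 * tr v' * (tr ([z, p] @ [z1]) * tr (z1 # v)))"
    by (subst sum.swap) (simp only: 1)
  also have "\<dots> = tr ((v' @ [z, p]) @ v) - \<kappa>\<^sup>2 * tr (v' @ [z, p]) * tr v
      - \<kappa>\<^sup>2 * tr v' * (tr ([z, p] @ v) - \<kappa>\<^sup>2 * tr [z, p] * tr v)"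
    by (simp only: sum_subtractf sum_distrib_left[symmetric] fuse)
  finally show ?thesis
    using tr_rotate[of v' "[z, p] @ v"] tr_rotate[of v' "[z, p]"]
    by (simp add: algebra_simps power2_eq_square power4_eq_xxxx)
qed

text \<open>
  Expanding the crossing leaves sums over colours that fusion and loops evaluate; the condition on \<open>a\<close> relates the value of a loop to
  the coefficients of the skein relation.
\<close>

lemma X_step:
  assumes z: "z \<in> B0" and p: "p \<in> B0" and w: "w \<in> B0" and a: "a \<noteq> 0" "a + 1 / a + 2 = N * K"
  shows "(\<Sum>p'\<in>B0. \<Sum>z1\<in>B0. X a z p p' z1 * Psi a z1 l w (u @ [p'])) = Psi a z (p # l) w u"
proof -
  let ?P = "\<lambda>p' z1. Psi a z1 l w (u @ [p'])"
  have split: "(\<Sum>p'\<in>B0. \<Sum>z1\<in>B0. X a z p p' z1 * ?P p' z1)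
    = a * (\<Sum>p'\<in>B0. of_bool (z = p') * (\<Sum>z1\<in>B0. of_bool (p = z1) * ?P p' z1))
    + (1 / a) * of_bool (z = p) * (\<Sum>p'\<in>B0. (\<Sum>z1\<in>B0. of_bool (p' = z1) * ?P p' z1))
    - K * (\<Sum>p'\<in>B0. \<Sum>z1\<in>B0. tr [z, p, z1, p'] * ?P p' z1)"
    by (simp add: X_def algebra_simps sum.distrib sum_subtractf sum_distrib_left)
  have T1: "(\<Sum>p'\<in>B0. of_bool (z = p') * (\<Sum>z1\<in>B0. of_bool (p = z1) * ?P p' z1)) = ?P z p"
    using z p by (simp add: sum_B0_delta)
  have T2: "(\<Sum>p'\<in>B0. (\<Sum>z1\<in>B0. of_bool (p' = z1) * ?P p' z1)) = (\<Sum>y\<in>B0. ?P y y)"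
    by (intro sum.cong) (auto simp: sum_B0_delta)
  have T2': "(\<Sum>y\<in>B0. ?P y y) = a * (N - \<kappa>\<^sup>2) * tr u * tr (l @ [w])
     + 1 / a * (tr (l @ w # u) - \<kappa>\<^sup>2 * tr l * tr (w # u))
     - K * ((N - \<kappa>\<^sup>2) * tr (l @ w # u)) + tr l * ((N - \<kappa>\<^sup>2) * tr (w # u))
     + (tr (u @ l @ [w]) - \<kappa>\<^sup>2 * tr u * tr (l @ [w]))"
    using loop'[of u] fuse'[of l "w # u"] loop'[of "l @ w # u"] loop'[of "w # u"] fuse[of u "l @ [w]"]
    by (simp add: Psi_def sum.distrib sum_subtractf sum_distrib_left[symmetric] sum_distrib_right[symmetric]
        sum_divide_distrib[symmetric] mult.assoc)
  have d: "tr [z, p] = of_bool (z = p)" using z p by (rule tr_pair0)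
  have T3: "(\<Sum>p'\<in>B0. \<Sum>z1\<in>B0. tr [z, p, z1, p'] * ?P p' z1)
     = a * tr (l @ [w]) * (\<Sum>p'\<in>B0. \<Sum>z1\<in>B0. tr [z, p, z1, p'] * tr (z1 # u @ [p']))
     + 1 / a * (\<Sum>p'\<in>B0. \<Sum>z1\<in>B0. tr [z, p, z1, p'] * (tr (z1 # l) * tr ((w # u) @ [p'])))
     - K * (\<Sum>p'\<in>B0. \<Sum>z1\<in>B0. tr [z, p, z1, p'] * tr (z1 # (l @ w # u) @ [p']))
     + tr l * (\<Sum>p'\<in>B0. \<Sum>z1\<in>B0. tr [z, p, z1, p'] * tr (z1 # (w # u) @ [p']))
     + (\<Sum>p'\<in>B0. \<Sum>z1\<in>B0. tr [z, p, z1, p'] * (tr (z1 # l @ [w]) * tr (u @ [p'])))"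
    by (simp add: Psi_def sum.distrib sum_subtractf sum_distrib_left algebra_simps)
  have r: "tr (p # u @ [z]) = tr (z # p # u)" "tr (w # u @ [z]) = tr (z # w # u)"
    "tr (p # l @ w # u @ [z]) = tr (z # p # l @ w # u)" "tr (p # w # u @ [z]) = tr (z # p # w # u)"
    "tr (u @ [z]) = tr (z # u)" "tr (u @ l @ [w]) = tr (l @ w # u)"
    using tr_rotate[of u "l @ [w]"] by (simp_all add: tr_move[of z])
  have q: "\<kappa>\<^sup>2 * K = 1" "\<kappa> ^ 4 = \<kappa>\<^sup>2 * \<kappa>\<^sup>2"
    using kappa_K by (simp_all add: power2_eq_square power4_eq_xxxx)
  show ?thesis
    unfolding split T1 T2 T2' T3 double1 double2 unfolding q(2) d Psi_def r append_Cons append_assoc append_Nil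
    by (rule X_step_algebra) (use a q in \<open>auto simp: mult.commute\<close>)
qed

end

section \<open>Sweeping a strand past a vertex\<close>

text \<open>
  The weight of a strand that enters with colour \<open>z\<close>, crosses strands of colours \<open>a\<close>, which leave with colours \<open>a'\<close>, and
  leaves with colour \<open>w\<close>.
\<close>

fun sweep_kernel :: "'c set \<Rightarrow> ('c \<Rightarrow> 'c \<Rightarrow> 'c \<Rightarrow> 'c \<Rightarrow> complex) \<Rightarrow> 'c \<Rightarrow> 'c list \<Rightarrow> 'c list \<Rightarrow> 'c \<Rightarrow> complex" where
  "sweep_kernel S x z [] a' w = of_bool (a' = [] \<and> z = w)"
| "sweep_kernel S x z (p # a) a' w =
     (\<Sum>y\<in>S. x z p (hd a') y * sweep_kernel S x y a (tl a') w)"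

definition words :: "'c set \<Rightarrow> nat \<Rightarrow> 'c list set" where
  "words S n = {c. length c = n \<and> set c \<subseteq> S}"

lemma words_0: "words S 0 = {[]}"
  by (auto simp: words_def)

lemma finite_words: "finite S \<Longrightarrow> finite (words S n)"
  using finite_lists_length_eq[of S n] by (simp add: words_def conj_commute)

lemma words_Suc: "words S (Suc n) = (\<lambda>(x, c). x # c) ` (S \<times> words S n)"
  by (auto simp: words_def length_Suc_conv image_iff)

lemma sum_words_0: "(\<Sum>c\<in>words S 0. f c) = f []"
  by (simp add: words_0)

lemma sum_words_Suc: "(\<Sum>c\<in>words S (Suc n). f c) = (\<Sum>x\<in>S. \<Sum>c\<in>words S n. f (x # c))"
  unfolding words_Suc
  by (subst sum.reindex) (auto simp: inj_on_def sum.cartesian_product case_prod_beta)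

lemma sum_words_rev: "(\<Sum>c\<in>words S n. f (rev c)) = (\<Sum>c\<in>words S n. f c)"
  by (rule sum.reindex_bij_witness[of _ rev rev]) (auto simp: words_def)

lemma sweep_kernel_snoc:
  assumes "finite S" "length a = length a'" "z \<in> S" "w \<in> S"
  shows "sweep_kernel S x z (a @ [p]) (a' @ [p']) w = (\<Sum>y\<in>S. sweep_kernel S x z a a' y * x y p p' w)"
  using assms(2,3)
proof (induction a a' arbitrary: z rule: list_induct2)
  case Nil
  then show ?case
    using assms by (auto simp: of_bool_def if_distrib[of "\<lambda>c. c * _"] if_distrib[of "\<lambda>c. _ * c"] cong: if_cong)
next
  case (Cons q a q' a')
  have "sweep_kernel S x z ((q # a) @ [p]) ((q' # a') @ [p']) w
     = (\<Sum>y\<in>S. x z q q' y * (\<Sum>y'\<in>S. sweep_kernel S x y a a' y' * x y' p p' w))"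
    using Cons.IH by simp
  also have "\<dots> = (\<Sum>y'\<in>S. \<Sum>y\<in>S. x z q q' y * sweep_kernel S x y a a' y' * x y' p p' w)"
    by (subst sum.swap) (simp add: sum_distrib_left mult.assoc)
  also have "\<dots> = (\<Sum>y'\<in>S. sweep_kernel S x z (q # a) (q' # a') y' * x y' p p' w)"
    by (simp add: sum_distrib_right)
  finally show ?case .
qed

lemma sweep_kernel_rotate:
  assumes "finite S" "length a = length a'" "z \<in> S" "w \<in> S" and x: "\<And>p q r s. x p q r s = x s r q p"
  shows "sweep_kernel S x z a a' w = sweep_kernel S x w (rev a') (rev a) z"
  using assms(2-4)
proof (induction a a' arbitrary: z w rule: list_induct2)
  case Nil
  then show ?case by auto
next
  case (Cons q a q' a')
  have "sweep_kernel S x w (rev a' @ [q']) (rev a @ [q]) z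
      = (\<Sum>y\<in>S. sweep_kernel S x w (rev a') (rev a) y * x y q' q z)"
    using assms(1) Cons by (intro sweep_kernel_snoc) auto
  also have "\<dots> = (\<Sum>y\<in>S. x z q q' y * sweep_kernel S x y a a' w)"
    using Cons.IH Cons.prems x by (intro sum.cong) (auto simp: mult.commute)
  finally show ?case by simp
qed

context trace_colouring
begin

lemma X_rotate: "X a p q r s = X a s r q p"
  using tr_rotate[of "[p, q]" "[s, r]"] by (auto simp: X_def)

text \<open>
  Sweeping across one half-edge after the other is an iteration of \<open>X_step\<close>.
\<close>

lemma sweep_trace:
  assumes a: "a \<noteq> 0" "a + 1 / a + 2 = N * K"
  shows "\<lbrakk>z \<in> B0; w \<in> B0; l \<in> words B0 m\<rbrakk> \<Longrightarrow>
    (\<Sum>l'\<in>words B0 m. sweep_kernel B0 (X a) z l l' w * tr (l' @ u)) = Psi a z l w u"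
proof (induction m arbitrary: z l u)
  case 0
  then show ?case
    by (simp add: words_0 Psi_def tr_single tr_Nil tr_pair0)
next
  case (Suc m)
  then obtain p l1 where l: "l = p # l1" and p: "p \<in> B0" and l1: "l1 \<in> words B0 m"
    by (auto simp: words_Suc)
  have "(\<Sum>l'\<in>words B0 (Suc m). sweep_kernel B0 (X a) z l l' w * tr (l' @ u))
    = (\<Sum>p'\<in>B0. \<Sum>l'\<in>words B0 m. \<Sum>y\<in>B0. X a z p p' y * (sweep_kernel B0 (X a) y l1 l' w * tr (l' @ u @ [p'])))"
    by (simp add: sum_words_Suc l sum_distrib_right mult.assoc tr_move)
  also have "\<dots> = (\<Sum>p'\<in>B0. \<Sum>y\<in>B0. X a z p p' y * (\<Sum>l'\<in>words B0 m. sweep_kernel B0 (X a) y l1 l' w * tr (l' @ u @ [p'])))"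
    by (subst sum.swap) (simp add: sum_distrib_left)
  also have "\<dots> = (\<Sum>p'\<in>B0. \<Sum>y\<in>B0. X a z p p' y * Psi a y l1 w (u @ [p']))"
    using Suc.IH l1 Suc.prems by (intro sum.cong refl) simp
  also have "\<dots> = Psi a z l w u"
    unfolding l using X_step[OF Suc.prems(1) p Suc.prems(2) a] .
  finally show ?case .
qed

text \<open>
  Passing on either side of the vertex gives the same value because \<open>Psi\<close> is symmetric. This is the fourth move, and by
  the skein relation it also contains the third.
\<close>

lemma sweep_vertex:
  assumes a: "a \<noteq> 0" "a + 1 / a + 2 = N * K"
    and z: "z \<in> B0" "w \<in> B0" "l \<in> words B0 m" "b \<in> words B0 n"
  shows "(\<Sum>l'\<in>words B0 m. sweep_kernel B0 (X a) z l l' w * tr (l' @ rev b))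
    = (\<Sum>b'\<in>words B0 n. tr (l @ rev b') * sweep_kernel B0 (X a) z b' b w)"
proof -
  have b: "rev b \<in> words B0 n" using z by (auto simp: words_def)
  have "(\<Sum>l'\<in>words B0 m. sweep_kernel B0 (X a) z l l' w * tr (l' @ rev b)) = Psi a w (rev b) z l"
    using sweep_trace[OF a z(1-3)] by (simp add: Psi_swap)
  also have "\<dots> = (\<Sum>b'\<in>words B0 n. sweep_kernel B0 (X a) w (rev b) (rev b') z * tr (rev b' @ l))"
    using sweep_trace[OF a z(2,1) b]
      sum_words_rev[of "\<lambda>b'. sweep_kernel B0 (X a) w (rev b) b' z * tr (b' @ l)"] by simp
  also have "\<dots> = (\<Sum>b'\<in>words B0 n. tr (l @ rev b') * sweep_kernel B0 (X a) z b' b w)"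
  proof (intro sum.cong refl)
    fix b' assume "b' \<in> words B0 n"
    then show "sweep_kernel B0 (X a) w (rev b) (rev b') z * tr (rev b' @ l)
      = tr (l @ rev b') * sweep_kernel B0 (X a) z b' b w"
      using sweep_kernel_rotate[OF finite_B0, of b' b z w "X a"] z X_rotate tr_rotate[of l "rev b'"]
      by (auto simp: words_def)
  qed
  finally show ?thesis .
qed

text \<open>
  The reversed product is a product in the opposite algebra, so facts on one side of the plane transfer to the other.
\<close>

lemma mirror: "trace_colouring B0 e (\<lambda>l. tr (rev l)) \<kappa> N K"
proof
  fix x y assume "x \<in> insert e B0" "y \<in> insert e B0"
  then show "tr (rev [x, y]) = of_bool (x = y)" by (simp add: tr_pair eq_commute del: insert_iff)
next
  fix l show "tr (rev (e # l)) = \<kappa> * tr (rev l)"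
    using tr_unit[of "rev l"] tr_move[of e "rev l"] by simp
next
  fix u v show "(\<Sum>b\<in>insert e B0. tr (rev (u @ [b])) * tr (rev (b # v))) = tr (rev (u @ v))"
    using tr_fusion[of "rev v" "rev u"] by (simp add: mult.commute del: sum.insert)
next
  fix u show "(\<Sum>b\<in>insert e B0. tr (rev (b # b # u))) = N * tr (rev u)"
    using tr_casimir[of "rev u"] tr_rotate[of "rev u" "[_, _]"] by (simp del: sum.insert)
qed (use finite_B0 e_notin tr_rotate tr_Nil kappa_K in auto)

lemma sweep_vertex_left:
  assumes a: "a \<noteq> 0" "a + 1 / a + 2 = N * K"
    and z: "z \<in> B0" "w \<in> B0" "l \<in> words B0 m" "b \<in> words B0 n"
  defines "x \<equiv> \<lambda>z p p' y. X a p z y p'"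
  shows "(\<Sum>l'\<in>words B0 m. sweep_kernel B0 x z (rev l) (rev l') w * tr (l' @ rev b))
    = (\<Sum>b'\<in>words B0 n. tr (l @ rev b') * sweep_kernel B0 x z (rev b') (rev b) w)"
proof -
  interpret m: trace_colouring B0 e "\<lambda>l. tr (rev l)" \<kappa> N K by (rule mirror)
  have x: "x = m.X a"
  proof (intro ext)
    fix z p p' y
    show "x z p p' y = m.X a z p p' y"
      using tr_rotate[of "[p, z]" "[p', y]"] by (auto simp: x_def X_def m.X_def)
  qed
  have "rev l \<in> words B0 m" "rev b \<in> words B0 n" using z by (auto simp: words_def)
  note * = m.sweep_vertex[OF a z(1,2) this]
  show ?thesis
    unfolding x
    using * sum_words_rev[of "\<lambda>l'. sweep_kernel B0 (m.X a) z (rev l) l' w * tr (rev b @ rev l')"]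
     sum_words_rev[of "\<lambda>b'. tr (b' @ l) * sweep_kernel B0 (m.X a) z b' (rev b) w"]
    by (simp add: tr_rotate[of l] tr_rotate[of _ "rev b"])
qed

text \<open>
  Sweeping a strand past both half-edges of a vertex of degree two gives these two crossings, while \<open>Psi\<close> with one side empty reduces
  to the identity.
\<close>

lemma X_inverse:
  assumes a: "a \<noteq> 0" "a + 1 / a + 2 = N * K" and "p \<in> B0" "q \<in> B0" "t \<in> B0" "u \<in> B0"
  shows "(\<Sum>r\<in>B0. \<Sum>s\<in>B0. X a p q r s * X (1 / a) r s t u) = of_bool (p = t \<and> q = u)"
proof -
  have turn: "X a s u r t = X (1 / a) r s t u" for r s
    using tr_rotate[of "[s, u, t]" "[r]"] by (auto simp: X_def)
  have 0: "(\<Sum>x\<in>B0. f x * of_bool (x = t)) = f t" for f :: "'c \<Rightarrow> complex"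
    using assms sum_B0_delta(2)[of t f] by (simp add: mult.commute)
  have "(\<Sum>l'\<in>words B0 2. sweep_kernel B0 (X a) p [q, u] l' t * tr (l' @ []))
     = (\<Sum>r\<in>B0. \<Sum>q'\<in>B0. of_bool (q' = r) * (\<Sum>y\<in>B0. X a p q r y * X a y u q' t))"
    unfolding numeral_2_eq_2 sum_words_Suc sum_words_0
    by (intro sum.cong refl) (simp add: 0 sum_distrib_left[symmetric] tr_pair0 eq_commute[of "_::'c"])
  also have "\<dots> = (\<Sum>r\<in>B0. \<Sum>s\<in>B0. X a p q r s * X (1 / a) r s t u)"
    by (rule sum.cong[OF refl]) (simp add: sum_B0_delta turn)
  finally have 1: "(\<Sum>r\<in>B0. \<Sum>s\<in>B0. X a p q r s * X (1 / a) r s t u) = Psi a p [q, u] t []"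
    using sweep_trace[OF a assms(3,5), of "[q, u]" 2 "[]"] assms by (simp add: words_def)
  show ?thesis
    unfolding 1 using assms by (auto simp: Psi_def tr_single tr_Nil tr_pair0)
qed

text \<open>
  The three terms of \<open>X\<close> give a circle, a plain strand and a loop at a vertex. A circle has the value \<open>a + 1 / a + 1\<close>, and \<open>K\<close> times
  a loop is \<open>a + 1 / a + 1\<close> times the strand, which leaves \<open>a\<^sup>2\<close>.
\<close>

lemma kink:
  assumes a: "a \<noteq> 0" "a + 1 / a + 2 = N * K" and "p \<in> B0" "q \<in> B0"
  shows "(\<Sum>y\<in>B0. X a p y q y) = a\<^sup>2 * of_bool (p = q)"
    and "(\<Sum>y\<in>B0. X a y p y q) = a\<^sup>2 * of_bool (p = q)"
proof -
  have K: "K * (N - \<kappa>\<^sup>2) = a + 1 / a + 1"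
    using a kappa_K by (simp add: algebra_simps)
  have c: "of_nat (card B0) = a + 1 / a + 1"
    using card_B0 unfolding a(2)[symmetric] by simp
  have l: "(\<Sum>y\<in>B0. tr [p, y, y, q]) = (N - \<kappa>\<^sup>2) * of_bool (p = q)"
    "(\<Sum>y\<in>B0. tr [y, p, q, y]) = (N - \<kappa>\<^sup>2) * of_bool (p = q)"
    using loop[of "[q, p]"] loop'[of "[p, q]"] assms tr_rotate[of "[p]" "[_, _, q]"]
    by (auto simp: tr_pair0)
  have d: "(\<Sum>y\<in>B0. of_bool (p = y) * of_bool (q = y)) = (of_bool (p = q) :: complex)"
    "(\<Sum>y\<in>B0. of_bool (y = p) * of_bool (y = q)) = (of_bool (p = q) :: complex)"
    using assms by (auto simp: sum_B0_delta)
  have "a * (a + 1 / a + 1) + 1 / a - (a + 1 / a + 1) = a\<^sup>2"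
    using a by (simp add: field_simps power2_eq_square)
  then have e: "a * ((a + 1 / a + 1) * t) + 1 / a * t - (a + 1 / a + 1) * t = a\<^sup>2 * t" for t
    by (metis (no_types, opaque_lifting) left_diff_distrib distrib_right mult.assoc)
  have "(\<Sum>y\<in>B0. X a p y q y) = a * (of_nat (card B0) * of_bool (p = q)) + 1 / a * (\<Sum>y\<in>B0. of_bool (p = y) * of_bool (q = y))
     - K * (\<Sum>y\<in>B0. tr [p, y, y, q])"
    by (simp add: X_def sum.distrib sum_subtractf sum_distrib_left mult.assoc)
  then show "(\<Sum>y\<in>B0. X a p y q y) = a\<^sup>2 * of_bool (p = q)"
    unfolding c l d using K e by (simp add: mult.assoc[symmetric])
  have "(\<Sum>y\<in>B0. X a y p y q) = a * (of_nat (card B0) * of_bool (p = q)) + 1 / a * (\<Sum>y\<in>B0. of_bool (y = p) * of_bool (y = q))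
     - K * (\<Sum>y\<in>B0. tr [y, p, q, y])"
    by (simp add: X_def sum.distrib sum_subtractf sum_distrib_left mult.assoc)
  then show "(\<Sum>y\<in>B0. X a y p y q) = a\<^sup>2 * of_bool (p = q)"
    unfolding c l d using K e by (simp add: mult.assoc[symmetric])
qed

lemma X_expand:
  assumes "p \<in> B0" "q \<in> B0"
  shows "(\<Sum>b\<in>words B0 2. X a p q (b ! 0) (b ! 1) * g b) = a * g [p, q]
     + 1 / a * of_bool (p = q) * (\<Sum>b\<in>words B0 2. of_bool (b ! 0 = b ! 1) * g b)
     - K * (\<Sum>b\<in>words B0 2. tr ([p, q] @ rev b) * g b)"
proof -
  have "(\<Sum>b\<in>words B0 2. X a p q (b ! 0) (b ! 1) * g b)
    = a * (\<Sum>r\<in>B0. of_bool (p = r) * (\<Sum>s\<in>B0. of_bool (q = s) * g [r, s]))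
     + 1 / a * of_bool (p = q) * (\<Sum>r\<in>B0. \<Sum>s\<in>B0. of_bool (r = s) * g [r, s])
     - K * (\<Sum>r\<in>B0. \<Sum>s\<in>B0. tr [p, q, s, r] * g [r, s])"
    unfolding numeral_2_eq_2 sum_words_Suc sum_words_0
    by (simp add: X_def algebra_simps sum.distrib sum_subtractf sum_distrib_left sum_divide_distrib)
  then show ?thesis
    using assms unfolding numeral_2_eq_2 sum_words_Suc sum_words_0 by (simp add: sum_B0_delta)
qed

definition twist_value :: "complex \<Rightarrow> nat \<Rightarrow> 'c list \<Rightarrow> 'c list \<Rightarrow> complex" where
  "twist_value a n d u = (- 1 / a) ^ n * (\<kappa>\<^sup>2 * (1 + a) * tr (rev d) * tr u - a * tr (rev d @ u))"

lemma twist_sum: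
  assumes a: "a \<noteq> 0" "a + 1 / a + 2 = N * K" and w: "w \<in> B0"
  shows "(\<Sum>z\<in>B0. Psi a w l z (z # u)) = - 1 / a * tr (l @ u @ [w])
     + \<kappa>\<^sup>2 * (1 + 1 / a) * (1 / a * tr u * tr (l @ [w]) + tr (u @ [w]) * tr l)"
proof -
  define g where "g = N - \<kappa>\<^sup>2"
  have r: "tr (l @ z # u @ [w]) = tr (w # l @ z # u)" "tr (w # z # u) = tr (z # u @ [w])"
     "tr (w # l @ z # z # u) = tr (z # z # u @ w # l)" "tr (w # z # z # u) = tr (z # z # u @ [w])"
     "tr (w # l @ [z]) = tr ((w # l) @ [z])" for z
    using tr_rotate[of "w # l" "z # z # u"] by (simp_all add: tr_move[of w])
  have s: "tr (w # l) = tr (l @ [w])" "tr (u @ w # l) = tr (l @ u @ [w])"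
    using tr_rotate[of "u @ [w]" l] by (simp_all add: tr_move[of w])
  have "(\<Sum>z\<in>B0. Psi a w l z (z # u)) =
    a * (\<Sum>z\<in>B0. tr (l @ [z]) * tr (z # u @ [w])) + 1 / a * tr (w # l) * (\<Sum>z\<in>B0. tr (z # z # u))
    - K * (\<Sum>z\<in>B0. tr (z # z # u @ w # l)) + tr l * (\<Sum>z\<in>B0. tr (z # z # u @ [w]))
    + (\<Sum>z\<in>B0. tr (z # u) * tr ((w # l) @ [z]))"
    unfolding Psi_def r by (simp add: sum.distrib sum_subtractf sum_distrib_left mult_ac)
  also have "\<dots> = a * (tr (l @ u @ [w]) - \<kappa>\<^sup>2 * tr l * tr (u @ [w])) + 1 / a * tr (l @ [w]) * (g * tr u)
    - K * (g * tr (l @ u @ [w])) + tr l * (g * tr (u @ [w])) + (tr (l @ u @ [w]) - \<kappa>\<^sup>2 * tr u * tr (l @ [w]))"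
    unfolding fuse fuse' loop s g_def by simp
  also have "\<dots> = (a + 1 - K * g) * tr (l @ u @ [w]) + (1 / a * g - \<kappa>\<^sup>2) * tr u * tr (l @ [w])
    + (g - a * \<kappa>\<^sup>2) * tr (u @ [w]) * tr l"
    by (simp add: algebra_simps)
  finally have *: "(\<Sum>z\<in>B0. Psi a w l z (z # u)) = \<dots>" .
  have "N = \<kappa>\<^sup>2 * (a + 1 / a + 2)"
    using a(2) kappa_K by (metis mult.assoc mult.commute mult.right_neutral)
  then have g: "g = \<kappa>\<^sup>2 * (a + 1 / a + 1)"
    by (simp add: g_def algebra_simps)
  have Kg: "K * g = a + 1 / a + 1"
    unfolding g using kappa_K by (simp add: mult.assoc[symmetric] mult.commute[of K])
  show ?thesis
    unfolding * Kg unfolding g using a(1) by (simp add: field_simps)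
qed

end

section \<open>Partition functions of words of layers\<close>

definition inputs :: "layer \<Rightarrow> 'a list \<Rightarrow> 'a list" where
  "inputs l a = take (ins l) (drop (offset l) a)"

definition update :: "layer \<Rightarrow> 'a list \<Rightarrow> 'a list \<Rightarrow> 'a list" where
  "update l b a = take (offset l) a @ b @ drop (offset l + ins l) a"

fun fits :: "nat \<Rightarrow> layer list \<Rightarrow> bool" where
  "fits n [] \<longleftrightarrow> True"
| "fits n (l # w) \<longleftrightarrow> offset l + ins l \<le> n \<and> fits (n - ins l + outs l) w"

fun width_from :: "nat \<Rightarrow> layer list \<Rightarrow> nat" where
  "width_from n [] = n"
| "width_from n (l # w) = width_from (n - ins l + outs l) w"

lemma width_from_append [simp]: "width_from n (u @ v) = width_from (width_from n u) v"
  by (induction u arbitrary: n) auto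

lemma fits_append [simp]: "fits n (u @ v) \<longleftrightarrow> fits n u \<and> fits (width_from n u) v"
  by (induction u arbitrary: n) auto

lemma width_from_foldl: "width_from n w = foldl (\<lambda>n l. n - ins l + outs l) n w"
  by (induction w arbitrary: n) auto

lemma width_eq: "width w = width_from 0 w"
  by (simp add: width_def width_from_foldl)

lemma fits_nth: "fits n D \<longleftrightarrow> (\<forall>t<length D. offset (D ! t) + ins (D ! t) \<le> width_from n (take t D))"
proof (induction D arbitrary: n)
  case (Cons l D)
  show ?case
    by (auto simp: Cons.IH less_Suc_eq_0_disj)
qed simp

lemma planar_word_iff: "planar_word D \<longleftrightarrow> fits 0 D \<and> width_from 0 D = 0"
  by (simp add: planar_word_def fits_nth width_eq)

lemma place_simps [simp]: "offset (place j l) = j" "ins (place j l) = ins l" "outs (place j l) = outs l"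
  by (cases l; simp)+

lemma shift_simps [simp]: "shift d [] = []" "shift d (l # w) = place (d + offset l) l # shift d w"
  "shift d (u @ v) = shift d u @ shift d v"
  by (simp_all add: shift_def)

lemma fits_shift: "d \<le> n \<Longrightarrow> fits n (shift d w) \<longleftrightarrow> fits (n - d) w"
proof (induction w arbitrary: n)
  case (Cons l w)
  show ?case
  proof (cases "d + offset l + ins l \<le> n")
    case True
    then have 1: "d \<le> n - ins l + outs l" and 2: "n - ins l + outs l - d = n - d - ins l + outs l"
      by linarith+
    have 3: "offset l + ins l \<le> n - d" using True by linarith
    show ?thesis using Cons.IH[OF 1] True 3 by (simp add: 2 ac_simps)
  qed (use Cons.prems in auto)
qed simp

lemma length_update: "offset l + ins l \<le> length a \<Longrightarrow> length (update l b a) = length a - ins l + length b"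
  by (simp add: update_def)

text \<open>
  The equation for \<open>\<alpha>\<close> is the one of \<open>X_step\<close>, and it is invariant under inverting \<open>\<alpha>\<close>, that is, under
  changing the crossing type.
\<close>

locale colour_model = trace_colouring B0 e tr \<kappa> N K
  for B0 :: "'c set" and e :: 'c and tr :: "'c list \<Rightarrow> complex" and \<kappa> N K :: complex +
  fixes \<alpha> :: complex
  assumes alpha: "\<alpha> \<noteq> 0" "\<alpha> + 1 / \<alpha> + 2 = N * K"
begin

definition par :: "crossing \<Rightarrow> complex" where
  "par c = (if c = Rising then \<alpha> else 1 / \<alpha>)"

lemma par: "par c \<noteq> 0" "par c + 1 / par c + 2 = N * K"
  using alpha by (auto simp: par_def algebra_simps)

lemma par_turn: "c \<noteq> Virtual \<Longrightarrow> par (turn c) = 1 / par c"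
  by (cases c) (auto simp: par_def)

text \<open>
  The weight of a layer with colours \<open>a\<close> below and \<open>b\<close> above. The half-edges of a vertex are read counterclockwise, whence the
  reversal of the upper ones.
\<close>

fun tau :: "layer \<Rightarrow> 'c list \<Rightarrow> 'c list \<Rightarrow> complex" where
  "tau (Cup i) a b = of_bool (b ! 0 = b ! 1)"
| "tau (Cap i) a b = of_bool (a ! 0 = a ! 1)"
| "tau (Cross c i) a b =
     (if c = Virtual then of_bool (b ! 0 = a ! 1 \<and> b ! 1 = a ! 0) else X (par c) (a ! 0) (a ! 1) (b ! 0) (b ! 1))"
| "tau (Vertex i m n) a b = tr (a @ rev b)"
| "tau (Mark i) a b = of_bool (a ! 0 = b ! 0)"

text \<open>
  The colour words allowed on strands with the given marks: the colour \<open>e\<close> is allowed exactly on marked strands.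
\<close>

definition colours :: "bool list \<Rightarrow> 'c list set" where
  "colours g = {c. list_all2 (\<lambda>m x. x \<in> (if m then insert e B0 else B0)) g c}"

text \<open>
  A transfer-matrix sum over all colourings of the layers above a height with colours \<open>a\<close>, with \<open>f\<close> the value of the top.
\<close>

fun amp :: "(layer \<times> bool list) list \<Rightarrow> ('c list \<Rightarrow> complex) \<Rightarrow> 'c list \<Rightarrow> complex" where
  "amp [] f a = f a"
| "amp ((l, g) # A) f a = (\<Sum>b\<in>colours g. tau l (inputs l a) b * amp A f (update l b a))"

definition val :: "layer list \<Rightarrow> ('c list \<Rightarrow> complex) \<Rightarrow> 'c list \<Rightarrow> complex" where
  "val w = amp (map (\<lambda>l. (l, replicate (outs l) False)) w)"

lemma colours_unmarked: "colours (replicate n False) = words B0 n"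
  by (auto simp: colours_def words_def list_all2_conv_all_nth in_set_conv_nth subset_iff)

lemma val_Nil [simp]: "val [] f a = f a"
  by (simp add: val_def)

lemma val_Cons: "val (l # w) f a = (\<Sum>b\<in>words B0 (outs l). tau l (inputs l a) b * val w f (update l b a))"
  by (simp add: val_def colours_unmarked)

lemma val_append: "val (u @ v) f a = val u (val v f) a"
  by (induction u arbitrary: a) (simp_all add: val_Cons)

lemma val_scale: "val w (\<lambda>b. x * f b) a = x * val w f a"
  by (induction w arbitrary: a) (simp_all add: val_Cons sum_distrib_left mult_ac)

lemma val_add: "val w (\<lambda>b. f b + g b) a = val w f a + val w g a"
  by (induction w arbitrary: a) (simp_all add: val_Cons sum.distrib algebra_simps)

lemma update_words:
  "\<lbrakk>a \<in> words S n; offset l + ins l \<le> n; b \<in> words S k\<rbrakk> \<Longrightarrow> update l b a \<in> words S (n - ins l + k)"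
  by (auto simp: words_def length_update) (auto simp: update_def dest: in_set_takeD in_set_dropD)

lemma val_cong:
  "\<lbrakk>a \<in> words B0 n; fits n w; \<And>b. b \<in> words B0 (width_from n w) \<Longrightarrow> f b = g b\<rbrakk> \<Longrightarrow> val w f a = val w g a"
proof (induction w arbitrary: a n)
  case (Cons l w)
  then show ?case
    unfolding val_Cons by (intro sum.cong refl arg_cong2[where f="(*)"] Cons.IH) (auto intro: update_words)
qed simp

lemma tau_place [simp]: "tau (place j l) = tau l"
  by (cases l) (auto intro!: ext)

lemma val_shift: "length p = d \<Longrightarrow> val (shift d w) f (p @ a) = val w (\<lambda>b. f (p @ b)) a"
  by (induction w arbitrary: a) (simp_all add: val_Cons inputs_def update_def)

lemma val_right:
  "fits (length a) w \<Longrightarrow> val w f (a @ t) = val w (\<lambda>b. f (b @ t)) a"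
proof (induction w arbitrary: a)
  case (Cons l w)
  have "update l b (a @ t) = update l b a @ t" "inputs l (a @ t) = inputs l a" for b
    using Cons.prems by (auto simp: update_def inputs_def)
  then show ?case
    unfolding val_Cons using Cons by (intro sum.cong) (auto simp: length_update words_def)
qed simp

lemma val_virtual:
  assumes "a ! i \<in> B0" "a ! Suc i \<in> B0" "Suc i < length a"
  shows "val (Cross Virtual i # w) f a = val w f (take i a @ [a ! Suc i, a ! i] @ drop (Suc (Suc i)) a)"
  using assms
  by (simp add: val_Cons numeral_2_eq_2 sum_words_Suc sum_words_0 update_def inputs_def of_bool_conj mult.assoc
      sum_distrib_left[symmetric] sum_B0_delta)

lemma val_cross:
  assumes "c \<noteq> Virtual" "Suc i < length a"
  shows "val (Cross c i # w) f a = (\<Sum>r\<in>B0. \<Sum>s\<in>B0. X (par c) (a ! i) (a ! Suc i) r s *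
     val w f (take i a @ [r, s] @ drop (Suc (Suc i)) a))"
  using assms
  by (simp add: val_Cons numeral_2_eq_2 sum_words_Suc sum_words_0 update_def inputs_def)

lemma val_cup: "val (Cup i # w) f a = (\<Sum>p\<in>B0. val w f (take i a @ [p, p] @ drop i a))"
  by (simp add: val_Cons numeral_2_eq_2 sum_words_Suc sum_words_0 update_def inputs_def sum_B0_delta)

lemma val_cap: "Suc i < length a \<Longrightarrow> val (Cap i # w) f a = of_bool (a ! i = a ! Suc i) * val w f (take i a @ drop (Suc (Suc i)) a)"
  by (simp add: val_Cons sum_words_0 update_def inputs_def)

lemma val_vertex: "val (Vertex i m n # w) f a = (\<Sum>b\<in>words B0 n. tr (take m (drop i a) @ rev b) * val w f (take i a @ b @ drop (i + m) a))"
  by (simp add: val_Cons update_def inputs_def)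

text \<open>
  The skein relation for unmarked strands: the three terms of \<open>X\<close> are the two smoothings and the vertex.
\<close>

lemma val_cross_expand:
  assumes "c \<noteq> Virtual" "Suc i < length a" "set a \<subseteq> B0"
  shows "val (Cross c i # w) f a = par c * val w f a + 1 / par c * val (Cap i # Cup i # w) f a
     - K * val (Vertex i 2 2 # w) f a"
proof -
  have "take 2 (drop i a) = [a ! i, a ! Suc i]"
    using assms by (simp add: numeral_2_eq_2 take_Suc_conv_app_nth)
  moreover have "a = take i a @ a ! i # a ! Suc i # drop (Suc (Suc i)) a"
    using assms by (metis Cons_nth_drop_Suc Suc_lessD append_take_drop_id)
  ultimately show ?thesis
    using X_expand[of "a ! i" "a ! Suc i" "par c" "\<lambda>b. val w f (take i a @ b @ drop (Suc (Suc i)) a)"] assms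
    by (simp add: val_Cons sum_words_0 update_def inputs_def min_def subset_iff)
qed

end

section \<open>Sweeps and half-twists in words of layers\<close>

lemma sum_words_append:
  "(\<Sum>c\<in>words S (m + n). f c) = (\<Sum>c\<in>words S m. \<Sum>d\<in>words S n. f (c @ d))"
  by (induction m arbitrary: f) (simp_all add: sum_words_0 sum_words_Suc)

lemma sum_words_1: "(\<Sum>c\<in>words S (Suc 0). f c) = (\<Sum>x\<in>S. f [x])"
  by (simp add: sum_words_0 sum_words_Suc)

lemma sum_words_snoc:
  "(\<Sum>c\<in>words S (Suc n). f c) = (\<Sum>c\<in>words S n. \<Sum>x\<in>S. f (c @ [x]))"
  using sum_words_append[of f S n 1] by (simp add: sum_words_1)

lemma sum_reverse3:
  "(\<Sum>x\<in>A. \<Sum>y\<in>B. \<Sum>z\<in>C. g x y z) = (\<Sum>z\<in>C. \<Sum>y\<in>B. \<Sum>x\<in>A. g x y z)"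
  by (rule trans[OF sum.swap], rule trans[OF sum.cong[OF refl sum.swap]], rule sum.swap)

lemma fits_crossings: "fits n (map (Cross c) xs) \<longleftrightarrow> (\<forall>x\<in>set xs. Suc x < n)"
proof (induction xs)
  case (Cons x xs)
  have "Suc (Suc (n - 2)) = n" if "Suc x < n" using that by auto
  with Cons show ?case by auto
qed simp

lemma width_crossings: "fits n (map (Cross c) xs) \<Longrightarrow> width_from n (map (Cross c) xs) = n"
proof (induction xs)
  case (Cons x xs)
  then have "Suc (Suc (n - 2)) = n" by auto
  with Cons show ?case by simp
qed simp

lemma fits_sweep: "fits n (sweep_right c m) \<longleftrightarrow> m = 0 \<or> m < n" "fits n (sweep_left c m) \<longleftrightarrow> m = 0 \<or> m < n"
  unfolding sweep_right_def sweep_left_def fits_crossings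
  by (cases m; force simp: less_Suc_eq)+

lemma width_sweep: "m < n \<Longrightarrow> width_from n (sweep_right c m) = n" "m < n \<Longrightarrow> width_from n (sweep_left c m) = n"
  using fits_sweep[of n c m] by (auto simp: sweep_right_def sweep_left_def intro: width_crossings)

lemma sweep_right_Suc: "sweep_right c (Suc m) = Cross c 0 # shift 1 (sweep_right c m)"
  by (simp add: sweep_right_def shift_def upt_conv_Cons map_Suc_upt[symmetric] del: upt_Suc map_Suc_upt)

lemma sweep_left_Suc: "sweep_left c (Suc m) = Cross c m # sweep_left c m"
  by (simp add: sweep_left_def)

lemma fits_half_twist: "n \<le> k \<Longrightarrow> fits k (half_twist c n)"
  by (induction n) (auto simp: fits_sweep width_sweep)

context colour_model
begin

definition crossing_kernel :: "crossing \<Rightarrow> 'c \<Rightarrow> 'c \<Rightarrow> 'c \<Rightarrow> 'c \<Rightarrow> complex" where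
  "crossing_kernel c p q r s = (if c = Virtual then of_bool (r = q \<and> s = p) else X (par c) p q r s)"

lemma val_any_cross:
  assumes "Suc i < length a"
  shows "val (Cross c i # w) f a = (\<Sum>r\<in>B0. \<Sum>s\<in>B0. crossing_kernel c (a ! i) (a ! Suc i) r s *
     val w f (take i a @ [r, s] @ drop (Suc (Suc i)) a))"
proof -
  have "take 2 (drop i a) = [a ! i, a ! Suc i]"
    using assms by (simp add: numeral_2_eq_2 take_Suc_conv_app_nth)
  then show ?thesis
    by (simp add: val_Cons update_def inputs_def crossing_kernel_def)
      (simp add: numeral_2_eq_2 sum_words_Suc sum_words_0 cong: if_cong)
qed

lemma crossing_kernel_turn:
  "crossing_kernel c p x r y = crossing_kernel (turn c) x y p r"
  "crossing_kernel c y p x r = crossing_kernel (turn c) x y r p"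
  using tr_rotate[of "[p]" "[x, y, r]"] tr_rotate[of "[y, p, r]" "[x]"]
  by (cases c; auto simp: crossing_kernel_def X_def par_def)+

lemma val_sweep_right:
  "\<lbrakk>z \<in> B0; a \<in> words B0 m\<rbrakk> \<Longrightarrow> val (sweep_right c m) f (z # a) =
    (\<Sum>a'\<in>words B0 m. \<Sum>w\<in>B0. sweep_kernel B0 (crossing_kernel c) z a a' w * f (a' @ [w]))"
proof (induction m arbitrary: z a f)
  case 0
  then show ?case by (simp add: sweep_right_def words_0 sum_B0_delta)
next
  case (Suc m)
  then obtain p a1 where a: "a = p # a1" "p \<in> B0" "a1 \<in> words B0 m"
    by (auto simp: words_Suc)
  have "val (sweep_right c (Suc m)) f (z # a) = (\<Sum>r\<in>B0. \<Sum>s\<in>B0. crossing_kernel c z p r s *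
      val (sweep_right c m) (\<lambda>b. f (r # b)) (s # a1))"
    unfolding sweep_right_Suc using val_shift[of "[_]" 1] by (simp add: val_any_cross a)
  also have "\<dots> = (\<Sum>r\<in>B0. \<Sum>s\<in>B0. \<Sum>a'\<in>words B0 m. \<Sum>w\<in>B0. crossing_kernel c z p r s *
      (sweep_kernel B0 (crossing_kernel c) s a1 a' w * f (r # a' @ [w])))"
    using Suc.IH a by (intro sum.cong refl) (simp add: sum_distrib_left)
  also have "\<dots> = (\<Sum>r\<in>B0. \<Sum>a'\<in>words B0 m. \<Sum>w\<in>B0. \<Sum>s\<in>B0. crossing_kernel c z p r s *
      (sweep_kernel B0 (crossing_kernel c) s a1 a' w * f (r # a' @ [w])))"
    by (rule sum.cong[OF refl], subst sum.swap, rule sum.cong[OF refl], subst sum.swap, rule refl)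
  finally show ?case
    by (simp add: sum_words_Suc a sum_distrib_right mult.assoc)
qed

lemma val_sweep_left:
  "\<lbrakk>z \<in> B0; a \<in> words B0 m\<rbrakk> \<Longrightarrow> val (sweep_left c m) f (a @ [z]) =
    (\<Sum>a'\<in>words B0 m. \<Sum>w\<in>B0. sweep_kernel B0 (\<lambda>z p p' y. crossing_kernel c p z y p') z (rev a) (rev a') w * f (w # a'))"
proof (induction m arbitrary: z a f)
  case 0
  then show ?case by (simp add: sweep_left_def words_0 sum_B0_delta)
next
  case (Suc m)
  define k where "k = (\<lambda>z p p' y. crossing_kernel c p z y p')"
  from Suc.prems obtain a1 p where a: "a = a1 @ [p]" "p \<in> B0" "a1 \<in> words B0 m"
    by (cases a rule: rev_cases) (auto simp: words_def)
  have len: "length a1 = m" using a by (simp add: words_def)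
  have "val (sweep_left c (Suc m)) f (a @ [z]) = (\<Sum>r\<in>B0. \<Sum>s\<in>B0. crossing_kernel c p z r s *
      val (sweep_left c m) (\<lambda>b. f (b @ [s])) (a1 @ [r]))"
    unfolding sweep_left_Suc using val_right[of "a1 @ [_]" "sweep_left c m" f "[_]"] fits_sweep(2)[of "Suc m" c m]
    by (simp add: val_any_cross a len nth_append)
  also have "\<dots> = (\<Sum>r\<in>B0. \<Sum>s\<in>B0. \<Sum>a'\<in>words B0 m. \<Sum>w\<in>B0. k z p s r *
      (sweep_kernel B0 k r (rev a1) (rev a') w * f (w # a' @ [s])))"
    using Suc.IH a by (intro sum.cong refl) (simp add: sum_distrib_left k_def)
  also have "\<dots> = (\<Sum>s\<in>B0. \<Sum>a'\<in>words B0 m. \<Sum>w\<in>B0. \<Sum>r\<in>B0. k z p s r *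
      (sweep_kernel B0 k r (rev a1) (rev a') w * f (w # a' @ [s])))"
    by (subst sum.swap, rule sum.cong[OF refl], subst sum.swap, rule sum.cong[OF refl], subst sum.swap, rule refl)
  also have "\<dots> = (\<Sum>a'\<in>words B0 m. \<Sum>s\<in>B0. \<Sum>w\<in>B0. \<Sum>r\<in>B0. k z p s r *
      (sweep_kernel B0 k r (rev a1) (rev a') w * f (w # a' @ [s])))"
    by (rule sum.swap)
  finally show ?case
    by (simp add: sum_words_snoc a sum_distrib_right mult.assoc k_def)
qed

lemma sweep_kernel_virtual:
  "\<lbrakk>z \<in> B0; set a \<subseteq> B0; length a = length a'\<rbrakk> \<Longrightarrow>
   sweep_kernel B0 (\<lambda>p q r s. of_bool (r = q \<and> s = p)) z a a' w = of_bool (a' = a \<and> w = z)"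
proof (induction a arbitrary: a')
  case (Cons p a)
  then obtain p' a1 where "a' = p' # a1" by (cases a') auto
  with Cons show ?case by (simp add: of_bool_conj mult.assoc sum_distrib_left[symmetric] sum_B0_delta)
qed auto

lemma sum_words_delta:
  assumes "l \<in> words B0 m"
  shows "(\<Sum>l'\<in>words B0 m. of_bool (l' = l) * f l') = (f l :: complex)"
    and "(\<Sum>l'\<in>words B0 m. of_bool (l = l') * f l') = (f l :: complex)"
  using assms finite_words[OF finite_B0] by (auto simp: of_bool_def if_distrib[of "\<lambda>c. c * _"] cong: if_cong)

text \<open>
  A virtual crossing exchanges colours, and a trace is cyclic, so that virtual strands pass vertices as classical ones do.
\<close>

lemma crossing_vertex:
  assumes "z \<in> B0" "w \<in> B0" "l \<in> words B0 m" "b \<in> words B0 n"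
  shows "(\<Sum>l'\<in>words B0 m. sweep_kernel B0 (crossing_kernel c) z l l' w * tr (l' @ rev b))
    = (\<Sum>b'\<in>words B0 n. tr (l @ rev b') * sweep_kernel B0 (crossing_kernel c) z b' b w)"
proof (cases "c = Virtual")
  case False
  then have "crossing_kernel c = X (par c)" by (intro ext) (simp add: crossing_kernel_def)
  then show ?thesis using sweep_vertex[OF par assms] by simp
next
  case True
  then have k: "crossing_kernel c = (\<lambda>p q r s. of_bool (r = q \<and> s = p))"
    by (intro ext) (simp add: crossing_kernel_def)
  have "sweep_kernel B0 (crossing_kernel c) z l l' w = of_bool (l' = l) * of_bool (w = z)" if "l' \<in> words B0 m" for l'
    using that assms unfolding k by (subst sweep_kernel_virtual) (auto simp: words_def)
  moreover have "sweep_kernel B0 (crossing_kernel c) z b' b w = of_bool (b = b') * of_bool (w = z)" if "b' \<in> words B0 n" for b'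
    using that assms unfolding k by (subst sweep_kernel_virtual) (auto simp: words_def)
  ultimately show ?thesis
    using sum_words_delta(1)[OF assms(3), of "\<lambda>l'. of_bool (w = z) * tr (l' @ rev b)"]
      sum_words_delta(2)[OF assms(4), of "\<lambda>b'. tr (l @ rev b') * of_bool (w = z)"]
    by (simp add: mult_ac)
qed

lemma crossing_vertex_left:
  assumes "z \<in> B0" "w \<in> B0" "l \<in> words B0 m" "b \<in> words B0 n"
    and k_def: "k = (\<lambda>z p p' y. crossing_kernel c p z y p')"
  shows "(\<Sum>l'\<in>words B0 m. sweep_kernel B0 k z (rev l) (rev l') w * tr (l' @ rev b))
    = (\<Sum>b'\<in>words B0 n. tr (l @ rev b') * sweep_kernel B0 k z (rev b') (rev b) w)"
proof (cases "c = Virtual")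
  case False
  then have "k = (\<lambda>z p p' y. X (par c) p z y p')" by (intro ext) (simp add: crossing_kernel_def k_def)
  then show ?thesis using sweep_vertex_left[OF par[of c] assms(1-4)] by simp
next
  case True
  then have k: "k = (\<lambda>p q r s. of_bool (r = q \<and> s = p))"
    by (intro ext) (auto simp add: crossing_kernel_def k_def)
  have "sweep_kernel B0 k z (rev l) (rev l') w = of_bool (l' = l) * of_bool (w = z)" if "l' \<in> words B0 m" for l'
    using that assms unfolding k by (subst sweep_kernel_virtual) (auto simp: words_def)
  moreover have "sweep_kernel B0 k z (rev b') (rev b) w = of_bool (b = b') * of_bool (w = z)" if "b' \<in> words B0 n" for b'
    using that assms unfolding k by (subst sweep_kernel_virtual) (auto simp: words_def)
  ultimately show ?thesis
    using sum_words_delta(1)[OF assms(3), of "\<lambda>l'. of_bool (w = z) * tr (l' @ rev b)"]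
      sum_words_delta(2)[OF assms(4), of "\<lambda>b'. tr (l @ rev b') * of_bool (w = z)"]
    by (simp add: mult_ac)
qed

text \<open>
  A local form of the effect of a move: the scalar is the same for all colours on the boundary and all continuations.
\<close>

definition proportional :: "layer list \<Rightarrow> layer list \<Rightarrow> complex \<Rightarrow> bool" where
  "proportional T T' x \<longleftrightarrow>
     (\<forall>n a f. a \<in> words B0 n \<longrightarrow> fits n T \<longrightarrow> fits n T' \<longrightarrow> val T f a = x * val T' f a)"

lemma words_ge1: "\<lbrakk>a \<in> words B0 n; 1 \<le> n\<rbrakk> \<Longrightarrow> \<exists>x t. a = x # t \<and> x \<in> B0 \<and> set t \<subseteq> B0"
  by (cases a) (auto simp: words_def)

lemma words_ge2: "\<lbrakk>a \<in> words B0 n; 2 \<le> n\<rbrakk> \<Longrightarrow> \<exists>x y t. a = x # y # t \<and> x \<in> B0 \<and> y \<in> B0 \<and> set t \<subseteq> B0"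
  by (cases a; cases "tl a") (auto simp: words_def)

lemma words_ge3: "\<lbrakk>a \<in> words B0 n; 3 \<le> n\<rbrakk> \<Longrightarrow>
   \<exists>x y z t. a = x # y # z # t \<and> x \<in> B0 \<and> y \<in> B0 \<and> z \<in> B0 \<and> set t \<subseteq> B0"
  by (cases a; cases "tl a"; cases "tl (tl a)") (auto simp: words_def)

lemma words_split: "\<lbrakk>a \<in> words B0 n; k \<le> n\<rbrakk> \<Longrightarrow> \<exists>p t. a = p @ t \<and> p \<in> words B0 k \<and> t \<in> words B0 (n - k)"
  by (rule exI[of _ "take k a"], rule exI[of _ "drop k a"])
     (auto simp: words_def dest: in_set_takeD in_set_dropD)

lemma sweep_vertex_proportional:
  "proportional (sweep_right c m @ [Vertex 0 m n]) (Vertex 1 m n # sweep_right c n) 1"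
  unfolding proportional_def
proof (intro allI impI)
  fix k a and f :: "'c list \<Rightarrow> complex"
  assume a: "a \<in> words B0 k" and "fits k (sweep_right c m @ [Vertex 0 m n])"
    "fits k (Vertex 1 m n # sweep_right c n)"
  then have k: "Suc m \<le> k" by simp
  then obtain z l t where al: "a = z # l @ t" and z: "z \<in> B0" and l: "l \<in> words B0 m"
    using words_split[OF a k] by (auto simp: words_Suc)
  have len: "length l = m" using l by (simp add: words_def)
  have "val (sweep_right c m @ [Vertex 0 m n]) f a = val (sweep_right c m) (\<lambda>b. val [Vertex 0 m n] f (b @ t)) (z # l)"
    using val_right[of "z # l" "sweep_right c m" "val [Vertex 0 m n] f" t]
    by (simp add: al val_append fits_sweep len)
  also have "\<dots> = (\<Sum>l'\<in>words B0 m. \<Sum>w\<in>B0. \<Sum>b\<in>words B0 n. sweep_kernel B0 (crossing_kernel c) z l l' w * (tr (l' @ rev b) * f (b @ w # t)))"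
    unfolding val_sweep_right[OF z l]
    by (intro sum.cong refl) (auto simp: val_vertex words_def sum_distrib_left)
  also have "\<dots> = (\<Sum>w\<in>B0. \<Sum>b\<in>words B0 n. \<Sum>l'\<in>words B0 m. sweep_kernel B0 (crossing_kernel c) z l l' w * (tr (l' @ rev b) * f (b @ w # t)))"
    by (subst sum.swap, rule sum.cong[OF refl], rule sum.swap)
  also have "\<dots> = (\<Sum>w\<in>B0. \<Sum>b\<in>words B0 n. \<Sum>b'\<in>words B0 n. tr (l @ rev b') * (sweep_kernel B0 (crossing_kernel c) z b' b w * f (b @ w # t)))"
    by (rule sum.cong[OF refl], rule sum.cong[OF refl])
      (simp add: mult.assoc[symmetric] sum_distrib_right[symmetric] crossing_vertex[OF z _ l])
  also have "\<dots> = (\<Sum>b'\<in>words B0 n. \<Sum>b\<in>words B0 n. \<Sum>w\<in>B0. tr (l @ rev b') * (sweep_kernel B0 (crossing_kernel c) z b' b w * f (b @ w # t)))"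
    by (subst sum.swap[of _ B0], rule trans[OF sum.cong[OF refl sum.swap]], rule sum.swap)
  also have "\<dots> = (\<Sum>b'\<in>words B0 n. tr (l @ rev b') * val (sweep_right c n) (\<lambda>b. f (b @ t)) (z # b'))"
    by (intro sum.cong refl) (simp add: val_sweep_right[OF z] sum_distrib_left)
  also have "\<dots> = val (Vertex 1 m n # sweep_right c n) f a"
    unfolding val_vertex
  proof (intro sum.cong refl)
    fix b' assume b': "b' \<in> words B0 n"
    then show "tr (l @ rev b') * val (sweep_right c n) (\<lambda>b. f (b @ t)) (z # b')
      = tr (take m (drop 1 a) @ rev b') * val (sweep_right c n) f (take 1 a @ b' @ drop (1 + m) a)"
      using val_right[of "z # b'" "sweep_right c n" f t] by (simp add: al len fits_sweep words_def)
  qed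
  finally show "val (sweep_right c m @ [Vertex 0 m n]) f a = 1 * val (Vertex 1 m n # sweep_right c n) f a"
    by simp
qed

lemma sweep_left_vertex_proportional:
  "proportional (sweep_left c m @ [Vertex 1 m n]) (Vertex 0 m n # sweep_left c n) 1"
  unfolding proportional_def
proof (intro allI impI)
  fix k a and f :: "'c list \<Rightarrow> complex"
  define x where "x = (\<lambda>z p p' y. crossing_kernel c p z y p')"
  assume a: "a \<in> words B0 k" and F: "fits k (sweep_left c m @ [Vertex 1 m n])"
    "fits k (Vertex 0 m n # sweep_left c n)"
  have k: "Suc m \<le> k"
  proof (cases "m = 0")
    case True
    then show ?thesis using F(1) by (simp add: sweep_left_def)
  next
    case False
    then show ?thesis using F(1) fits_sweep(2)[of k c m] by simp
  qed
  then obtain l z t where al: "a = l @ z # t" and z: "z \<in> B0" and l: "l \<in> words B0 m"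
    using words_split[OF a k] by (auto simp: words_def length_Suc_conv_rev)
  have len: "length l = m" using l by (simp add: words_def)
  have "val (sweep_left c m @ [Vertex 1 m n]) f a = val (sweep_left c m) (\<lambda>b. val [Vertex 1 m n] f (b @ t)) (l @ [z])"
    using val_right[of "l @ [z]" "sweep_left c m" "val [Vertex 1 m n] f" t]
    by (simp add: al val_append fits_sweep len)
  also have "\<dots> = (\<Sum>l'\<in>words B0 m. \<Sum>w\<in>B0. \<Sum>b\<in>words B0 n. sweep_kernel B0 x z (rev l) (rev l') w * (tr (l' @ rev b) * f (w # b @ t)))"
    unfolding val_sweep_left[OF z l] x_def
    by (intro sum.cong refl) (auto simp: val_vertex words_def sum_distrib_left)
  also have "\<dots> = (\<Sum>w\<in>B0. \<Sum>b\<in>words B0 n. \<Sum>l'\<in>words B0 m. sweep_kernel B0 x z (rev l) (rev l') w * (tr (l' @ rev b) * f (w # b @ t)))"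
    by (subst sum.swap, rule sum.cong[OF refl], rule sum.swap)
  also have "\<dots> = (\<Sum>w\<in>B0. \<Sum>b\<in>words B0 n. \<Sum>b'\<in>words B0 n. tr (l @ rev b') * (sweep_kernel B0 x z (rev b') (rev b) w * f (w # b @ t)))"
    unfolding x_def
    by (rule sum.cong[OF refl], rule sum.cong[OF refl])
      (simp add: mult.assoc[symmetric] sum_distrib_right[symmetric] crossing_vertex_left[OF z _ l _ refl])
  also have "\<dots> = (\<Sum>b'\<in>words B0 n. \<Sum>b\<in>words B0 n. \<Sum>w\<in>B0. tr (l @ rev b') * (sweep_kernel B0 x z (rev b') (rev b) w * f (w # b @ t)))"
    by (subst sum.swap[of _ B0], rule trans[OF sum.cong[OF refl sum.swap]], rule sum.swap)
  also have "\<dots> = (\<Sum>b'\<in>words B0 n. tr (l @ rev b') * val (sweep_left c n) (\<lambda>b. f (b @ t)) (b' @ [z]))"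
    unfolding x_def
    by (intro sum.cong refl) (simp add: val_sweep_left[OF z] sum_distrib_left)
  also have "\<dots> = val (Vertex 0 m n # sweep_left c n) f a"
    unfolding val_vertex
  proof (intro sum.cong refl)
    fix b' assume b': "b' \<in> words B0 n"
    then show "tr (l @ rev b') * val (sweep_left c n) (\<lambda>b. f (b @ t)) (b' @ [z])
      = tr (take m (drop 0 a) @ rev b') * val (sweep_left c n) f (take 0 a @ b' @ drop (0 + m) a)"
      using val_right[of "b' @ [z]" "sweep_left c n" f t] by (simp add: al len fits_sweep words_def)
  qed
  finally show "val (sweep_left c m @ [Vertex 1 m n]) f a = 1 * val (Vertex 0 m n # sweep_left c n) f a"
    by simp
qed

lemma twist_value_Nil: "twist_value a n d [] = (- 1 / a) ^ n * tr (rev d)"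
proof -
  have "\<kappa>\<^sup>2 * (1 + a) * tr (rev d) * tr [] = (\<kappa>\<^sup>2 * K) * ((1 + a) * tr (rev d))"
    by (simp only: mult_ac tr_Nil)
  then show ?thesis
    unfolding twist_value_def kappa_K by (simp add: algebra_simps)
qed

text \<open>
  The strands enter the twist one by one: \<open>sweep_trace\<close> evaluates the sweep of one strand across the others, and \<open>twist_sum\<close> the sum over
  its colour.
\<close>

lemma half_twist_sum:
  assumes c: "c \<noteq> Virtual"
  shows "(\<Sum>b\<in>words B0 n. tr (rev b @ u) * val (half_twist c n) f b) = (\<Sum>d\<in>words B0 n. twist_value (par c) n d u * f d)"
proof (induction n arbitrary: u f)
  case 0
  have "\<kappa>\<^sup>2 * (1 + par c) * (K * tr u) = (\<kappa>\<^sup>2 * K) * ((1 + par c) * tr u)"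
    by (simp only: mult_ac)
  then have "\<kappa>\<^sup>2 * (1 + par c) * (K * tr u) = tr u + par c * tr u"
    unfolding kappa_K by (simp add: algebra_simps)
  then show ?case
    by (simp add: words_0 twist_value_def tr_Nil mult.assoc)
next
  case (Suc n)
  define a where "a = par c"
  have ck: "crossing_kernel c = X a" using c by (intro ext) (simp add: crossing_kernel_def a_def)
  note a = par[of c, folded a_def]
  define c1 c2 where "c1 = - 1 / a" and "c2 = \<kappa>\<^sup>2 * (1 + 1 / a) * (1 / a) * tr u"
  define c3 where "c3 = (\<lambda>w. \<kappa>\<^sup>2 * (1 + 1 / a) * tr (u @ [w]))"
  define H where "H = (\<lambda>w. val (half_twist c n) (\<lambda>d. f (d @ [w])))"
  have tv: "(\<Sum>b\<in>words B0 n. tr (rev b @ u) * H w b) = (\<Sum>d\<in>words B0 n. twist_value a n d u * f (d @ [w]))" for u w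
    using Suc.IH[of u "\<lambda>d. f (d @ [w])"] by (simp add: H_def a_def)
  have "(\<Sum>b\<in>words B0 (Suc n). tr (rev b @ u) * val (half_twist c (Suc n)) f b)
    = (\<Sum>z\<in>B0. \<Sum>b\<in>words B0 n. tr (rev b @ z # u) * val (sweep_right c n) (val (half_twist c n) f) (z # b))"
    by (simp add: sum_words_Suc val_append)
  also have "\<dots> = (\<Sum>z\<in>B0. \<Sum>b\<in>words B0 n. \<Sum>b'\<in>words B0 n. \<Sum>w\<in>B0. tr (rev b @ z # u) * (sweep_kernel B0 (X a) z b b' w * H w b'))"
  proof (intro sum.cong refl)
    fix z b assume "z \<in> B0" "b \<in> words B0 n"
    moreover have "val (half_twist c n) f (b' @ [w]) = H w b'" if "b' \<in> words B0 n" for b' w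
      using that val_right[of b' "half_twist c n" f "[w]"] by (simp add: H_def words_def fits_half_twist)
    ultimately show "tr (rev b @ z # u) * val (sweep_right c n) (val (half_twist c n) f) (z # b)
      = (\<Sum>b'\<in>words B0 n. \<Sum>w\<in>B0. tr (rev b @ z # u) * (sweep_kernel B0 (X a) z b b' w * H w b'))"
      by (simp add: val_sweep_right ck sum_distrib_left)
  qed
  also have "\<dots> = (\<Sum>z\<in>B0. \<Sum>b'\<in>words B0 n. \<Sum>w\<in>B0. \<Sum>b\<in>words B0 n. tr (rev b @ z # u) * (sweep_kernel B0 (X a) z b b' w * H w b'))"
    by (rule sum.cong[OF refl], subst sum.swap, rule sum.cong[OF refl], rule sum.swap)
  also have "\<dots> = (\<Sum>z\<in>B0. \<Sum>b'\<in>words B0 n. \<Sum>w\<in>B0. Psi a w (rev b') z (z # u) * H w b')"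
  proof (intro sum.cong refl)
    fix z b' w assume *: "z \<in> B0" "b' \<in> words B0 n" "w \<in> B0"
    then have **: "rev b' \<in> words B0 n" by (auto simp: words_def)
    have "(\<Sum>b\<in>words B0 n. tr (rev b @ z # u) * sweep_kernel B0 (X a) z b b' w)
      = (\<Sum>b\<in>words B0 n. sweep_kernel B0 (X a) w (rev b') (rev b) z * tr (rev b @ z # u))"
    proof (intro sum.cong refl)
      fix b assume "b \<in> words B0 n"
      then show "tr (rev b @ z # u) * sweep_kernel B0 (X a) z b b' w
        = sweep_kernel B0 (X a) w (rev b') (rev b) z * tr (rev b @ z # u)"
        using sweep_kernel_rotate[OF finite_B0 _ *(1,3) X_rotate, of b b' a] *
        by (simp add: words_def)
    qed
    also have "\<dots> = Psi a w (rev b') z (z # u)"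
      using sum_words_rev[of "\<lambda>b. sweep_kernel B0 (X a) w (rev b') b z * tr (b @ z # u)"] sweep_trace[OF a *(3,1) **] by simp
    finally show "(\<Sum>b\<in>words B0 n. tr (rev b @ z # u) * (sweep_kernel B0 (X a) z b b' w * H w b'))
      = Psi a w (rev b') z (z # u) * H w b'"
      by (simp add: mult.assoc[symmetric] sum_distrib_right[symmetric])
  qed
  also have "\<dots> = (\<Sum>w\<in>B0. \<Sum>b'\<in>words B0 n. (\<Sum>z\<in>B0. Psi a w (rev b') z (z # u)) * H w b')"
    unfolding sum_distrib_right
    by (rule sum_reverse3)
  also have "\<dots> = (\<Sum>w\<in>B0. \<Sum>b'\<in>words B0 n. c1 * (tr (rev b' @ u @ [w]) * H w b')
      + c2 * (tr (rev b' @ [w]) * H w b') + c3 w * (tr (rev b' @ []) * H w b'))"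
    unfolding c1_def c2_def c3_def
    by (intro sum.cong refl) (simp add: twist_sum[OF a] algebra_simps add_divide_distrib)
  also have "\<dots> = (\<Sum>w\<in>B0. \<Sum>d\<in>words B0 n. (c1 * twist_value a n d (u @ [w])
      + c2 * twist_value a n d [w] + c3 w * twist_value a n d []) * f (d @ [w]))"
    unfolding sum.distrib sum_distrib_left[symmetric] tv
    unfolding sum_distrib_left sum.distrib[symmetric] by (simp add: algebra_simps)
  also have "\<dots> = (\<Sum>w\<in>B0. \<Sum>d\<in>words B0 n. twist_value a (Suc n) (d @ [w]) u * f (d @ [w]))"
  proof (intro sum.cong refl)
    fix w d assume w: "w \<in> B0"
    define y where "y = (- 1 / a) ^ n"
    have 1: "twist_value a n d [] = y * tr (rev d)"
      by (simp add: twist_value_Nil y_def)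
    have 2: "twist_value a n d [w] = y * (- a * tr (rev d @ [w]))"
      by (simp add: twist_value_def y_def tr_single w)
    have 3: "tr (w # rev d @ u) = tr (rev d @ u @ [w])" "tr (w # rev d) = tr (rev d @ [w])"
      by (simp_all add: tr_move)
    have "c1 * twist_value a n d (u @ [w]) + c2 * twist_value a n d [w] + c3 w * twist_value a n d []
      = - 1 / a * y * (\<kappa>\<^sup>2 * (1 + a) * tr (rev d @ [w]) * tr u - a * tr (rev d @ u @ [w]))"
      unfolding 1 2 c1_def c2_def c3_def unfolding twist_value_def y_def[symmetric] using a(1) by (simp add: field_simps)
    then show "(c1 * twist_value a n d (u @ [w]) + c2 * twist_value a n d [w] + c3 w * twist_value a n d [])
         * f (d @ [w]) = twist_value a (Suc n) (d @ [w]) u * f (d @ [w])"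
      by (simp add: twist_value_def 3 y_def)
  qed
  also have "\<dots> = (\<Sum>d\<in>words B0 (Suc n). twist_value a (Suc n) d u * f d)"
    unfolding sum_words_snoc by (rule sum.swap)
  finally show ?case by (simp add: a_def)
qed

end

section \<open>Moves multiply the partition function by a scalar\<close>

context colour_model
begin

lemma proportional_trans_append:
  assumes "proportional T T' x" shows "\<lbrakk>a \<in> words B0 n; fits n T; fits n T'\<rbrakk> \<Longrightarrow> val (T @ v) f a = x * val (T' @ v) f a"
  using assms by (simp add: proportional_def val_append)

lemma heights_proportional:
  assumes "offset A + outs A \<le> offset B"
  shows "proportional [A, B] [place (offset B - outs A + ins A) B, A] 1"
  unfolding proportional_def
proof (intro allI impI)
  fix n a and f :: "'c list \<Rightarrow> complex"
  let ?B = "place (offset B - outs A + ins A) B"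
  assume a: "a \<in> words B0 n" "fits n [A, B]" "fits n [?B, A]"
  then have len: "length a = n" and n: "offset A + ins A + (offset B - (offset A + outs A)) + ins B \<le> n"
    using assms by (auto simp: words_def)
  define P where "P = take (offset A) a"
  define Q where "Q = take (ins A) (drop (offset A) a)"
  define R where "R = take (offset B - (offset A + outs A)) (drop (ins A) (drop (offset A) a))"
  define S where "S = take (ins B) (drop (offset B - (offset A + outs A)) (drop (ins A) (drop (offset A) a)))"
  define U where "U = drop (ins B) (drop (offset B - (offset A + outs A)) (drop (ins A) (drop (offset A) a)))"
  have PQ: "a = P @ Q @ R @ S @ U"
    unfolding P_def Q_def R_def S_def U_def by (simp only: append_take_drop_id)
  have l: "length P = offset A" "length Q = ins A" "length S = ins B"
    "length R = offset B - (offset A + outs A)"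
    using len n unfolding P_def Q_def R_def S_def by auto
  have B: "offset B = length P + outs A + length R" using l assms by simp
  have 1: "inputs A a = Q" "inputs A (P @ Q @ R @ c @ U) = Q" "update A b a = P @ b @ R @ S @ U"
     "update A b (P @ Q @ R @ c @ U) = P @ b @ R @ c @ U" for b c
    using l by (simp_all add: PQ inputs_def update_def)
  have 2: "inputs ?B a = S" "update ?B c a = P @ Q @ R @ c @ U" for c
    using l B by (simp_all add: PQ inputs_def update_def)
  have 3: "inputs B (P @ b @ R @ S @ U) = S" "update B c (P @ b @ R @ S @ U) = P @ b @ R @ c @ U"
    if "b \<in> words B0 (outs A)" for b c
    using l B that by (simp_all add: words_def inputs_def update_def)
  have "val [A, B] f a = (\<Sum>b\<in>words B0 (outs A). \<Sum>c\<in>words B0 (outs B). tau A Q b * (tau B S c * f (P @ b @ R @ c @ U)))"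
    unfolding val_Cons 1 by (intro sum.cong refl) (simp add: 3 sum_distrib_left)
  also have "\<dots> = (\<Sum>c\<in>words B0 (outs B). \<Sum>b\<in>words B0 (outs A). tau A Q b * (tau B S c * f (P @ b @ R @ c @ U)))"
    by (rule sum.swap)
  also have "\<dots> = val [?B, A] f a"
    unfolding val_Cons 2 1 by (simp add: sum_distrib_left mult_ac)
  finally show "val [A, B] f a = 1 * val [?B, A] f a" by simp
qed

lemma proportionalI1:
  assumes "\<And>n. fits n T \<Longrightarrow> fits n T' \<Longrightarrow> 1 \<le> n"
    and "\<And>x t f. \<lbrakk>x \<in> B0; set t \<subseteq> B0\<rbrakk> \<Longrightarrow> val T f (x # t) = k * val T' f (x # t)"
  shows "proportional T T' k"
  unfolding proportional_def using assms words_ge1 by blast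

lemma proportionalI2:
  assumes "\<And>n. fits n T \<Longrightarrow> fits n T' \<Longrightarrow> 2 \<le> n"
    and "\<And>x y t f. \<lbrakk>x \<in> B0; y \<in> B0; set t \<subseteq> B0\<rbrakk> \<Longrightarrow> val T f (x # y # t) = k * val T' f (x # y # t)"
  shows "proportional T T' k"
  unfolding proportional_def
proof (intro allI impI)
  fix n a and f :: "'c list \<Rightarrow> complex" assume a: "a \<in> words B0 n" "fits n T" "fits n T'"
  obtain x y t where "a = x # y # t" "x \<in> B0" "y \<in> B0" "set t \<subseteq> B0"
    using words_ge2[OF a(1) assms(1)[OF a(2,3)]] by blast
  then show "val T f a = k * val T' f a" using assms(2) by simp
qed

lemma proportionalI3:
  assumes "\<And>n. fits n T \<Longrightarrow> fits n T' \<Longrightarrow> 3 \<le> n"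
    and "\<And>x y z t f. \<lbrakk>x \<in> B0; y \<in> B0; z \<in> B0; set t \<subseteq> B0\<rbrakk> \<Longrightarrow> val T f (x # y # z # t) = k * val T' f (x # y # z # t)"
  shows "proportional T T' k"
  unfolding proportional_def
proof (intro allI impI)
  fix n a and f :: "'c list \<Rightarrow> complex" assume a: "a \<in> words B0 n" "fits n T" "fits n T'"
  obtain x y z t where "a = x # y # z # t" "x \<in> B0" "y \<in> B0" "z \<in> B0" "set t \<subseteq> B0"
    using words_ge3[OF a(1) assms(1)[OF a(2,3)]] by blast
  then show "val T f a = k * val T' f a" using assms(2) by simp
qed

text \<open>
  Planar isotopy only uses that the trace is cyclic and that cups and caps identify colours.
\<close>

lemma planar_proportional:
  assumes "planar_move T T'" shows "proportional T T' 1"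
  using assms
proof cases
  case (heights A B)
  then show ?thesis using heights_proportional by simp
next
  case zigzag_left
  show ?thesis unfolding zigzag_left
    by (rule proportionalI1) (auto simp: val_cup val_cap sum_B0_delta)
next
  case zigzag_right
  show ?thesis unfolding zigzag_right
    by (rule proportionalI1) (auto simp: val_cup val_cap sum_B0_delta)
next
  case (turn_crossing_left c)
  show ?thesis unfolding turn_crossing_left
  proof (rule proportionalI2)
    fix x y t and f :: "'c list \<Rightarrow> complex" assume *: "x \<in> B0" "y \<in> B0" "set t \<subseteq> B0"
    have "val [Cup 0, Cross c 1, Cap 2] f (x # y # t)
      = (\<Sum>p\<in>B0. \<Sum>r\<in>B0. \<Sum>s\<in>B0. of_bool (s = y) * (crossing_kernel c p x r s * f (p # r # t)))"
      by (auto simp: val_cup val_cap val_any_cross mult_ac intro!: sum.cong)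
    also have "\<dots> = (\<Sum>p\<in>B0. \<Sum>r\<in>B0. crossing_kernel c p x r y * f (p # r # t))"
      using * by (simp add: sum_B0_delta)
    also have "\<dots> = val [Cross (turn c) 0] f (x # y # t)"
      by (simp add: val_any_cross crossing_kernel_turn(1)[of c])
    finally show "val [Cup 0, Cross c 1, Cap 2] f (x # y # t) = 1 * val [Cross (turn c) 0] f (x # y # t)"
      by simp
  qed auto
next
  case (turn_crossing_right c)
  show ?thesis unfolding turn_crossing_right
  proof (rule proportionalI2)
    fix x y t and f :: "'c list \<Rightarrow> complex" assume *: "x \<in> B0" "y \<in> B0" "set t \<subseteq> B0"
    have "val [Cup 2, Cross c 1, Cap 0] f (x # y # t)
      = (\<Sum>p\<in>B0. \<Sum>r\<in>B0. of_bool (x = r) * (\<Sum>s\<in>B0. crossing_kernel c y p r s * f (s # p # t)))"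
      by (auto simp: val_cup val_cap val_any_cross sum_distrib_left mult_ac numeral_2_eq_2 intro!: sum.cong)
    also have "\<dots> = (\<Sum>p\<in>B0. \<Sum>s\<in>B0. crossing_kernel c y p x s * f (s # p # t))"
      using * by (simp add: sum_B0_delta)
    also have "\<dots> = (\<Sum>s\<in>B0. \<Sum>p\<in>B0. crossing_kernel c y p x s * f (s # p # t))"
      by (rule sum.swap)
    also have "\<dots> = val [Cross (turn c) 0] f (x # y # t)"
      by (simp add: val_any_cross crossing_kernel_turn(2)[of c])
    finally show "val [Cup 2, Cross c 1, Cap 0] f (x # y # t) = 1 * val [Cross (turn c) 0] f (x # y # t)"
      by simp
  qed auto
next
  case (turn_half_edge_left m n)
  show ?thesis unfolding turn_half_edge_left proportional_def
  proof (intro allI impI)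
    fix k a and f :: "'c list \<Rightarrow> complex"
    have "val [Cup 0, Vertex 1 (Suc m) n] f a = (\<Sum>p\<in>B0. \<Sum>b\<in>words B0 n. tr (p # take m a @ rev b) * f (p # b @ drop m a))"
      by (simp add: val_cup val_vertex)
    also have "\<dots> = (\<Sum>p\<in>B0. \<Sum>b\<in>words B0 n. tr (take m a @ rev b @ [p]) * f (p # b @ drop m a))"
      by (simp add: tr_move)
    also have "\<dots> = val [Vertex 0 m (Suc n)] f a"
      by (simp add: val_vertex sum_words_Suc)
    finally show "val [Cup 0, Vertex 1 (Suc m) n] f a = 1 * val [Vertex 0 m (Suc n)] f a" by simp
  qed
next
  case (turn_half_edge_right m n)
  show ?thesis unfolding turn_half_edge_right proportional_def
  proof (intro allI impI)
    fix k a and f :: "'c list \<Rightarrow> complex"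
    assume a: "a \<in> words B0 k" "fits k [Cup m, Vertex 0 (Suc m) n]" "fits k [Vertex 0 m (Suc n)]"
    then have "m \<le> length a" by (simp add: words_def)
    then have "val [Cup m, Vertex 0 (Suc m) n] f a = (\<Sum>p\<in>B0. \<Sum>b\<in>words B0 n. tr (take m a @ p # rev b) * f (b @ p # drop m a))"
      by (simp add: val_cup val_vertex min_def)
    also have "\<dots> = (\<Sum>b\<in>words B0 n. \<Sum>p\<in>B0. tr (take m a @ p # rev b) * f (b @ p # drop m a))"
      by (rule sum.swap)
    also have "\<dots> = val [Vertex 0 m (Suc n)] f a"
      by (simp add: val_vertex sum_words_snoc)
    finally show "val [Cup m, Vertex 0 (Suc m) n] f a = 1 * val [Vertex 0 m (Suc n)] f a" by simp
  qed
qed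

lemma kink_right_proportional:
  assumes "c \<noteq> Virtual" shows "proportional [Cup 1, Cross c 0, Cap 1] [] ((par c)\<^sup>2)"
proof (rule proportionalI1)
  fix x t and f :: "'c list \<Rightarrow> complex" assume *: "x \<in> B0" "set t \<subseteq> B0"
  have "val [Cup 1, Cross c 0, Cap 1] f (x # t)
    = (\<Sum>p\<in>B0. \<Sum>r\<in>B0. \<Sum>s\<in>B0. of_bool (s = p) * (X (par c) x p r s * f (r # t)))"
    using assms by (auto simp: val_cup val_cap val_cross mult_ac intro!: sum.cong)
  also have "\<dots> = (\<Sum>p\<in>B0. \<Sum>r\<in>B0. X (par c) x p r p * f (r # t))"
    by (intro sum.cong refl) (simp add: sum_B0_delta)
  also have "\<dots> = (\<Sum>r\<in>B0. (\<Sum>p\<in>B0. X (par c) x p r p) * f (r # t))"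
    by (subst sum.swap) (simp add: sum_distrib_right)
  also have "\<dots> = (par c)\<^sup>2 * val [] f (x # t)"
    using * kink(1)[OF par] by (simp add: mult.assoc sum_distrib_left[symmetric] sum_B0_delta)
  finally show "val [Cup 1, Cross c 0, Cap 1] f (x # t) = (par c)\<^sup>2 * val [] f (x # t)" .
qed auto

lemma kink_left_proportional:
  assumes "c \<noteq> Virtual" shows "proportional [Cup 0, Cross c 1, Cap 0] [] ((par c)\<^sup>2)"
proof (rule proportionalI1)
  fix x t and f :: "'c list \<Rightarrow> complex" assume *: "x \<in> B0" "set t \<subseteq> B0"
  have "val [Cup 0, Cross c 1, Cap 0] f (x # t)
    = (\<Sum>p\<in>B0. \<Sum>r\<in>B0. of_bool (p = r) * (\<Sum>s\<in>B0. X (par c) p x r s * f (s # t)))"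
    using assms by (auto simp: val_cup val_cap val_cross mult_ac sum_distrib_left intro!: sum.cong)
  also have "\<dots> = (\<Sum>p\<in>B0. \<Sum>s\<in>B0. X (par c) p x p s * f (s # t))"
    by (rule sum.cong[OF refl]) (simp add: sum_B0_delta)
  also have "\<dots> = (\<Sum>s\<in>B0. (\<Sum>p\<in>B0. X (par c) p x p s) * f (s # t))"
    by (subst sum.swap) (simp add: sum_distrib_right)
  also have "\<dots> = (par c)\<^sup>2 * val [] f (x # t)"
    using * kink(2)[OF par] by (simp add: mult.assoc sum_distrib_left[symmetric] sum_B0_delta)
  finally show "val [Cup 0, Cross c 1, Cap 0] f (x # t) = (par c)\<^sup>2 * val [] f (x # t)" .
qed auto

lemma II_proportional:
  assumes "c \<noteq> Virtual" shows "proportional [Cross c 0, Cross (turn c) 0] [] 1"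
proof (rule proportionalI2)
  fix x y t and f :: "'c list \<Rightarrow> complex" assume *: "x \<in> B0" "y \<in> B0" "set t \<subseteq> B0"
  have t: "turn c \<noteq> Virtual" using assms by (cases c) auto
  have "val [Cross c 0, Cross (turn c) 0] f (x # y # t)
    = (\<Sum>r\<in>B0. \<Sum>s\<in>B0. \<Sum>p\<in>B0. \<Sum>q\<in>B0. X (par c) x y r s * X (1 / par c) r s p q * f (p # q # t))"
    using assms t by (simp add: val_cross par_turn sum_distrib_left mult_ac)
  also have "\<dots> = (\<Sum>p\<in>B0. \<Sum>q\<in>B0. \<Sum>r\<in>B0. \<Sum>s\<in>B0. X (par c) x y r s * X (1 / par c) r s p q * f (p # q # t))"
    by (rule trans[OF sum_reverse3], rule sum.cong[OF refl], rule trans[OF sum.cong[OF refl sum.swap]], rule trans[OF sum.swap]) (rule sum.cong[OF refl sum.swap])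
  also have "\<dots> = (\<Sum>p\<in>B0. \<Sum>q\<in>B0. of_bool (x = p \<and> y = q) * f (p # q # t))"
    using * X_inverse[OF par] by (intro sum.cong refl) (simp add: sum_distrib_right[symmetric])
  also have "\<dots> = f (x # y # t)"
    using * by (simp add: of_bool_conj mult.assoc sum_distrib_left[symmetric] sum_B0_delta)
  finally show "val [Cross c 0, Cross (turn c) 0] f (x # y # t) = 1 * val [] f (x # y # t)" by simp
qed auto

lemma virtual_proportional:
  "proportional [Cup 1, Cross Virtual 0, Cap 1] [] 1"
  "proportional [Cup 0, Cross Virtual 1, Cap 0] [] 1"
  "proportional [Cross Virtual 0, Cross Virtual 0] [] 1"
  "proportional [Cross Virtual 0, Cross Virtual 1, Cross Virtual 0] [Cross Virtual 1, Cross Virtual 0, Cross Virtual 1] 1"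
  "c \<noteq> Virtual \<Longrightarrow> proportional [Cross Virtual 0, Cross Virtual 1, Cross c 0] [Cross c 1, Cross Virtual 0, Cross Virtual 1] 1"
  "c \<noteq> Virtual \<Longrightarrow> proportional [Cross Virtual 0, Cross c 1, Cross Virtual 0] [Cross Virtual 1, Cross c 0, Cross Virtual 1] 1"
  "c \<noteq> Virtual \<Longrightarrow> proportional [Cross c 0, Cross Virtual 1, Cross Virtual 0] [Cross Virtual 1, Cross Virtual 0, Cross c 1] 1"
  by (rule proportionalI1 proportionalI2 proportionalI3; 
      force simp: val_virtual val_cross val_cup val_cap sum_B0_delta nth_Cons' intro!: sum.cong)+

lemma val_cap_vertex: "set a \<subseteq> B0 \<Longrightarrow> Suc i < length a \<Longrightarrow> val (Cap i # w) f a = val (Vertex i 2 0 # w) f a"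
proof -
  assume a: "set a \<subseteq> B0" "Suc i < length a"
  then have "take 2 (drop i a) = [a ! i, a ! Suc i]"
    by (simp add: numeral_2_eq_2 take_Suc_conv_app_nth)
  moreover have "a ! i \<in> B0" "a ! Suc i \<in> B0" using a by (auto simp: subset_iff)
  ultimately show ?thesis using a by (simp add: val_cap val_vertex words_0 tr_pair0)
qed

lemma val_cup_vertex: "val (Cup i # w) f a = val (Vertex i 0 2 # w) f a"
  unfolding val_vertex numeral_2_eq_2 sum_words_Suc sum_words_0 val_cup
  by (rule sum.cong[OF refl]) (simp add: tr_pair0 sum_B0_delta)

lemma val_cross_vertices:
  assumes "c \<noteq> Virtual" "Suc i < length a" "set a \<subseteq> B0"
  shows "val [Cross c i] f a = par c * f a + 1 / par c * val [Vertex i 2 0, Vertex i 0 2] f a - K * val [Vertex i 2 2] f a"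
proof -
  have "val [Cap i, Cup i] f a = val [Vertex i 2 0, Vertex i 0 2] f a"
    using val_cap_vertex[of a i "[Cup i]" f] assms by (simp add: val_vertex val_cup_vertex)
  then show ?thesis using val_cross_expand[OF assms] by simp
qed

text \<open>
  Expanding one crossing by the skein relation reduces the third move to a pair of strands moving past a vertex of degree four,
  past a cap and past a cup. The last two are vertices of degree two, so that all three are sweeps.
\<close>

lemma III_aux:
  assumes "c \<noteq> Virtual" and a: "a \<in> words B0 n" "3 \<le> n"
    and W: "fits n W" "width_from n W = n"
    and 2: "val (W @ [Vertex i 2 2]) f a = val (Vertex j 2 2 # W) f a"
    and 20: "val (W @ [Vertex i 2 0, Vertex i 0 2]) f a = val (Vertex j 2 0 # Vertex j 0 2 # W) f a"
    and i: "i \<le> 1" "j \<le> 1"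
  shows "val (W @ [Cross c i]) f a = val (Cross c j # W) f a"
proof -
  have "val (W @ [Cross c i]) f a = val W (\<lambda>b. par c * f b + 1 / par c * val [Vertex i 2 0, Vertex i 0 2] f b + (- K) * val [Vertex i 2 2] f b) a"
    unfolding val_append using a W i assms(1)
    by (intro val_cong[of a n]) (auto simp: words_def val_cross_vertices)
  also have "\<dots> = par c * val W f a + 1 / par c * val (W @ [Vertex i 2 0, Vertex i 0 2]) f a + (- K) * val (W @ [Vertex i 2 2]) f a"
    by (simp only: val_add val_scale val_append)
  also have "\<dots> = val [Cross c j] (val W f) a"
    using a assms(1) i by (simp add: 2 20 val_cross_vertices words_def) (simp add: val_append[symmetric])
  finally show ?thesis by (simp add: val_append[symmetric])
qed

text \<open>
  If two consecutive crossing types agree, one strand is swept across the crossing of the other two.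
\<close>

lemma III_proportional:
  assumes "a \<noteq> Virtual" "b \<noteq> Virtual" "c \<noteq> Virtual" "a = b \<or> b = c"
  shows "proportional [Cross a 0, Cross b 1, Cross c 0] [Cross c 1, Cross b 0, Cross a 1] 1"
  unfolding proportional_def
proof (intro allI impI)
  fix n x and f :: "'c list \<Rightarrow> complex"
  assume x: "x \<in> words B0 n" and "fits n [Cross a 0, Cross b 1, Cross c 0]"
  then have n: "3 \<le> n" by auto
  have sw: "sweep_right c 2 = [Cross c 0, Cross c 1]" "sweep_left c 2 = [Cross c 1, Cross c 0]"
    "sweep_right c 0 = []" "sweep_left c 0 = []" for c
    by (simp_all add: sweep_right_def sweep_left_def numeral_2_eq_2)
  have k: "Suc (Suc (n - 2)) = n" "Suc (Suc (n - Suc (Suc 0))) = n" using n by auto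
  have R: "val (T @ v) g x' = val (T' @ v) g x'"
    if "proportional T T' 1" "x' \<in> words B0 n'" "fits n' T" "fits n' T'" for T T' v g x' n'
    using proportional_trans_append[OF that] by simp
  show "val [Cross a 0, Cross b 1, Cross c 0] f x = 1 * val [Cross c 1, Cross b 0, Cross a 1] f x"
  proof (cases "a = b")
    case True
    have 2: "val (sweep_right a 2 @ [Vertex 0 2 2]) f x = val (Vertex 1 2 2 # sweep_right a 2) f x"
      using R[OF sweep_vertex_proportional x, of a 2 2 "[]" f] n k by (simp add: sw)
    have 3: "val (sweep_right a 2 @ [Vertex 0 2 0, Vertex 0 0 2]) f x = val (Vertex 1 2 0 # Vertex 0 0 2 # []) f x"
      using R[OF sweep_vertex_proportional x, of a 2 0 "[Vertex 0 0 2]" f] n k by (simp add: sw)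
    have "val [Vertex 0 0 2] f y = val (Vertex 1 0 2 # sweep_right a 2) f y" if "y \<in> words B0 (n - 2)" for y
      using R[OF sweep_vertex_proportional that, of a 0 2 "[]" f] n k by (simp add: sw)
    moreover have "take 1 x @ drop 3 x \<in> words B0 (n - 2)"
      using x n by (auto simp: words_def dest: in_set_takeD in_set_dropD)
    ultimately have 4: "val (Vertex 1 2 0 # Vertex 0 0 2 # []) f x = val (Vertex 1 2 0 # Vertex 1 0 2 # sweep_right a 2) f x"
      unfolding val_vertex[of 1 2 0] by (simp add: words_0 numeral_3_eq_3)
    show ?thesis
      using III_aux[OF assms(3) x n, of "sweep_right a 2" 0 f 1] True 2 3 4 n k by (simp add: sw)
  next
    case False
    then have bc: "b = c" using assms by simp
    have 2: "val (sweep_left b 2 @ [Vertex 1 2 2]) f x = val (Vertex 0 2 2 # sweep_left b 2) f x"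
      using R[OF sweep_left_vertex_proportional x, of b 2 2 "[]" f] n k by (simp add: sw)
    have 3: "val (sweep_left b 2 @ [Vertex 1 2 0, Vertex 1 0 2]) f x = val (Vertex 0 2 0 # Vertex 1 0 2 # []) f x"
      using R[OF sweep_left_vertex_proportional x, of b 2 0 "[Vertex 1 0 2]" f] n k by (simp add: sw)
    have "val [Vertex 1 0 2] f y = val (Vertex 0 0 2 # sweep_left b 2) f y" if "y \<in> words B0 (n - 2)" for y
      using R[OF sweep_left_vertex_proportional that, of b 0 2 "[]" f] n k by (simp add: sw)
    moreover have "drop 2 x \<in> words B0 (n - 2)"
      using x n by (auto simp: words_def dest: in_set_takeD in_set_dropD)
    ultimately have 4: "val (Vertex 0 2 0 # Vertex 1 0 2 # []) f x = val (Vertex 0 2 0 # Vertex 0 0 2 # sweep_left b 2) f x"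
      unfolding val_vertex[of 0 2 0] by (simp add: words_0 numeral_2_eq_2)
    show ?thesis
      using III_aux[OF assms(1) x n, of "sweep_left b 2" 1 f 0] bc 2 3 4 n k by (simp add: sw)
  qed
qed

lemma V_proportional:
  assumes "c \<noteq> Virtual"
  shows "proportional (Vertex 0 0 n # half_twist c n) [Vertex 0 0 n] ((- 1 / par c) ^ n)"
  unfolding proportional_def
proof (intro allI impI)
  fix k a and f :: "'c list \<Rightarrow> complex"
  note t = twist_value_Nil
  have "val (Vertex 0 0 n # half_twist c n) f a = (\<Sum>b\<in>words B0 n. tr (rev b @ []) * val (half_twist c n) (\<lambda>d. f (d @ a)) b)"
    unfolding val_vertex by (intro sum.cong refl) (auto simp: words_def val_right fits_half_twist)
  also have "\<dots> = (- 1 / par c) ^ n * val [Vertex 0 0 n] f a"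
    unfolding half_twist_sum[OF assms] t by (simp add: val_vertex sum_distrib_left mult.assoc)
  finally show "val (Vertex 0 0 n # half_twist c n) f a = (- 1 / par c) ^ n * val [Vertex 0 0 n] f a" .
qed

text \<open>
  A crossing is a half-twist of two half-edges, to which \<open>half_twist_sum\<close> applies. It produces a multiple of the vertex and a term with
  the trace of the remaining half-edges as a factor. This trace is zero for a single remaining half-edge, and with none remaining both
  terms are multiples of the vertex.
\<close>

lemma VI_proportional:
  assumes c: "c \<noteq> Virtual" and j: "Suc j < n" and mn: "m + n \<le> 3"
  shows "proportional [Vertex 0 m n, Cross c j] [Vertex 0 m n] (if m + n = 2 then (1 / par c)\<^sup>2 else - 1 / par c)"
  unfolding proportional_def
proof (intro allI impI)
  fix k a and f :: "'c list \<Rightarrow> complex"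
  let ?x = "if m + n = 2 then (1 / par c)\<^sup>2 else - 1 / par c"
  assume a: "a \<in> words B0 k" "fits k [Vertex 0 m n, Cross c j]"
  then have m: "take m a \<in> words B0 m" by (auto simp: words_def dest: in_set_takeD)
  obtain i where n: "n = j + (2 + i)" using j by (metis add_2_eq_Suc less_iff_Suc_add add.assoc add.commute plus_1_eq_Suc add_Suc_right)
  have ht: "half_twist c 2 = [Cross c 0]"
    by (simp add: numeral_2_eq_2 sweep_right_def)
  have tv: "twist_value (par c) 2 d u = ?x * tr (rev d @ u)"
    if u: "u \<in> words B0 (m + n - 2)" for d u
  proof (cases "m + n = 2")
    case True
    then have "u = []" using u by (simp add: words_0)
    then show ?thesis
      using True twist_value_Nil[of "par c" 2 d] by simp
  next
    case False
    then have "m + n - 2 = Suc 0" using mn j by simp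
    then obtain y where "u = [y]" "y \<in> B0" using u by (auto simp: words_Suc words_0)
    then show ?thesis
      using False par[of c] by (simp add: twist_value_def tr_single power2_eq_square)
  qed
  have "val [Vertex 0 m n, Cross c j] f a = (\<Sum>b1\<in>words B0 j. \<Sum>b\<in>words B0 2. \<Sum>b2\<in>words B0 i.
     tr (take m a @ rev b2 @ rev b @ rev b1) * val [Cross c j] f (b1 @ b @ b2 @ drop m a))"
    by (simp add: val_vertex n sum_words_append del: add_2_eq_Suc)
  also have "\<dots> = (\<Sum>b1\<in>words B0 j. \<Sum>b2\<in>words B0 i. \<Sum>b\<in>words B0 2.
     tr (rev b @ (rev b1 @ take m a @ rev b2)) * val (half_twist c 2) (\<lambda>d. f (b1 @ d @ b2 @ drop m a)) b)"
  proof (rule sum.cong[OF refl], rule trans[OF sum.swap], intro sum.cong refl)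
    fix b1 b2 b assume b: "b1 \<in> words B0 j" "b \<in> words B0 2"
    have "val [Cross c j] f (b1 @ b @ b2 @ drop m a) = val [Cross c 0] (\<lambda>d. f (b1 @ d @ b2 @ drop m a)) b"
      using val_shift[of b1 j "[Cross c 0]" f "b @ b2 @ drop m a"] val_right[of b "[Cross c 0]" "\<lambda>d. f (b1 @ d)" "b2 @ drop m a"] b
      by (simp add: words_def)
    moreover have "tr (take m a @ rev b2 @ rev b @ rev b1) = tr (rev b @ (rev b1 @ take m a @ rev b2))"
      using tr_rotate[of "take m a @ rev b2" "rev b @ rev b1"] by simp
    ultimately show "tr (take m a @ rev b2 @ rev b @ rev b1) * val [Cross c j] f (b1 @ b @ b2 @ drop m a)
      = tr (rev b @ (rev b1 @ take m a @ rev b2)) * val (half_twist c 2) (\<lambda>d. f (b1 @ d @ b2 @ drop m a)) b"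
      by (simp add: ht)
  qed
  also have "\<dots> = (\<Sum>b1\<in>words B0 j. \<Sum>b2\<in>words B0 i. \<Sum>b\<in>words B0 2.
     ?x * (tr (take m a @ rev b2 @ rev b @ rev b1) * f (b1 @ b @ b2 @ drop m a)))"
    unfolding half_twist_sum[OF c]
  proof (intro sum.cong refl)
    fix b1 b2 b assume b: "b1 \<in> words B0 j" "b2 \<in> words B0 i"
    then have "rev b1 @ take m a @ rev b2 \<in> words B0 (m + n - 2)"
      using m by (auto simp: words_def n)
    note tv[OF this, of b]
    moreover have "tr (take m a @ rev b2 @ rev b @ rev b1) = tr (rev b @ (rev b1 @ take m a @ rev b2))"
      using tr_rotate[of "take m a @ rev b2" "rev b @ rev b1"] by simp
    ultimately show "twist_value (par c) 2 b (rev b1 @ take m a @ rev b2) * f (b1 @ b @ b2 @ drop m a)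
      = ?x * (tr (take m a @ rev b2 @ rev b @ rev b1) * f (b1 @ b @ b2 @ drop m a))"
      by simp
  qed
  also have "\<dots> = (\<Sum>b1\<in>words B0 j. \<Sum>b\<in>words B0 2. \<Sum>b2\<in>words B0 i.
     ?x * (tr (take m a @ rev b2 @ rev b @ rev b1) * f (b1 @ b @ b2 @ drop m a)))"
    by (rule sum.cong[OF refl], rule sum.swap)
  also have "\<dots> = ?x * val [Vertex 0 m n] f a"
    by (simp add: val_vertex n sum_words_append sum_distrib_left del: add_2_eq_Suc)
  finally show "val [Vertex 0 m n, Cross c j] f a = ?x * val [Vertex 0 m n] f a" .
qed

text \<open>
  A local factor becomes a global one because the strands to the left of the piece are carried along unchanged.
\<close>

lemma proportional_context:
  assumes "proportional T T' x" "fits 0 (u @ shift d T @ v)" "fits 0 (u @ shift d T' @ v)" "T \<noteq> [] \<or> T' \<noteq> []"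
  shows "val (u @ shift d T @ v) f [] = x * val (u @ shift d T' @ v) f []"
proof -
  define n where "n = width_from 0 u"
  have ge: "d \<le> n" if "fits n (shift d W)" "W \<noteq> []" for W
    using that by (cases W) auto
  have d: "d \<le> n" using ge assms n_def by auto
  have F: "fits (n - d) T" "fits (n - d) T'" using assms d by (auto simp: n_def fits_shift)
  have "val u (val (shift d T) (val v f)) [] = val u (\<lambda>a. x * val (shift d T') (val v f) a) []"
  proof (rule val_cong[of _ 0])
    fix a assume "a \<in> words B0 (width_from 0 u)"
    then obtain p t where a: "a = p @ t" "p \<in> words B0 d" "t \<in> words B0 (n - d)"
      using words_split d unfolding n_def by blast
    then show "val (shift d T) (val v f) a = x * val (shift d T') (val v f) a"
      using assms(1) F by (simp add: val_shift words_def[of _ d] proportional_def)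
  qed (use assms in \<open>auto simp: words_0\<close>)
  moreover have "val (W @ v) f = val W (val v f)" for W
    by (intro ext) (rule val_append)
  ultimately show ?thesis by (simp add: val_append val_scale)
qed

end

section \<open>Labellings of the points of a diagram\<close>

text \<open>
  The labels of the strands above a list of layers that carry labels on their outgoing strands, with \<open>a\<close> the labels below.
\<close>

fun run :: "'a list \<Rightarrow> (layer \<times> 'a list) list \<Rightarrow> 'a list" where
  "run a [] = a"
| "run a ((l, g) # A) = run (update l g a) A"

text \<open>
  \<open>Q\<close> relates every layer to the labels on its incoming and outgoing strands.
\<close>

fun along :: "(layer \<Rightarrow> 'a list \<Rightarrow> 'a list \<Rightarrow> bool) \<Rightarrow> 'a list \<Rightarrow> (layer \<times> 'a list) list \<Rightarrow> bool" where
  "along Q a [] \<longleftrightarrow> True"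
| "along Q a ((l, g) # A) \<longleftrightarrow> Q l (inputs l a) g \<and> along Q (update l g a) A"

lemma run_append [simp]: "run a (A @ A') = run (run a A) A'"
  by (induction a A rule: run.induct) auto

lemma along_append [simp]: "along Q a (A @ A') \<longleftrightarrow> along Q a A \<and> along Q (run a A) A'"
  by (induction a A rule: run.induct) auto

lemma along_nth: "along Q a A \<longleftrightarrow> (\<forall>t<length A. Q (fst (A ! t)) (inputs (fst (A ! t)) (run a (take t A))) (snd (A ! t)))"
  by (induction a A rule: run.induct) (auto simp: less_Suc_eq_0_disj)

lemma along_mono: "along Q a A \<Longrightarrow> (\<And>l f g. Q l f g \<Longrightarrow> Q' l f g) \<Longrightarrow> along Q' a A"
  by (simp add: along_nth)

text \<open>
  The labels of strand ends that a layer joins agree; a vertex joins nothing.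
\<close>

fun linked :: "layer \<Rightarrow> 'a list \<Rightarrow> 'a list \<Rightarrow> bool" where
  "linked (Cup i) f g \<longleftrightarrow> g ! 0 = g ! 1"
| "linked (Cap i) f g \<longleftrightarrow> f ! 0 = f ! 1"
| "linked (Cross c i) f g \<longleftrightarrow> g ! 0 = f ! 1 \<and> g ! 1 = f ! 0"
| "linked (Vertex i m n) f g \<longleftrightarrow> True"
| "linked (Mark i) f g \<longleftrightarrow> f ! 0 = g ! 0"

definition link_ok :: "layer \<Rightarrow> 'a list \<Rightarrow> 'a list \<Rightarrow> bool" where
  "link_ok l f g \<longleftrightarrow> length g = outs l \<and> linked l f g"

abbreviation consistent :: "'a list \<Rightarrow> (layer \<times> 'a list) list \<Rightarrow> bool" where
  "consistent \<equiv> along link_ok"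

definition sized :: "layer \<Rightarrow> 'a list \<Rightarrow> 'a list \<Rightarrow> bool" where
  "sized l f g \<longleftrightarrow> length g = outs l"

lemma consistent_sized: "consistent a A \<Longrightarrow> along sized a A"
  by (erule along_mono) (simp add: sized_def link_ok_def)

lemma length_run:
  "\<lbrakk>along sized a A; fits (length a) (map fst A)\<rbrakk> \<Longrightarrow> length (run a A) = width_from (length a) (map fst A)"
  by (induction a A rule: run.induct) (auto simp: sized_def length_update)

lemma length_run_take:
  assumes "along sized [] A" "fits 0 (map fst A)"
  shows "length (run [] (take t A)) = width (take t (map fst A))"
proof -
  have "along sized [] (take t A @ drop t A)" "fits 0 (map fst (take t A @ drop t A))" using assms by simp_all
  then have "along sized [] (take t A)" "fits 0 (map fst (take t A))"
    unfolding along_append map_append fits_append by auto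
  then show ?thesis using length_run[of "[]" "take t A"] by (simp add: width_eq take_map)
qed

lemma fits_layer: "\<lbrakk>fits 0 D; t < length D\<rbrakk> \<Longrightarrow> offset (D ! t) + ins (D ! t) \<le> width (take t D)"
  by (simp add: fits_nth width_eq)

lemma width_Suc: "t < length D \<Longrightarrow> width (take (Suc t) D) = width (take t D) - ins (D ! t) + outs (D ! t)"
  by (simp add: width_eq take_Suc_conv_app_nth)

definition entry :: "(layer \<times> 'a list) list \<Rightarrow> nat \<times> nat \<Rightarrow> 'a" where
  "entry A = (\<lambda>(t, p). run [] (take t A) ! p)"

lemma update_nth:
  assumes "offset l + ins l \<le> length a" "length g = outs l"
  shows "p < offset l \<Longrightarrow> update l g a ! p = a ! p"
    and "q < outs l \<Longrightarrow> update l g a ! (offset l + q) = g ! q"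
    and "\<lbrakk>offset l + ins l \<le> p; p < length a\<rbrakk> \<Longrightarrow> update l g a ! (p - ins l + outs l) = a ! p"
proof -
  have [simp]: "min (length a) (offset l) = offset l" using assms by auto
  show "p < offset l \<Longrightarrow> update l g a ! p = a ! p" "q < outs l \<Longrightarrow> update l g a ! (offset l + q) = g ! q"
    "\<lbrakk>offset l + ins l \<le> p; p < length a\<rbrakk> \<Longrightarrow> update l g a ! (p - ins l + outs l) = a ! p"
    using assms by (auto simp: update_def nth_append)
qed

lemma inputs_nth: "\<lbrakk>offset l + ins l \<le> length a; q < ins l\<rbrakk> \<Longrightarrow> inputs l a ! q = a ! (offset l + q)"
  by (simp add: inputs_def)

lemma run_Suc: "t < length A \<Longrightarrow> run a (take (Suc t) A) = update (fst (A ! t)) (snd (A ! t)) (run a (take t A))"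
  by (cases "A ! t") (simp add: take_Suc_conv_app_nth)

lemma entry_layer:
  assumes A: "along sized [] A" "fits 0 D" "map fst A = D" and t: "t < length D"
  shows "p < offset (D ! t) \<Longrightarrow> entry A (Suc t, p) = entry A (t, p)"
    and "\<lbrakk>offset (D ! t) + ins (D ! t) \<le> p; p < width (take t D)\<rbrakk> \<Longrightarrow> entry A (Suc t, p - ins (D ! t) + outs (D ! t)) = entry A (t, p)"
    and "q < outs (D ! t) \<Longrightarrow> entry A (Suc t, offset (D ! t) + q) = snd (A ! t) ! q"
    and "q < ins (D ! t) \<Longrightarrow> inputs (D ! t) (run [] (take t A)) ! q = entry A (t, offset (D ! t) + q)"
proof -
  have tA: "t < length A" using A(3) t by auto
  have D: "D ! t = fst (A ! t)" using A(3) tA by auto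
  have l: "length (run [] (take t A)) = width (take t D)"
    using length_run_take[of A t] A by simp
  have le: "offset (D ! t) + ins (D ! t) \<le> length (run [] (take t A))"
    using fits_layer[OF A(2) t] l by simp
  have g: "length (snd (A ! t)) = outs (D ! t)"
    using A(1) tA by (simp add: along_nth sized_def D)
  note * = update_nth[OF le g]
  show "p < offset (D ! t) \<Longrightarrow> entry A (Suc t, p) = entry A (t, p)"
    using *(1) by (simp add: entry_def run_Suc tA D)
  show "\<lbrakk>offset (D ! t) + ins (D ! t) \<le> p; p < width (take t D)\<rbrakk> \<Longrightarrow> entry A (Suc t, p - ins (D ! t) + outs (D ! t)) = entry A (t, p)"
    using *(3) by (simp add: entry_def run_Suc tA D l)
  show "q < outs (D ! t) \<Longrightarrow> entry A (Suc t, offset (D ! t) + q) = snd (A ! t) ! q"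
    using *(2) by (simp add: entry_def run_Suc tA D)
  show "q < ins (D ! t) \<Longrightarrow> inputs (D ! t) (run [] (take t A)) ! q = entry A (t, offset (D ! t) + q)"
    using inputs_nth[OF le] by (simp add: entry_def)
qed

lemma entry_strand:
  assumes A: "consistent [] A" "fits 0 D" "map fst A = D" and s: "strand D P Q"
  shows "entry A P = entry A Q"
proof -
  note sz = consistent_sized[OF A(1)]
  have L: "linked (D ! t) (inputs (D ! t) (run [] (take t A))) (snd (A ! t))" if "t < length D" for t
    using A(1,3) that by (auto simp: along_nth link_ok_def)
  show ?thesis
    using s
  proof cases
    case (left t p)
    then show ?thesis using entry_layer(1)[OF sz A(2,3)] by simp
  next
    case (right t p)
    then show ?thesis using entry_layer(2)[OF sz A(2,3)] by simp
  next
    case (cup t i)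
    then show ?thesis using L[of t] entry_layer(3)[OF sz A(2,3), of t 0] entry_layer(3)[OF sz A(2,3), of t 1] by simp
  next
    case (cap t i)
    then show ?thesis using L[of t] entry_layer(4)[OF sz A(2,3), of t 0] entry_layer(4)[OF sz A(2,3), of t 1] by simp
  next
    case (cross_rising t c i)
    then show ?thesis using L[of t] entry_layer(4)[OF sz A(2,3), of t 0] entry_layer(3)[OF sz A(2,3), of t 1] by simp
  next
    case (cross_falling t c i)
    then show ?thesis using L[of t] entry_layer(4)[OF sz A(2,3), of t 1] entry_layer(3)[OF sz A(2,3), of t 0] by simp
  next
    case (mark t i)
    then show ?thesis using L[of t] entry_layer(4)[OF sz A(2,3), of t 0] entry_layer(3)[OF sz A(2,3), of t 0] by simp
  qed
qed

lemma equivclp_invariant: "\<lbrakk>equivclp r x y; \<And>x y. r x y \<Longrightarrow> f x = f y\<rbrakk> \<Longrightarrow> f x = f y"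
  by (induction rule: equivclp_induct) auto

lemma entry_same_edge:
  "\<lbrakk>consistent [] A; fits 0 D; map fst A = D; same_edge D P Q\<rbrakk> \<Longrightarrow> entry A P = entry A Q"
  unfolding same_edge_def by (erule equivclp_invariant) (rule entry_strand)

text \<open>
  Labelling each layer by a function on points; only the outgoing strands are recorded, since every strand leaves some layer.
\<close>

fun annot :: "(nat \<times> nat \<Rightarrow> 'a) \<Rightarrow> nat \<Rightarrow> layer list \<Rightarrow> (layer \<times> 'a list) list" where
  "annot m t [] = []"
| "annot m t (l # w) = (l, map (\<lambda>q. m (Suc t, offset l + q)) [0..<outs l]) # annot m (Suc t) w"

lemma annot_append: "annot m t (u @ v) = annot m t u @ annot m (t + length u) v"
  by (induction u arbitrary: t) auto

lemma length_annot [simp]: "length (annot m t w) = length w"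
  by (induction w arbitrary: t) auto

lemma map_fst_annot [simp]: "map fst (annot m t w) = w"
  by (induction w arbitrary: t) auto

lemma annot_nth: "k < length w \<Longrightarrow> annot m t w ! k = (w ! k, map (\<lambda>q. m (Suc (t + k), offset (w ! k) + q)) [0..<outs (w ! k)])"
  by (induction w arbitrary: t k) (auto simp: nth_Cons split: nat.splits)

definition row :: "(nat \<times> nat \<Rightarrow> 'a) \<Rightarrow> layer list \<Rightarrow> nat \<Rightarrow> 'a list" where
  "row m D t = map (\<lambda>p. m (t, p)) [0..<width (take t D)]"

lemma run_annot:
  assumes D: "fits 0 D" and m: "\<And>P Q. strand D P Q \<Longrightarrow> m P = m Q" and t: "t \<le> length D"
  shows "run [] (take t (annot m 0 D)) = row m D t"
  using t
proof (induction t)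
  case 0
  then show ?case by (simp add: row_def width_def)
next
  case (Suc t)
  let ?l = "D ! t"
  have IH: "run [] (take t (annot m 0 D)) = row m D t" and t: "t < length D" using Suc by simp_all
  have le: "offset ?l + ins ?l \<le> width (take t D)" by (rule fits_layer[OF D t])
  have "run [] (take (Suc t) (annot m 0 D)) = update ?l (map (\<lambda>q. m (Suc t, offset ?l + q)) [0..<outs ?l]) (row m D t)"
    using t IH by (simp add: run_Suc annot_nth)
  also have "\<dots> = row m D (Suc t)"
  proof (rule nth_equalityI)
    show "length (update ?l (map (\<lambda>q. m (Suc t, offset ?l + q)) [0..<outs ?l]) (row m D t)) = length (row m D (Suc t))"
      using le by (simp add: length_update row_def width_Suc t)
    fix p assume p: "p < length (update ?l (map (\<lambda>q. m (Suc t, offset ?l + q)) [0..<outs ?l]) (row m D t))"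
    note un = update_nth[of ?l "row m D t" "map (\<lambda>q. m (Suc t, offset ?l + q)) [0..<outs ?l]"]
    have p': "p < width (take (Suc t) D)" using p le by (simp add: length_update row_def width_Suc t)
    then have R: "row m D (Suc t) ! p = m (Suc t, p)" by (simp add: row_def)
    consider "p < offset ?l" | q where "p = offset ?l + q" "q < outs ?l"
      | q where "p = q - ins ?l + outs ?l" "offset ?l + ins ?l \<le> q" "q < width (take t D)"
    proof -
      { assume "\<not> p < offset ?l" "\<not> p < offset ?l + outs ?l"
        then have "p = (p - outs ?l + ins ?l) - ins ?l + outs ?l" "offset ?l + ins ?l \<le> p - outs ?l + ins ?l"
          "p - outs ?l + ins ?l < width (take t D)"
          using p' le t by (auto simp: width_Suc) }
      moreover have "\<exists>q. p = offset ?l + q \<and> q < outs ?l" if "\<not> p < offset ?l" "p < offset ?l + outs ?l"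
        using that by (intro exI[of _ "p - offset ?l"]) auto
      ultimately show thesis using that by metis
    qed
    then show "update ?l (map (\<lambda>q. m (Suc t, offset ?l + q)) [0..<outs ?l]) (row m D t) ! p = row m D (Suc t) ! p"
    proof cases
      case 1
      then show ?thesis using un(1) le R m[OF strand.left[OF t]] by (simp add: row_def)
    next
      case (2 q)
      then show ?thesis using un(2) le R by (simp add: row_def)
    next
      case (3 q)
      then show ?thesis using un(3) le R m[OF strand.right[OF t]] by (simp add: row_def)
    qed
  qed
  finally show ?case .
qed

lemma entry_annot:
  assumes "fits 0 D" "\<And>P Q. strand D P Q \<Longrightarrow> m P = m Q" "P \<in> points D"
  shows "entry (annot m 0 D) P = m P"
  using assms run_annot[of D m "fst P"] by (auto simp: points_def entry_def row_def)

lemma consistent_annot: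
  assumes D: "fits 0 D" and m: "\<And>P Q. strand D P Q \<Longrightarrow> m P = m Q"
  shows "consistent [] (annot m 0 D)"
  unfolding along_nth
proof (intro allI impI)
  fix t assume "t < length (annot m 0 D)"
  then have t: "t < length D" by simp
  let ?l = "D ! t"
  have le: "offset ?l + ins ?l \<le> width (take t D)" by (rule fits_layer[OF D t])
  have i: "inputs ?l (run [] (take t (annot m 0 D))) ! q = m (t, offset ?l + q)" if "q < ins ?l" for q
    using that le t by (simp add: run_annot[OF D m] inputs_def row_def)
  have o: "snd (annot m 0 D ! t) ! q = m (Suc t, offset ?l + q)" if "q < outs ?l" for q
    using that t by (simp add: annot_nth)
  have "linked ?l (inputs ?l (run [] (take t (annot m 0 D)))) (snd (annot m 0 D ! t))"
    using m[OF strand.cup[OF t]] m[OF strand.cap[OF t]] m[OF strand.cross_rising[OF t]]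
      m[OF strand.cross_falling[OF t]] m[OF strand.mark[OF t]] i o
    by (cases ?l) auto
  then show "link_ok (fst (annot m 0 D ! t)) (inputs (fst (annot m 0 D ! t)) (run [] (take t (annot m 0 D)))) (snd (annot m 0 D ! t))"
    using t by (simp add: link_ok_def annot_nth)
qed

text \<open>
  A set of strands that is a union of edges and contains every strand with a mark.
\<close>

definition flag_ok :: "layer \<Rightarrow> bool list \<Rightarrow> bool list \<Rightarrow> bool" where
  "flag_ok l f g \<longleftrightarrow> link_ok l f g \<and> (\<forall>i. l = Mark i \<longrightarrow> f ! 0)"

definition flagged :: "layer list \<Rightarrow> (layer \<times> bool list) list" where
  "flagged D = annot (marked D) 0 D"

definition below :: "(layer \<times> bool list) list \<Rightarrow> (layer \<times> bool list) list \<Rightarrow> bool" where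
  "below = list_all2 (\<lambda>x y. fst x = fst y \<and> list_all2 (\<longrightarrow>) (snd x) (snd y))"

lemma same_edge_equiv: "same_edge D P P" "same_edge D P Q \<Longrightarrow> same_edge D Q P"
  "same_edge D P Q \<Longrightarrow> same_edge D Q R \<Longrightarrow> same_edge D P R"
  "strand D P Q \<Longrightarrow> same_edge D P Q"
  unfolding same_edge_def by (auto intro: equivclp_sym equivclp_trans)

lemma marked_same_edge: "same_edge D P Q \<Longrightarrow> marked D P = marked D Q"
  unfolding marked_def using same_edge_equiv by metis

lemma marked_strand: "strand D P Q \<Longrightarrow> marked D P = marked D Q"
  by (rule marked_same_edge) (rule same_edge_equiv)

lemma flag_ok_consistent: "along flag_ok a A \<Longrightarrow> consistent a A"
  by (erule along_mono) (simp add: flag_ok_def)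

lemma flag_ok_at_mark:
  assumes "along flag_ok [] A" "fits 0 D" "map fst A = D" "t < length D" "D ! t = Mark i"
  shows "entry A (t, i)"
proof -
  have tA: "t < length A" using assms by auto
  have "flag_ok (fst (A ! t)) (inputs (fst (A ! t)) (run [] (take t A))) (snd (A ! t))"
    using assms(1) tA by (simp add: along_nth)
  moreover have "fst (A ! t) = Mark i" using assms tA by auto
  ultimately have "inputs (Mark i) (run [] (take t A)) ! 0" by (simp add: flag_ok_def)
  then show ?thesis
    using entry_layer(4)[OF consistent_sized[OF flag_ok_consistent[OF assms(1)]] assms(2-4), of 0] assms(5) by simp
qed

lemma marked_at:
  assumes "along flag_ok [] A" "fits 0 D" "map fst A = D" "marked D P"
  shows "entry A P"
  using assms(4) entry_same_edge[OF flag_ok_consistent[OF assms(1)] assms(2,3)] flag_ok_at_mark[OF assms(1-3)]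
  unfolding marked_def by blast

lemma below_annot:
  assumes A: "along sized [] A" "fits 0 D" "map fst A = D" and m: "\<And>P. m P \<Longrightarrow> entry A P"
  shows "below (annot m 0 D) A"
  unfolding below_def
proof (rule list_all2_all_nthI, goal_cases)
  case 1
  show "length (annot m 0 D) = length A" using A(3) by auto
next
  case (2 t)
  then have t: "t < length D" and tA: "t < length A" and D: "D ! t = fst (A ! t)" using A(3) by auto
  have "list_all2 (\<longrightarrow>) (map (\<lambda>q. m (Suc t, offset (D ! t) + q)) [0..<outs (D ! t)]) (snd (A ! t))"
    unfolding list_all2_conv_all_nth using A(1) tA m entry_layer(3)[OF A t]
    by (auto simp: along_nth sized_def D)
  then show ?case
    using t D by (simp add: annot_nth)
qed

section \<open>Marked diagrams: vertices of degree two and crossings\<close>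

lemma imp_antisym: "\<lbrakk>list_all2 (\<longrightarrow>) f g; list_all2 (\<longrightarrow>) g f\<rbrakk> \<Longrightarrow> f = g"
  by (rule list_all2_antisym[of "(\<longrightarrow>)" "(\<longrightarrow>)"]) auto

lemma below_antisym: assumes "below A B" "below B A" shows "A = B"
  by (rule list_all2_antisym[OF _ assms[unfolded below_def]]) (auto intro: prod_eqI imp_antisym)

lemma below_append: "length A = length A' \<Longrightarrow> below (A @ B) (A' @ B') \<longleftrightarrow> below A A' \<and> below B B'"
  unfolding below_def by (rule list_all2_append)

lemma below_Nil [simp]: "below [] B \<longleftrightarrow> B = []" "below A [] \<longleftrightarrow> A = []"
  by (simp_all add: below_def)

lemma below_Cons [simp]: "below (x # A) (y # B) \<longleftrightarrow> fst x = fst y \<and> list_all2 (\<longrightarrow>) (snd x) (snd y) \<and> below A B"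
  by (simp add: below_def)

lemma below_run: "\<lbrakk>below A A'; list_all2 (\<longrightarrow>) a a'\<rbrakk> \<Longrightarrow> list_all2 (\<longrightarrow>) (run a A) (run a' A')"
proof (induction A arbitrary: A' a a')
  case (Cons x A)
  then obtain y B where A': "A' = y # B" by (cases A') auto
  have "list_all2 (\<longrightarrow>) (update (fst x) (snd x) a) (update (fst x) (snd y) a')"
    using Cons.prems by (auto simp: A' update_def intro!: list_all2_appendI)
  with Cons show ?case by (cases x; cases y) (auto simp: A')
qed simp

lemma flagged_ok: assumes "fits 0 D" shows "along flag_ok [] (flagged D)"
proof -
  have "consistent [] (flagged D)"
    unfolding flagged_def by (rule consistent_annot[OF assms]) (rule marked_strand)
  moreover have "\<forall>i. fst (flagged D ! t) = Mark i \<longrightarrow> inputs (fst (flagged D ! t)) (run [] (take t (flagged D))) ! 0"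
    if "t < length (flagged D)" for t
  proof (intro allI impI)
    fix i assume i: "fst (flagged D ! t) = Mark i"
    have t: "t < length D" using that by (simp add: flagged_def)
    have D: "D ! t = Mark i" using i t by (simp add: flagged_def annot_nth)
    have "marked D (t, i)" unfolding marked_def using t D same_edge_equiv(1) by blast
    then show "inputs (fst (flagged D ! t)) (run [] (take t (flagged D))) ! 0"
      using fits_layer[OF assms t] t unfolding i unfolding flagged_def
      by (simp add: run_annot[OF assms marked_strand] inputs_def row_def D)
  qed
  ultimately show ?thesis by (simp add: along_nth flag_ok_def)
qed

text \<open>
  The marked strands form the least set of strands that is a union of edges and contains the marks. This replaces reasoning about
  paths in later comparisons of diagrams.
\<close>

lemma flagged_below: "\<lbrakk>along flag_ok [] A; fits 0 D; map fst A = D\<rbrakk> \<Longrightarrow> below (flagged D) A"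
  unfolding flagged_def
  by (rule below_annot) (auto intro: consistent_sized flag_ok_consistent marked_at)

lemma map_fst_flagged [simp]: "map fst (flagged D) = D" "length (flagged D) = length D"
  by (simp_all add: flagged_def)

lemma flagged_split:
  "flagged (u @ T @ v) = annot (marked (u @ T @ v)) 0 u @ annot (marked (u @ T @ v)) (length u) T
     @ annot (marked (u @ T @ v)) (length u + length T) v"
  by (simp add: flagged_def annot_append)

definition clear :: "layer \<Rightarrow> bool list \<Rightarrow> bool list \<Rightarrow> bool" where
  "clear l f g \<longleftrightarrow> (\<forall>c i. l = Cross c i \<longrightarrow> c \<noteq> Virtual \<longrightarrow> \<not> f ! 0 \<and> \<not> f ! 1)"

lemma marked_diagram_points:
  assumes "fits 0 D"
  shows "(\<forall>P \<in> points D. marked D P \<longrightarrow> \<not> carries_classical D P) \<longleftrightarrow>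
    (\<forall>t c i. t < length D \<longrightarrow> D ! t = Cross c i \<longrightarrow> c \<noteq> Virtual \<longrightarrow> \<not> marked D (t, i) \<and> \<not> marked D (t, Suc i))"
    (is "?L = ?R")
proof
  assume L: ?L
  show ?R
  proof (intro allI impI)
    fix t c i assume *: "t < length D" "D ! t = Cross c i" "c \<noteq> Virtual"
    have "(t, i) \<in> points D" "(t, Suc i) \<in> points D"
      using fits_layer[OF assms *(1)] * by (auto simp: points_def)
    moreover have "carries_classical D (t, i)" "carries_classical D (t, Suc i)"
      unfolding carries_classical_def using * same_edge_equiv(1) by blast+
    ultimately show "\<not> marked D (t, i) \<and> \<not> marked D (t, Suc i)" using L by blast
  qed
next
  assume ?R
  then show ?L unfolding carries_classical_def using marked_same_edge by metis
qed

text \<open>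
  Only the points at classical crossings matter, since marks spread along edges.
\<close>

lemma marked_diagram_clear: "marked_diagram D \<longleftrightarrow> planar_word D \<and> along clear [] (flagged D)"
proof (cases "fits 0 D")
  case False
  then show ?thesis by (simp add: marked_diagram_def planar_word_iff)
next
  case True
  have "along clear [] (flagged D) \<longleftrightarrow>
    (\<forall>t c i. t < length D \<longrightarrow> D ! t = Cross c i \<longrightarrow> c \<noteq> Virtual \<longrightarrow> \<not> marked D (t, i) \<and> \<not> marked D (t, Suc i))"
  proof -
    have "clear (D ! t) (inputs (D ! t) (run [] (take t (flagged D)))) g
       \<longleftrightarrow> (\<forall>c i. D ! t = Cross c i \<longrightarrow> c \<noteq> Virtual \<longrightarrow> \<not> marked D (t, i) \<and> \<not> marked D (t, Suc i))"
      if t: "t < length D" for t g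
    proof -
      have *: "inputs (D ! t) (run [] (take t (flagged D))) ! q = marked D (t, offset (D ! t) + q)" if "q < ins (D ! t)" for q
        using that fits_layer[OF True t] t
        by (simp add: flagged_def run_annot[OF True marked_strand] inputs_def row_def)
      show ?thesis using *[of 0] *[of 1] by (auto simp: clear_def)
    qed
    then show ?thesis
      by (auto simp: along_nth flagged_def annot_nth)
  qed
  then show ?thesis
    unfolding marked_diagram_def marked_diagram_points[OF True] by simp
qed

text \<open>
  As the marks of a diagram are its least valid labelling, it suffices to turn labellings of \<open>T'\<close> into labellings of \<open>T\<close>
  with the same labels on the boundary.
\<close>

lemma flagged_replace:
  assumes D: "fits 0 (u @ T @ v)" "fits 0 (u @ T' @ v)"
    and A: "flagged (u @ T @ v) = Au @ At @ Av" "map fst Au = u" "map fst At = T" "map fst Av = v"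
    and At': "map fst At' = T'" "along flag_ok (run [] Au) At'" "run (run [] Au) At' = run (run [] Au) At"
    and lift: "\<And>r B. \<lbrakk>list_all2 (\<longrightarrow>) r (run [] Au); map fst B = T'; below B At'; along flag_ok r B\<rbrakk> \<Longrightarrow>
      \<exists>C. map fst C = T \<and> along flag_ok r C \<and> run r C = run r B \<and> (below At C \<longrightarrow> below At' B)"
  shows "flagged (u @ T' @ v) = Au @ At' @ Av"
proof -
  have ok: "along flag_ok [] (Au @ At @ Av)" using flagged_ok[OF D(1)] A(1) by simp
  then have ok': "along flag_ok [] (Au @ At' @ Av)" using At' by simp
  have m: "map fst (Au @ At' @ Av) = u @ T' @ v" using A At' by simp
  define M where "M = marked (u @ T' @ v)"
  define Bu B Bv where "Bu = annot M 0 u" and "B = annot M (length u) T'" and "Bv = annot M (length u + length T') v"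
  have B: "flagged (u @ T' @ v) = Bu @ B @ Bv" "map fst Bu = u" "map fst B = T'" "map fst Bv = v"
    unfolding flagged_split Bu_def B_def Bv_def M_def by simp_all
  have len: "length Bu = length Au" "length B = length At'" "length Bv = length Av"
    using B A At' by (metis length_map)+
  have le: "below Bu Au" "below B At'" "below Bv Av"
    using flagged_below[OF ok' D(2) m] unfolding B(1) by (simp_all add: below_append len)
  have okB: "along flag_ok [] Bu" "along flag_ok (run [] Bu) B" "along flag_ok (run (run [] Bu) B) Bv"
    using flagged_ok[OF D(2)] unfolding B(1) by simp_all
  have "list_all2 (\<longrightarrow>) (run [] Bu) (run [] Au)"
    by (rule below_run[OF le(1)]) simp
  from lift[OF this B(3) le(2) okB(2)] obtain C where
    C: "map fst C = T" "along flag_ok (run [] Bu) C" "run (run [] Bu) C = run (run [] Bu) B"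
      "below At C \<longrightarrow> below At' B" by blast
  have "along flag_ok [] (Bu @ C @ Bv)" using okB C by simp
  moreover have "map fst (Bu @ C @ Bv) = u @ T @ v" using B C by simp
  ultimately have "below (Au @ At @ Av) (Bu @ C @ Bv)" using flagged_below[OF _ D(1)] A(1) by metis
  moreover have "length At = length C" using A(3) C(1) by (metis length_map)
  ultimately have "below Au Bu" "below At C" "below Av Bv" by (simp_all add: below_append len)
  then have "Bu = Au" "Bv = Av" "B = At'" using le C(4) by (auto intro: below_antisym)
  then show ?thesis using B by simp
qed

lemma list_all2_imp_nth: "\<lbrakk>list_all2 (\<longrightarrow>) f g; i < length g; \<not> g ! i\<rbrakk> \<Longrightarrow> \<not> f ! i"
  by (auto simp: list_all2_conv_all_nth)

lemma list_eq_2: "length g = 2 \<Longrightarrow> g = [g ! 0, g ! 1]"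
  by (cases g; cases "tl g") auto

lemma update_same:
  "\<lbrakk>offset l + ins l \<le> length r; g = inputs l r\<rbrakk> \<Longrightarrow> update l g r = r"
  by (simp add: update_def inputs_def) (metis append_take_drop_id drop_drop add.commute)

lemma inputs_1: "\<lbrakk>ins l = 1; offset l + 1 \<le> length r\<rbrakk> \<Longrightarrow> inputs l r = [r ! offset l]"
  by (simp add: inputs_def take_Suc_conv_app_nth)

lemma inputs_2: "\<lbrakk>ins l = 2; offset l + 2 \<le> length r\<rbrakk> \<Longrightarrow> inputs l r = [r ! offset l, r ! Suc (offset l)]"
  by (simp add: inputs_def numeral_2_eq_2 take_Suc_conv_app_nth)

text \<open>
  No mark passes through a classical crossing, so that replacing the crossing reconnects unmarked strands only and leaves all marks
  as they were.
\<close>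

lemma crossing_replaced:
  assumes D: "marked_diagram (u @ [Cross c i] @ v)" "c \<noteq> Virtual"
  obtains Au Av where "flagged (u @ [Cross c i] @ v) = Au @ [(Cross c i, [False, False])] @ Av"
    and "flagged (u @ v) = Au @ Av" and "flagged (u @ [Cap i, Cup i] @ v) = Au @ [(Cap i, []), (Cup i, [False, False])] @ Av"
    and "flagged (u @ [Vertex i 2 2] @ v) = Au @ [(Vertex i 2 2, [False, False])] @ Av"
    and "marked_diagram (u @ v)" "marked_diagram (u @ [Cap i, Cup i] @ v)" "marked_diagram (u @ [Vertex i 2 2] @ v)"
    and "i + 2 \<le> length (run [] Au)" "\<not> run [] Au ! i" "\<not> run [] Au ! Suc i"
proof -
  let ?D = "u @ [Cross c i] @ v"
  define M where "M = marked ?D"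
  have pl: "planar_word ?D" using D by (simp add: marked_diagram_def)
  then have f: "fits 0 ?D" by (simp add: planar_word_iff)
  define Au Av where "Au = annot M 0 u" and "Av = annot M (Suc (length u)) v"
  have Dt: "?D ! length u = Cross c i" "length u < length ?D" by (simp_all add: nth_append)
  have w: "i + 2 \<le> width (take (length u) ?D)"
    using fits_layer[OF f Dt(2)] Dt by simp
  have nM: "\<not> M (length u, i)" "\<not> M (length u, Suc i)"
    using D marked_diagram_points[OF f] Dt unfolding marked_diagram_def M_def by blast+
  then have nM': "\<not> M (Suc (length u), i)" "\<not> M (Suc (length u), Suc i)"
    using marked_strand[OF strand.cross_rising[OF Dt(2,1)]] marked_strand[OF strand.cross_falling[OF Dt(2,1)]]
    unfolding M_def by auto
  have A: "flagged ?D = Au @ [(Cross c i, [False, False])] @ Av"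
    using flagged_split[of u "[Cross c i]" v] nM' unfolding M_def[symmetric] by (simp add: Au_def Av_def upt_rec)
  have r: "run [] Au = row M ?D (length u)"
    using run_annot[OF f marked_strand, where t = "length u"] by (simp add: Au_def M_def annot_append)
  have ri: "\<not> run [] Au ! i" "\<not> run [] Au ! Suc i" and lr: "i + 2 \<le> length (run [] Au)"
    using w nM by (simp_all add: r row_def)
  have w': "i + 2 \<le> width_from 0 u"
    using pl by (simp add: planar_word_iff)
  then have ww: "Suc (Suc (width_from 0 u - 2)) = width_from 0 u" by simp
  have ww': "Suc (Suc (width_from 0 u - Suc (Suc 0))) = width_from 0 u" using w' by simp
  have pl': "planar_word (u @ [] @ v)" "planar_word (u @ [Cap i, Cup i] @ v)" "planar_word (u @ [Vertex i 2 2] @ v)"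
    using pl ww w' by (auto simp: planar_word_iff)
  then have f': "fits 0 (u @ [] @ v)" "fits 0 (u @ [Cap i, Cup i] @ v)" "fits 0 (u @ [Vertex i 2 2] @ v)"
    by (auto simp: planar_word_iff)
  have up: "update (Cross c i) [False, False] s = s" if "i + 2 \<le> length s" "\<not> s ! i" "\<not> s ! Suc i" for s
    using that by (intro update_same) (auto simp: inputs_2)
  have upd: "update l g s = take i s @ g @ drop (i + 2) s" if "l = Vertex i 2 2 \<or> l = Cross c i" for l s and g :: "bool list"
    using that by (auto simp: update_def)
  have upd2: "update (Cup i) g (update (Cap i) [] s) = take i s @ g @ drop (i + 2) s" if "i + 2 \<le> length s" for s and g :: "bool list"
    using that by (auto simp: update_def)
  have low: "length s = length (run [] Au) \<and> \<not> s ! i \<and> \<not> s ! Suc i" if "list_all2 (\<longrightarrow>) s (run [] Au)" for s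
    using list_all2_imp_nth[OF that, of i] list_all2_imp_nth[OF that, of "Suc i"] that ri lr
    by (auto dest: list_all2_lengthD)
  have g: "g = [False, False]" if "list_all2 (\<longrightarrow>) g [False, False]" for g
    using that by (auto simp: list_all2_Cons2)
  have 1: "flagged (u @ [] @ v) = Au @ [] @ Av"
  proof (rule flagged_replace[OF f f'(1) A])
    fix r and B :: "(layer \<times> bool list) list" assume *: "list_all2 (\<longrightarrow>) r (run [] Au)" "map fst B = ([] :: layer list)"
    then show "\<exists>C. map fst C = [Cross c i] \<and> along flag_ok r C \<and> run r C = run r B
       \<and> (below [(Cross c i, [False, False])] C \<longrightarrow> below [] B)"
      using low[OF *(1)] lr up[of r]
      by (intro exI[of _ "[(Cross c i, [False, False])]"]) (auto simp: flag_ok_def link_ok_def inputs_2)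
  qed (use up lr ri in \<open>auto simp: Au_def Av_def\<close>)
  have 2: "flagged (u @ [Cap i, Cup i] @ v) = Au @ [(Cap i, []), (Cup i, [False, False])] @ Av"
  proof (rule flagged_replace[OF f f'(2) A])
    fix r and B :: "(layer \<times> bool list) list" assume *: "list_all2 (\<longrightarrow>) r (run [] Au)" "map fst B = [Cap i, Cup i]"
      "below B [(Cap i, []), (Cup i, [False, False])]"
    then have B: "B = [(Cap i, []), (Cup i, [False, False])]"
      by (auto simp: map_eq_Cons_conv g)
    show "\<exists>C. map fst C = [Cross c i] \<and> along flag_ok r C \<and> run r C = run r B
       \<and> (below [(Cross c i, [False, False])] C \<longrightarrow> below [(Cap i, []), (Cup i, [False, False])] B)"
      using low[OF *(1)] lr upd upd2[of r]
      by (intro exI[of _ "[(Cross c i, [False, False])]"]) (auto simp: B flag_ok_def link_ok_def inputs_2)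
  qed (use upd upd2 lr ri in \<open>auto simp: Au_def Av_def flag_ok_def link_ok_def inputs_2\<close>)
  have 3: "flagged (u @ [Vertex i 2 2] @ v) = Au @ [(Vertex i 2 2, [False, False])] @ Av"
  proof (rule flagged_replace[OF f f'(3) A])
    fix r and B :: "(layer \<times> bool list) list" assume *: "list_all2 (\<longrightarrow>) r (run [] Au)" "map fst B = [Vertex i 2 2]"
      "below B [(Vertex i 2 2, [False, False])]"
    then have B: "B = [(Vertex i 2 2, [False, False])]"
      by (auto simp: map_eq_Cons_conv g)
    show "\<exists>C. map fst C = [Cross c i] \<and> along flag_ok r C \<and> run r C = run r B
       \<and> (below [(Cross c i, [False, False])] C \<longrightarrow> below [(Vertex i 2 2, [False, False])] B)"
      using low[OF *(1)] lr upd
      by (intro exI[of _ "[(Cross c i, [False, False])]"]) (auto simp: B flag_ok_def link_ok_def inputs_2)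
  qed (use upd lr ri in \<open>auto simp: Au_def Av_def flag_ok_def link_ok_def inputs_2\<close>)
  have cl: "along clear [] Au" "along clear (run [] Au) Av"
    using D(1) up[OF lr ri] unfolding marked_diagram_clear A by auto
  have "marked_diagram (u @ [] @ v)" "marked_diagram (u @ [Cap i, Cup i] @ v)" "marked_diagram (u @ [Vertex i 2 2] @ v)"
    unfolding marked_diagram_clear 1 2 3 using cl pl' up[OF lr ri] upd upd2[OF lr] by (auto simp: clear_def)
  with A 1 2 3 that[of Au Av] lr ri show thesis by simp
qed

context colour_model
begin

lemma amp_append: "amp (A @ A') f a = amp A (amp A' f) a"
  by (induction A arbitrary: a) (auto)

lemma amp_scale: "amp A (\<lambda>b. x * f b) a = x * amp A f a"
  by (induction A f a rule: amp.induct) (simp_all add: sum_distrib_left mult_ac)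

lemma amp_add: "amp A (\<lambda>b. f b + g b) a = amp A f a + amp A g a"
  by (induction A f a rule: amp.induct) (simp_all add: sum.distrib algebra_simps)

lemma colours_update: "\<lbrakk>a \<in> colours r; b \<in> colours g\<rbrakk> \<Longrightarrow> update l b a \<in> colours (update l g r)"
  by (auto simp: colours_def update_def intro!: list_all2_appendI list_all2_takeI list_all2_dropI)

lemma amp_cong:
  "\<lbrakk>a \<in> colours r; \<And>b. b \<in> colours (run r A) \<Longrightarrow> f b = g b\<rbrakk> \<Longrightarrow> amp A f a = amp A g a"
proof (induction A arbitrary: a r)
  case (Cons x A)
  show ?case
  proof (cases x)
    case (Pair l h)
    then show ?thesis
      using Cons by (auto intro!: sum.cong arg_cong2[where f = "(*)"] Cons.IH[of _ "update l h r"] colours_update)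
  qed
qed simp

text \<open>
  The partition function of a marked diagram: unmarked edges are summed over \<open>B0\<close>, marked ones over the whole basis.
\<close>

definition F :: "layer list \<Rightarrow> complex" where
  "F D = amp (flagged D) (\<lambda>_. 1) []"

lemma colours_length: "a \<in> colours r \<Longrightarrow> length a = length r"
  by (auto simp: colours_def list_all2_lengthD)

lemma colours_Nil: "colours [] = {[]}"
  by (auto simp: colours_def)

lemma colours_nth: "\<lbrakk>a \<in> colours r; i < length r\<rbrakk> \<Longrightarrow> a ! i \<in> (if r ! i then insert e B0 else B0)"
  unfolding colours_def by (drule CollectD, drule list_all2_nthD[of _ _ _ i]) auto

lemma colours_pair: "colours [False, False] = words B0 2"
  using colours_unmarked[of 2] by (simp add: numeral_2_eq_2)

lemma tr_pair_colours: "\<lbrakk>x \<in> (if m then insert e B0 else B0); y \<in> (if m' then insert e B0 else B0)\<rbrakk> \<Longrightarrow> tr [x, y] = of_bool (x = y)"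
  by (rule tr_pair) (auto split: if_splits)

lemma sum_colours_1: "(\<Sum>b\<in>colours [m]. f b) = (\<Sum>x\<in>(if m then insert e B0 else B0). f [x])"
proof -
  have "colours [m] = (\<lambda>x. [x]) ` (if m then insert e B0 else B0)"
    by (auto simp: colours_def list_all2_Cons1)
  then show ?thesis by (simp add: sum.reindex inj_on_def)
qed

lemma F_replace:
  assumes "flagged (u @ T @ v) = Au @ At @ Av" "flagged (u @ T' @ v) = Au @ At' @ Av"
    and "\<And>a. a \<in> colours (run [] Au) \<Longrightarrow> amp (At @ Av) (\<lambda>_. 1) a = amp (At' @ Av) (\<lambda>_. 1) a"
  shows "F (u @ T @ v) = F (u @ T' @ v)"
  unfolding F_def assms(1,2) amp_append[of Au]
  by (rule amp_cong[of _ "[]"]) (auto simp: colours_Nil intro: assms(3))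

lemma F_absorb_through:
  assumes D: "marked_diagram (u @ [Vertex i 1 1] @ v)" "marked_diagram (u @ v)"
    and m: "marked (u @ [Vertex i 1 1] @ v) (length u, i) = marked (u @ [Vertex i 1 1] @ v) (Suc (length u), i)"
  shows "F (u @ [Vertex i 1 1] @ v) = F (u @ v)"
proof -
  let ?D = "u @ [Vertex i 1 1] @ v"
  define M where "M = marked ?D"
  have f: "fits 0 ?D" "fits 0 (u @ [] @ v)" using D by (auto simp: marked_diagram_def planar_word_iff)
  define Au Av where "Au = annot M 0 u" and "Av = annot M (Suc (length u)) v"
  define y where "y = M (Suc (length u), i)"
  have A: "flagged ?D = Au @ [(Vertex i 1 1, [y])] @ Av"
    using flagged_split[of u "[Vertex i 1 1]" v] by (simp add: Au_def Av_def y_def M_def)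
  have r: "run [] Au = row M ?D (length u)"
    using run_annot[OF f(1) marked_strand, where t = "length u"] by (simp add: Au_def M_def annot_append)
  have w: "Suc i \<le> width (take (length u) ?D)"
    using fits_layer[OF f(1), of "length u"] by (simp add: nth_append)
  have ri: "run [] Au ! i = y" and lr: "Suc i \<le> length (run [] Au)"
    using w m by (simp_all add: r row_def y_def M_def)
  have up: "update (Vertex i 1 1) [y] (run [] Au) = run [] Au"
    using lr ri by (intro update_same) (auto simp: inputs_1)
  have "flagged (u @ [] @ v) = Au @ [] @ Av"
  proof (rule flagged_replace[OF f A])
    fix r and B :: "(layer \<times> bool list) list" assume "list_all2 (\<longrightarrow>) r (run [] Au)" "map fst B = ([] :: layer list)"
    then have "Suc i \<le> length r" "B = []" using lr by (auto dest: list_all2_lengthD)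
    then show "\<exists>C. map fst C = [Vertex i 1 1] \<and> along flag_ok r C \<and> run r C = run r B
       \<and> (below [(Vertex i 1 1, [y])] C \<longrightarrow> below [] B)"
      by (intro exI[of _ "[(Vertex i 1 1, [r ! i])]"])
        (auto simp: flag_ok_def link_ok_def inputs_1 intro!: update_same)
  qed (use up in \<open>auto simp: Au_def Av_def\<close>)
  from A this have "F ?D = F (u @ [] @ v)"
  proof (rule F_replace)
    fix a assume a: "a \<in> colours (run [] Au)"
    have la: "Suc i \<le> length a" using colours_length[OF a] lr by simp
    have ai: "a ! i \<in> (if y then insert e B0 else B0)" using colours_nth[OF a, of i] lr ri by simp
    have "amp ([(Vertex i 1 1, [y])] @ Av) (\<lambda>_. 1) a
      = (\<Sum>x\<in>(if y then insert e B0 else B0). of_bool (a ! i = x) * amp Av (\<lambda>_. 1) (update (Vertex i 1 1) [x] a))"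
      using la ai tr_pair_colours[OF ai] by (simp add: sum_colours_1 inputs_1 del: if_split cong: sum.cong) 
    also have "\<dots> = amp Av (\<lambda>_. 1) (update (Vertex i 1 1) [a ! i] a)"
      using ai finite_B0 by (auto simp: of_bool_def if_distrib[of "\<lambda>c. c * _"] cong: if_cong)
    also have "update (Vertex i 1 1) [a ! i] a = a"
      using la by (intro update_same) (auto simp: inputs_1)
    finally show "amp ([(Vertex i 1 1, [y])] @ Av) (\<lambda>_. 1) a = amp ([] @ Av) (\<lambda>_. 1) a" by simp
  qed
  then show ?thesis by simp
qed

lemma F_absorb_cup:
  assumes D: "marked_diagram (u @ [Vertex i 0 2] @ v)" "marked_diagram (u @ [Cup i] @ v)"
    and m: "marked (u @ [Vertex i 0 2] @ v) (Suc (length u), Suc i) = marked (u @ [Vertex i 0 2] @ v) (Suc (length u), i)"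
  shows "F (u @ [Vertex i 0 2] @ v) = F (u @ [Cup i] @ v)"
proof -
  let ?D = "u @ [Vertex i 0 2] @ v"
  define M where "M = marked ?D"
  have f: "fits 0 ?D" "fits 0 (u @ [Cup i] @ v)" using D by (auto simp: marked_diagram_def planar_word_iff)
  define Au Av where "Au = annot M 0 u" and "Av = annot M (Suc (length u)) v"
  define y where "y = M (Suc (length u), i)"
  have A: "flagged ?D = Au @ [(Vertex i 0 2, [y, y])] @ Av"
    using flagged_split[of u "[Vertex i 0 2]" v] m by (simp add: Au_def Av_def y_def M_def upt_rec)
  have "flagged (u @ [Cup i] @ v) = Au @ [(Cup i, [y, y])] @ Av"
  proof (rule flagged_replace[OF f A])
    fix r and B :: "(layer \<times> bool list) list" assume "map fst B = [Cup i]" "along flag_ok r B"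
    then obtain g where "B = [(Cup i, g)]" "length g = 2"
      by (cases B) (auto simp: flag_ok_def link_ok_def)
    then show "\<exists>C. map fst C = [Vertex i 0 2] \<and> along flag_ok r C \<and> run r C = run r B
       \<and> (below [(Vertex i 0 2, [y, y])] C \<longrightarrow> below [(Cup i, [y, y])] B)"
      by (intro exI[of _ "[(Vertex i 0 2, g)]"]) (auto simp: flag_ok_def link_ok_def update_def)
  qed (auto simp: Au_def Av_def flag_ok_def link_ok_def update_def)
  from A this show ?thesis
  proof (rule F_replace)
    fix a assume a: "a \<in> colours (run [] Au)"
    show "amp ([(Vertex i 0 2, [y, y])] @ Av) (\<lambda>_. 1) a = amp ([(Cup i, [y, y])] @ Av) (\<lambda>_. 1) a"
    proof (simp add: inputs_def, rule sum.cong[OF refl])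
      fix b assume b: "b \<in> colours [y, y]"
      then have "b = [b ! 0, b ! 1]" by (intro list_eq_2) (auto dest: colours_length)
      moreover from this have "tr (rev b) = of_bool (b ! 1 = b ! 0)"
        using tr_pair_colours[of "b ! 1" y "b ! 0" y] colours_nth[OF b, of 0] colours_nth[OF b, of 1]
        by (metis (no_types, lifting) One_nat_def append.simps(1) append_Cons length_Cons lessI list.size(3) nth_Cons_0 nth_Cons_Suc rev.simps zero_less_Suc)
      ultimately show "tr (rev b) * amp Av (\<lambda>_. 1) (update (Vertex i 0 2) b a)
        = of_bool (b ! 0 = b ! Suc 0) * amp Av (\<lambda>_. 1) (update (Cup i) b a)"
        by (simp add: update_def eq_commute)
    qed
  qed
qed

lemma F_absorb_cap:
  assumes D: "marked_diagram (u @ [Vertex i 2 0] @ v)" "marked_diagram (u @ [Cap i] @ v)"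
    and m: "marked (u @ [Vertex i 2 0] @ v) (length u, i) = marked (u @ [Vertex i 2 0] @ v) (length u, Suc i)"
  shows "F (u @ [Vertex i 2 0] @ v) = F (u @ [Cap i] @ v)"
proof -
  let ?D = "u @ [Vertex i 2 0] @ v"
  define M where "M = marked ?D"
  have f: "fits 0 ?D" "fits 0 (u @ [Cap i] @ v)" using D by (auto simp: marked_diagram_def planar_word_iff)
  define Au Av where "Au = annot M 0 u" and "Av = annot M (Suc (length u)) v"
  have A: "flagged ?D = Au @ [(Vertex i 2 0, [])] @ Av"
    using flagged_split[of u "[Vertex i 2 0]" v] by (simp add: Au_def Av_def M_def)
  have r: "run [] Au = row M ?D (length u)"
    using run_annot[OF f(1) marked_strand, where t = "length u"] by (simp add: Au_def M_def annot_append)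
  have w: "i + 2 \<le> width (take (length u) ?D)"
    using fits_layer[OF f(1), of "length u"] by (simp add: nth_append)
  have ri: "run [] Au ! i = run [] Au ! Suc i" and lr: "i + 2 \<le> length (run [] Au)"
    using w m by (simp_all add: r row_def M_def)
  have "flagged (u @ [Cap i] @ v) = Au @ [(Cap i, [])] @ Av"
  proof (rule flagged_replace[OF f A])
    fix r and B :: "(layer \<times> bool list) list" assume "map fst B = [Cap i]" "along flag_ok r B"
    then have "B = [(Cap i, [])]"
      by (cases B) (auto simp: flag_ok_def link_ok_def)
    then show "\<exists>C. map fst C = [Vertex i 2 0] \<and> along flag_ok r C \<and> run r C = run r B
       \<and> (below [(Vertex i 2 0, [])] C \<longrightarrow> below [(Cap i, [])] B)"
      by (intro exI[of _ "[(Vertex i 2 0, [])]"]) (auto simp: flag_ok_def link_ok_def update_def)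
  qed (use ri lr in \<open>auto simp: Au_def Av_def flag_ok_def link_ok_def update_def inputs_2\<close>)
  from A this show ?thesis
  proof (rule F_replace)
    fix a assume a: "a \<in> colours (run [] Au)"
    have la: "i + 2 \<le> length a" using colours_length[OF a] lr by simp
    have "tr [a ! i, a ! Suc i] = of_bool (a ! i = a ! Suc i)"
      using colours_nth[OF a, of i] colours_nth[OF a, of "Suc i"] lr ri tr_pair_colours by simp
    then show "amp ([(Vertex i 2 0, [])] @ Av) (\<lambda>_. 1) a = amp ([(Cap i, [])] @ Av) (\<lambda>_. 1) a"
      using la by (simp add: colours_Nil inputs_2 update_def)
  qed
qed

text \<open>
  The third term has the sign of the weight of a crossing; the strands involved are unmarked, so that \<open>X\<close> applies.
\<close>

lemma F_skein:
  assumes D: "marked_diagram (u @ [Cross c i] @ v)" "c \<noteq> Virtual"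
  shows "F (u @ [Cross c i] @ v) = \<alpha> * F (u @ A_smoothing c i @ v) + 1 / \<alpha> * F (u @ B_smoothing c i @ v)
    - K * F (u @ [Vertex i 2 2] @ v)"
proof -
  obtain Au Av where A: "flagged (u @ [Cross c i] @ v) = Au @ [(Cross c i, [False, False])] @ Av"
    and B: "flagged (u @ v) = Au @ Av" "flagged (u @ [Cap i, Cup i] @ v) = Au @ [(Cap i, []), (Cup i, [False, False])] @ Av"
    "flagged (u @ [Vertex i 2 2] @ v) = Au @ [(Vertex i 2 2, [False, False])] @ Av"
    and r: "i + 2 \<le> length (run [] Au)" "\<not> run [] Au ! i" "\<not> run [] Au ! Suc i"
    using crossing_replaced[OF D] by blast
  have "F (u @ [Cross c i] @ v) = amp Au (amp ((Cross c i, [False, False]) # Av) (\<lambda>_. 1)) []"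
    unfolding F_def A amp_append[of Au] by simp
  also have "\<dots> = amp Au (\<lambda>a. par c * amp Av (\<lambda>_. 1) a + 1 / par c * amp ((Cap i, []) # (Cup i, [False, False]) # Av) (\<lambda>_. 1) a
     + (- K) * amp ((Vertex i 2 2, [False, False]) # Av) (\<lambda>_. 1) a) []"
  proof (rule amp_cong[of _ "[]"])
    fix a assume a: "a \<in> colours (run [] Au)"
    have la: "i + 2 \<le> length a" and c: "a ! i \<in> B0" "a ! Suc i \<in> B0"
      using colours_length[OF a] colours_nth[OF a, of i] colours_nth[OF a, of "Suc i"] r by auto
    have u: "update (Cross c i) [a ! i, a ! Suc i] a = a"
      using la by (intro update_same) (auto simp: inputs_2)
    have u2: "update (Cup i) b (update (Cap i) [] a) = update (Cross c i) b a"
      "update (Vertex i 2 2) b a = update (Cross c i) b a" for b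
      using la by (auto simp: update_def)
    show "amp ((Cross c i, [False, False]) # Av) (\<lambda>_. 1) a = par c * amp Av (\<lambda>_. 1) a
      + 1 / par c * amp ((Cap i, []) # (Cup i, [False, False]) # Av) (\<lambda>_. 1) a
     + (- K) * amp ((Vertex i 2 2, [False, False]) # Av) (\<lambda>_. 1) a"
      using X_expand[OF c, of "par c" "\<lambda>b. amp Av (\<lambda>_. 1) (update (Cross c i) b a)"] la D(2)
      by (simp add: inputs_2 colours_pair colours_Nil u u2)
  qed (simp add: colours_Nil)
  also have "\<dots> = par c * F (u @ v) + 1 / par c * F (u @ [Cap i, Cup i] @ v) - K * F (u @ [Vertex i 2 2] @ v)"
    unfolding F_def B amp_append[of Au] unfolding amp_add amp_scale by (simp del: amp.simps)
  finally show ?thesis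
    using D(2) by (cases c) (auto simp: par_def)
qed

end

section \<open>The two ends of an edge\<close>

definition flip :: "'p \<times> bool \<Rightarrow> 'p \<times> bool" where
  "flip s = (fst s, \<not> snd s)"

lemma flip_simps [simp]: "flip (flip s) = s" "fst (flip s) = fst s" "flip s \<noteq> s" "flip s = flip s' \<longleftrightarrow> s = s'"
  by (auto simp: flip_def prod_eq_iff)

text \<open>
  Points have two sides, some of which are linked in pairs. Starting at a free side and passing alternately through a point and along a
  link never revisits a point, since links can be reversed; on a finite set the walk ends at another free side, and it
  exhausts the class of its points.
\<close>

lemma other_end:
  fixes lnk :: "'p \<times> bool \<Rightarrow> ('p \<times> bool) option"
  assumes fin: "finite X"
    and closed: "\<And>s s'. \<lbrakk>fst s \<in> X; lnk s = Some s'\<rbrakk> \<Longrightarrow> fst s' \<in> X"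
    and sym: "\<And>s s'. \<lbrakk>fst s \<in> X; lnk s = Some s'\<rbrakk> \<Longrightarrow> lnk s' = Some s"
    and irr: "\<And>s. fst s \<in> X \<Longrightarrow> lnk s \<noteq> Some s"
    and s0: "fst s0 \<in> X" "lnk s0 = None"
  defines "adj \<equiv> \<lambda>P Q. P \<in> X \<and> Q \<in> X \<and> (\<exists>d d'. lnk (P, d) = Some (Q, d'))"
  shows "\<exists>s'. s' \<noteq> s0 \<and> fst s' \<in> X \<and> lnk s' = None \<and> equivclp adj (fst s0) (fst s') \<and>
    (\<forall>s''. lnk s'' = None \<longrightarrow> equivclp adj (fst s0) (fst s'') \<longrightarrow> s'' = s0 \<or> s'' = s')"
proof -
  define W where "W i = ((\<lambda>s. the (lnk (flip s))) ^^ i) s0" for i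
  have W0: "W 0 = s0" and WSuc: "W (Suc i) = the (lnk (flip (W i)))" for i
    by (simp_all add: W_def)
  have step: "lnk (flip (W i)) = Some (W (Suc i)) \<and> fst (W (Suc i)) \<in> X"
    if "fst (W i) \<in> X" "lnk (flip (W i)) \<noteq> None" for i
    using that closed[of "flip (W i)"] by (auto simp: WSuc)
  have WX: "fst (W i) \<in> X" if "\<forall>j<i. lnk (flip (W j)) \<noteq> None" for i
    using that by (induction i) (use s0 step W0 in auto)
  have inj: "W i \<noteq> W j" if "i < j" "\<forall>k<j. lnk (flip (W k)) \<noteq> None" for i j
    using that
  proof (induction i arbitrary: j)
    case 0
    then obtain k where j: "j = Suc k" by (cases j) auto
    have k: "fst (W k) \<in> X" using WX[of k] 0(2) j by simp
    have "lnk (flip (W k)) = Some (W j)" using step[OF k] 0(2) j by simp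
    then have "lnk (W j) = Some (flip (W k))" by (rule sym[rotated]) (simp add: k)
    then show ?case using s0(2) W0 by (metis option.distinct(1))
  next
    case (Suc i)
    then obtain k where j: "j = Suc k" by (cases j) auto
    have k: "fst (W k) \<in> X" using WX[of k] Suc.prems(2) j by simp
    have i: "fst (W i) \<in> X" using WX[of i] Suc.prems j by simp
    have "lnk (flip (W k)) = Some (W j)" "lnk (flip (W i)) = Some (W (Suc i))"
      using step[OF k] step[OF i] Suc.prems j by simp_all
    then have "lnk (W j) = Some (flip (W k))" "lnk (W (Suc i)) = Some (flip (W i))"
      using k i by (auto intro!: sym)
    moreover have "W i \<noteq> W k" using Suc.IH[of k] Suc.prems j by simp
    ultimately show ?case by (metis flip_simps(4) option.inject)
  qed
  have "\<exists>n. lnk (flip (W n)) = None"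
  proof (rule ccontr)
    assume "\<nexists>n. lnk (flip (W n)) = None"
    then have all: "\<forall>n. lnk (flip (W n)) \<noteq> None" by auto
    then have "inj W" using inj by (metis injI linorder_neqE_nat)
    moreover have "range W \<subseteq> X \<times> UNIV" using WX all by (simp add: mem_Times_iff image_subset_iff)
    ultimately show False
      using fin by (metis finite_SigmaI finite_UNIV finite_imageD finite_subset infinite_UNIV_nat)
  qed
  define n where "n = (LEAST n. lnk (flip (W n)) = None)"
  have n: "lnk (flip (W n)) = None" unfolding n_def using \<open>\<exists>n. _\<close> by (rule LeastI_ex)
  have less: "lnk (flip (W k)) \<noteq> None" if "k < n" for k
    using that not_less_Least unfolding n_def by blast
  have X: "fst (W k) \<in> X" if "k \<le> n" for k using WX less that by simp
  have fwd: "lnk (flip (W k)) = Some (W (Suc k))" if "k < n" for k using step X less that by simp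
  have bwd: "lnk (W (Suc k)) = Some (flip (W k))" if "k < n" for k
    using sym[OF _ fwd[OF that]] X that by simp
  have rev: "flip (W n) = s0 \<Longrightarrow> k \<le> n \<Longrightarrow> W (n - k) = flip (W k)" for k
  proof (induction k)
    case 0
    then show ?case using W0 by (metis flip_simps(1) minus_nat.diff_0)
  next
    case (Suc k)
    then have "W (n - k) = flip (W k)" by simp
    moreover have "n - k = Suc (n - Suc k)" using Suc.prems by simp
    ultimately have "lnk (flip (W k)) = Some (flip (W (n - Suc k)))" using bwd[of "n - Suc k"] Suc.prems by simp
    then show ?case using fwd[of k] Suc.prems by (metis Suc_le_lessD flip_simps(1) option.inject)
  qed
  have ne: "flip (W n) \<noteq> s0"
  proof
    assume *: "flip (W n) = s0"
    show False
    proof (cases "even n")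
      case True
      then obtain k where "n = k + k" by (metis evenE mult_2)
      then show False using rev[OF *, of k] by (metis add_diff_cancel_left' flip_simps(3) le_add1)
    next
      case False
      then obtain k where k: "n = Suc (k + k)" by (metis oddE Suc_eq_plus1 mult_2)
      then have "W (Suc k) = flip (W k)" using rev[OF *, of k] by (simp add: Suc_diff_le)
      then show False using fwd[of k] irr[of "flip (W k)"] X[of k] k by simp
    qed
  qed
  have conn: "equivclp adj (fst s0) (fst (W k))" if "k \<le> n" for k
    using that
  proof (induction k)
    case (Suc k)
    then have "adj (fst (W k)) (fst (W (Suc k)))"
      using fwd[of k] X[of k] X[of "Suc k"] unfolding adj_def flip_def by (metis Suc_leD Suc_le_lessD prod.collapse)
    then show ?case using Suc by (metis Suc_leD equivclp_trans r_into_equivclp)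
  qed (simp add: W0)
  have side: "s = W k \<or> s = flip (W k)" if "fst s = fst (W k)" for s k
    using that by (auto simp: flip_def prod_eq_iff)
  have walk: "\<exists>k\<le>n. P = fst (W k)" if "equivclp adj (fst s0) P" for P
    using that
  proof (induction rule: equivclp_induct)
    case base
    then show ?case using W0 by auto
  next
    case (step y z)
    then obtain k where k: "k \<le> n" "y = fst (W k)" by auto
    have "\<exists>d d'. lnk (y, d) = Some (z, d')"
      using step.hyps(2) unfolding adj_def using sym by (metis fst_conv)
    then obtain d d' where d: "lnk (y, d) = Some (z, d')" by auto
    consider "(y, d) = W k" | "(y, d) = flip (W k)" using side[of "(y, d)" k] k by auto
    then show ?case
    proof cases
      case 1
      show ?thesis
      proof (cases k)
        case 0
        then show ?thesis using d 1 s0 W0 by simp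
      next
        case (Suc m)
        then have "Some (z, d') = Some (flip (W m))" using d 1 k bwd[of m] by simp
        then have "z = fst (W m)" by (metis flip_simps(2) fst_conv option.inject)
        then show ?thesis using Suc k by (intro exI[of _ m]) simp
      qed
    next
      case 2
      then have "k < n" using d n k by (cases "k = n") auto
      then show ?thesis using 2 d fwd[of k] by (metis Suc_leI fst_conv option.inject)
    qed
  qed
  have uniq: "s'' = s0 \<or> s'' = flip (W n)" if s'': "lnk s'' = None" "equivclp adj (fst s0) (fst s'')" for s''
  proof -
    obtain k where k: "k \<le> n" "fst s'' = fst (W k)" using walk[OF s''(2)] by auto
    consider "s'' = W k" | "s'' = flip (W k)" using side[OF k(2)] by auto
    then show ?thesis
    proof cases
      case 1
      then show ?thesis using s'' W0 k bwd[of "k - 1"] by (cases k) auto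
    next
      case 2
      then show ?thesis using s'' fwd[of k] k by (cases "k = n") auto
    qed
  qed
  show ?thesis
    by (rule exI[of _ "flip (W n)"]) (use ne n X[of n] conn[of n] uniq in auto)
qed

text \<open>
  The second component of a side tells whether a point is left upwards (\<open>True\<close>) or downwards; free sides are those at vertices.
\<close>

fun lnk :: "layer list \<Rightarrow> (nat \<times> nat) \<times> bool \<Rightarrow> ((nat \<times> nat) \<times> bool) option" where
  "lnk D ((t, p), True) =
     (if length D \<le> t then None
      else if p < offset (D ! t) then Some ((Suc t, p), False)
      else if offset (D ! t) + ins (D ! t) \<le> p then Some ((Suc t, p - ins (D ! t) + outs (D ! t)), False)
      else case D ! t of Cap i \<Rightarrow> Some ((t, 2 * i + 1 - p), True)
        | Cross c i \<Rightarrow> Some ((Suc t, 2 * i + 1 - p), False)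
        | Mark i \<Rightarrow> Some ((Suc t, p), False) | _ \<Rightarrow> None)"
| "lnk D ((t, p), False) =
     (if t = 0 \<or> length D < t then None
      else if p < offset (D ! (t - 1)) then Some ((t - 1, p), True)
      else if offset (D ! (t - 1)) + outs (D ! (t - 1)) \<le> p then Some ((t - 1, p - outs (D ! (t - 1)) + ins (D ! (t - 1))), True)
      else case D ! (t - 1) of Cup i \<Rightarrow> Some ((t, 2 * i + 1 - p), False)
        | Cross c i \<Rightarrow> Some ((t - 1, 2 * i + 1 - p), True)
        | Mark i \<Rightarrow> Some ((t - 1, p), True) | _ \<Rightarrow> None)"

lemma lnk_sym: "lnk D s = Some s' \<Longrightarrow> lnk D s' = Some s"
proof -
  obtain t p d where s: "s = ((t, p), d)" by (metis prod.collapse)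
  assume "lnk D s = Some s'"
  then show ?thesis
    unfolding s by (cases d; cases "D ! t"; cases "D ! (t - 1)") (auto split: if_splits)
qed

lemma lnk_irr: "lnk D s \<noteq> Some s"
proof -
  obtain t p d where s: "s = ((t, p), d)" by (metis prod.collapse)
  have [simp]: "Suc (2 * i) - p \<noteq> p" for i by presburger
  show ?thesis unfolding s by (cases d; cases "D ! t"; cases "D ! (t - 1)") auto
qed

lemma strand_points: "\<lbrakk>fits 0 D; strand D P Q\<rbrakk> \<Longrightarrow> P \<in> points D \<and> Q \<in> points D"
proof (erule strand.cases, goal_cases)
  case (2 t p)
  then show ?case by (auto simp: points_def width_Suc)
qed (use fits_layer[of D] in \<open>force simp: points_def width_Suc\<close>)+

lemma lnk_strand: "\<lbrakk>lnk D (P, d) = Some (Q, d'); P \<in> points D\<rbrakk> \<Longrightarrow> strand D P Q \<or> strand D Q P"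
proof -
  obtain t p where P: "P = (t, p)" by (metis prod.collapse)
  assume *: "lnk D (P, d) = Some (Q, d')" "P \<in> points D"
  show ?thesis
  proof (cases d)
    case True
    show ?thesis
    proof (cases "D ! t")
      case (Cap i)
      then have "p = i \<or> p = Suc i" if "i \<le> p" "p < i + 2" using that by auto
      with * True Cap show ?thesis
        using strand.left[of t D p] strand.right[of t D p] strand.cap[of t D i]
        by (auto simp: P points_def split: if_splits)
    next
      case (Cross c i)
      then have "p = i \<or> p = Suc i" if "i \<le> p" "p < i + 2" using that by auto
      with * True Cross show ?thesis
        using strand.left[of t D p] strand.right[of t D p] strand.cross_rising[of t D c i] strand.cross_falling[of t D c i]
        by (auto simp: P points_def split: if_splits)
    next
      case (Mark i)
      consider "p < i" | "p = i" | "i < p" by linarith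
      then show ?thesis
        using * True Mark strand.left[of t D p] strand.right[of t D p] strand.mark[of t D i]
        by cases (auto simp: P points_def split: if_splits)
    qed (use * True strand.left[of t D p] strand.right[of t D p] in \<open>auto simp: P points_def split: if_splits\<close>)
  next
    case False
    then obtain u where t: "t = Suc u" "u < length D" using * by (cases t) (auto simp: P split: if_splits)
    have w: "p < width (take u D) - ins (D ! u) + outs (D ! u)" using *(2) t by (simp add: P points_def width_Suc)
    have R: "strand D (u, p - outs (D ! u) + ins (D ! u)) (Suc u, p)" if "offset (D ! u) + outs (D ! u) \<le> p"
      using strand.right[of u D "p - outs (D ! u) + ins (D ! u)"] that w t by simp
    show ?thesis
    proof (cases "D ! u")
      case (Cup i)
      then have "p = i \<or> p = Suc i" if "i \<le> p" "p < i + 2" using that by auto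
      with * False Cup t R show ?thesis
        using strand.left[of u D p] strand.cup[of u D i]
        by (auto simp: P split: if_splits)
    next
      case (Cross c i)
      then have "p = i \<or> p = Suc i" if "i \<le> p" "p < i + 2" using that by auto
      with * False Cross t R show ?thesis
        using strand.left[of u D p] strand.cross_rising[of u D c i] strand.cross_falling[of u D c i]
        by (auto simp: P split: if_splits)
    next
      case (Mark i)
      consider "p < i" | "p = i" | "i < p" by linarith
      then show ?thesis
        using * False Mark t R strand.left[of u D p] strand.mark[of u D i]
        by cases (auto simp: P split: if_splits)
    qed (use * False t R strand.left[of u D p] in \<open>auto simp: P split: if_splits\<close>)
  qed
qed

lemma strand_lnk: "strand D P Q \<Longrightarrow> \<exists>d d'. lnk D (P, d) = Some (Q, d')"
proof (erule strand.cases, goal_cases)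
  case (1 t p)
  then show ?case by (intro exI[of _ True] exI[of _ False]) auto
next
  case (2 t p)
  then show ?case by (intro exI[of _ True] exI[of _ False]) auto
next
  case (3 t i)
  then show ?case by (intro exI[of _ False]) auto
next
  case (4 t i)
  then show ?case by (intro exI[of _ True]) auto
qed (intro exI[of _ True] exI[of _ False]; auto)+

lemma finite_points: "finite (points D)"
proof -
  have "points D = Sigma {..length D} (\<lambda>t. {..<width (take t D)})" by (auto simp: points_def)
  then show ?thesis by simp
qed

lemma equivclp_mono': "\<lbrakk>equivclp r x y; \<And>x y. r x y \<Longrightarrow> equivclp r' x y\<rbrakk> \<Longrightarrow> equivclp r' x y"
proof (induction rule: equivclp_induct)
  case (step y z)
  have "equivclp r' y z" using step.hyps(2) step.prems by (auto intro: equivclp_sym)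
  with step show ?case by (blast intro: equivclp_trans)
qed simp

definition end_side :: "layer list \<Rightarrow> nat \<times> nat \<Rightarrow> (nat \<times> nat) \<times> bool" where
  "end_side D h = (leg D h, snd h < ins (D ! fst h))"

lemma leg_points: "\<lbrakk>fits 0 D; h \<in> diagram_half_edges D\<rbrakk> \<Longrightarrow> leg D h \<in> points D"
  using fits_layer[of D "fst h"]
  by (auto simp: diagram_half_edges_def diagram_vertices_def leg_def points_def width_Suc split: if_splits)

lemma end_side_lnk: "\<lbrakk>fits 0 D; h \<in> diagram_half_edges D\<rbrakk> \<Longrightarrow> lnk D (end_side D h) = None"
  by (auto simp: diagram_half_edges_def diagram_vertices_def leg_def end_side_def)

lemma lnk_end_side:
  assumes "planar_word D" "fst s \<in> points D" "lnk D s = None"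
  shows "\<exists>h \<in> diagram_half_edges D. s = end_side D h"
proof -
  obtain t p d where s: "s = ((t, p), d)" by (metis prod.collapse)
  have p: "t \<le> length D" "p < width (take t D)" using assms by (auto simp: s points_def)
  have "0 < t" using p by (cases t) (simp_all add: width_def)
  have "t < length D"
    using assms(1) p by (auto simp: planar_word_def le_less)
  show ?thesis
  proof (cases d)
    case True
    then obtain i m n where V: "D ! t = Vertex i m n" "i \<le> p" "p < i + m"
      using assms(3) \<open>t < length D\<close> unfolding s by (cases "D ! t") (auto split: if_splits)
    then show ?thesis
      using \<open>t < length D\<close> True
      by (intro bexI[of _ "(t, p - i)"]) (auto simp: s end_side_def leg_def diagram_half_edges_def diagram_vertices_def)
  next
    case False
    obtain u where t: "t = Suc u" "u < length D" using \<open>t < length D\<close> \<open>0 < t\<close> by (cases t) auto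
    obtain i m n where V: "D ! u = Vertex i m n" "i \<le> p" "p < i + n"
      using assms(3) t False unfolding s by (cases "D ! u") (auto split: if_splits)
    then show ?thesis
      using t False
      by (intro bexI[of _ "(u, m + n - 1 - (p - i))"]) (auto simp: s end_side_def leg_def diagram_half_edges_def diagram_vertices_def)
  qed
qed

lemma end_side_inj: "inj_on (end_side D) (diagram_half_edges D)"
  by (rule inj_onI) (auto simp: end_side_def leg_def diagram_half_edges_def diagram_vertices_def split: if_splits)

text \<open>
  The half-edges of a diagram are precisely the free sides of points, to which \<open>other_end\<close> applies.
\<close>

lemma other_half_edge:
  assumes D: "planar_word D" and h: "h \<in> diagram_half_edges D"
  shows "\<exists>!h'. h' \<in> diagram_half_edges D \<and> h' \<noteq> h \<and> same_edge D (leg D h) (leg D h')"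
proof -
  have f: "fits 0 D" using D by (simp add: planar_word_iff)
  define adj where "adj = (\<lambda>P Q. P \<in> points D \<and> Q \<in> points D \<and> (\<exists>d d'. lnk D (P, d) = Some (Q, d')))"
  have same: "equivclp adj = same_edge D"
  proof (intro ext iffI)
    fix P Q assume "equivclp adj P Q"
    then show "same_edge D P Q"
      unfolding same_edge_def
      by (rule equivclp_mono') (auto simp: adj_def dest: lnk_strand intro: equivclp_sym)
  next
    fix P Q assume "same_edge D P Q"
    then show "equivclp adj P Q"
      unfolding same_edge_def
      by (rule equivclp_mono') (auto simp: adj_def strand_points[OF f] intro!: r_into_equivclp strand_lnk)
  qed
  have "\<exists>s'. s' \<noteq> end_side D h \<and> fst s' \<in> points D \<and> lnk D s' = None \<and> equivclp adj (fst (end_side D h)) (fst s') \<and>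
    (\<forall>s''. lnk D s'' = None \<longrightarrow> equivclp adj (fst (end_side D h)) (fst s'') \<longrightarrow> s'' = end_side D h \<or> s'' = s')"
    unfolding adj_def
  proof (rule other_end[OF finite_points])
    show "fst s' \<in> points D" if "fst s \<in> points D" "lnk D s = Some s'" for s s'
      using lnk_strand[of D "fst s" "snd s" "fst s'" "snd s'"] that strand_points[OF f] by (metis prod.collapse)
    show "lnk D s' = Some s" if "lnk D s = Some s'" for s s' using that by (rule lnk_sym)
    show "lnk D s \<noteq> Some s" for s by (rule lnk_irr)
    show "fst (end_side D h) \<in> points D" using leg_points[OF f h] by (simp add: end_side_def)
    show "lnk D (end_side D h) = None" by (rule end_side_lnk[OF f h])
  qed
  then obtain s' where s': "s' \<noteq> end_side D h" "fst s' \<in> points D" "lnk D s' = None"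
    "same_edge D (leg D h) (fst s')"
    "\<And>s''. lnk D s'' = None \<Longrightarrow> same_edge D (leg D h) (fst s'') \<Longrightarrow> s'' = end_side D h \<or> s'' = s'"
    unfolding same fst_conv[of "leg D h" "snd h < ins (D ! fst h)", folded end_side_def] by blast
  obtain h' where h': "h' \<in> diagram_half_edges D" "s' = end_side D h'"
    using lnk_end_side[OF D s'(2,3)] by auto
  show ?thesis
  proof (rule ex1I[of _ h'])
    show "h' \<in> diagram_half_edges D \<and> h' \<noteq> h \<and> same_edge D (leg D h) (leg D h')"
      using s' h' by (auto simp: end_side_def)
    fix k assume k: "k \<in> diagram_half_edges D \<and> k \<noteq> h \<and> same_edge D (leg D h) (leg D k)"
    then have "end_side D k = end_side D h \<or> end_side D k = s'"
      using s'(5)[of "end_side D k"] end_side_lnk[OF f] by (auto simp: end_side_def)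
    then show "k = h'" using k h h' inj_onD[OF end_side_inj] by blast
  qed
qed

section \<open>Marking an edge\<close>

lemma same_edge_strand: assumes "strand D Q Q'" shows "same_edge D P Q = same_edge D P Q'"
  using same_edge_equiv(4)[OF assms] same_edge_equiv(2,3) by blast

definition selections :: "'c set list \<Rightarrow> 'c list set" where
  "selections Xs = {c. list_all2 (\<lambda>X x. x \<in> X) Xs c}"

lemma selections_nth: "c \<in> selections Xs \<Longrightarrow> q < length Xs \<Longrightarrow> c ! q \<in> Xs ! q"
  unfolding selections_def by (drule CollectD, drule list_all2_nthD) auto

lemma selections_iff: "c \<in> selections Xs \<longleftrightarrow> length c = length Xs \<and> (\<forall>q<length Xs. c ! q \<in> Xs ! q)"
  by (auto simp: selections_def list_all2_conv_all_nth)

lemma selections_update: "\<lbrakk>a \<in> selections r; b \<in> selections g\<rbrakk> \<Longrightarrow> update l b a \<in> selections (update l g r)"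
  by (auto simp: selections_def update_def intro!: list_all2_appendI list_all2_takeI list_all2_dropI)

lemma selections_Nil: "selections [] = {[]}"
  by (auto simp: selections_def)

lemma selections_Cons: "selections (X # Xs) = (\<lambda>(x, c). x # c) ` (X \<times> selections Xs)"
  by (auto simp: selections_def list_all2_Cons1)

lemma finite_selections: "\<forall>X\<in>set Xs. finite X \<Longrightarrow> finite (selections Xs)"
  by (induction Xs) (auto simp: selections_Nil selections_Cons)

text \<open>
  All colourings, when the outgoing strands of each layer have prescribed sets of colours. In contrast to \<open>amp\<close> these sets may differ
  from strand to strand, as is needed for splitting the sum over a single edge.
\<close>

definition choices :: "(layer \<times> 'c set list) list \<Rightarrow> (layer \<times> 'c list) list set" where
  "choices A = {C. list_all2 (\<lambda>x y. fst x = fst y \<and> snd y \<in> selections (snd x)) A C}"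

lemma choices_Nil: "choices [] = {[]}"
  by (auto simp: choices_def)

lemma choices_Cons: "choices ((l, X) # A) = (\<lambda>(c, C). (l, c) # C) ` (selections X \<times> choices A)"
  by (force simp: choices_def list_all2_Cons1)

lemma choices_run: "\<lbrakk>C \<in> choices A; a \<in> selections r\<rbrakk> \<Longrightarrow> run a C \<in> selections (run r A)"
proof (induction A arbitrary: C a r)
  case (Cons x A)
  obtain l X where x: "x = (l, X)" by (cases x)
  from Cons.prems obtain c C' where C: "C = (l, c) # C'" "c \<in> selections X" "C' \<in> choices A"
    by (auto simp: x choices_Cons)
  show ?case
    using Cons.IH[OF C(3) selections_update[OF Cons.prems(2) C(2)]] by (simp add: C x)
qed (simp add: choices_Nil)

lemma choices_take: "C \<in> choices A \<Longrightarrow> take t C \<in> choices (take t A)"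
  by (auto simp: choices_def)

lemma choices_annot:
  "C \<in> choices (annot R 0 D) \<longleftrightarrow> map fst C = D \<and>
    (\<forall>t<length D. length (snd (C ! t)) = outs (D ! t) \<and> (\<forall>q<outs (D ! t). snd (C ! t) ! q \<in> R (Suc t, offset (D ! t) + q)))"
proof -
  have "C \<in> choices (annot R 0 D) \<longleftrightarrow> length C = length D \<and>
    (\<forall>t<length D. D ! t = fst (C ! t) \<and> snd (C ! t) \<in> selections (map (\<lambda>q. R (Suc t, offset (D ! t) + q)) [0..<outs (D ! t)]))"
    unfolding choices_def by (auto simp: list_all2_conv_all_nth annot_nth)
  also have "\<dots> \<longleftrightarrow> map fst C = D \<and>
    (\<forall>t<length D. snd (C ! t) \<in> selections (map (\<lambda>q. R (Suc t, offset (D ! t) + q)) [0..<outs (D ! t)]))"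
    by (auto intro: nth_equalityI)
  finally show ?thesis
    by (simp add: selections_iff)
qed

text \<open>
  Marking one strand marks its edge and nothing else, by minimality of the marks.
\<close>

lemma flagged_mark:
  assumes D: "fits 0 (u @ v)" and P: "(length u, i) \<in> points (u @ v)"
  defines "m \<equiv> \<lambda>Q. marked (u @ v) Q \<or> same_edge (u @ v) (length u, i) Q"
  shows "flagged (u @ [Mark i] @ v) = annot m 0 u @ [(Mark i, [True])] @ annot m (length u) v"
    and "fits 0 (u @ [Mark i] @ v)" and "width_from 0 (u @ [Mark i] @ v) = width_from 0 (u @ v)"
    and "Suc i \<le> length (run [] (annot m 0 u))" and "run [] (annot m 0 u) ! i"
proof -
  let ?D = "u @ v" and ?D' = "u @ [Mark i] @ v"
  have i: "Suc i \<le> width_from 0 u" using P by (simp add: points_def width_eq)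
  then have Suc: "Suc (width_from 0 u - Suc 0) = width_from 0 u" by simp
  show f': "fits 0 ?D'" using D i Suc by simp
  show "width_from 0 (u @ [Mark i] @ v) = width_from 0 (u @ v)" using Suc by simp
  have m: "m Q = m Q'" if "strand ?D Q Q'" for Q Q'
    unfolding m_def marked_strand[OF that] same_edge_strand[OF that] ..
  define Au Av where "Au = annot m 0 u" and "Av = annot m (length u) v"
  have A: "annot m 0 ?D = Au @ Av" by (simp add: Au_def Av_def annot_append)
  have "run [] (take (length u) (annot m 0 ?D)) = row m ?D (length u)"
    by (rule run_annot[OF D m]) simp_all
  then have r: "run [] Au = row m ?D (length u)"
    unfolding A by (simp add: Au_def del: length_map)
  show lr: "Suc i \<le> length (run [] (annot m 0 u))" and ri: "run [] (annot m 0 u) ! i"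
    using i unfolding Au_def[symmetric] r
    by (simp_all add: row_def width_eq m_def same_edge_equiv(1))
  have up: "update (Mark i) [True] s = s" if "Suc i \<le> length s" "s ! i" for s
    using that by (intro update_same) (auto simp: inputs_1)
  have "along flag_ok [] (annot m 0 ?D)"
  proof -
    have "consistent [] (annot m 0 ?D)" by (rule consistent_annot[OF D m])
    moreover have "inputs (fst (annot m 0 ?D ! t)) (run [] (take t (annot m 0 ?D))) ! 0"
      if "t < length ?D" "fst (annot m 0 ?D ! t) = Mark j" for t j
    proof -
      have Dt: "?D ! t = Mark j" using that by (simp add: annot_nth)
      have "marked ?D (t, j)" unfolding marked_def using that(1) Dt same_edge_equiv(1) by blast
      then have "m (t, j)" by (simp add: m_def)
      moreover have R: "run [] (take t (annot m 0 ?D)) = row m ?D t"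
        by (rule run_annot[OF D m]) (use that(1) in simp_all)
      ultimately show ?thesis
        using fits_layer[OF D that(1)] Dt unfolding that(2) R
        by (simp add: inputs_def row_def)
    qed
    ultimately show ?thesis by (simp add: along_nth flag_ok_def)
  qed
  then have ok: "along flag_ok [] (Au @ [(Mark i, [True])] @ Av)"
    using lr ri up unfolding A Au_def[symmetric] by (simp add: flag_ok_def link_ok_def inputs_1)
  have "below (flagged ?D') (Au @ [(Mark i, [True])] @ Av)"
    by (rule flagged_below[OF ok f']) (simp add: Au_def Av_def)
  moreover have "below (Au @ [(Mark i, [True])] @ Av) (flagged ?D')"
  proof -
    define M where "M = marked ?D'"
    define Bu g Bv where "Bu = annot M 0 u" and "g = [M (Suc (length u), i)]" and "Bv = annot M (Suc (length u)) v"
    have B: "flagged ?D' = Bu @ [(Mark i, g)] @ Bv"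
      using flagged_split[of u "[Mark i]" v] by (simp add: Bu_def Bv_def g_def M_def)
    have okB: "along flag_ok [] (Bu @ [(Mark i, g)] @ Bv)" using flagged_ok[OF f'] B by simp
    have "length (run [] Bu) = width_from 0 u"
      using okB length_run[of "[]" Bu] f' by (simp add: consistent_sized flag_ok_consistent Bu_def)
    then have Bi: "Suc i \<le> length (run [] Bu)" using i by simp
    then have gi: "run [] Bu ! i" "g = [True]"
      using okB by (auto simp: flag_ok_def link_ok_def inputs_1 g_def)
    then have ok2: "along flag_ok [] (Bu @ Bv)" using okB up[OF Bi gi(1)] by simp
    have mf: "map fst (Bu @ Bv) = ?D" by (simp add: Bu_def Bv_def)
    have "entry (Bu @ Bv) (length u, i)" using gi by (simp add: entry_def Bu_def)
    then have "entry (Bu @ Bv) Q" if "m Q" for Q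
      using that marked_at[OF ok2 D mf] entry_same_edge[OF flag_ok_consistent[OF ok2] D mf]
      unfolding m_def by metis
    then have "below (annot m 0 ?D) (Bu @ Bv)"
      by (rule below_annot[OF consistent_sized[OF flag_ok_consistent[OF ok2]] D mf])
    then have "below Au Bu" "below Av Bv"
      unfolding A by (simp_all add: below_append Au_def Bu_def)
    then show ?thesis unfolding B gi(2) by (simp add: below_append Au_def Bu_def)
  qed
  ultimately have "flagged ?D' = Au @ [(Mark i, [True])] @ Av" by (rule below_antisym)
  then show "flagged (u @ [Mark i] @ v) = annot m 0 u @ [(Mark i, [True])] @ annot m (length u) v"
    by (simp add: Au_def Av_def)
qed

context colour_model
begin

fun weight :: "'c list \<Rightarrow> (layer \<times> 'c list) list \<Rightarrow> complex" where
  "weight a [] = 1"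
| "weight a ((l, c) # C) = tau l (inputs l a) c * weight (update l c a) C"

fun amp_sets :: "(layer \<times> 'c set list) list \<Rightarrow> ('c list \<Rightarrow> complex) \<Rightarrow> 'c list \<Rightarrow> complex" where
  "amp_sets [] f a = f a"
| "amp_sets ((l, Y) # A) f a = (\<Sum>b\<in>selections Y. tau l (inputs l a) b * amp_sets A f (update l b a))"

definition range_of :: "bool \<Rightarrow> 'c set" where
  "range_of m = (if m then insert e B0 else B0)"

lemma colours_selections: "colours g = selections (map range_of g)"
  by (auto simp: colours_def selections_def list_all2_map1 range_of_def)

lemma amp_amp_sets: "amp A f a = amp_sets (map (\<lambda>(l, g). (l, map range_of g)) A) f a"
  by (induction A f a rule: amp.induct) (simp_all add: colours_selections)

lemma amp_sets_choices: "amp_sets A f a = (\<Sum>C\<in>choices A. weight a C * f (run a C))"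
proof (induction A f a rule: amp_sets.induct)
  case (1 f a)
  then show ?case by (simp add: choices_Nil)
next
  case (2 l Y A f a)
  have "(\<Sum>C\<in>choices ((l, Y) # A). weight a C * f (run a C))
    = (\<Sum>c\<in>selections Y. \<Sum>C\<in>choices A. tau l (inputs l a) c * weight (update l c a) C * f (run (update l c a) C))"
    unfolding choices_Cons
    by (subst sum.reindex) (auto simp: inj_on_def sum.cartesian_product case_prod_beta)
  then show ?case using 2 by (simp add: sum_distrib_left mult.assoc)
qed

lemma amp_annot: "amp (annot m t D) f a = amp_sets (annot (\<lambda>Q. range_of (m Q)) t D) f a"
  unfolding amp_amp_sets by (rule arg_cong[where f = "\<lambda>A. amp_sets A f a"])
    (induction D arbitrary: t, simp_all)

lemma weight_nth: "weight a C \<noteq> 0 \<Longrightarrow> t < length C \<Longrightarrow> tau (fst (C ! t)) (inputs (fst (C ! t)) (run a (take t C))) (snd (C ! t)) \<noteq> 0"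
  by (induction a C arbitrary: t rule: weight.induct) (auto simp: nth_Cons split: nat.splits)

text \<open>
  Away from classical crossings a colouring of non-zero weight is constant along strands, and therefore on edges.
\<close>

lemma colour_strand:
  assumes C: "along sized [] C" "fits 0 D" "map fst C = D" "weight [] C \<noteq> 0"
    and s: "strand D P Q" and nc: "\<not> carries_classical D P"
  shows "entry C P = entry C Q"
proof -
  have T: "tau (D ! t) (inputs (D ! t) (run [] (take t C))) (snd (C ! t)) \<noteq> 0" if "t < length D" for t
    using weight_nth[OF C(4), of t] that C(3) by auto
  show ?thesis
    using s
  proof cases
    case (left t p)
    then show ?thesis using entry_layer(1)[OF C(1-3)] by simp
  next
    case (right t p)
    then show ?thesis using entry_layer(2)[OF C(1-3)] by simp
  next
    case (cup t i)
    then show ?thesis using T[of t] entry_layer(3)[OF C(1-3), of t 0] entry_layer(3)[OF C(1-3), of t 1] by simp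
  next
    case (cap t i)
    then show ?thesis using T[of t] entry_layer(4)[OF C(1-3), of t 0] entry_layer(4)[OF C(1-3), of t 1] by simp
  next
    case (cross_rising t c i)
    then have "c = Virtual" using nc same_edge_equiv(1) unfolding carries_classical_def by blast
    then show ?thesis using cross_rising T[of t] entry_layer(4)[OF C(1-3), of t 0] entry_layer(3)[OF C(1-3), of t 1] by simp
  next
    case (cross_falling t c i)
    then have "c = Virtual" using nc same_edge_equiv(1) unfolding carries_classical_def by blast
    then show ?thesis using cross_falling T[of t] entry_layer(4)[OF C(1-3), of t 1] entry_layer(3)[OF C(1-3), of t 0] by simp
  next
    case (mark t i)
    then show ?thesis using T[of t] entry_layer(4)[OF C(1-3), of t 0] entry_layer(3)[OF C(1-3), of t 0] by simp
  qed
qed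

lemma carries_same_edge: "same_edge D P Q \<Longrightarrow> carries_classical D P = carries_classical D Q"
  unfolding carries_classical_def using same_edge_equiv by metis

lemma colour_edge:
  assumes C: "along sized [] C" "fits 0 D" "map fst C = D" "weight [] C \<noteq> 0"
    and s: "same_edge D P Q" and nc: "\<not> carries_classical D P"
  shows "entry C P = entry C Q"
  using s unfolding same_edge_def
proof (induction rule: equivclp_induct)
  case (step y z)
  have y: "same_edge D P y" using step.hyps(1) by (simp add: same_edge_def)
  have "strand D y z \<or> strand D z y" using step.hyps(2) by blast
  then have "same_edge D P z" using y same_edge_equiv by blast
  then have "\<not> carries_classical D y" "\<not> carries_classical D z" using y nc carries_same_edge by metis+
  then show ?case using step colour_strand[OF C] by metis
qed simp

text \<open>
  Colourings of non-zero weight are constant on the edge of \<open>P\<close>. Hence the sum over the basis splits into the colourings in which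
  this edge has a colour in \<open>B0\<close> and those in which it has colour \<open>e\<close>.
\<close>

lemma edge_split:
  assumes f: "fits 0 D" and P: "P \<in> points D" "\<not> carries_classical D P"
    and R: "\<And>Q Q'. strand D Q Q' \<Longrightarrow> R Q = R Q'" "\<And>Q. finite (R Q)"
  defines "on \<equiv> \<lambda>Y Q. if same_edge D P Q then Y else R Q"
  shows "amp_sets (annot (on (insert e B0)) 0 D) (\<lambda>_. 1) [] =
    amp_sets (annot (on B0) 0 D) (\<lambda>_. 1) [] + amp_sets (annot (on {e}) 0 D) (\<lambda>_. 1) []"
proof -
  have on: "on Y Q = on Y Q'" if "strand D Q Q'" for Y Q Q'
    unfolding on_def R(1)[OF that] same_edge_strand[OF that] ..
  have fin: "finite (choices (annot (on Y) t w))" if "finite Y" for Y t w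
    using that R(2) by (induction w arbitrary: t)
      (auto simp: choices_Nil choices_Cons on_def intro!: finite_imageI finite_cartesian_product finite_selections)
  have entryP: "entry C P \<in> Y" if "C \<in> choices (annot (on Y) 0 D)" for C Y
  proof -
    have "run [] (take (fst P) C) \<in> selections (run [] (take (fst P) (annot (on Y) 0 D)))"
      by (rule choices_run[OF choices_take[OF that]]) (simp add: selections_Nil)
    moreover have "fst P \<le> length D" using P by (auto simp: points_def)
    ultimately have "run [] (take (fst P) C) \<in> selections (row (on Y) D (fst P))"
      by (simp add: run_annot[OF f on])
    then have "entry C P \<in> on Y P"
      using P selections_nth[of _ "row (on Y) D (fst P)" "snd P"] by (auto simp: points_def entry_def row_def)
    then show ?thesis using same_edge_equiv(1) by (simp add: on_def)
  qed
  have "(\<Sum>C\<in>choices (annot (on (insert e B0)) 0 D). weight [] C)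
    = (\<Sum>C\<in>choices (annot (on B0) 0 D) \<union> choices (annot (on {e}) 0 D). weight [] C)"
  proof (rule sum.mono_neutral_right)
    show "finite (choices (annot (on (insert e B0)) 0 D))" using fin finite_B0 by blast
    show "choices (annot (on B0) 0 D) \<union> choices (annot (on {e}) 0 D) \<subseteq> choices (annot (on (insert e B0)) 0 D)"
      by (auto simp: choices_annot on_def split: if_splits) (metis insertI1 insertI2 singletonD)+
    show "\<forall>C\<in>choices (annot (on (insert e B0)) 0 D) - (choices (annot (on B0) 0 D) \<union> choices (annot (on {e}) 0 D)). weight [] C = 0"
    proof (intro ballI, rule ccontr)
      fix C assume C: "C \<in> choices (annot (on (insert e B0)) 0 D) - (choices (annot (on B0) 0 D) \<union> choices (annot (on {e}) 0 D))"
        and w: "weight [] C \<noteq> 0"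
      then have C': "map fst C = D" "\<And>t. t < length D \<Longrightarrow> length (snd (C ! t)) = outs (D ! t)"
         "\<And>t q. \<lbrakk>t < length D; q < outs (D ! t)\<rbrakk> \<Longrightarrow> snd (C ! t) ! q \<in> on (insert e B0) (Suc t, offset (D ! t) + q)"
        by (auto simp: choices_annot)
      have "along sized [] C"
        unfolding along_nth sized_def using C'(1,2) by auto
      note sz = this f C'(1)
      have const: "snd (C ! t) ! q = entry C P" if "t < length D" "q < outs (D ! t)" "same_edge D P (Suc t, offset (D ! t) + q)" for t q
        using colour_edge[OF sz w that(3) P(2)] entry_layer(3)[OF sz that(1,2)] by simp
      have in_on: "C \<in> choices (annot (on Y) 0 D)" if "entry C P \<in> Y" for Y
        unfolding choices_annot
      proof (intro conjI allI impI C'(1,2))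
        fix t q assume tq: "t < length D" "q < outs (D ! t)"
        show "snd (C ! t) ! q \<in> on Y (Suc t, offset (D ! t) + q)"
          using const[OF tq] C'(3)[OF tq] that by (simp add: on_def split: if_splits)
      qed
      have "entry C P \<in> insert e B0" using entryP C by blast
      then have "C \<in> choices (annot (on B0) 0 D) \<or> C \<in> choices (annot (on {e}) 0 D)"
        using in_on[of B0] in_on[of "{e}"] by auto
      then show False using C by blast
    qed
  qed
  also have "\<dots> = (\<Sum>C\<in>choices (annot (on B0) 0 D). weight [] C) + (\<Sum>C\<in>choices (annot (on {e}) 0 D). weight [] C)"
  proof (rule sum.union_disjoint)
    show "choices (annot (on B0) 0 D) \<inter> choices (annot (on {e}) 0 D) = {}"
      using entryP[of _ B0] entryP[of _ "{e}"] e_notin by fastforce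
  qed (use fin finite_B0 in auto)
  finally show ?thesis by (simp add: amp_sets_choices)
qed

lemma F_mark:
  assumes D: "fits 0 (u @ v)" and P: "(length u, i) \<in> points (u @ v)"
  shows "F (u @ [Mark i] @ v) =
    amp (annot (\<lambda>Q. marked (u @ v) Q \<or> same_edge (u @ v) (length u, i) Q) 0 (u @ v)) (\<lambda>_. 1) []"
proof -
  define m where "m = (\<lambda>Q. marked (u @ v) Q \<or> same_edge (u @ v) (length u, i) Q)"
  note M = flagged_mark[OF D P, folded m_def]
  have "F (u @ [Mark i] @ v) = amp (annot m 0 u) (amp ((Mark i, [True]) # annot m (length u) v) (\<lambda>_. 1)) []"
    unfolding F_def M(1) by (simp add: amp_append del: amp.simps)
  also have "\<dots> = amp (annot m 0 u) (amp (annot m (length u) v) (\<lambda>_. 1)) []"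
  proof (rule amp_cong[of _ "[]"])
    fix a assume a: "a \<in> colours (run [] (annot m 0 u))"
    have la: "Suc i \<le> length a" using colours_length[OF a] M(4) by simp
    have ai: "a ! i \<in> insert e B0" using colours_nth[OF a, of i] M(4,5) by (simp split: if_splits)
    have "amp ((Mark i, [True]) # annot m (length u) v) (\<lambda>_. 1) a
      = (\<Sum>x\<in>insert e B0. of_bool (a ! i = x) * amp (annot m (length u) v) (\<lambda>_. 1) (update (Mark i) [x] a))"
      using la by (simp add: sum_colours_1 inputs_1 del: sum.insert insert_iff)
    also have "\<dots> = amp (annot m (length u) v) (\<lambda>_. 1) (update (Mark i) [a ! i] a)"
      using ai finite_B0 by (simp add: of_bool_def if_distrib[of "\<lambda>c. c * _"] cong: if_cong del: sum.insert)
    also have "update (Mark i) [a ! i] a = a"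
      using la by (intro update_same) (auto simp: inputs_1)
    finally show "amp ((Mark i, [True]) # annot m (length u) v) (\<lambda>_. 1) a = amp (annot m (length u) v) (\<lambda>_. 1) a" .
  qed (simp add: colours_Nil)
  finally show ?thesis
    unfolding m_def[symmetric] by (simp add: annot_append amp_append)
qed

end

section \<open>Deleting an edge\<close>

definition keep :: "(bool \<times> 'a) list \<Rightarrow> 'a list" where
  "keep z = map snd (filter (\<lambda>x. \<not> fst x) z)"

definition kept :: "bool list \<Rightarrow> nat" where
  "kept s = length (filter Not s)"

text \<open>
  The inverse of \<open>keep\<close>: \<open>d\<close> is inserted at the deleted positions.
\<close>

fun fill :: "'a \<Rightarrow> bool list \<Rightarrow> 'a list \<Rightarrow> 'a list" where
  "fill d [] k = []"
| "fill d (True # s) k = d # fill d s k"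
| "fill d (False # s) k = hd k # fill d s (tl k)"

text \<open>
  \<open>delete_layer\<close> with the set of deleted points replaced by the deleted strands below (\<open>s\<close>) and the deleted outgoing strands
  (\<open>g\<close>), which makes deletion a computation along the layers.
\<close>

fun dl :: "layer \<Rightarrow> bool list \<Rightarrow> bool list \<Rightarrow> layer list" where
  "dl (Cup i) s g = (if g ! 0 then [] else [Cup (kept (take i s))])"
| "dl (Cap i) s g = (if s ! i then [] else [Cap (kept (take i s))])"
| "dl (Cross c i) s g = (if s ! i \<or> s ! Suc i then [] else [Cross c (kept (take i s))])"
| "dl (Vertex i m n) s g = [Vertex (kept (take i s)) (kept (take m (drop i s))) (kept g)]"
| "dl (Mark i) s g = (if s ! i then [] else [Mark (kept (take i s))])"

fun del :: "(bool \<times> 'a) list \<Rightarrow> (layer \<times> (bool \<times> 'a) list) list \<Rightarrow> (layer \<times> 'a list) list" where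
  "del z [] = []"
| "del z ((l, g) # A) = map (\<lambda>l'. (l', keep g)) (dl l (map fst z) (map fst g)) @ del (update l g z) A"

fun dels :: "bool list \<Rightarrow> (layer \<times> bool list) list \<Rightarrow> layer list" where
  "dels s [] = []"
| "dels s ((l, g) # A) = dl l s g @ dels (update l g s) A"

text \<open>
  The deleted strands form a union of edges without classical crossings and marks.
\<close>

definition del_ok :: "layer \<Rightarrow> bool list \<Rightarrow> bool list \<Rightarrow> bool" where
  "del_ok l f g \<longleftrightarrow> link_ok l f g \<and> (\<forall>c i. l = Cross c i \<longrightarrow> c \<noteq> Virtual \<longrightarrow> \<not> f ! 0 \<and> \<not> f ! 1)
     \<and> (\<forall>i. l = Mark i \<longrightarrow> \<not> f ! 0)"

lemma keep_simps [simp]: "keep [] = []" "keep ((True, x) # z) = keep z" "keep ((False, x) # z) = x # keep z"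
  "keep (z @ z') = keep z @ keep z'"
  by (simp_all add: keep_def)

lemma keep_Cons: "keep (x # z) = (if fst x then keep z else snd x # keep z)"
  by (simp add: keep_def)

lemma kept_simps [simp]: "kept [] = 0" "kept (b # s) = of_bool (\<not> b) + kept s" "kept (s @ s') = kept s + kept s'"
  by (simp_all add: kept_def)

lemma length_keep: "length (keep z) = kept (map fst z)"
  by (induction z) (auto simp: keep_Cons)

lemma map_update: "map h (update l g z) = update l (map h g) (map h z)"
  by (simp add: update_def take_map drop_map)

lemma map_inputs: "map h (inputs l z) = inputs l (map h z)"
  by (simp add: inputs_def take_map drop_map)

lemma length_fill [simp]: "length (fill d s k) = length s"
  by (induction d s k rule: fill.induct) auto

lemma keep_zip_fill: "length k = kept s \<Longrightarrow> keep (zip s (fill d s k)) = k"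
  by (induction d s k rule: fill.induct) (auto simp: length_Suc_conv)

lemma fill_keep: "(\<And>x. (True, x) \<in> set z \<Longrightarrow> x = d) \<Longrightarrow> fill d (map fst z) (keep z) = map snd z"
proof (induction z)
  case (Cons y z)
  then show ?case by (cases y; cases "fst y") auto
qed simp

lemma fill_True: "(True, x) \<in> set (zip s (fill d s k)) \<Longrightarrow> x = d"
  by (induction d s k rule: fill.induct) auto

lemma row_split:
  assumes "offset l + ins l \<le> length z"
  obtains z1 f z3 where "z = z1 @ f @ z3" "length z1 = offset l" "length f = ins l" "inputs l z = f"
    "\<And>g. update l g z = z1 @ g @ z3"
proof
  show "z = take (offset l) z @ inputs l z @ drop (offset l + ins l) z"
    by (simp add: inputs_def) (metis append_take_drop_id drop_drop add.commute)
qed (use assms in \<open>auto simp: inputs_def update_def\<close>)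

lemma length_0_1_2: "length f = Suc 0 \<longleftrightarrow> (\<exists>x. f = [x])" "length f = Suc (Suc 0) \<longleftrightarrow> (\<exists>x y. f = [x, y])"
  by (auto simp: length_Suc_conv)

lemma dl_one:
  assumes "offset l + ins l \<le> length z" "del_ok l (map fst (inputs l z)) (map fst g)"
    and "dl l (map fst z) (map fst g) = [l']"
  shows "inputs l' (keep z) = keep (inputs l z) \<and> update l' (keep g) (keep z) = keep (update l g z)
    \<and> offset l' + ins l' \<le> length (keep z) \<and> outs l' = length (keep g)"
proof -
  obtain z1 f z3 where z: "z = z1 @ f @ z3" "length z1 = offset l" "length f = ins l" "inputs l z = f"
    "\<And>g. update l g z = z1 @ g @ z3" using row_split[OF assms(1)] by metis
  have n1: "kept (take (offset l) (map fst z)) = length (keep z1)"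
    using z by (simp add: length_keep)
  have nf: "(map fst z) ! (offset l + q) = fst (f ! q)" if "q < ins l" for q
    using z that by (simp add: nth_append)
  have g: "length g = outs l" using assms(2) by (auto simp: del_ok_def link_ok_def)
  have *: "offset l' = length (keep z1) \<and> ins l' = length (keep f) \<and> outs l' = length (keep g)"
  proof (cases l)
    case (Cup i)
    then obtain x y where "g = [x, y]" using g by (auto simp: length_0_1_2 numeral_2_eq_2)
    then show ?thesis using assms(2,3) n1 z Cup
      by (auto simp: del_ok_def link_ok_def keep_Cons split: if_splits)
  next
    case (Cap i)
    then obtain x y where "f = [x, y]" using z by (auto simp: length_0_1_2 numeral_2_eq_2)
    then show ?thesis using assms(2,3) n1 z Cap g nf[of 0]
      by (auto simp: del_ok_def link_ok_def keep_Cons split: if_splits)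
  next
    case (Cross c i)
    then obtain x y where "f = [x, y]" using z by (auto simp: length_0_1_2 numeral_2_eq_2)
    moreover obtain p q where "g = [p, q]" using g Cross by (auto simp: length_0_1_2 numeral_2_eq_2)
    ultimately show ?thesis using assms(2,3) n1 z Cross nf[of 0] nf[of 1]
      by (auto simp: del_ok_def link_ok_def keep_Cons split: if_splits)
  next
    case (Vertex i m n)
    then show ?thesis using assms(3) n1 z g by (auto simp: length_keep)
  next
    case (Mark i)
    then obtain x where "f = [x]" using z by (auto simp: length_0_1_2)
    moreover obtain p where "g = [p]" using g Mark by (auto simp: length_0_1_2)
    ultimately show ?thesis using assms(2,3) n1 z Mark nf[of 0]
      by (auto simp: del_ok_def link_ok_def keep_Cons split: if_splits)
  qed
  then show ?thesis
    unfolding z(4,5) by (simp add: z(1) inputs_def update_def)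
qed

lemma dl_none:
  assumes "offset l + ins l \<le> length z" "keep g = keep (inputs l z)"
  shows "keep (update l g z) = keep z"
proof -
  obtain z1 f z3 where z: "z = z1 @ f @ z3" "inputs l z = f" "\<And>g. update l g z = z1 @ g @ z3"
    using row_split[OF assms(1)] by metis
  show ?thesis using assms(2) unfolding z(2,3) by (simp add: z(1))
qed

lemma dl_cases: "dl l s g = [] \<or> (\<exists>l'. dl l s g = [l'])"
  by (cases l) auto

lemma dl_none_kept:
  assumes "offset l + ins l \<le> length s" "del_ok l (inputs l s) g" "dl l s g = []"
  shows "kept g = kept (inputs l s)"
proof -
  obtain z1 f z3 where z: "s = z1 @ f @ z3" "length z1 = offset l" "length f = ins l" "inputs l s = f"
    using row_split[OF assms(1)] by metis
  have nf: "s ! (offset l + q) = f ! q" if "q < ins l" for q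
    using z that by (simp add: nth_append)
  have g: "length g = outs l" using assms(2) by (auto simp: del_ok_def link_ok_def)
  show "kept g = kept (inputs l s)"
  proof (cases l)
    case (Cup i)
    then obtain x y where "g = [x, y]" using g by (auto simp: length_0_1_2 numeral_2_eq_2)
    then show ?thesis using assms(2,3) z Cup by (auto simp: del_ok_def link_ok_def split: if_splits)
  next
    case (Cap i)
    then obtain x y where "f = [x, y]" using z by (auto simp: length_0_1_2 numeral_2_eq_2)
    then show ?thesis using assms(2,3) z Cap g nf[of 0] by (auto simp: del_ok_def link_ok_def split: if_splits)
  next
    case (Cross c i)
    then obtain x y where "f = [x, y]" using z by (auto simp: length_0_1_2 numeral_2_eq_2)
    moreover obtain p q where "g = [p, q]" using g Cross by (auto simp: length_0_1_2 numeral_2_eq_2)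
    ultimately show ?thesis using assms(2) z Cross by (auto simp: del_ok_def link_ok_def)
  next
    case (Vertex i m n)
    then show ?thesis using assms(3) by simp
  next
    case (Mark i)
    then obtain x where "f = [x]" using z by (auto simp: length_0_1_2)
    then show ?thesis using assms(2,3) z Mark nf[of 0] by (auto simp: del_ok_def split: if_splits)
  qed
qed

lemma flag_ok_dl:
  assumes "offset l + ins l \<le> length z" "del_ok l (map fst (inputs l z)) (map fst g)"
    and "dl l (map fst z) (map fst g) = [l']" "flag_ok l (map snd (inputs l z)) (map snd g)"
  shows "flag_ok l' (keep (inputs l z)) (keep g)"
proof -
  obtain z1 f z3 where z: "z = z1 @ f @ z3" "length z1 = offset l" "length f = ins l" "inputs l z = f"
    "\<And>g. update l g z = z1 @ g @ z3" using row_split[OF assms(1)] by metis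
  have nf: "(map fst z) ! (offset l + q) = fst (f ! q)" if "q < ins l" for q
    using z that by (simp add: nth_append)
  have g: "length g = outs l" using assms(2) by (auto simp: del_ok_def link_ok_def)
  show ?thesis
  proof (cases l)
    case (Cup i)
    then obtain x y where "g = [x, y]" using g by (auto simp: length_0_1_2 numeral_2_eq_2)
    then show ?thesis using assms(2,3,4) z Cup
      by (auto simp: flag_ok_def del_ok_def link_ok_def keep_Cons split: if_splits)
  next
    case (Cap i)
    then obtain x y where "f = [x, y]" using z by (auto simp: length_0_1_2 numeral_2_eq_2)
    then show ?thesis using assms(2,3,4) z Cap g nf[of 0]
      by (auto simp: flag_ok_def del_ok_def link_ok_def keep_Cons split: if_splits)
  next
    case (Cross c i)
    then obtain x y where "f = [x, y]" using z by (auto simp: length_0_1_2 numeral_2_eq_2)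
    moreover obtain p q where "g = [p, q]" using g Cross by (auto simp: length_0_1_2 numeral_2_eq_2)
    ultimately show ?thesis using assms(2,3,4) z Cross nf[of 0] nf[of 1]
      by (auto simp: flag_ok_def del_ok_def link_ok_def keep_Cons split: if_splits)
  next
    case (Vertex i m n)
    then show ?thesis using assms(3) z g by (auto simp: flag_ok_def link_ok_def length_keep)
  next
    case (Mark i)
    then obtain x where "f = [x]" using z by (auto simp: length_0_1_2)
    moreover obtain p where "g = [p]" using g Mark by (auto simp: length_0_1_2)
    ultimately show ?thesis using assms(2,3,4) z Mark nf[of 0]
      by (auto simp: flag_ok_def del_ok_def link_ok_def keep_Cons split: if_splits)
  qed
qed

text \<open>
  The labelling is extended by \<open>False\<close> on the deleted strands.
\<close>

lemma flag_ok_fill: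
  assumes "offset l + ins l \<le> length z" "del_ok l (map fst (inputs l z)) (map fst g)"
    and T: "\<And>x. (True, x) \<in> set z \<Longrightarrow> \<not> x" "\<And>x. (True, x) \<in> set g \<Longrightarrow> \<not> x"
    and "\<And>l'. dl l (map fst z) (map fst g) = [l'] \<Longrightarrow> flag_ok l' (keep (inputs l z)) (keep g)"
    and "dl l (map fst z) (map fst g) = [] \<Longrightarrow> keep g = keep (inputs l z)"
  shows "flag_ok l (map snd (inputs l z)) (map snd g)"
proof -
  obtain z1 f z3 where z: "z = z1 @ f @ z3" "length z1 = offset l" "length f = ins l" "inputs l z = f"
    "\<And>g. update l g z = z1 @ g @ z3" using row_split[OF assms(1)] by metis
  have nf: "(map fst z) ! (offset l + q) = fst (f ! q)" if "q < ins l" for q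
    using z that by (simp add: nth_append)
  have g: "length g = outs l" using assms(2) by (auto simp: del_ok_def link_ok_def)
  have Tf: "fst x \<Longrightarrow> \<not> snd x" if "x \<in> set f" for x using T(1)[of "snd x"] that z(1) by (cases x) auto
  have Tg: "fst x \<Longrightarrow> \<not> snd x" if "x \<in> set g" for x using T(2)[of "snd x"] that by (cases x) auto
  show ?thesis
  proof (cases l)
    case (Cup i)
    then obtain x y where "g = [x, y]" using g by (auto simp: length_0_1_2 numeral_2_eq_2)
    moreover from this have "fst x \<Longrightarrow> \<not> snd x" "fst y \<Longrightarrow> \<not> snd y" using Tg[of x] Tg[of y] by auto
    ultimately show ?thesis using assms(2,5,6) z Cup
      by (auto simp: flag_ok_def del_ok_def link_ok_def keep_Cons split: if_splits)
  next
    case (Cap i)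
    then obtain x y where "f = [x, y]" using z by (auto simp: length_0_1_2 numeral_2_eq_2)
    moreover from this have "fst x \<Longrightarrow> \<not> snd x" "fst y \<Longrightarrow> \<not> snd y" using Tf[of x] Tf[of y] by auto
    ultimately show ?thesis using assms(2,5,6) z Cap g nf[of 0]
      by (auto simp: flag_ok_def del_ok_def link_ok_def keep_Cons split: if_splits)
  next
    case (Cross c i)
    then obtain x y where "f = [x, y]" using z by (auto simp: length_0_1_2 numeral_2_eq_2)
    moreover obtain p q where "g = [p, q]" using g Cross by (auto simp: length_0_1_2 numeral_2_eq_2)
    moreover have "fst x \<Longrightarrow> \<not> snd x" "fst y \<Longrightarrow> \<not> snd y" "fst p \<Longrightarrow> \<not> snd p" "fst q \<Longrightarrow> \<not> snd q"
      using Tf[of x] Tf[of y] Tg[of p] Tg[of q] calculation by auto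
    ultimately show ?thesis using assms(2,5,6) z Cross nf[of 0] nf[of 1]
      by (auto simp: flag_ok_def del_ok_def link_ok_def keep_Cons split: if_splits)
  next
    case (Vertex i m n)
    then show ?thesis using g by (auto simp: flag_ok_def link_ok_def)
  next
    case (Mark i)
    then obtain x where "f = [x]" using z by (auto simp: length_0_1_2)
    moreover obtain p where "g = [p]" using g Mark by (auto simp: length_0_1_2)
    ultimately show ?thesis using assms(2,5,6) z Mark nf[of 0]
      by (auto simp: flag_ok_def del_ok_def link_ok_def keep_Cons split: if_splits)
  qed
qed

abbreviation fsts :: "(layer \<times> ('a \<times> 'b) list) list \<Rightarrow> (layer \<times> 'a list) list" where
  "fsts \<equiv> map (apsnd (map fst))"
abbreviation snds :: "(layer \<times> ('a \<times> 'b) list) list \<Rightarrow> (layer \<times> 'b list) list" where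
  "snds \<equiv> map (apsnd (map snd))"

lemma map_fst_del: "map fst (del z A) = dels (map fst z) (fsts A)"
  by (induction z A rule: del.induct) (simp_all add: map_update comp_def)

definition flagged_del_ok :: "layer \<Rightarrow> (bool \<times> bool) list \<Rightarrow> (bool \<times> bool) list \<Rightarrow> bool" where
  "flagged_del_ok l f g \<longleftrightarrow> del_ok l (map fst f) (map fst g) \<and> flag_ok l (map snd f) (map snd g)"

lemma keep_linked:
  assumes "offset l + ins l \<le> length z" "del_ok l (map fst (inputs l z)) (map fst g)"
    and "dl l (map fst z) (map fst g) = []" "linked l (map snd (inputs l z)) (map snd g)"
  shows "keep g = keep (inputs l z)"
proof -
  obtain z1 f z3 where z: "z = z1 @ f @ z3" "length z1 = offset l" "length f = ins l" "inputs l z = f"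
    using row_split[OF assms(1)] by metis
  have nf: "(map fst z) ! (offset l + q) = fst (f ! q)" if "q < ins l" for q
    using z that by (simp add: nth_append)
  have g: "length g = outs l" using assms(2) by (auto simp: del_ok_def link_ok_def)
  show ?thesis
  proof (cases l)
    case (Cup i)
    then obtain x y where "g = [x, y]" using g by (auto simp: length_0_1_2 numeral_2_eq_2)
    then show ?thesis using assms(2,3,4) z Cup by (auto simp: del_ok_def link_ok_def keep_Cons split: if_splits)
  next
    case (Cap i)
    then obtain x y where "f = [x, y]" using z by (auto simp: length_0_1_2 numeral_2_eq_2)
    then show ?thesis using assms(2,3,4) z Cap g nf[of 0] by (auto simp: del_ok_def link_ok_def keep_Cons split: if_splits)
  next
    case (Cross c i)
    then obtain x y where "f = [x, y]" using z by (auto simp: length_0_1_2 numeral_2_eq_2)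
    moreover obtain p q where "g = [p, q]" using g Cross by (auto simp: length_0_1_2 numeral_2_eq_2)
    ultimately show ?thesis using assms(2,3,4) z Cross nf[of 0] nf[of 1]
      by (auto simp: del_ok_def link_ok_def keep_Cons split: if_splits)
  next
    case (Vertex i m n)
    then show ?thesis using assms(3) by simp
  next
    case (Mark i)
    then obtain x where "f = [x]" using z by (auto simp: length_0_1_2)
    then show ?thesis using assms(2,3) z Mark nf[of 0] by (auto simp: del_ok_def split: if_splits)
  qed
qed

lemma del_flag_ok:
  "\<lbrakk>along flagged_del_ok z A; fits (length z) (map fst A)\<rbrakk> \<Longrightarrow>
    along flag_ok (keep z) (del z A) \<and> fits (length (keep z)) (map fst (del z A)) \<and> run (keep z) (del z A) = keep (run z A)"
proof (induction z A rule: del.induct)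
  case (2 z l g A)
  have ok: "del_ok l (map fst (inputs l z)) (map fst g)" "flag_ok l (map snd (inputs l z)) (map snd g)"
    and le: "offset l + ins l \<le> length z" using 2 by (auto simp: flagged_del_ok_def)
  have g: "length g = outs l" using ok by (auto simp: flag_ok_def link_ok_def)
  have IH: "along flag_ok (keep (update l g z)) (del (update l g z) A) \<and>
     fits (length (keep (update l g z))) (map fst (del (update l g z) A)) \<and> run (keep (update l g z)) (del (update l g z) A) = keep (run (update l g z) A)"
    using 2 g le by (simp add: length_update)
  consider "dl l (map fst z) (map fst g) = []" | l' where "dl l (map fst z) (map fst g) = [l']" using dl_cases by blast
  then show ?case
  proof cases
    case 1
    have "keep (update l g z) = keep z"
      using dl_none[OF le keep_linked[OF le ok(1) 1]] ok(2) by (simp add: flag_ok_def link_ok_def)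
    then show ?thesis using IH 1 by simp
  next
    case (2 l')
    note D = dl_one[OF le ok(1) 2]
    have "length (keep z) - ins l' + outs l' = length (keep (update l g z))"
      using D length_update[of l' "keep z" "keep g"] by simp
    then show ?thesis
      using D IH flag_ok_dl[OF le ok(1) 2 ok(2)] by (simp add: 2)
  qed
qed simp

lemma del_clear:
  "\<lbrakk>along flagged_del_ok z A; fits (length z) (map fst A); along clear (map snd z) (snds A)\<rbrakk> \<Longrightarrow>
    along clear (keep z) (del z A)"
proof (induction z A rule: del.induct)
  case (2 z l g A)
  have ok: "del_ok l (map fst (inputs l z)) (map fst g)" "flag_ok l (map snd (inputs l z)) (map snd g)"
    and cl: "clear l (map snd (inputs l z)) (map snd g)"
    and le: "offset l + ins l \<le> length z" using 2 by (auto simp: flagged_del_ok_def map_inputs)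
  have g: "length g = outs l" using ok by (auto simp: flag_ok_def link_ok_def)
  have IH: "along clear (keep (update l g z)) (del (update l g z) A)"
    using 2 g le by (simp add: length_update map_update)
  consider "dl l (map fst z) (map fst g) = []" | l' where "dl l (map fst z) (map fst g) = [l']" using dl_cases by blast
  then show ?case
  proof cases
    case 1
    have "keep (update l g z) = keep z"
      using dl_none[OF le keep_linked[OF le ok(1) 1]] ok(2) by (simp add: flag_ok_def link_ok_def)
    then show ?thesis using IH 1 by simp
  next
    case (2 l')
    note D = dl_one[OF le ok(1) 2]
    have "clear l' (keep (inputs l z)) (keep g)"
    proof (cases l)
      case (Cross c i)
      obtain x y where xy: "inputs l z = [x, y]" using inputs_2[of l z] le Cross by auto
      have "fst x = map fst z ! i" "fst y = map fst z ! Suc i"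
        using xy inputs_2[of l z] le Cross by auto
      then show ?thesis
        using 2 cl Cross xy by (auto simp: clear_def keep_Cons split: if_splits)
    qed (use 2 in \<open>auto simp: clear_def split: if_splits\<close>)
    then show ?thesis using D IH by (simp add: 2)
  qed
qed simp

fun zip_words :: "(layer \<times> 'a list) list \<Rightarrow> (layer \<times> 'b list) list \<Rightarrow> (layer \<times> ('a \<times> 'b) list) list" where
  "zip_words ((l, s) # A) ((l', g) # C) = (l, zip s g) # zip_words A C"
| "zip_words _ _ = []"

lemma zip_words_annot: "zip_words (annot r t w) (annot m t w) = annot (\<lambda>Q. (r Q, m Q)) t w"
  by (induction w arbitrary: t) (auto simp: zip_map_map map_zip_map zip_same_conv_map)

text \<open>
  A labelling of the diagram after the deletion extends by \<open>False\<close> to one of the diagram before. With minimality of the marks it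
  follows that the deletion does not change the marks of the remaining edges.
\<close>

lemma lift_flags:
  "\<lbrakk>along del_ok s A; fits (length s) (map fst A); length k = kept s; map fst B = dels s A; along flag_ok k B\<rbrakk> \<Longrightarrow>
   \<exists>C. map fst C = map fst A \<and> along flag_ok (fill False s k) C \<and> del (zip s (fill False s k)) (zip_words A C) = B"
proof (induction A arbitrary: s k B)
  case Nil
  then show ?case by (intro exI[of _ "[]"]) auto
next
  case (Cons x A)
  obtain l g where x: "x = (l, g)" by (cases x)
  define z where "z = zip s (fill False s k)"
  have fz: "map fst z = s" and sz: "map snd z = fill False s k" and kz: "keep z = k" and lz: "length z = length s"
    using keep_zip_fill[OF Cons.prems(3)] by (simp_all add: z_def)
  have iz: "map fst (inputs l z) = inputs l s" by (simp add: map_inputs fz)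
  have le: "offset l + ins l \<le> length z" and ok: "del_ok l (map fst (inputs l z)) g"
    using Cons.prems x lz iz by auto
  have g: "length g = outs l" using ok by (simp add: del_ok_def link_ok_def)
  have Tz: "\<not> y" if "(True, y) \<in> set z" for y using fill_True[of y s False k] that by (auto simp: z_def)
  have upds: "length (update l g s) = length s - ins l + outs l"
    using le lz g by (simp add: length_update)
  have main: "\<exists>C. map fst C = map fst (x # A) \<and> along flag_ok (fill False s k) C \<and> del z (zip_words (x # A) C) = B"
    if h: "length h = kept g" and B: "B = map (\<lambda>l'. (l', h)) (dl l s g) @ B1"
      and B1: "map fst B1 = dels (update l g s) A" "along flag_ok (keep (update l (zip g (fill False g h)) z)) B1"
      and f1: "\<And>l'. dl l s g = [l'] \<Longrightarrow> flag_ok l' (keep (inputs l z)) h"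
      and f0: "dl l s g = [] \<Longrightarrow> h = keep (inputs l z)" for h B1
  proof -
    define zg where "zg = zip g (fill False g h)"
    have zg: "map fst zg = g" "map snd zg = fill False g h" "keep zg = h"
      using keep_zip_fill[OF h] by (simp_all add: zg_def)
    have Tg: "\<not> y" if "(True, y) \<in> set zg" for y using fill_True[of y g False h] that by (auto simp: zg_def)
    have fo: "flag_ok l (map snd (inputs l z)) (map snd zg)"
      by (rule flag_ok_fill[OF le]) (use ok Tz Tg f1 f0 in \<open>auto simp: fz zg\<close>)
    define z' where "z' = update l zg z"
    have Tz': "\<not> y" if "(True, y) \<in> set z'" for y
      using that Tz Tg by (auto simp: z'_def update_def dest: in_set_takeD in_set_dropD)
    have fz': "map fst z' = update l g s" by (simp add: z'_def map_update fz zg)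
    have "fill False (update l g s) (keep z') = map snd z'"
      using fill_keep[of z' False] Tz' fz' by auto
    then have sz': "fill False (update l g s) (keep z') = update l (fill False g h) (fill False s k)"
      by (simp add: z'_def map_update zg sz)
    have zz': "zip (update l g s) (fill False (update l g s) (keep z')) = z'"
      using \<open>fill False (update l g s) (keep z') = map snd z'\<close> fz' zip_map_fst_snd[of z'] by simp
    have "\<exists>C. map fst C = map fst A \<and> along flag_ok (fill False (update l g s) (keep z')) C \<and>
       del (zip (update l g s) (fill False (update l g s) (keep z'))) (zip_words A C) = B1"
    proof (rule Cons.IH)
      show "along del_ok (update l g s) A" using Cons.prems x by simp
      show "fits (length (update l g s)) (map fst A)" using Cons.prems(2) unfolding x upds
        by (simp only: fits.simps list.map fst_conv)
      show "length (keep z') = kept (update l g s)" by (simp add: length_keep fz')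
      show "map fst B1 = dels (update l g s) A" by (rule B1)
      show "along flag_ok (keep z') B1" using B1(2) by (simp add: z'_def zg_def)
    qed
    then obtain C where C: "map fst C = map fst A" "along flag_ok (update l (fill False g h) (fill False s k)) C"
      "del z' (zip_words A C) = B1"
      unfolding zz' unfolding sz' by (elim exE conjE)
    have "along flag_ok (fill False s k) ((l, fill False g h) # C)"
      using C(2) fo by (simp only: along.simps map_inputs sz zg(2) simp_thms)
    moreover have "del z (zip_words (x # A) ((l, fill False g h) # C)) = B"
      by (simp only: x zip_words.simps del.simps zg_def[symmetric] fz zg(1,3) z'_def[symmetric] C(3) B)
    ultimately show ?thesis
      using C(1) x by (intro exI[of _ "(l, fill False g h) # C"]) simp
  qed
  consider "dl l s g = []" | l' where "dl l s g = [l']" using dl_cases by blast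
  then have "\<exists>C. map fst C = map fst (x # A) \<and> along flag_ok (fill False s k) C \<and> del z (zip_words (x # A) C) = B"
  proof cases
    case 1
    have kg: "length (keep (inputs l z)) = kept g"
      using dl_none_kept[of l s g] le lz ok 1 by (simp add: length_keep iz)
    have "keep (update l (zip g (fill False g (keep (inputs l z)))) z) = keep z"
      by (rule dl_none[OF le]) (simp add: keep_zip_fill kg)
    then show ?thesis
      using main[of "keep (inputs l z)" B] kg 1 Cons.prems x kz by simp
  next
    case (2 l')
    then obtain h B1 where B: "B = (l', h) # B1" "map fst B1 = dels (update l g s) A"
      using Cons.prems(4) x by auto
    have D: "inputs l' (keep z) = keep (inputs l z) \<and> update l' (keep (zip g y)) (keep z) = keep (update l (zip g y) z)
       \<and> outs l' = length (keep (zip g y))" if "length y = length g" for y :: "bool list"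
      using dl_one[OF le, of "zip g y" l'] ok 2 that by (simp add: fz)
    have "outs l' = kept g" using D[of g] by (simp add: length_keep)
    then have h: "length h = kept g" using Cons.prems(5) B by (simp add: flag_ok_def link_ok_def)
    have D': "inputs l' k = keep (inputs l z)" "update l' h k = keep (update l (zip g (fill False g h)) z)"
      using D[of "fill False g h"] kz h by (simp_all add: keep_zip_fill)
    show ?thesis
      by (rule main[of h B1]) (use h B 2 Cons.prems(5) D' in auto)
  qed
  then show ?case by (simp add: z_def)
qed

lemma below_del:
  "\<lbrakk>below C C'; map fst C = map fst A; list_all2 (\<lambda>x y. length (snd x) = length (snd y)) A C; length a = length s; length a' = length s\<rbrakk> \<Longrightarrow>
    below (del (zip s a) (zip_words A C)) (del (zip s a') (zip_words A C'))"
proof (induction A arbitrary: C C' s a a')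
  case Nil
  then show ?case by (simp add: below_def)
next
  case (Cons x A)
  obtain l g where x: "x = (l, g)" by (cases x)
  obtain h C1 where C: "C = (l, h) # C1" using Cons.prems(2) x by (cases C) auto
  obtain h' C1' where C': "C' = (l, h') # C1'" using Cons.prems(1) C by (cases C') auto
  have len: "length h = length g" "length h' = length g"
    using Cons.prems(1,3) C C' x by (auto dest: list_all2_lengthD)
  have hh: "list_all2 (\<longrightarrow>) h h'" using Cons.prems C C' by simp
  have kk: "list_all2 (\<longrightarrow>) (keep (zip g h)) (keep (zip g h'))"
    using hh len
  proof (induction g arbitrary: h h')
    case (Cons b g)
    then obtain y h1 y' h1' where "h = y # h1" "h' = y' # h1'" by (cases h; cases h') auto
    with Cons show ?case by (cases b) auto
  qed simp
  have u: "update l (zip g h) (zip s a) = zip (update l g s) (update l h a)"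
    "update l (zip g h') (zip s a') = zip (update l g s) (update l h' a')"
    using len Cons.prems(4,5) by (simp_all add: update_def take_zip drop_zip)
  have lu: "length (update l h a) = length (update l g s)" "length (update l h' a') = length (update l g s)"
    using len Cons.prems(4,5) by (simp_all add: update_def)
  have IH: "below (del (zip (update l g s) (update l h a)) (zip_words A C1)) (del (zip (update l g s) (update l h' a')) (zip_words A C1'))"
    using Cons.prems lu by (intro Cons.IH) (auto simp: C C' x)
  have fz: "map fst (zip s a) = s" "map fst (zip s a') = s" "map fst (zip g h) = g" "map fst (zip g h') = g"
    using len Cons.prems by simp_all
  consider "dl l s g = []" | l' where "dl l s g = [l']" using dl_cases by blast
  then show ?case
    using IH kk by cases (simp_all add: x C C' fz u)
qed

definition hits :: "layer \<Rightarrow> (bool \<times> 'a) list \<Rightarrow> (bool \<times> 'a) list \<Rightarrow> nat" where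
  "hits l f g = (if \<exists>i m n. l = Vertex i m n then length (filter fst f) + length (filter fst g) else 0)"

text \<open>
  The number of half-edges at vertices that belong to the deleted strands.
\<close>

fun total_hits :: "(bool \<times> 'a) list \<Rightarrow> (layer \<times> (bool \<times> 'a) list) list \<Rightarrow> nat" where
  "total_hits z [] = 0"
| "total_hits z ((l, g) # A) = hits l (inputs l z) g + total_hits (update l g z) A"

lemma length_filter_fst: "length (filter fst w) = length (filter (\<lambda>x. x) (map fst w))"
  by (induction w) auto

lemma total_hits_nth: "total_hits z A = (\<Sum>t<length A. hits (fst (A ! t)) (inputs (fst (A ! t)) (run z (take t A))) (snd (A ! t)))"
  by (induction z A rule: total_hits.induct) (simp_all add: sum.lessThan_Suc_shift del: sum.lessThan_Suc)

context colour_model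
begin

lemma tr_keep: "(\<And>x. (True, x) \<in> set w \<Longrightarrow> x = e) \<Longrightarrow> tr (map snd w @ u) = \<kappa> ^ length (filter fst w) * tr (keep w @ u)"
proof (induction w arbitrary: u)
  case (Cons y w)
  obtain b x where y: "y = (b, x)" by (cases y)
  show ?case
  proof (cases b)
    case True
    then have "x = e" using Cons.prems y by auto
    moreover have "tr (map snd w @ u) = \<kappa> ^ length (filter fst w) * tr (keep w @ u)"
      by (rule Cons.IH) (use Cons.prems in auto)
    ultimately show ?thesis using True by (simp add: y tr_unit)
  next
    case False
    then show ?thesis
      using Cons.IH[of "u @ [x]"] Cons.prems tr_move[of x "map snd w @ u"] tr_move[of x "keep w @ u"] by (simp add: y)
  qed
qed simp

text \<open>
  The element \<open>e\<close> is a multiple of the unit: it can be removed from the trace of a vertex at the cost of a factor, and at the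
  other layers it is passed on.
\<close>

lemma tau_dl:
  assumes "offset l + ins l \<le> length z" "del_ok l (map fst (inputs l z)) (map fst g)"
    and T: "\<And>x. (True, x) \<in> set z \<Longrightarrow> x = e" "\<And>x. (True, x) \<in> set g \<Longrightarrow> x = e"
  shows "tau l (map snd (inputs l z)) (map snd g) = \<kappa> ^ hits l (inputs l z) g *
    (case dl l (map fst z) (map fst g) of [] \<Rightarrow> of_bool (keep g = keep (inputs l z)) | l' # _ \<Rightarrow> tau l' (keep (inputs l z)) (keep g))"
proof -
  obtain z1 f z3 where z: "z = z1 @ f @ z3" "length z1 = offset l" "length f = ins l" "inputs l z = f"
    using row_split[OF assms(1)] by metis
  have nf: "(map fst z) ! (offset l + q) = fst (f ! q)" if "q < ins l" for q
    using z that by (simp add: nth_append)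
  have g: "length g = outs l" using assms(2) by (auto simp: del_ok_def link_ok_def)
  have Tf: "fst x \<Longrightarrow> snd x = e" if "x \<in> set f" for x using T(1)[of "snd x"] that z(1) by (cases x) auto
  have Tg: "fst x \<Longrightarrow> snd x = e" if "x \<in> set g" for x using T(2)[of "snd x"] that by (cases x) auto
  show ?thesis
    unfolding z(4)
  proof (cases l)
    case (Cup i)
    then obtain x y where xy: "g = [x, y]" using g by (auto simp: length_0_1_2 numeral_2_eq_2)
    then have "fst x \<Longrightarrow> snd x = e" "fst y \<Longrightarrow> snd y = e" using Tg[of x] Tg[of y] by auto
    then show "tau l (map snd f) (map snd g) = \<kappa> ^ hits l f g *
      (case dl l (map fst z) (map fst g) of [] \<Rightarrow> of_bool (keep g = keep f) | l' # _ \<Rightarrow> tau l' (keep f) (keep g))"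
      using assms(2) xy z Cup by (auto simp: del_ok_def link_ok_def keep_Cons hits_def)
  next
    case (Cap i)
    then obtain x y where xy: "f = [x, y]" using z by (auto simp: length_0_1_2 numeral_2_eq_2)
    then have "fst x \<Longrightarrow> snd x = e" "fst y \<Longrightarrow> snd y = e" using Tf[of x] Tf[of y] by auto
    then show "tau l (map snd f) (map snd g) = \<kappa> ^ hits l f g *
      (case dl l (map fst z) (map fst g) of [] \<Rightarrow> of_bool (keep g = keep f) | l' # _ \<Rightarrow> tau l' (keep f) (keep g))"
      using assms(2) xy z Cap g nf[of 0] by (auto simp: del_ok_def link_ok_def keep_Cons hits_def)
  next
    case (Cross c i)
    then obtain x y where xy: "f = [x, y]" using z by (auto simp: length_0_1_2 numeral_2_eq_2)
    obtain p q where pq: "g = [p, q]" using g Cross by (auto simp: length_0_1_2 numeral_2_eq_2)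
    have "fst x \<Longrightarrow> snd x = e" "fst y \<Longrightarrow> snd y = e" "fst p \<Longrightarrow> snd p = e" "fst q \<Longrightarrow> snd q = e"
      using Tf[of x] Tf[of y] Tg[of p] Tg[of q] xy pq by auto
    then show "tau l (map snd f) (map snd g) = \<kappa> ^ hits l f g *
      (case dl l (map fst z) (map fst g) of [] \<Rightarrow> of_bool (keep g = keep f) | l' # _ \<Rightarrow> tau l' (keep f) (keep g))"
      using assms(2) xy pq z Cross g nf[of 0] nf[of 1] by (auto simp: del_ok_def link_ok_def keep_Cons hits_def)
  next
    case (Vertex i m n)
    have "tr (map snd f @ rev (map snd g)) = \<kappa> ^ length (filter fst f) * tr (keep f @ rev (map snd g))"
      by (rule tr_keep) (use T z(1) in auto)
    also have "tr (keep f @ rev (map snd g)) = tr (map snd (rev g) @ keep f)"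
      by (simp add: rev_map tr_rotate)
    also have "\<dots> = \<kappa> ^ length (filter fst (rev g)) * tr (keep (rev g) @ keep f)"
      by (rule tr_keep) (use T in auto)
    also have "keep (rev g) = rev (keep g)" by (simp add: keep_def rev_map rev_filter[symmetric] del: rev_filter)
    finally show "tau l (map snd f) (map snd g) = \<kappa> ^ hits l f g *
      (case dl l (map fst z) (map fst g) of [] \<Rightarrow> of_bool (keep g = keep f) | l' # _ \<Rightarrow> tau l' (keep f) (keep g))"
      using tr_rotate[of "rev (keep g)" "keep f"]
      by (simp add: Vertex hits_def power_add rev_filter[symmetric] del: rev_filter)
  next
    case (Mark i)
    then obtain x where xy: "f = [x]" using z by (auto simp: length_0_1_2)
    obtain p where pq: "g = [p]" using g Mark by (auto simp: length_0_1_2)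
    show "tau l (map snd f) (map snd g) = \<kappa> ^ hits l f g *
      (case dl l (map fst z) (map fst g) of [] \<Rightarrow> of_bool (keep g = keep f) | l' # _ \<Rightarrow> tau l' (keep f) (keep g))"
      using assms(2) xy pq z Mark g nf[of 0] by (auto simp: del_ok_def link_ok_def keep_Cons hits_def)
  qed
qed

definition deleted_range :: "bool \<times> bool \<Rightarrow> 'c set" where
  "deleted_range x = (if fst x then {e} else range_of (snd x))"

lemma deleted_range_simps [simp]: "deleted_range (True, m) = {e}" "deleted_range (False, m) = range_of m"
  by (simp_all add: deleted_range_def)

lemma sum_fill:
  "(\<Sum>b\<in>selections (map deleted_range g). \<phi> b) = (\<Sum>b\<in>colours (keep g). \<phi> (fill e (map fst g) b))"
proof (induction g arbitrary: \<phi>)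
  case Nil
  then show ?case by (simp add: selections_Nil colours_Nil)
next
  case (Cons x g)
  have C: "(\<Sum>b\<in>selections (Y # Ys). \<psi> b) = (\<Sum>y\<in>Y. \<Sum>b\<in>selections Ys. \<psi> (y # b))" for Y :: "'c set" and Ys \<psi>
    unfolding selections_Cons by (subst sum.reindex) (auto simp: inj_on_def sum.cartesian_product case_prod_beta)
  obtain m y where x: "x = (m, y)" by (cases x)
  show ?case
    by (cases m) (simp_all add: x C Cons.IH colours_selections)
qed

lemma amp_delete:
  "\<lbrakk>along flagged_del_ok a A; fits (length a) (map fst A); c \<in> colours (keep a)\<rbrakk> \<Longrightarrow>
    amp_sets (map (\<lambda>(l, g). (l, map deleted_range g)) A) (\<lambda>_. 1) (fill e (map fst a) c)
      = \<kappa> ^ total_hits a A * amp (del a A) (\<lambda>_. 1) c"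
proof (induction A arbitrary: a c)
  case (Cons x A)
  obtain l g where x: "x = (l, g)" by (cases x)
  have "flagged_del_ok l (inputs l a) g" and A: "along flagged_del_ok (update l g a) A"
    and le: "offset l + ins l \<le> length a" using Cons.prems by (simp_all add: x)
  then have ok: "del_ok l (map fst (inputs l a)) (map fst g)" "flag_ok l (map snd (inputs l a)) (map snd g)"
    by (simp_all add: flagged_del_ok_def)
  have g: "length g = outs l" using ok by (auto simp: flag_ok_def link_ok_def)
  define s where "s = map fst a"
  define gs where "gs = map fst g"
  define za where "za = zip s (fill e s c)"
  define zg where "zg = (\<lambda>b. zip gs (fill e gs b))"
  have lc: "length c = kept s" using colours_length[OF Cons.prems(3)] by (simp add: length_keep s_def)
  have za: "map fst za = s" "map snd za = fill e s c" "keep za = c" "length za = length a"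
    using keep_zip_fill[OF lc] by (simp_all add: za_def s_def)
  have Ta: "y = e" if "(True, y) \<in> set za" for y using fill_True[of y s e c] that by (simp add: za_def)
  have lez: "offset l + ins l \<le> length za" using le za by simp
  have iz: "map fst (inputs l za) = map fst (inputs l a)" by (simp add: map_inputs za(1)) (simp add: s_def)
  have zg: "map fst (zg b) = gs" "map snd (zg b) = fill e gs b" "\<And>y. (True, y) \<in> set (zg b) \<Longrightarrow> y = e" for b
    using fill_True[of _ gs e b] by (simp_all add: zg_def)
  have kg: "keep (zg b) = b" if "b \<in> colours (keep g)" for b
    using colours_length[OF that] by (simp add: zg_def keep_zip_fill length_keep gs_def)
  have hits: "hits l (inputs l za) (zg b) = hits l (inputs l a) g" for b
  proof -
    have "length (filter fst (inputs l za)) = length (filter fst (inputs l a))"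
      "length (filter fst (zg b)) = length (filter fst g)"
      unfolding length_filter_fst iz zg(1) by (simp_all add: gs_def)
    then show ?thesis unfolding hits_def by simp
  qed
  have okz: "del_ok l (map fst (inputs l za)) (map fst (zg b))" for b using ok by (simp add: iz zg gs_def)
  have T: "tau l (inputs l (fill e s c)) (fill e gs b) = \<kappa> ^ hits l (inputs l a) g *
     (case dl l s gs of [] \<Rightarrow> of_bool (b = keep (inputs l za)) | l' # _ \<Rightarrow> tau l' (keep (inputs l za)) b)"
    if "b \<in> colours (keep g)" for b
  proof -
    have TG: "\<And>y. (True, y) \<in> set (zg b) \<Longrightarrow> y = e" by (rule zg(3))
    show ?thesis
      using tau_dl[OF lez okz[of b] Ta TG] unfolding kg[OF that] by (simp add: za zg hits map_inputs)
  qed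
  have U: "update l (fill e gs b) (fill e s c) = fill e (map fst (update l g a)) (keep (update l (zg b) za))" for b
  proof -
    have "y = e" if "(True, y) \<in> set (update l (zg b) za)" for y
      using that Ta zg(3) by (auto simp: update_def dest: in_set_takeD in_set_dropD)
    from fill_keep[of "update l (zg b) za" e, OF this] show ?thesis
      by (simp add: map_update za zg) (simp add: s_def gs_def)
  qed
  have fitsA: "fits (length (update l g a)) (map fst A)"
    using Cons.prems(2) length_update[OF le, of g] g unfolding x by (simp only: fits.simps list.map fst_conv)
  have IH: "amp_sets (map (\<lambda>(l, g). (l, map deleted_range g)) A) (\<lambda>_. 1) (fill e (map fst (update l g a)) c')
      = \<kappa> ^ total_hits (update l g a) A * amp (del (update l g a) A) (\<lambda>_. 1) c'"
    if "c' \<in> colours (keep (update l g a))" for c'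
    by (rule Cons.IH[OF A fitsA that])
  have "amp_sets (map (\<lambda>(l, g). (l, map deleted_range g)) (x # A)) (\<lambda>_. 1) (fill e s c)
    = (\<Sum>b\<in>colours (keep g). tau l (inputs l (fill e s c)) (fill e gs b) *
        amp_sets (map (\<lambda>(l, g). (l, map deleted_range g)) A) (\<lambda>_. 1) (update l (fill e gs b) (fill e s c)))"
    by (simp add: x sum_fill gs_def)
  also have "\<dots> = (\<Sum>b\<in>colours (keep g). \<kappa> ^ hits l (inputs l a) g *
     (case dl l s gs of [] \<Rightarrow> of_bool (b = keep (inputs l za)) | l' # _ \<Rightarrow> tau l' (keep (inputs l za)) b) *
        amp_sets (map (\<lambda>(l, g). (l, map deleted_range g)) A) (\<lambda>_. 1) (fill e (map fst (update l g a)) (keep (update l (zg b) za))))"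
    by (intro sum.cong refl) (simp only: T U)
  also have "\<dots> = \<kappa> ^ total_hits a (x # A) * amp (del a (x # A)) (\<lambda>_. 1) c"
  proof -
    consider "dl l s gs = []" | l' where "dl l s gs = [l']" using dl_cases by blast
    then show ?thesis
    proof cases
      case 1
      then have D: "dl l (map fst a) (map fst g) = []" by (simp add: s_def gs_def)
      have kl: "keep g = keep (inputs l a)"
        using keep_linked[OF le ok(1) D] ok(2) by (simp add: flag_ok_def link_ok_def)
      have ku: "keep (update l g a) = keep a" by (rule dl_none[OF le kl])
      have mem: "keep (inputs l za) \<in> colours (keep g)"
      proof -
        obtain a1 a2 a3 where a: "a = a1 @ a2 @ a3" "length a1 = offset l" "length a2 = ins l" "inputs l a = a2"
          using row_split[OF le] by metis
        obtain z1 z2 z3 where z: "za = z1 @ z2 @ z3" "length z1 = offset l" "length z2 = ins l" "inputs l za = z2"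
          using row_split[OF lez] by metis
        have m: "map fst z1 = map fst a1" "map fst z2 = map fst a2"
          using za(1) a z unfolding s_def by (auto simp: append_eq_append_conv)
        have "keep z1 @ keep z2 @ keep z3 \<in> colours (keep a1 @ keep a2 @ keep a3)"
          using Cons.prems(3) za(3) a(1) z(1) by simp
        then have "keep z2 \<in> colours (keep a2)"
          using m by (auto simp: colours_def list_all2_append length_keep)
        then show ?thesis unfolding kl a(4) z(4) .
      qed
      have kz: "keep (update l (zg (keep (inputs l za))) za) = c"
        using dl_none[OF lez, of "zg (keep (inputs l za))"] kg[OF mem] za by simp
      have fin: "finite (colours (keep g))"
        unfolding colours_selections by (rule finite_selections) (auto simp: range_of_def finite_B0)
      have "(\<Sum>b\<in>colours (keep g). \<kappa> ^ hits l (inputs l a) g * of_bool (b = keep (inputs l za)) *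
        amp_sets (map (\<lambda>(l, g). (l, map deleted_range g)) A) (\<lambda>_. 1) (fill e (map fst (update l g a)) (keep (update l (zg b) za))))
        = \<kappa> ^ hits l (inputs l a) g * amp_sets (map (\<lambda>(l, g). (l, map deleted_range g)) A) (\<lambda>_. 1) (fill e (map fst (update l g a)) c)"
        using mem fin by (subst sum.remove[OF fin mem]) (auto simp: kz intro!: sum.neutral)
      then show ?thesis
        using IH[of c] Cons.prems(3) D by (simp add: 1 ku x power_add mult.assoc)
    next
      case (2 l')
      then have D: "dl l (map fst a) (map fst g) = [l']" by (simp add: s_def gs_def)
      note D1 = dl_one[OF le ok(1) D]
      have D2: "inputs l' c = keep (inputs l za)" "keep (update l (zg b) za) = update l' b c"
        if "b \<in> colours (keep g)" for b
        using dl_one[OF lez okz[of b], of l'] 2 kg[OF that] by (simp_all add: za zg)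
      have mem: "update l' b c \<in> colours (keep (update l g a))" if "b \<in> colours (keep g)" for b
        using colours_update[OF Cons.prems(3) that, of l'] D1 by simp
      show ?thesis
        unfolding 2 by (simp add: x D sum_distrib_left power_add D2 IH[OF mem] mult_ac cong: sum.cong)
    qed
  qed
  finally show ?case by (simp add: s_def)
qed simp

end

lemma surviving_row:
  assumes "i + m \<le> n"
  shows "surviving S t {i..<i + m} = kept (take m (drop i (map (\<lambda>p. (t, p) \<in> S) [0..<n])))"
proof -
  have "take m (drop i (map (\<lambda>p. (t, p) \<in> S) [0..<n])) = map (\<lambda>p. (t, p) \<in> S) [i..<i + m]"
    using assms by (simp add: take_map drop_map)
  then have "kept (take m (drop i (map (\<lambda>p. (t, p) \<in> S) [0..<n]))) = length (filter (\<lambda>p. (t, p) \<notin> S) [i..<i + m])"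
    by (simp add: kept_def filter_map comp_def)
  also have "\<dots> = card (set (filter (\<lambda>p. (t, p) \<notin> S) [i..<i + m]))"
    by (rule distinct_card[symmetric]) simp
  finally show ?thesis
    by (simp add: surviving_def)
qed

lemma surviving_prefix:
  "i \<le> n \<Longrightarrow> surviving S t {..<i} = kept (take i (map (\<lambda>p. (t, p) \<in> S) [0..<n]))"
  using surviving_row[of 0 i n S t] by (simp add: lessThan_atLeast0)

lemma surviving_outputs:
  "surviving S t {i..<i + n} = kept (map (\<lambda>q. (t, i + q) \<in> S) [0..<n])"
proof -
  have "map (\<lambda>q. (t, i + q) \<in> S) [0..<n] = take n (drop i (map (\<lambda>p. (t, p) \<in> S) [0..<i + n]))"
    by (rule nth_equalityI) auto
  then show ?thesis using surviving_row[of i n "i + n" S t] by simp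
qed

lemma delete_layers_dels:
  assumes D: "fits 0 D" and r: "\<And>P Q. strand D P Q \<Longrightarrow> (P \<in> S) = (Q \<in> S)" and t: "t \<le> length D"
  shows "delete_layers S t (drop t D) = dels (row (\<lambda>Q. Q \<in> S) D t) (annot (\<lambda>Q. Q \<in> S) t (drop t D))"
  using t
proof (induction t rule: inc_induct)
  case base
  then show ?case by simp
next
  case (step t)
  let ?r = "\<lambda>Q. Q \<in> S"
  let ?l = "D ! t"
  have t: "t < length D" using step by simp
  have d: "drop t D = ?l # drop (Suc t) D" using t by (simp add: Cons_nth_drop_Suc)
  have le: "offset ?l + ins ?l \<le> width (take t D)" by (rule fits_layer[OF D t])
  have u: "update ?l (map (\<lambda>q. ?r (Suc t, offset ?l + q)) [0..<outs ?l]) (row ?r D t) = row ?r D (Suc t)"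
    using run_annot[OF D r, where t = "Suc t"] run_annot[OF D r, where t = t] t
    by (simp add: run_Suc annot_nth)
  have "delete_layer S t ?l = dl ?l (row ?r D t) (map (\<lambda>q. ?r (Suc t, offset ?l + q)) [0..<outs ?l])"
    using le
    by (cases ?l) (auto simp: row_def surviving_prefix[of _ "width (take t D)"] surviving_row[of _ _ "width (take t D)"] surviving_outputs[of S "Suc t"])
  then show ?case
    using step.IH by (simp add: d u)
qed

lemma annot_pair: "fsts (annot (\<lambda>Q. (r Q, m Q)) t w) = annot r t w" "snds (annot (\<lambda>Q. (r Q, m Q)) t w) = annot m t w"
  by (induction w arbitrary: t) auto

lemma run_map: "run (map h z) (map (apsnd (map h)) A) = map h (run z A)"
  by (induction z A rule: run.induct) (auto simp: map_update[symmetric])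

lemma along_map: "along Q (map h z) (map (apsnd (map h)) A) \<longleftrightarrow> along (\<lambda>l f g. Q l (map h f) (map h g)) z A"
  by (induction z A rule: run.induct) (auto simp: map_update[symmetric] map_inputs)

lemma edge_del_ok:
  assumes D: "marked_diagram D" and P: "\<not> marked D P" "\<not> carries_classical D P"
  defines "A \<equiv> annot (\<lambda>Q. (same_edge D P Q, marked D Q)) 0 D"
  shows "along flagged_del_ok [] A" "along clear [] (snds A)"
proof -
  have f: "fits 0 D" using D by (simp add: marked_diagram_def planar_word_iff)
  have S: "same_edge D P Q = same_edge D P Q'" if "strand D Q Q'" for Q Q' by (rule same_edge_strand[OF that])
  have sn: "snds A = flagged D" by (simp add: A_def annot_pair flagged_def)
  have 1: "along flag_ok (map snd []) (snds A)" unfolding sn using flagged_ok[OF f] by simp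
  show "along clear [] (snds A)" unfolding sn using D by (simp add: marked_diagram_clear)
  have "consistent (map fst []) (fsts A)"
    using consistent_annot[OF f S] by (simp add: A_def annot_pair)
  then have 2: "along (\<lambda>l f g. link_ok l (map fst f) (map fst g)) [] A"
    using along_map[of link_ok fst "[]" A] by simp
  have 3: "along (\<lambda>l f g. (\<forall>c i. l = Cross c i \<longrightarrow> c \<noteq> Virtual \<longrightarrow> \<not> map fst f ! 0 \<and> \<not> map fst f ! 1)
     \<and> (\<forall>i. l = Mark i \<longrightarrow> \<not> map fst f ! 0)) [] A"
    unfolding along_nth
  proof (intro allI impI)
    fix t assume "t < length A"
    then have t: "t < length D" by (simp add: A_def)
    have l: "fst (A ! t) = D ! t" using t by (simp add: A_def annot_nth)
    have "run [] (take t (fsts A)) = row (same_edge D P) D t"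
      using run_annot[OF f S, where t = t] t by (simp add: A_def annot_pair)
    then have "map fst (run [] (take t A)) = row (same_edge D P) D t"
      using run_map[of fst "[]" "take t A"] by (simp add: take_map)
    then have "map fst (inputs (D ! t) (run [] (take t A))) = inputs (D ! t) (row (same_edge D P) D t)"
      by (simp only: map_inputs)
    then have i: "map fst (inputs (D ! t) (run [] (take t A))) ! q = same_edge D P (t, offset (D ! t) + q)"
      if "q < ins (D ! t)" for q
      using that fits_layer[OF f t] by (simp add: inputs_def row_def)
    show "(\<forall>c i. fst (A ! t) = Cross c i \<longrightarrow> c \<noteq> Virtual \<longrightarrow> \<not> map fst (inputs (fst (A ! t)) (run [] (take t A))) ! 0 \<and>
         \<not> map fst (inputs (fst (A ! t)) (run [] (take t A))) ! 1) \<and>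
      (\<forall>i. fst (A ! t) = Mark i \<longrightarrow> \<not> map fst (inputs (fst (A ! t)) (run [] (take t A))) ! 0)"
      using i[of 0] i[of 1] t P unfolding l carries_classical_def marked_def by auto
  qed
  have f1: "along (\<lambda>l f g. flag_ok l (map snd f) (map snd g)) [] A"
    using 1 along_map[of flag_ok snd "[]" A] by simp
  show "along flagged_del_ok [] A"
    using f1 2 3 unfolding flagged_del_ok_def del_ok_def along_nth by auto
qed

text \<open>
  Both inequalities between the two labellings come from minimality of the marks, once in either diagram.
\<close>

lemma flagged_delete:
  assumes D: "marked_diagram D" and P: "\<not> marked D P" "\<not> carries_classical D P"
  defines "A \<equiv> annot (\<lambda>Q. (same_edge D P Q, marked D Q)) 0 D"
  shows "flagged (delete_edge P D) = del [] A" "marked_diagram (delete_edge P D)"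
proof -
  have f: "fits 0 D" and w: "width_from 0 D = 0" using D by (simp_all add: marked_diagram_def planar_word_iff)
  have S: "same_edge D P Q = same_edge D P Q'" if "strand D Q Q'" for Q Q' by (rule same_edge_strand[OF that])
  note ok = edge_del_ok[OF D P, folded A_def]
  have mA: "map fst A = D" by (simp add: A_def)
  have sn: "snds A = flagged D" and fs: "fsts A = annot (same_edge D P) 0 D" by (simp_all add: A_def annot_pair flagged_def)
  have zA: "A = zip_words (annot (same_edge D P) 0 D) (flagged D)"
    by (simp add: A_def zip_words_annot flagged_def)
  have "delete_edge P D = dels [] (annot (same_edge D P) 0 D)"
    using delete_layers_dels[OF f, of "Collect (same_edge D P)" 0] S by (simp add: delete_edge_def row_def width_def)
  then have mE: "map fst (del [] A) = delete_edge P D" by (simp add: map_fst_del fs)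
  have E: "along flag_ok [] (del [] A)" "fits 0 (map fst (del [] A))" "run [] (del [] A) = keep (run [] A)"
    using del_flag_ok[OF ok(1)] f mA by simp_all
  have "run (map snd []) (snds A) = []"
    using length_run[of "[]" "flagged D"] flagged_ok[OF f] f w by (simp add: sn consistent_sized flag_ok_consistent)
  then have "run [] A = []" using run_map[of snd "[]" A] by simp
  then have "width_from 0 (delete_edge P D) = 0"
    using length_run[of "[]" "del [] A"] E by (simp add: mE consistent_sized flag_ok_consistent)
  then have pl: "planar_word (delete_edge P D)" using E(2) by (simp add: planar_word_iff mE)
  have 1: "below (flagged (delete_edge P D)) (del [] A)"
    by (rule flagged_below[OF E(1)]) (use E(2) mE in auto)
  let ?B = "flagged (delete_edge P D)"
  have "\<exists>C. map fst C = map fst (annot (same_edge D P) 0 D) \<and> along flag_ok (fill False [] []) C \<and>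
     del (zip [] (fill False [] [])) (zip_words (annot (same_edge D P) 0 D) C) = ?B"
  proof (rule lift_flags)
    have "along flagged_del_ok [] A" by (rule ok)
    then have "along (\<lambda>l f g. del_ok l (map fst f) (map fst g)) [] A"
      by (rule along_mono) (simp add: flagged_del_ok_def)
    then show "along del_ok [] (annot (same_edge D P) 0 D)"
      using along_map[of del_ok fst "[]" A] by (simp add: fs)
    show "map fst ?B = dels [] (annot (same_edge D P) 0 D)"
      using mE by (simp add: map_fst_del fs)
    show "along flag_ok [] ?B" using E(2) mE by (simp add: flagged_ok)
  qed (use f in auto)
  then obtain C where C: "map fst C = D" "along flag_ok [] C" "del [] (zip_words (annot (same_edge D P) 0 D) C) = ?B"
    by auto
  have "below (flagged D) C" by (rule flagged_below[OF C(2) f C(1)])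
  then have "below (del (zip [] []) (zip_words (annot (same_edge D P) 0 D) (flagged D)))
      (del (zip [] []) (zip_words (annot (same_edge D P) 0 D) C))"
    by (rule below_del) (auto simp: flagged_def list_all2_conv_all_nth annot_nth)
  then have "below (del [] A) ?B" by (simp add: zA C)
  with 1 show fl: "flagged (delete_edge P D) = del [] A" by (rule below_antisym)
  have "along clear (keep []) (del [] A)"
    by (rule del_clear[OF ok(1)]) (use ok(2) f mA in simp_all)
  then show "marked_diagram (delete_edge P D)"
    unfolding marked_diagram_clear fl using pl by simp
qed

lemma length_filter_card: "length (filter Q (map h [0..<n])) = card {q. q < n \<and> Q (h q)}"
proof -
  have "length (filter Q (map h [0..<n])) = length (filter (Q \<circ> h) [0..<n])" by (simp add: filter_map)
  also have "\<dots> = card (set (filter (Q \<circ> h) [0..<n]))" by (rule distinct_card[symmetric]) simp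
  also have "set (filter (Q \<circ> h) [0..<n]) = {q. q < n \<and> Q (h q)}" by auto
  finally show ?thesis .
qed

text \<open>
  An edge that is not a circle has exactly two ends.
\<close>

lemma total_hits_edge:
  assumes D: "planar_word D" and P: "\<not> on_circle D P"
  shows "total_hits [] (annot (\<lambda>Q. (same_edge D P Q, m Q)) 0 D) = 2"
    (is "total_hits [] ?A = 2")
proof -
  have f: "fits 0 D" using D by (simp add: planar_word_iff)
  have S: "same_edge D P Q = same_edge D P Q'" if "strand D Q Q'" for Q Q' by (rule same_edge_strand[OF that])
  \<comment> \<open>the set of ends of the edge\<close>
  define H where "H = {h \<in> diagram_half_edges D. same_edge D P (leg D h)}"
  obtain h where h: "h \<in> diagram_half_edges D" "same_edge D P (leg D h)"
    using P by (auto simp: on_circle_def)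
  obtain h' where h': "h' \<in> diagram_half_edges D \<and> h' \<noteq> h \<and> same_edge D (leg D h) (leg D h')"
    and u: "\<forall>k. k \<in> diagram_half_edges D \<and> k \<noteq> h \<and> same_edge D (leg D h) (leg D k) \<longrightarrow> k = h'"
    using other_half_edge[OF D h(1)] unfolding Ex1_def by blast
  have "same_edge D P (leg D k) \<longleftrightarrow> same_edge D (leg D h) (leg D k)" for k
    using h(2) same_edge_equiv(2,3) by blast
  then have "H = {h, h'}"
    unfolding H_def using h h' u by blast
  then have c2: "card H = 2" using h' by auto
  define V where "V = diagram_vertices D"
  have finV: "finite V" by (auto simp: V_def diagram_vertices_def)
  have "H = (SIGMA t:V. {j. j < ins (D ! t) + outs (D ! t) \<and> same_edge D P (leg D (t, j))})"
    by (auto simp: H_def V_def diagram_half_edges_def)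
  then have "card H = (\<Sum>t\<in>V. card {j. j < ins (D ! t) + outs (D ! t) \<and> same_edge D P (leg D (t, j))})"
    using finV by simp
  also have "\<dots> = (\<Sum>t\<in>V. hits (D ! t) (inputs (D ! t) (run [] (take t ?A))) (snd (?A ! t)))"
  proof (intro sum.cong refl)
    fix t assume "t \<in> V"
    then obtain i a b where t: "t < length D" "D ! t = Vertex i a b" by (auto simp: V_def diagram_vertices_def)
    have "run [] (take t (fsts ?A)) = row (same_edge D P) D t"
      using run_annot[OF f S, where t = t] t by (simp add: annot_pair)
    then have "map fst (run [] (take t ?A)) = row (same_edge D P) D t"
      using run_map[of fst "[]" "take t ?A"] by (simp add: take_map)
    then have "map fst (inputs (D ! t) (run [] (take t ?A))) = map (\<lambda>q. same_edge D P (t, i + q)) [0..<a]"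
      using fits_layer[OF f t(1)] t(2) unfolding map_inputs
      by (intro nth_equalityI) (auto simp: inputs_def row_def)
    then have F: "length (filter fst (inputs (D ! t) (run [] (take t ?A)))) = card {q. q < a \<and> same_edge D P (t, i + q)}"
      using length_filter_card[of "\<lambda>x. x" "\<lambda>q. same_edge D P (t, i + q)" a] unfolding length_filter_fst by simp
    have G: "length (filter fst (snd (?A ! t))) = card {q. q < b \<and> same_edge D P (Suc t, i + q)}"
      using t length_filter_card[of fst "\<lambda>q. (same_edge D P (Suc t, i + q), m (Suc t, i + q))" b] by (simp add: annot_nth)
    have "{j. j < a + b \<and> same_edge D P (leg D (t, j))}
       = {q. q < a \<and> same_edge D P (t, i + q)} \<union> (\<lambda>q. a + b - 1 - q) ` {q. q < b \<and> same_edge D P (Suc t, i + q)}"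
    proof (intro set_eqI iffI)
      fix j assume j: "j \<in> {j. j < a + b \<and> same_edge D P (leg D (t, j))}"
      show "j \<in> {q. q < a \<and> same_edge D P (t, i + q)} \<union> (\<lambda>q. a + b - 1 - q) ` {q. q < b \<and> same_edge D P (Suc t, i + q)}"
      proof (cases "j < a")
        case True
        then show ?thesis using j t by (auto simp: leg_def)
      next
        case False
        then show ?thesis using j t
          by (intro UnI2 image_eqI[of _ _ "a + b - 1 - j"]) (auto simp: leg_def)
      qed
    qed (use t in \<open>auto simp: leg_def\<close>)
    moreover have "card ((\<lambda>q. a + b - 1 - q) ` {q. q < b \<and> same_edge D P (Suc t, i + q)}) = card {q. q < b \<and> same_edge D P (Suc t, i + q)}"
      by (intro card_image inj_onI) auto
    moreover have "card ({q. q < a \<and> same_edge D P (t, i + q)} \<union> (\<lambda>q. a + b - 1 - q) ` {q. q < b \<and> same_edge D P (Suc t, i + q)})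
      = card {q. q < a \<and> same_edge D P (t, i + q)} + card ((\<lambda>q. a + b - 1 - q) ` {q. q < b \<and> same_edge D P (Suc t, i + q)})"
      by (rule card_Un_disjoint) auto
    ultimately show "card {j. j < ins (D ! t) + outs (D ! t) \<and> same_edge D P (leg D (t, j))}
       = hits (D ! t) (inputs (D ! t) (run [] (take t ?A))) (snd (?A ! t))"
      using t(2) F G by (simp add: hits_def)
  qed
  also have "\<dots> = (\<Sum>t<length D. hits (D ! t) (inputs (D ! t) (run [] (take t ?A))) (snd (?A ! t)))"
    by (rule sum.mono_neutral_left) (auto simp: V_def diagram_vertices_def hits_def)
  also have "\<dots> = total_hits [] ?A"
    unfolding total_hits_nth by (intro sum.cong) (auto simp: annot_nth)
  finally show ?thesis using c2 by simp
qed

context colour_model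
begin

text \<open>
  Marking the edge adds the colour \<open>e\<close> to its colours; in this colour the edge is deleted and each of its two ends contributes
  \<open>\<kappa>\<close>.
\<close>

lemma F_delete:
  assumes D: "marked_diagram (u @ v)" and P: "(length u, i) \<in> points (u @ v)" "\<not> on_circle (u @ v) (length u, i)"
    "\<not> marked (u @ v) (length u, i)" "\<not> carries_classical (u @ v) (length u, i)"
  shows "F (u @ v) = - \<kappa>\<^sup>2 * F (delete_edge (length u, i) (u @ v)) + F (u @ [Mark i] @ v)"
proof -
  let ?D = "u @ v" and ?P = "(length u, i)"
  have f: "fits 0 ?D" and pl: "planar_word ?D" using D by (simp_all add: marked_diagram_def planar_word_iff)
  define R where "R = (\<lambda>Q. range_of (marked ?D Q))"
  define on where "on = (\<lambda>Y Q. if same_edge ?D ?P Q then Y else R Q)"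
  have 0: "amp_sets (annot (on (insert e B0)) 0 ?D) (\<lambda>_. 1) [] =
    amp_sets (annot (on B0) 0 ?D) (\<lambda>_. 1) [] + amp_sets (annot (on {e}) 0 ?D) (\<lambda>_. 1) []"
    unfolding on_def
  proof (rule edge_split[OF f P(1,4)])
    show "R Q = R Q'" if "strand ?D Q Q'" for Q Q' unfolding R_def marked_strand[OF that] ..
    show "finite (R Q)" for Q using finite_B0 by (simp add: R_def range_of_def)
  qed
  have un: "\<not> marked ?D Q" if "same_edge ?D ?P Q" for Q using marked_same_edge[OF that] P(3) by simp
  have "on B0 = R" unfolding on_def R_def range_of_def using un by (intro ext) auto
  then have 1: "amp_sets (annot (on B0) 0 ?D) (\<lambda>_. 1) [] = F ?D"
    by (simp add: F_def flagged_def amp_annot R_def)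
  have "on (insert e B0) = (\<lambda>Q. range_of (marked ?D Q \<or> same_edge ?D ?P Q))"
    unfolding on_def R_def range_of_def by (intro ext) auto
  then have 2: "amp_sets (annot (on (insert e B0)) 0 ?D) (\<lambda>_. 1) [] = F (u @ [Mark i] @ v)"
    unfolding F_mark[OF f P(1)] amp_annot by simp
  define A where "A = annot (\<lambda>Q. (same_edge ?D ?P Q, marked ?D Q)) 0 ?D"
  have "on {e} = (\<lambda>Q. deleted_range (same_edge ?D ?P Q, marked ?D Q))"
    unfolding on_def R_def deleted_range_def by (intro ext) auto
  then have "annot (on {e}) 0 ?D = map (\<lambda>(l, g). (l, map deleted_range g)) A"
  proof -
    have "annot (\<lambda>Q. h (k Q)) t w = map (\<lambda>(l, g). (l, map h g)) (annot k t w)" for h :: "bool \<times> bool \<Rightarrow> 'c set" and k t w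
      by (induction w arbitrary: t) auto
    then show ?thesis unfolding A_def \<open>on {e} = _\<close> .
  qed
  then have 3: "amp_sets (annot (on {e}) 0 ?D) (\<lambda>_. 1) [] = \<kappa>\<^sup>2 * F (delete_edge ?P ?D)"
    using amp_delete[of "[]" A "[]"] edge_del_ok(1)[OF D P(3,4)] f flagged_delete(1)[OF D P(3,4)]
      total_hits_edge[OF pl P(2), of "marked ?D"]
    by (simp add: A_def colours_Nil F_def)
  show ?thesis using 0 unfolding 1 2 3 by simp
qed

end

section \<open>Traces of block matrices\<close>

lemma prod_sum_choice:
  fixes f :: "'a \<Rightarrow> 'b \<Rightarrow> complex"
  assumes "finite A" "\<And>x. x \<in> A \<Longrightarrow> finite (T x)"
  shows "(\<Prod>x\<in>A. \<Sum>y\<in>T x. f x y) = (\<Sum>g\<in>PiE A T. \<Prod>x\<in>A. f x (g x))"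
  using assms
proof (induction A rule: finite_induct)
  case empty
  then show ?case by simp
next
  case (insert a A)
  have "(\<Sum>g\<in>PiE (insert a A) T. \<Prod>x\<in>insert a A. f x (g x))
    = (\<Sum>(y, g)\<in>T a \<times> PiE A T. \<Prod>x\<in>insert a A. f x ((g(a := y)) x))"
    unfolding PiE_insert_eq
    by (subst sum.reindex[OF inj_combinator[OF insert.hyps(2)]]) (simp add: case_prod_beta)
  also have "\<dots> = (\<Sum>(y, g)\<in>T a \<times> PiE A T. f a y * (\<Prod>x\<in>A. f x (g x)))"
  proof (intro sum.cong refl, clarify)
    fix y g
    have "(\<Prod>x\<in>A. f x ((g(a := y)) x)) = (\<Prod>x\<in>A. f x (g x))"
      using insert.hyps by (intro prod.cong) auto
    then show "(\<Prod>x\<in>insert a A. f x ((g(a := y)) x)) = f a y * (\<Prod>x\<in>A. f x (g x))"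
      using insert.hyps by simp
  qed
  also have "\<dots> = (\<Sum>y\<in>T a. f a y) * (\<Sum>g\<in>PiE A T. \<Prod>x\<in>A. f x (g x))"
    by (simp add: sum_product sum.cartesian_product)
  finally show ?case using insert by simp
qed

text \<open>
  Such functions are functions on the classes of \<open>r\<close>.
\<close>

lemma card_constant_functions:
  assumes A: "finite A" and r: "\<And>x y. r x y \<Longrightarrow> x \<in> A \<and> y \<in> A"
  shows "card {f \<in> PiE A (\<lambda>_. T). \<forall>x y. r x y \<longrightarrow> f x = f y} = card T ^ num_classes A r"
proof -
  define cl where "cl = (\<lambda>x. Collect (equivclp r x))"
  define rep where "rep = (\<lambda>Z. SOME x. x \<in> Z \<and> x \<in> A)"
  have self: "x \<in> cl x" for x by (simp add: cl_def)
  have eq: "cl x = cl y" if "equivclp r x y" for x y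
    using that unfolding cl_def by (blast intro: equivclp_trans equivclp_sym)
  have rep: "rep Z \<in> A \<and> cl (rep Z) = Z" if Z: "Z \<in> cl ` A" for Z
  proof -
    obtain x where x: "x \<in> A" "Z = cl x" using Z by blast
    have "x \<in> Z \<and> x \<in> A" using x self by simp
    then have "rep Z \<in> Z \<and> rep Z \<in> A" unfolding rep_def by (rule someI)
    then show ?thesis using x eq by (auto simp: cl_def)
  qed
  have const: "f x = f y" if "\<forall>x y. r x y \<longrightarrow> f x = f y" "equivclp r x y" for f :: "'a \<Rightarrow> 'b" and x y
    using that(2) by (rule equivclp_invariant) (use that(1) in auto)
  have "bij_betw (\<lambda>f. \<lambda>Z\<in>cl ` A. f (rep Z)) {f \<in> PiE A (\<lambda>_. T). \<forall>x y. r x y \<longrightarrow> f x = f y} (PiE (cl ` A) (\<lambda>_. T))"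
  proof (rule bij_betw_byWitness[where f' = "\<lambda>g. \<lambda>x\<in>A. g (cl x)"])
    show "\<forall>f\<in>{f \<in> PiE A (\<lambda>_. T). \<forall>x y. r x y \<longrightarrow> f x = f y}. (\<lambda>x\<in>A. (\<lambda>Z\<in>cl ` A. f (rep Z)) (cl x)) = f"
    proof
      fix f assume f: "f \<in> {f \<in> PiE A (\<lambda>_. T). \<forall>x y. r x y \<longrightarrow> f x = f y}"
      have "f (rep (cl x)) = f x" if "x \<in> A" for x
      proof (rule const)
        have "cl (rep (cl x)) = cl x" using rep that by blast
        then have "x \<in> cl (rep (cl x))" using self[of x] by simp
        then show "equivclp r (rep (cl x)) x" unfolding cl_def by (rule CollectD)
      qed (use f in auto)
      then show "(\<lambda>x\<in>A. (\<lambda>Z\<in>cl ` A. f (rep Z)) (cl x)) = f"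
        using f by (intro ext) (auto simp: PiE_def extensional_def)
    qed
    show "\<forall>g\<in>PiE (cl ` A) (\<lambda>_. T). (\<lambda>Z\<in>cl ` A. (\<lambda>x\<in>A. g (cl x)) (rep Z)) = g"
      using rep by (auto simp: PiE_def extensional_def intro!: ext)
    show "(\<lambda>f. \<lambda>Z\<in>cl ` A. f (rep Z)) ` {f \<in> PiE A (\<lambda>_. T). \<forall>x y. r x y \<longrightarrow> f x = f y} \<subseteq> PiE (cl ` A) (\<lambda>_. T)"
      using rep by (auto simp: PiE_iff)
    show "(\<lambda>g. \<lambda>x\<in>A. g (cl x)) ` PiE (cl ` A) (\<lambda>_. T) \<subseteq> {f \<in> PiE A (\<lambda>_. T). \<forall>x y. r x y \<longrightarrow> f x = f y}"
      using r by (auto simp: PiE_iff) (metis eq r_into_equivclp)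
  qed
  then have "card {f \<in> PiE A (\<lambda>_. T). \<forall>x y. r x y \<longrightarrow> f x = f y} = card (PiE (cl ` A) (\<lambda>_. T))"
    by (rule bij_betw_same_card)
  also have "\<dots> = card T ^ card (cl ` A)"
    using A by (simp add: card_PiE)
  finally show ?thesis by (simp add: num_classes_def cl_def)
qed

text \<open>
  Summing over the common label of each pair of half-edges makes the sum a product over pairs.
\<close>

lemma sum_paired:
  fixes \<phi> :: "'h \<Rightarrow> 'b \<Rightarrow> complex"
  assumes "finite H" and "finite B"
    and "\<And>h. h \<in> H \<Longrightarrow> \<pi> h \<in> H \<and> \<pi> h \<noteq> h \<and> \<pi> (\<pi> h) = h"
    and "\<And>h. h \<in> H \<Longrightarrow> (\<Sum>b\<in>B. \<phi> h b * \<phi> (\<pi> h) b) = of_bool (cond h)"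
    and "\<And>h. h \<in> H \<Longrightarrow> cond (\<pi> h) = cond h"
  shows "(\<Sum>\<eta>\<in>{\<eta> \<in> PiE H (\<lambda>_. B). \<forall>h\<in>H. \<eta> (\<pi> h) = \<eta> h}. \<Prod>h\<in>H. \<phi> h (\<eta> h)) = of_bool (\<forall>h\<in>H. cond h)"
  using assms(1,3-5)
proof (induction "card H" arbitrary: H rule: less_induct)
  case less
  show ?case
  proof (cases "H = {}")
    case True
    then show ?thesis by simp
  next
    case False
    then obtain h where h: "h \<in> H" by auto
    define H' where "H' = H - {h, \<pi> h}"
    have ph: "\<pi> h \<in> H" "\<pi> h \<noteq> h" "\<pi> (\<pi> h) = h" using less.prems(2)[OF h] by auto
    have fin: "finite H'" using less.prems(1) by (simp add: H'_def)
    have H: "H = insert h (insert (\<pi> h) H')" "h \<notin> insert (\<pi> h) H'" "\<pi> h \<notin> H'" using h ph by (auto simp: H'_def)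
    have pH': "\<pi> k \<in> H'" if "k \<in> H'" for k
    proof -
      have k: "k \<in> H" "k \<noteq> h" "k \<noteq> \<pi> h" using that by (auto simp: H'_def)
      have "\<pi> k \<noteq> h" "\<pi> k \<noteq> \<pi> h" using less.prems(2)[OF k(1)] ph k by metis+
      then show ?thesis using less.prems(2)[OF k(1)] by (simp add: H'_def)
    qed
    define Y where "Y = {\<eta> \<in> PiE H' (\<lambda>_. B). \<forall>h\<in>H'. \<eta> (\<pi> h) = \<eta> h}"
    have IH: "(\<Sum>\<eta>\<in>Y. \<Prod>h\<in>H'. \<phi> h (\<eta> h)) = of_bool (\<forall>h\<in>H'. cond h)"
      unfolding Y_def
    proof (rule less.hyps)
      show "card H' < card H" unfolding H(1) using H(2,3) fin by simp
      show "\<pi> k \<in> H' \<and> \<pi> k \<noteq> k \<and> \<pi> (\<pi> k) = k" if "k \<in> H'" for k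
        using pH'[OF that] less.prems(2)[of k] that by (auto simp: H'_def)
    qed (use less.prems fin in \<open>auto simp: H'_def\<close>)
    have "(\<Sum>\<eta>\<in>{\<eta> \<in> PiE H (\<lambda>_. B). \<forall>h\<in>H. \<eta> (\<pi> h) = \<eta> h}. \<Prod>h\<in>H. \<phi> h (\<eta> h))
      = (\<Sum>(b, \<eta>)\<in>B \<times> Y. \<phi> h b * \<phi> (\<pi> h) b * (\<Prod>h\<in>H'. \<phi> h (\<eta> h)))"
    proof (rule sum.reindex_bij_witness[where
          j = "\<lambda>\<eta>. (\<eta> h, restrict \<eta> H')" and i = "\<lambda>(b, \<eta>). \<eta>(h := b, \<pi> h := b)"], goal_cases)
      case (1 \<eta>)
      then have *: "\<eta> \<in> PiE H (\<lambda>_. B)" "\<eta> (\<pi> h) = \<eta> h" using h by auto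
      show ?case
      proof
        fix k show "(case (\<eta> h, restrict \<eta> H') of (b, \<eta>) \<Rightarrow> \<eta>(h := b, \<pi> h := b)) k = \<eta> k"
          using * by (cases "k \<in> H") (auto simp: H'_def PiE_def extensional_def)
      qed
    next
      case (2 \<eta>)
      then show ?case using pH' h by (auto simp: Y_def PiE_iff H'_def)
    next
      case (3 x)
      then obtain b \<eta> where x: "x = (b, \<eta>)" "b \<in> B" "\<eta> \<in> Y" by auto
      have "restrict (\<eta>(h := b, \<pi> h := b)) H' = \<eta>"
        using x(3) by (intro ext) (auto simp: Y_def PiE_def extensional_def H'_def)
      then show ?case using x ph(2) by simp
    next
      case (4 x)
      then obtain b \<eta> where x: "x = (b, \<eta>)" "b \<in> B" "\<eta> \<in> Y" by auto
      have "\<eta>(h := b, \<pi> h := b) \<in> PiE H (\<lambda>_. B)"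
        using x h ph by (auto simp: Y_def PiE_iff H(1) extensional_def)
      moreover have "(\<eta>(h := b, \<pi> h := b)) (\<pi> k) = (\<eta>(h := b, \<pi> h := b)) k" if "k \<in> H" for k
      proof (cases "k \<in> H'")
        case True
        then have "\<pi> k \<in> H'" "\<eta> (\<pi> k) = \<eta> k" using pH' x by (auto simp: Y_def)
        then show ?thesis using True by (auto simp: H'_def)
      next
        case False
        then have "k = h \<or> k = \<pi> h" using that by (auto simp: H'_def)
        then show ?thesis using ph by auto
      qed
      ultimately show ?case using x by auto
    next
      case (5 \<eta>)
      then have "\<eta> (\<pi> h) = \<eta> h" using h by auto
      then show ?case unfolding H(1) using H(2,3) fin by (simp add: mult.assoc)
    qed
    also have "\<dots> = of_bool (cond h) * of_bool (\<forall>h\<in>H'. cond h)"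
      unfolding IH[symmetric] less.prems(3)[OF h, symmetric]
      by (simp add: sum_product sum.cartesian_product)
    also have "\<dots> = of_bool (\<forall>h\<in>H. cond h)"
      using less.prems(4)[OF h] by (auto simp: H(1))
    finally show ?thesis .
  qed
qed

text \<open>
  An orthonormal basis of the direct sum of \<open>q\<close> algebras of matrices of size \<open>n\<close>; \<open>M b c\<close> is block \<open>c\<close> of the basis element \<open>b\<close>.
  The condition \<open>complete\<close> expresses that the basis gives the identity of this algebra.
\<close>

locale matrix_model =
  fixes B0 :: "'c set" and e :: 'c and M :: "'c \<Rightarrow> nat \<Rightarrow> nat \<Rightarrow> nat \<Rightarrow> complex"
    and n q :: nat and \<kappa> :: complex
  assumes finite_B0: "finite B0" and e_notin: "e \<notin> B0"
    and complete: "\<lbrakk>c < q; c' < q; i < n; j < n; i' < n; j' < n\<rbrakk> \<Longrightarrow>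
      (\<Sum>b\<in>insert e B0. M b c i j * M b c' i' j') = of_bool (c = c' \<and> i = j' \<and> j = i')"
    and orthonormal: "\<lbrakk>b \<in> insert e B0; b' \<in> insert e B0\<rbrakk> \<Longrightarrow>
      (\<Sum>c<q. \<Sum>i<n. \<Sum>j<n. M b c i j * M b' c j i) = of_bool (b = b')"
    and unit: "\<lbrakk>c < q; i < n; j < n\<rbrakk> \<Longrightarrow> M e c i j = \<kappa> * of_bool (i = j)"
    and kappa: "\<kappa>\<^sup>2 * (of_nat q * of_nat n) = 1"
begin

fun mprod :: "nat \<Rightarrow> 'c list \<Rightarrow> nat \<Rightarrow> nat \<Rightarrow> complex" where
  "mprod c [] i j = of_bool (i = j)"
| "mprod c (b # l) i j = (\<Sum>k<n. M b c i k * mprod c l k j)"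

definition trace :: "'c list \<Rightarrow> complex" where
  "trace l = (\<Sum>c<q. \<Sum>i<n. mprod c l i i)"

lemma sum_delta_less: "k < n \<Longrightarrow> (\<Sum>i<n. of_bool (k = i) * f i) = (f k :: complex)"
  "k < n \<Longrightarrow> (\<Sum>i<n. of_bool (i = k) * f i) = (f k :: complex)"
  "k < n \<Longrightarrow> (\<Sum>i<n. f i * of_bool (k = i)) = (f k :: complex)"
  "k < n \<Longrightarrow> (\<Sum>i<n. f i * of_bool (i = k)) = (f k :: complex)"
  by (auto simp: of_bool_def if_distrib[of "\<lambda>c. c * _"] if_distrib[of "\<lambda>c. _ * c"] cong: if_cong)

lemma mprod_append: "i < n \<Longrightarrow> mprod c (a @ b) i j = (\<Sum>k<n. mprod c a i k * mprod c b k j)"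
proof (induction a arbitrary: i)
  case Nil
  then show ?case by (simp add: sum_delta_less)
next
  case (Cons x a)
  have "mprod c ((x # a) @ b) i j = (\<Sum>k<n. \<Sum>m<n. M x c i k * (mprod c a k m * mprod c b m j))"
    using Cons.IH by (simp add: sum_distrib_left)
  also have "\<dots> = (\<Sum>m<n. \<Sum>k<n. M x c i k * (mprod c a k m * mprod c b m j))"
    by (rule sum.swap)
  finally show ?case by (simp add: sum_distrib_right mult.assoc)
qed

lemma mprod_single: "k < n \<Longrightarrow> j < n \<Longrightarrow> mprod c [b] k j = M b c k j"
  by (simp add: sum_delta_less)

sublocale trace_colouring B0 e trace \<kappa> "of_nat n" "of_nat q * of_nat n"
proof
  show "finite B0" "e \<notin> B0" by (fact finite_B0 e_notin)+
  show "\<kappa>\<^sup>2 * (of_nat q * of_nat n) = 1" by (fact kappa)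
  show "trace [] = of_nat q * of_nat n" by (simp add: trace_def)
  fix a b
  have "(\<Sum>i<n. mprod c (a @ b) i i) = (\<Sum>i<n. mprod c (b @ a) i i)" for c
  proof -
    have "(\<Sum>i<n. mprod c (a @ b) i i) = (\<Sum>i<n. \<Sum>k<n. mprod c a i k * mprod c b k i)"
      by (intro sum.cong) (auto simp: mprod_append)
    also have "\<dots> = (\<Sum>k<n. \<Sum>i<n. mprod c b k i * mprod c a i k)"
      by (subst sum.swap) (simp add: mult.commute)
    also have "\<dots> = (\<Sum>i<n. mprod c (b @ a) i i)"
      by (intro sum.cong) (auto simp: mprod_append)
    finally show ?thesis .
  qed
  then show "trace (a @ b) = trace (b @ a)" by (simp add: trace_def)
next
  fix x y assume *: "x \<in> insert e B0" "y \<in> insert e B0"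
  have "trace [x, y] = (\<Sum>c<q. \<Sum>i<n. \<Sum>j<n. M x c i j * M y c j i)"
    unfolding trace_def
  proof (intro sum.cong refl)
    fix c i assume "i \<in> {..<n}"
    then have "mprod c [y] k i = M y c k i" if "k < n" for k using that by (intro mprod_single) auto
    then show "mprod c [x, y] i i = (\<Sum>j<n. M x c i j * M y c j i)"
      by (simp del: mprod.simps add: mprod.simps(2)[of c x "[y]"])
  qed
  then show "trace [x, y] = of_bool (x = y)" using orthonormal[OF *] by simp
next
  fix l
  have "mprod c (e # l) i i = \<kappa> * mprod c l i i" if "c < q" "i < n" for c i
    using that by (simp add: unit mult.assoc sum_distrib_left[symmetric] sum_delta_less)
  then show "trace (e # l) = \<kappa> * trace l" by (simp add: trace_def sum_distrib_left)
next
  fix u v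
  let ?B = "insert e B0"
  have tu: "trace (u @ [b]) = (\<Sum>c<q. \<Sum>i<n. \<Sum>k<n. mprod c u i k * M b c k i)" for b
    unfolding trace_def
  proof (intro sum.cong refl)
    fix c i assume i: "i \<in> {..<n}"
    then show "mprod c (u @ [b]) i i = (\<Sum>k<n. mprod c u i k * M b c k i)"
      by (simp del: mprod.simps add: mprod_append mprod_single)
  qed
  have "(\<Sum>b\<in>?B. trace (u @ [b]) * trace (b # v))
    = (\<Sum>c<q. \<Sum>i<n. \<Sum>k<n. \<Sum>c'<q. \<Sum>i'<n. \<Sum>k'<n. \<Sum>b\<in>?B. (mprod c' u i' k' * mprod c v k i) * (M b c' k' i' * M b c i k))"
    unfolding tu unfolding trace_def mprod.simps sum_distrib_right sum_distrib_left
    by (subst sum.swap, rule sum.cong[OF refl])+ (simp add: mult_ac)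
  also have "\<dots> = (\<Sum>c<q. \<Sum>i<n. \<Sum>k<n. \<Sum>c'<q. \<Sum>i'<n. \<Sum>k'<n. (mprod c' u i' k' * mprod c v k i) * of_bool (c' = c \<and> k' = k \<and> i' = i))"
    by (intro sum.cong refl) (simp add: sum_distrib_left[symmetric] complete del: sum.insert)
  also have "\<dots> = (\<Sum>c<q. \<Sum>i<n. \<Sum>k<n. mprod c u i k * mprod c v k i)"
  proof (intro sum.cong refl)
    fix c i k assume *: "c \<in> {..<q}" "i \<in> {..<n}" "k \<in> {..<n}"
    have "(\<Sum>c'<q. \<Sum>i'<n. \<Sum>k'<n. (mprod c' u i' k' * mprod c v k i) * of_bool (c' = c \<and> k' = k \<and> i' = i))
      = (\<Sum>c'<q. of_bool (c' = c) * (\<Sum>i'<n. of_bool (i' = i) * (\<Sum>k'<n. of_bool (k' = k) * (mprod c' u i' k' * mprod c v k i))))"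
      unfolding sum_distrib_left by (intro sum.cong refl) (simp only: of_bool_conj mult_ac)
    also have "\<dots> = mprod c u i k * mprod c v k i"
      using * by (simp add: sum_delta_less)
    finally show "(\<Sum>c'<q. \<Sum>i'<n. \<Sum>k'<n. (mprod c' u i' k' * mprod c v k i) * of_bool (c' = c \<and> k' = k \<and> i' = i))
      = mprod c u i k * mprod c v k i" .
  qed
  also have "\<dots> = trace (u @ v)"
    unfolding trace_def by (intro sum.cong) (auto simp: mprod_append)
  finally show "(\<Sum>b\<in>?B. trace (u @ [b]) * trace (b # v)) = trace (u @ v)" .
next
  fix u
  let ?B = "insert e B0"
  have "(\<Sum>b\<in>?B. trace (b # b # u)) = (\<Sum>c<q. \<Sum>i<n. \<Sum>k<n. \<Sum>m<n. \<Sum>b\<in>?B. (M b c i k * M b c k m) * mprod c u m i)"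
    unfolding trace_def mprod.simps sum_distrib_left mult.assoc
    by (rule trans[OF sum.swap], rule sum.cong[OF refl])+ simp
  also have "\<dots> = (\<Sum>c<q. \<Sum>i<n. \<Sum>k<n. \<Sum>m<n. of_bool (i = m) * mprod c u m i)"
    by (intro sum.cong refl) (simp add: sum_distrib_right[symmetric] complete del: sum.insert)
  also have "\<dots> = of_nat n * trace u"
    unfolding trace_def sum_distrib_left by (intro sum.cong refl) (simp add: sum_delta_less)
  finally show "(\<Sum>b\<in>?B. trace (b # b # u)) = of_nat n * trace u" .
qed

end

section \<open>Boundary components of ribbon graphs\<close>

context matrix_model
begin

fun path_product :: "nat \<Rightarrow> 'c list \<Rightarrow> nat \<Rightarrow> nat list \<Rightarrow> complex" where
  "path_product c [] p w = 1"
| "path_product c (b # l) p w = M b c p (hd w) * path_product c l (hd w) (tl w)"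

lemma mprod_paths: "p < n \<Longrightarrow> mprod c l p r = (\<Sum>w\<in>words {..<n} (length l). of_bool (last (p # w) = r) * path_product c l p w)"
proof (induction l arbitrary: p)
  case Nil
  then show ?case by (simp add: words_0)
next
  case (Cons b l)
  have "mprod c (b # l) p r = (\<Sum>k<n. \<Sum>w\<in>words {..<n} (length l). M b c p k * (of_bool (last (k # w) = r) * path_product c l k w))"
    using Cons.IH by (simp add: sum_distrib_left)
  then show ?case by (simp add: sum_words_Suc mult_ac cong: sum.cong)
qed

lemma path_product_nth:
  "length w = length l \<Longrightarrow> path_product c l p w = (\<Prod>j<length l. M (l ! j) c ((p # w) ! j) (w ! j))"
proof (induction l arbitrary: p w)
  case (Cons b l)
  then obtain k w' where w: "w = k # w'" by (cases w) auto
  show ?case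
    using Cons.IH[of w' k] Cons.prems by (simp add: w prod.lessThan_Suc_shift del: prod.lessThan_Suc)
qed simp

lemma rotate1_words: "(\<Sum>w\<in>words S m. f (rotate1 w)) = (\<Sum>w\<in>words S m. f w)"
proof (rule sum.reindex_bij_witness[where j = rotate1 and i = "\<lambda>w. rotate (m - 1) w"])
  fix w assume "w \<in> words S m"
  then have l: "length w = m" by (simp add: words_def)
  have "rotate (m - 1) (rotate1 w) = rotate m w \<and> rotate1 (rotate (m - 1) w) = rotate m w"
    using l by (cases m) (simp_all add: rotate1_rotate_swap[symmetric] rotate_Suc)
  then show "rotate (m - 1) (rotate1 w) = w" "rotate1 (rotate (m - 1) w) = w"
    using l by (simp_all add: rotate_id)
qed (auto simp: words_def)

lemma rotate1_nth': "length w = m \<Longrightarrow> j < m \<Longrightarrow> rotate1 w ! j = w ! (Suc j mod m)"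
  using nth_rotate1[of j w] by simp

text \<open>
  A trace of a product is a sum over closed sequences of matrix indices; the index between two consecutive factors belongs to the
  corner between two consecutive half-edges at a vertex.
\<close>

lemma trace_paths:
  assumes "l \<noteq> []"
  shows "trace l = (\<Sum>c<q. \<Sum>w\<in>words {..<n} (length l). \<Prod>j<length l. M (l ! j) c (w ! j) (w ! (Suc j mod length l)))"
  unfolding trace_def
proof (rule sum.cong[OF refl])
  fix c
  let ?m = "length l"
  obtain m' where m': "?m = Suc m'" using assms by (cases l) auto
  have "(\<Sum>p<n. mprod c l p p) = (\<Sum>p<n. \<Sum>w\<in>words {..<n} ?m. of_bool (last (p # w) = p) * path_product c l p w)"
    by (intro sum.cong refl) (simp add: mprod_paths)
  also have "\<dots> = (\<Sum>w\<in>words {..<n} ?m. \<Sum>p<n. of_bool (last w = p) * path_product c l p w)"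
    by (subst sum.swap) (intro sum.cong refl, auto simp: words_def m')
  also have "\<dots> = (\<Sum>w\<in>words {..<n} ?m. path_product c l (last w) w)"
  proof (rule sum.cong[OF refl])
    fix w assume "w \<in> words {..<n} ?m"
    then have "w \<noteq> []" "set w \<subseteq> {..<n}" by (auto simp: words_def m')
    then have "last w < n" using last_in_set[of w] by blast
    then show "(\<Sum>p<n. of_bool (last w = p) * path_product c l p w) = path_product c l (last w) w"
      by (rule sum_delta_less)
  qed
  also have "\<dots> = (\<Sum>w\<in>words {..<n} ?m. path_product c l (last (rotate1 w)) (rotate1 w))"
    by (rule rotate1_words[symmetric])
  also have "\<dots> = (\<Sum>w\<in>words {..<n} ?m. \<Prod>j<?m. M (l ! j) c (w ! j) (w ! (Suc j mod ?m)))"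
  proof (rule sum.cong[OF refl])
    fix w assume "w \<in> words {..<n} ?m"
    then have w: "length w = ?m" by (simp add: words_def)
    then obtain x w' where x: "w = x # w'" using m' by (cases w) auto
    have "path_product c l (last (rotate1 w)) (rotate1 w) = (\<Prod>j<?m. M (l ! j) c ((x # rotate1 w) ! j) (rotate1 w ! j))"
      using w by (subst path_product_nth) (simp_all add: x)
    also have "\<dots> = (\<Prod>j<?m. M (l ! j) c (w ! j) (w ! (Suc j mod ?m)))"
    proof (rule prod.cong[OF refl])
      fix j assume "j \<in> {..<?m}"
      then have j: "j < ?m" by simp
      have "(x # rotate1 w) ! j = w ! j" using j w by (cases j) (auto simp: x nth_append)
      then show "M (l ! j) c ((x # rotate1 w) ! j) (rotate1 w ! j) = M (l ! j) c (w ! j) (w ! (Suc j mod ?m))"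
        using rotate1_nth'[OF w j] by simp
    qed
    finally show "path_product c l (last (rotate1 w)) (rotate1 w) = (\<Prod>j<?m. M (l ! j) c (w ! j) (w ! (Suc j mod ?m)))" .
  qed
  finally show "(\<Sum>p<n. mprod c l p p) = (\<Sum>w\<in>words {..<n} ?m. \<Prod>j<?m. M (l ! j) c (w ! j) (w ! (Suc j mod ?m)))" .
qed

lemma sum_words_PiE: "(\<Sum>w\<in>words S m. f w) = (\<Sum>g\<in>PiE {..<m} (\<lambda>_. S). f (map g [0..<m]))"
proof (rule sum.reindex_bij_witness[where j = "\<lambda>w. \<lambda>j\<in>{..<m}. w ! j" and i = "\<lambda>g. map g [0..<m]"])
  fix w assume "w \<in> words S m"
  then have w: "length w = m" "set w \<subseteq> S" by (auto simp: words_def)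
  show "map (\<lambda>j\<in>{..<m}. w ! j) [0..<m] = w" using w by (intro nth_equalityI) auto
  then show "f (map (\<lambda>j\<in>{..<m}. w ! j) [0..<m]) = f w" by simp
  show "(\<lambda>j\<in>{..<m}. w ! j) \<in> PiE {..<m} (\<lambda>_. S)" using w by (auto simp: subset_iff)
next
  fix g assume g: "g \<in> PiE {..<m} (\<lambda>_. S)"
  show "(\<lambda>j\<in>{..<m}. map g [0..<m] ! j) = g" using g by (intro ext) (auto simp: PiE_def extensional_def)
  show "map g [0..<m] \<in> words S m" using g by (auto simp: words_def PiE_iff)
qed

lemma trace_corners:
  "trace (map g [0..<m]) = (if m = 0 then of_nat n else 1) *
     (\<Sum>c<q. \<Sum>w\<in>PiE {..<m} (\<lambda>_. {..<n}). \<Prod>j<m. M (g j) c (w j) (w (Suc j mod m)))"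
proof (cases "m = 0")
  case True
  then show ?thesis by (simp add: trace_def)
next
  case False
  then have "trace (map g [0..<m]) = (\<Sum>c<q. \<Sum>w\<in>PiE {..<m} (\<lambda>_. {..<n}). \<Prod>j<m. M (map g [0..<m] ! j) c (map w [0..<m] ! j) (map w [0..<m] ! (Suc j mod m)))"
    by (subst trace_paths) (simp_all add: sum_words_PiE)
  also have "\<dots> = (\<Sum>c<q. \<Sum>w\<in>PiE {..<m} (\<lambda>_. {..<n}). \<Prod>j<m. M (g j) c (w j) (w (Suc j mod m)))"
    by (intro sum.cong prod.cong refl) (use False in auto)
  finally show ?thesis using False by simp
qed

text \<open>
  After expanding all traces, \<open>complete\<close> says at each edge that the blocks at its ends agree and that the indices along
  either side of its band agree. So blocks are constant on components, and indices are constant on boundary components; a vertex of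
  degree zero has a free index of its own.
\<close>

lemma cyclic_graph_sum:
  fixes G :: cyclic_graph
  assumes fin: "finite (vertices G)"
    and dom: "\<And>h h'. joined G h h' \<Longrightarrow> h \<in> half_edges G \<and> h' \<in> half_edges G"
    and ex1: "\<And>h. h \<in> half_edges G \<Longrightarrow> \<exists>!h'. joined G h h'"
    and sym: "\<And>h h'. joined G h h' \<Longrightarrow> joined G h' h"
    and irr: "\<And>h. \<not> joined G h h"
  shows "(\<Sum>\<eta>\<in>{\<eta> \<in> PiE (half_edges G) (\<lambda>_. insert e B0). \<forall>h h'. joined G h h' \<longrightarrow> \<eta> h' = \<eta> h}.
      \<Prod>v\<in>vertices G. trace (map (\<lambda>j. \<eta> (v, j)) [0..<degree G v]))
    = of_nat q ^ components G * of_nat n ^ boundary_components G"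
proof -
  let ?V = "vertices G" and ?H = "half_edges G" and ?d = "degree G" and ?B = "insert e B0"
  define \<pi> where "\<pi> = (\<lambda>h. THE h'. joined G h h')"
  have pi: "joined G h h' \<longleftrightarrow> h' = \<pi> h" if "h \<in> ?H" for h h'
    using ex1[OF that] unfolding \<pi>_def by (metis the_equality theI')
  have pH: "\<pi> h \<in> ?H \<and> \<pi> h \<noteq> h \<and> \<pi> (\<pi> h) = h" if "h \<in> ?H" for h
    using pi dom sym irr that by metis
  define nx where "nx = (\<lambda>h::nat \<times> nat. (fst h, Suc (snd h) mod ?d (fst h)))"
  have nxH: "nx h \<in> ?H" if "h \<in> ?H" for h
    using that by (auto simp: half_edges_def nx_def)
  have H: "?H = Sigma ?V (\<lambda>v. {..<?d v})" by (auto simp: half_edges_def)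
  have finH: "finite ?H" unfolding H using fin by simp
  define iso where "iso = card {v \<in> ?V. ?d v = 0}"
  define Y where "Y = {\<eta> \<in> PiE ?H (\<lambda>_. ?B). \<forall>h h'. joined G h h' \<longrightarrow> \<eta> h' = \<eta> h}"
  have Y: "Y = {\<eta> \<in> PiE ?H (\<lambda>_. ?B). \<forall>h\<in>?H. \<eta> (\<pi> h) = \<eta> h}"
  proof -
    have "joined G h h' \<longleftrightarrow> h \<in> ?H \<and> h' = \<pi> h" for h h' using pi dom by metis
    then have "(\<forall>h h'. joined G h h' \<longrightarrow> \<eta> h' = \<eta> h) \<longleftrightarrow> (\<forall>h\<in>?H. \<eta> (\<pi> h) = \<eta> h)" for \<eta> :: "nat \<times> nat \<Rightarrow> 'c"
      by auto
    then show ?thesis by (simp add: Y_def)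
  qed
  have prod_corner: "(\<Prod>v\<in>?V. trace (map (\<lambda>j. \<eta> (v, j)) [0..<?d v]))
    = of_nat n ^ iso * (\<Sum>c\<in>PiE ?V (\<lambda>_. {..<q}). \<Sum>i\<in>PiE ?H (\<lambda>_. {..<n}). \<Prod>h\<in>?H. M (\<eta> h) (c (fst h)) (i h) (i (nx h)))" for \<eta>
  proof -
    have iso': "(\<Prod>v\<in>?V. if ?d v = 0 then (of_nat n :: complex) else 1) = of_nat n ^ iso"
      using prod.inter_filter[OF fin, of "\<lambda>_. of_nat n :: complex" "\<lambda>v. ?d v = 0"] by (simp add: iso_def)
    have "(\<Prod>v\<in>?V. trace (map (\<lambda>j. \<eta> (v, j)) [0..<?d v]))
      = of_nat n ^ iso * (\<Prod>v\<in>?V. \<Sum>c<q. \<Sum>w\<in>PiE {..<?d v} (\<lambda>_. {..<n}). \<Prod>j<?d v. M (\<eta> (v, j)) c (w j) (w (Suc j mod ?d v)))"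
      unfolding trace_corners prod.distrib iso' ..
    also have "(\<Prod>v\<in>?V. \<Sum>c<q. \<Sum>w\<in>PiE {..<?d v} (\<lambda>_. {..<n}). \<Prod>j<?d v. M (\<eta> (v, j)) c (w j) (w (Suc j mod ?d v)))
      = (\<Sum>c\<in>PiE ?V (\<lambda>_. {..<q}). \<Sum>W\<in>PiE ?V (\<lambda>v. PiE {..<?d v} (\<lambda>_. {..<n})). \<Prod>v\<in>?V. \<Prod>j<?d v. M (\<eta> (v, j)) (c v) (W v j) (W v (Suc j mod ?d v)))"
      by (rule trans[OF prod_sum_choice[OF fin]], simp, rule sum.cong[OF refl], rule prod_sum_choice[OF fin])
        (auto intro!: finite_PiE)
    also have "\<dots> = (\<Sum>c\<in>PiE ?V (\<lambda>_. {..<q}). \<Sum>i\<in>PiE ?H (\<lambda>_. {..<n}). \<Prod>h\<in>?H. M (\<eta> h) (c (fst h)) (i h) (i (nx h)))"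
    proof (rule sum.cong[OF refl], rule sum.reindex_bij_witness[where
          j = "\<lambda>W. \<lambda>h\<in>?H. W (fst h) (snd h)" and i = "\<lambda>i. \<lambda>v\<in>?V. \<lambda>j\<in>{..<?d v}. i (v, j)"], goal_cases)
      case (1 c W)
      then have W: "W \<in> PiE ?V (\<lambda>v. PiE {..<?d v} (\<lambda>_. {..<n}))" by simp
      show ?case
      proof
        fix v
        show "(\<lambda>v\<in>?V. \<lambda>j\<in>{..<?d v}. (\<lambda>h\<in>?H. W (fst h) (snd h)) (v, j)) v = W v"
        proof (cases "v \<in> ?V")
          case True
          then have "W v \<in> extensional {..<?d v}" using W by (auto simp: PiE_iff)
          then show ?thesis using True by (intro ext) (auto simp: half_edges_def extensional_def)
        next
          case False
          then show ?thesis using W by (auto simp: PiE_def extensional_def)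
        qed
      qed
    next
      case (2 c W)
      then show ?case by (auto simp: PiE_iff half_edges_def)
    next
      case (3 c i)
      then show ?case by (intro ext) (auto simp: half_edges_def PiE_def extensional_def)
    next
      case (4 c i)
      then show ?case by (auto simp: PiE_iff half_edges_def)
    next
      case (5 c W)
      have "(\<Prod>h\<in>?H. M (\<eta> h) (c (fst h)) ((\<lambda>h\<in>?H. W (fst h) (snd h)) h) ((\<lambda>h\<in>?H. W (fst h) (snd h)) (nx h)))
        = (\<Prod>h\<in>?H. M (\<eta> h) (c (fst h)) (W (fst h) (snd h)) (W (fst h) (Suc (snd h) mod ?d (fst h))))"
        using nxH by (intro prod.cong refl) (simp add: nx_def)
      also have "\<dots> = (\<Prod>v\<in>?V. \<Prod>j<?d v. M (\<eta> (v, j)) (c v) (W v j) (W v (Suc j mod ?d v)))"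
        unfolding H using fin by (subst prod.Sigma) (auto simp: case_prod_beta)
      finally show ?case by simp
    qed
    finally show ?thesis .
  qed
  define cond where "cond = (\<lambda>(c :: nat \<Rightarrow> nat) (i :: nat \<times> nat \<Rightarrow> nat) h.
    c (fst h) = c (fst (\<pi> h)) \<and> i h = i (nx (\<pi> h)) \<and> i (nx h) = i (\<pi> h))"
  have "(\<Sum>\<eta>\<in>Y. \<Prod>v\<in>?V. trace (map (\<lambda>j. \<eta> (v, j)) [0..<?d v]))
    = of_nat n ^ iso * (\<Sum>c\<in>PiE ?V (\<lambda>_. {..<q}). \<Sum>i\<in>PiE ?H (\<lambda>_. {..<n}). \<Sum>\<eta>\<in>Y. \<Prod>h\<in>?H. M (\<eta> h) (c (fst h)) (i h) (i (nx h)))"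
    unfolding prod_corner sum_distrib_left[symmetric]
    by (subst sum.swap, subst sum.swap[of _ _ Y]) simp
  also have "\<dots> = of_nat n ^ iso * (\<Sum>c\<in>PiE ?V (\<lambda>_. {..<q}). \<Sum>i\<in>PiE ?H (\<lambda>_. {..<n}). of_bool (\<forall>h\<in>?H. cond c i h))"
  proof (rule arg_cong[where f = "\<lambda>x. of_nat n ^ iso * x"], intro sum.cong refl)
    fix c i assume c: "c \<in> PiE ?V (\<lambda>_. {..<q})" and i: "i \<in> PiE ?H (\<lambda>_. {..<n})"
    show "(\<Sum>\<eta>\<in>Y. \<Prod>h\<in>?H. M (\<eta> h) (c (fst h)) (i h) (i (nx h))) = of_bool (\<forall>h\<in>?H. cond c i h)"
      unfolding Y
    proof (rule sum_paired[where \<phi> = "\<lambda>h b. M b (c (fst h)) (i h) (i (nx h))"])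
      show "finite ?H" "finite ?B" using finH finite_B0 by auto
      fix h assume h: "h \<in> ?H"
      show "\<pi> h \<in> ?H \<and> \<pi> h \<noteq> h \<and> \<pi> (\<pi> h) = h" by (rule pH[OF h])
      have ph: "\<pi> h \<in> ?H" using pH[OF h] by simp
      have b: "c (fst k) < q" "i k < n" "i (nx k) < n" if "k \<in> ?H" for k
        using c i nxH[OF that] that by (auto simp: PiE_iff half_edges_def)
      show "(\<Sum>b\<in>?B. M b (c (fst h)) (i h) (i (nx h)) * M b (c (fst (\<pi> h))) (i (\<pi> h)) (i (nx (\<pi> h)))) = of_bool (cond c i h)"
        using complete[OF b(1)[OF h] b(1)[OF ph] b(2,3)[OF h] b(2,3)[OF ph]] by (simp only: cond_def)
      show "cond c i (\<pi> h) = cond c i h" using pH[OF h] by (auto simp: cond_def)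
    qed
  qed
  also have "\<dots> = of_nat n ^ iso * (\<Sum>c\<in>PiE ?V (\<lambda>_. {..<q}). \<Sum>i\<in>PiE ?H (\<lambda>_. {..<n}).
      of_bool (\<forall>v v'. (\<exists>j j'. joined G (v, j) (v', j')) \<longrightarrow> c v = c v') * of_bool (\<forall>h h'. boundary_step G h h' \<longrightarrow> i h = i h'))"
  proof (rule arg_cong[where f = "\<lambda>x. of_nat n ^ iso * x"], intro sum.cong refl)
    fix c :: "nat \<Rightarrow> nat" and i :: "nat \<times> nat \<Rightarrow> nat"
    have 1: "(\<forall>v v'. (\<exists>j j'. joined G (v, j) (v', j')) \<longrightarrow> c v = c v') \<longleftrightarrow> (\<forall>h\<in>?H. c (fst h) = c (fst (\<pi> h)))"
      using pi dom by (metis fst_conv prod.collapse)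
    have "boundary_step G h h' \<longleftrightarrow> h \<in> ?H \<and> h' = nx (\<pi> h)" for h h'
    proof
      assume "boundary_step G h h'"
      then show "h \<in> ?H \<and> h' = nx (\<pi> h)"
      proof cases
        case (1 v j)
        have h: "h \<in> ?H" using dom[OF 1(2)] by simp
        then have "\<pi> h = (v, j)" using pi[OF h] 1(2) by simp
        then show ?thesis using h 1(1) by (simp add: nx_def)
      qed
    next
      assume *: "h \<in> ?H \<and> h' = nx (\<pi> h)"
      then have "joined G h (fst (\<pi> h), snd (\<pi> h))" using pi by simp
      then show "boundary_step G h h'" using * boundary_step.intros by (simp add: nx_def)
    qed
    then have 2: "(\<forall>h h'. boundary_step G h h' \<longrightarrow> i h = i h') \<longleftrightarrow> (\<forall>h\<in>?H. i h = i (nx (\<pi> h)))" by auto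
    have 3: "(\<forall>h\<in>?H. i h = i (nx (\<pi> h))) \<longleftrightarrow> (\<forall>h\<in>?H. i h = i (nx (\<pi> h)) \<and> i (nx h) = i (\<pi> h))"
      using pH by metis
    show "(of_bool (\<forall>h\<in>?H. cond c i h) :: complex) =
      of_bool (\<forall>v v'. (\<exists>j j'. joined G (v, j) (v', j')) \<longrightarrow> c v = c v') * of_bool (\<forall>h h'. boundary_step G h h' \<longrightarrow> i h = i h')"
      unfolding 1 2 3 by (auto simp: cond_def)
  qed
  also have "\<dots> = of_nat n ^ iso * ((\<Sum>c\<in>PiE ?V (\<lambda>_. {..<q}). of_bool (\<forall>v v'. (\<exists>j j'. joined G (v, j) (v', j')) \<longrightarrow> c v = c v'))
      * (\<Sum>i\<in>PiE ?H (\<lambda>_. {..<n}). of_bool (\<forall>h h'. boundary_step G h h' \<longrightarrow> i h = i h')))"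
    by (simp only: sum_product)
  also have "(\<Sum>c\<in>PiE ?V (\<lambda>_. {..<q}). of_bool (\<forall>v v'. (\<exists>j j'. joined G (v, j) (v', j')) \<longrightarrow> c v = c v'))
    = (of_nat (card {c \<in> PiE ?V (\<lambda>_. {..<q}). \<forall>v v'. (\<exists>j j'. joined G (v, j) (v', j')) \<longrightarrow> c v = c v'}) :: complex)"
    using fin by (simp add: sum_of_bool_eq finite_PiE Int_def)
  also have "card {c \<in> PiE ?V (\<lambda>_. {..<q}). \<forall>v v'. (\<exists>j j'. joined G (v, j) (v', j')) \<longrightarrow> c v = c v'} = q ^ components G"
    unfolding components_def
    by (subst card_constant_functions[OF fin]) (use dom in \<open>auto simp: half_edges_def\<close>)
  also have "(\<Sum>i\<in>PiE ?H (\<lambda>_. {..<n}). of_bool (\<forall>h h'. boundary_step G h h' \<longrightarrow> i h = i h'))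
    = (of_nat (card {i \<in> PiE ?H (\<lambda>_. {..<n}). \<forall>h h'. boundary_step G h h' \<longrightarrow> i h = i h'}) :: complex)"
    using finH by (simp add: sum_of_bool_eq finite_PiE Int_def)
  also have "card {i \<in> PiE ?H (\<lambda>_. {..<n}). \<forall>h h'. boundary_step G h h' \<longrightarrow> i h = i h'} = n ^ num_classes ?H (boundary_step G)"
  proof (subst card_constant_functions[OF finH])
    fix h h' assume "boundary_step G h h'"
    then show "h \<in> ?H \<and> h' \<in> ?H"
    proof cases
      case (1 v j)
      then have "h \<in> ?H" "(v, j) \<in> ?H" using dom by auto
      then show ?thesis using nxH[of "(v, j)"] 1 by (auto simp: nx_def)
    qed
  qed simp
  finally show ?thesis
    unfolding Y_def[symmetric] by (simp add: boundary_components_def iso_def power_add mult_ac)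
qed

end

text \<open>
  Each component has a half-edge or is an isolated vertex, and boundary components lie in components.
\<close>

lemma components_le_boundary:
  assumes fin: "finite (vertices G)"
    and dom: "\<And>h h'. joined G h h' \<Longrightarrow> h \<in> half_edges G \<and> h' \<in> half_edges G"
  shows "components G \<le> boundary_components G"
proof -
  let ?V = "vertices G" and ?H = "half_edges G"
  define r where "r = (\<lambda>v v'. \<exists>j j'. joined G (v, j) (v', j'))"
  define cl where "cl = (\<lambda>v. Collect (equivclp r v))"
  define bl where "bl = (\<lambda>h. Collect (equivclp (boundary_step G) h))"
  have H: "?H = Sigma ?V (\<lambda>v. {..<degree G v})" by (auto simp: half_edges_def)
  have finH: "finite ?H" unfolding H using fin by simp
  have step: "cl (fst h) = cl (fst h')" if "equivclp (boundary_step G) h h'" for h h'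
    using that
  proof (rule equivclp_invariant)
    fix x y assume "boundary_step G x y"
    then show "cl (fst x) = cl (fst y)"
    proof cases
      case (1 v j)
      then have "r (fst x) (fst y)" unfolding r_def by (metis fst_conv prod.collapse)
      then show ?thesis unfolding cl_def by (blast intro: equivclp_trans equivclp_sym r_into_equivclp)
    qed
  qed
  define \<psi> where "\<psi> = (\<lambda>Z. cl (fst (SOME h :: nat \<times> nat. h \<in> Z)))"
  have psi: "\<psi> (bl h) = cl (fst h)" for h
  proof -
    have "h \<in> bl h" by (simp add: bl_def)
    then have "(SOME k. k \<in> bl h) \<in> bl h" by (rule someI)
    then have "equivclp (boundary_step G) h (SOME k. k \<in> bl h)" by (simp only: bl_def mem_Collect_eq)
    then show ?thesis unfolding \<psi>_def using step by metis
  qed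
  have "cl ` ?V \<subseteq> \<psi> ` (bl ` ?H) \<union> cl ` {v \<in> ?V. degree G v = 0}"
  proof
    fix Z assume "Z \<in> cl ` ?V"
    then obtain v where v: "v \<in> ?V" "Z = cl v" by blast
    show "Z \<in> \<psi> ` (bl ` ?H) \<union> cl ` {v \<in> ?V. degree G v = 0}"
    proof (cases "degree G v = 0")
      case False
      then have "(v, 0) \<in> ?H" using v by (simp add: half_edges_def)
      moreover have "Z = \<psi> (bl (v, 0))" using v psi by simp
      ultimately show ?thesis by blast
    qed (use v in blast)
  qed
  then have "card (cl ` ?V) \<le> card (\<psi> ` (bl ` ?H) \<union> cl ` {v \<in> ?V. degree G v = 0})"
    using fin finH by (intro card_mono) auto
  also have "\<dots> \<le> card (\<psi> ` (bl ` ?H)) + card (cl ` {v \<in> ?V. degree G v = 0})" by (rule card_Un_le)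
  also have "\<dots> \<le> card (bl ` ?H) + card {v \<in> ?V. degree G v = 0}"
    using fin finH by (intro add_mono card_image_le) auto
  finally show ?thesis
    by (simp add: components_def boundary_components_def num_classes_def cl_def bl_def r_def)
qed

section \<open>Diagrams without classical crossings\<close>

locale matrix_colour_model = matrix_model B0 e M n q \<kappa>
  for B0 :: "'c set" and e :: 'c and M n q \<kappa> +
  fixes \<alpha> :: complex
  assumes alpha_n: "\<alpha> \<noteq> 0" "\<alpha> + 1 / \<alpha> + 2 = of_nat n * (of_nat q * of_nat n)"
begin

sublocale colour_model B0 e trace \<kappa> "of_nat n" "of_nat q * of_nat n" \<alpha>
  by unfold_locales (fact alpha_n)+

lemma weight_prod: "weight a C = (\<Prod>t<length C. tau (fst (C ! t)) (inputs (fst (C ! t)) (run a (take t C))) (snd (C ! t)))"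
  by (induction a C rule: weight.induct) (simp_all add: prod.lessThan_Suc_shift del: prod.lessThan_Suc)

text \<open>
  Colourings of non-zero weight are constant on edges, and every edge ends at vertices. So the colourings are those of the
  cyclic graph, and the weights of all layers except the vertices are 1.
\<close>

lemma F_cyclic_graph:
  assumes D: "marked_diagram D" and virt: "\<And>c i. Cross c i \<in> set D \<Longrightarrow> c = Virtual"
    and all: "\<And>P. P \<in> points D \<Longrightarrow> marked D P \<and> \<not> on_circle D P"
  defines "G \<equiv> cyclic_graph_of D"
  shows "F D = of_nat q ^ components G * of_nat n ^ boundary_components G"
    and "components G \<le> boundary_components G"
proof -
  have pl: "planar_word D" and f: "fits 0 D" using D by (simp_all add: marked_diagram_def planar_word_iff)
  let ?B = "insert e B0" and ?H = "diagram_half_edges D"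
  have HG: "half_edges G = ?H" and VG: "vertices G = diagram_vertices D"
    and dG: "degree G = (\<lambda>t. ins (D ! t) + outs (D ! t))"
    by (auto simp: G_def cyclic_graph_of_def half_edges_def diagram_half_edges_def)
  have J: "joined G h h' \<longleftrightarrow> h \<in> ?H \<and> h' \<in> ?H \<and> h \<noteq> h' \<and> same_edge D (leg D h) (leg D h')" for h h'
    by (simp add: G_def cyclic_graph_of_def)
  have finV: "finite (vertices G)" by (auto simp: VG diagram_vertices_def)
  show "components G \<le> boundary_components G"
    by (rule components_le_boundary[OF finV]) (auto simp: J HG)
  have nc: "\<not> carries_classical D P" for P
    using virt unfolding carries_classical_def by (metis nth_mem)
  define A where "A = annot (\<lambda>Q. range_of (marked D Q)) 0 D"
  have out: "(Suc t, offset (D ! t) + k) \<in> points D" if "t < length D" "k < outs (D ! t)" for t k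
    using fits_layer[OF f that(1)] that by (simp add: points_def width_Suc)
  have A: "C \<in> choices A \<longleftrightarrow> map fst C = D \<and>
    (\<forall>t<length D. length (snd (C ! t)) = outs (D ! t) \<and> (\<forall>k<outs (D ! t). snd (C ! t) ! k \<in> ?B))" for C
    unfolding A_def choices_annot using out all by (auto simp: range_of_def)
  have FA: "F D = (\<Sum>C\<in>choices A. weight [] C)"
    by (simp add: F_def flagged_def amp_annot amp_sets_choices A_def)
  have finA: "finite (choices A)"
  proof -
    have "finite (choices (annot (\<lambda>Q. range_of (m Q)) t w))" for m t w
      by (induction w arbitrary: t) (auto simp: choices_Nil choices_Cons range_of_def finite_B0
          intro!: finite_imageI finite_cartesian_product finite_selections)
    then show ?thesis by (simp add: A_def)
  qed
  have size: "along sized [] C" "map fst C = D" if "C \<in> choices A" for C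
    using that unfolding A along_nth sized_def by auto
  have entryB: "entry C P \<in> ?B" if C: "C \<in> choices A" and P: "P \<in> points D" for C P
  proof -
    have S: "range_of (marked D Q) = range_of (marked D Q')" if "strand D Q Q'" for Q Q'
      unfolding marked_strand[OF that] ..
    have "run [] (take (fst P) C) \<in> selections (run [] (take (fst P) A))"
      by (rule choices_run[OF choices_take[OF C]]) (simp add: selections_Nil)
    moreover have "run [] (take (fst P) A) = row (\<lambda>Q. range_of (marked D Q)) D (fst P)"
      unfolding A_def by (rule run_annot[OF f S]) (use P in \<open>auto simp: points_def\<close>)
    ultimately have "run [] (take (fst P) C) \<in> selections (row (\<lambda>Q. range_of (marked D Q)) D (fst P))" by simp
    moreover have "snd P < length (row (\<lambda>Q. range_of (marked D Q)) D (fst P))"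
      "row (\<lambda>Q. range_of (marked D Q)) D (fst P) ! snd P = range_of (marked D P)"
      using P by (auto simp: points_def row_def)
    ultimately have "run [] (take (fst P) C) ! snd P \<in> range_of (marked D P)"
      using selections_nth by metis
    then show ?thesis
      using conjunct1[OF all[OF P]] by (simp add: entry_def range_of_def case_prod_beta)
  qed
  define good where "good = (\<lambda>C :: (layer \<times> 'c list) list. \<forall>P Q. strand D P Q \<longrightarrow> entry C P = entry C Q)"
  have goodE: "entry C P = entry C Q" if "good C" "same_edge D P Q" for C P Q
    using that(2) unfolding same_edge_def by (rule equivclp_invariant) (use that(1) in \<open>unfold good_def, blast\<close>)
  have W: "weight [] C = (\<Prod>v\<in>vertices G. trace (map (\<lambda>j. entry C (leg D (v, j))) [0..<degree G v]))"
    if C: "C \<in> choices A" "good C" for C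
  proof -
    note sz = size(1)[OF C(1)] f size(2)[OF C(1)]
    have lC: "length C = length D" using sz(3) by auto
    have fC: "fst (C ! t) = D ! t" if "t < length D" for t using sz(3) that by auto
    have "weight [] C = (\<Prod>t<length D. tau (D ! t) (inputs (D ! t) (run [] (take t C))) (snd (C ! t)))"
      unfolding weight_prod lC by (intro prod.cong refl) (simp add: fC)
    also have "\<dots> = (\<Prod>t\<in>vertices G. tau (D ! t) (inputs (D ! t) (run [] (take t C))) (snd (C ! t)))"
    proof (rule prod.mono_neutral_right)
      show "\<forall>t\<in>{..<length D} - vertices G. tau (D ! t) (inputs (D ! t) (run [] (take t C))) (snd (C ! t)) = 1"
      proof
        fix t assume "t \<in> {..<length D} - vertices G"
        then have t: "t < length D" and nv: "\<And>i a b. D ! t \<noteq> Vertex i a b"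
          by (auto simp: VG diagram_vertices_def)
        note el = entry_layer(3,4)[OF sz t]
        have S: "strand D P Q \<Longrightarrow> entry C P = entry C Q" for P Q using C(2) unfolding good_def by blast
        show "tau (D ! t) (inputs (D ! t) (run [] (take t C))) (snd (C ! t)) = 1"
        proof (cases "D ! t")
          case (Cup i)
          then show ?thesis using el(1)[of 0] el(1)[of 1] S[OF strand.cup[OF t Cup]] by simp
        next
          case (Cap i)
          then show ?thesis using el(2)[of 0] el(2)[of 1] S[OF strand.cap[OF t Cap]] by simp
        next
          case (Cross c i)
          then have "c = Virtual" using virt t by (metis nth_mem)
          then show ?thesis
            using Cross el(1)[of 0] el(1)[of 1] el(2)[of 0] el(2)[of 1] S[OF strand.cross_rising[OF t Cross]] S[OF strand.cross_falling[OF t Cross]]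
            by simp
        next
          case (Vertex i a b)
          then show ?thesis using nv by simp
        next
          case (Mark i)
          then show ?thesis using el(1)[of 0] el(2)[of 0] S[OF strand.mark[OF t Mark]] by simp
        qed
      qed
    qed (auto simp: VG diagram_vertices_def)
    also have "\<dots> = (\<Prod>v\<in>vertices G. trace (map (\<lambda>j. entry C (leg D (v, j))) [0..<degree G v]))"
    proof (rule prod.cong[OF refl])
      fix t assume "t \<in> vertices G"
      then obtain i a b where t: "t < length D" and V: "D ! t = Vertex i a b" by (auto simp: VG diagram_vertices_def)
      note el = entry_layer(3,4)[OF sz t]
      have li: "length (inputs (D ! t) (run [] (take t C))) = a"
        using length_run_take[OF sz(1), of t] sz(2,3) fits_layer[OF f t] V by (simp add: inputs_def)
      have lg: "length (snd (C ! t)) = b" using C(1) t V unfolding A by simp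
      have "inputs (D ! t) (run [] (take t C)) @ rev (snd (C ! t)) = map (\<lambda>j. entry C (leg D (t, j))) [0..<a + b]"
      proof (rule nth_equalityI)
        show "length (inputs (D ! t) (run [] (take t C)) @ rev (snd (C ! t))) = length (map (\<lambda>j. entry C (leg D (t, j))) [0..<a + b])"
          using li lg by simp
        fix j assume "j < length (inputs (D ! t) (run [] (take t C)) @ rev (snd (C ! t)))"
        then have j: "j < a + b" using li lg by simp
        show "(inputs (D ! t) (run [] (take t C)) @ rev (snd (C ! t))) ! j = map (\<lambda>j. entry C (leg D (t, j))) [0..<a + b] ! j"
        proof (cases "j < a")
          case True
          then show ?thesis using j li el(2)[of j] V by (simp add: nth_append leg_def)
        next
          case False
          then have "a + b - Suc j < b" using j by simp
          then show ?thesis using j li lg False el(1)[of "a + b - Suc j"] V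
            by (simp add: nth_append leg_def rev_nth add.commute[of b a])
        qed
      qed
      then show "tau (D ! t) (inputs (D ! t) (run [] (take t C))) (snd (C ! t)) = trace (map (\<lambda>j. entry C (leg D (t, j))) [0..<degree G t])"
        by (simp add: V dG)
    qed
    finally show ?thesis .
  qed
  define Y where "Y = {\<eta> \<in> PiE ?H (\<lambda>_. ?B). \<forall>h h'. joined G h h' \<longrightarrow> \<eta> h' = \<eta> h}"
  define hf where "hf = (\<lambda>Q. SOME h. h \<in> ?H \<and> same_edge D Q (leg D h))"
  have hf: "hf Q \<in> ?H \<and> same_edge D Q (leg D (hf Q))" if "Q \<in> points D" for Q
  proof -
    have "\<exists>h. h \<in> ?H \<and> same_edge D Q (leg D h)" using all[OF that] by (auto simp: on_circle_def)
    then show ?thesis unfolding hf_def by (rule someI_ex)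
  qed
  have hfc: "hf Q = hf Q'" if "strand D Q Q'" for Q Q'
  proof -
    have "same_edge D Q X = same_edge D Q' X" for X
      using same_edge_equiv(4)[OF that] same_edge_equiv(2,3) by blast
    then show ?thesis by (simp add: hf_def)
  qed
  have "F D = (\<Sum>C\<in>{C \<in> choices A. good C}. weight [] C)"
    unfolding FA
  proof (rule sum.mono_neutral_right[OF finA])
    show "\<forall>C\<in>choices A - {C \<in> choices A. good C}. weight [] C = 0"
      using colour_strand[OF size(1) f size(2) _ _ nc] unfolding good_def by blast
  qed auto
  also have "\<dots> = (\<Sum>\<eta>\<in>Y. \<Prod>v\<in>vertices G. trace (map (\<lambda>j. \<eta> (v, j)) [0..<degree G v]))"
  proof (rule sum.reindex_bij_witness[where j = "\<lambda>C. \<lambda>h\<in>?H. entry C (leg D h)" and i = "\<lambda>\<eta>. annot (\<lambda>Q. \<eta> (hf Q)) 0 D"], goal_cases)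
    case (1 C)
    then have C: "C \<in> choices A" "good C" by auto
    show ?case
    proof (rule nth_equalityI)
      show "length (annot (\<lambda>Q. (\<lambda>h\<in>?H. entry C (leg D h)) (hf Q)) 0 D) = length C"
        using size(2)[OF C(1)] by auto
      fix t assume "t < length (annot (\<lambda>Q. (\<lambda>h\<in>?H. entry C (leg D h)) (hf Q)) 0 D)"
      then have t: "t < length D" by simp
      have "snd (C ! t) = map (\<lambda>k. (\<lambda>h\<in>?H. entry C (leg D h)) (hf (Suc t, offset (D ! t) + k))) [0..<outs (D ! t)]"
      proof (rule nth_equalityI)
        show "length (snd (C ! t)) = length (map (\<lambda>k. (\<lambda>h\<in>?H. entry C (leg D h)) (hf (Suc t, offset (D ! t) + k))) [0..<outs (D ! t)])"
          using C(1) t unfolding A by simp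
        fix k assume "k < length (snd (C ! t))"
        then have k: "k < outs (D ! t)" using C(1) t unfolding A by simp
        note h = hf[OF out[OF t k]]
        have "entry C (Suc t, offset (D ! t) + k) = snd (C ! t) ! k"
          by (rule entry_layer(3)[OF size(1)[OF C(1)] f size(2)[OF C(1)] t k])
        then show "snd (C ! t) ! k = map (\<lambda>k. (\<lambda>h\<in>?H. entry C (leg D h)) (hf (Suc t, offset (D ! t) + k))) [0..<outs (D ! t)] ! k"
          using goodE[OF C(2) conjunct2[OF h]] conjunct1[OF h] k by simp
      qed
      then show "annot (\<lambda>Q. (\<lambda>h\<in>?H. entry C (leg D h)) (hf Q)) 0 D ! t = C ! t"
        using t size(2)[OF C(1)] by (auto simp: annot_nth prod_eq_iff)
    qed
  next
    case (2 C)
    then have C: "C \<in> choices A" "good C" by auto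
    then show ?case
      using entryB[OF C(1) leg_points[OF f]] goodE[OF C(2)] unfolding Y_def J
      by (auto simp: same_edge_equiv(2))
  next
    case (3 \<eta>)
    then have \<eta>: "\<eta> \<in> PiE ?H (\<lambda>_. ?B)" "\<And>h h'. joined G h h' \<Longrightarrow> \<eta> h' = \<eta> h" by (auto simp: Y_def)
    have "entry (annot (\<lambda>Q. \<eta> (hf Q)) 0 D) (leg D h) = \<eta> h" if h: "h \<in> ?H" for h
    proof -
      have "entry (annot (\<lambda>Q. \<eta> (hf Q)) 0 D) (leg D h) = \<eta> (hf (leg D h))"
        by (rule entry_annot[OF f _ leg_points[OF f h]]) (simp add: hfc)
      also have "\<dots> = \<eta> h"
        using hf[OF leg_points[OF f h]] h \<eta>(2)[of h "hf (leg D h)"] unfolding J by metis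
      finally show ?thesis .
    qed
    then show ?case using \<eta>(1) by (intro ext) (auto simp: PiE_def extensional_def)
  next
    case (4 \<eta>)
    then have \<eta>: "\<eta> \<in> PiE ?H (\<lambda>_. ?B)" by (auto simp: Y_def)
    have "annot (\<lambda>Q. \<eta> (hf Q)) 0 D \<in> choices A"
      unfolding A using hf[OF out] \<eta> by (auto simp: annot_nth PiE_iff)
    moreover have "good (annot (\<lambda>Q. \<eta> (hf Q)) 0 D)"
      unfolding good_def
    proof (intro allI impI)
      fix P Q assume s: "strand D P Q"
      show "entry (annot (\<lambda>Q. \<eta> (hf Q)) 0 D) P = entry (annot (\<lambda>Q. \<eta> (hf Q)) 0 D) Q"
        by (rule entry_strand[OF consistent_annot[OF f] f _ s]) (simp_all add: hfc)
    qed
    ultimately show ?case by simp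
  next
    case (5 C)
    then have C: "C \<in> choices A" "good C" by auto
    show ?case
      unfolding W[OF C]
      by (intro prod.cong arg_cong[where f = trace] map_cong refl) (auto simp: HG[symmetric] half_edges_def)
  qed
  also have "\<dots> = of_nat q ^ components G * of_nat n ^ boundary_components G"
    unfolding Y_def HG[symmetric]
  proof (rule cyclic_graph_sum[OF finV])
    show "\<exists>!h'. joined G h h'" if "h \<in> half_edges G" for h
      using other_half_edge[OF pl, of h] that unfolding J HG by metis
    show "joined G h h' \<Longrightarrow> joined G h' h" for h h' unfolding J using same_edge_equiv(2) by blast
  qed (auto simp: J HG)
  finally show "F D = of_nat q ^ components G * of_nat n ^ boundary_components G" .
qed

end

section \<open>Orthonormal bases containing a multiple of the unit\<close>

text \<open>
  A combination of a matrix unit and its transpose for which the basis is orthonormal without conjugation, and not merely dual to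
  the transposed basis.
\<close>

definition hermitian_unit :: "nat \<times> nat \<times> nat \<Rightarrow> nat \<Rightarrow> nat \<Rightarrow> nat \<Rightarrow> complex" where
  "hermitian_unit x c p r = (case x of (c', i, j) \<Rightarrow> of_bool (c' = c) *
     ((1 + \<i>) / 2 * (of_bool (i = p) * of_bool (j = r)) + (1 - \<i>) / 2 * (of_bool (i = r) * of_bool (j = p))))"

lemma sum_delta2:
  "\<lbrakk>p < n; r < n\<rbrakk> \<Longrightarrow> (\<Sum>i<n. \<Sum>j<n. of_bool (i = p) * of_bool (j = r) * f i j) = (f p r :: complex)" for n :: nat
proof -
  assume *: "p < n" "r < n"
  have "(\<Sum>i<n. \<Sum>j<n. of_bool (i = p) * of_bool (j = r) * f i j) = (\<Sum>i<n. of_bool (i = p) * (\<Sum>j<n. of_bool (j = r) * f i j))"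
    by (simp only: sum_distrib_left mult.assoc)
  also have "\<dots> = f p r"
    using * by (simp add: of_bool_def if_distrib[of "\<lambda>c. c * _"] cong: if_cong)
  finally show ?thesis .
qed

lemma sum_delta1: "p < n \<Longrightarrow> (\<Sum>i<n. of_bool (i = p) * f i) = (f p :: complex)" for n :: nat
  by (simp add: of_bool_def if_distrib[of "\<lambda>c. c * _"] cong: if_cong)

lemma hermitian_pair:
  assumes "p < n" "r < n" "p' < n" "r' < (n::nat)"
  shows "(\<Sum>i<n. \<Sum>j<n.
     ((1 + \<i>) / 2 * (of_bool (i = p) * of_bool (j = r)) + (1 - \<i>) / 2 * (of_bool (i = r) * of_bool (j = p))) *
     ((1 + \<i>) / 2 * (of_bool (i = p') * of_bool (j = r')) + (1 - \<i>) / 2 * (of_bool (i = r') * of_bool (j = p'))))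
    = of_bool (p = r' \<and> r = p')"
proof -
  define g where "g i j = (1 + \<i>) / 2 * (of_bool (i = p') * of_bool (j = r')) + (1 - \<i>) / 2 * (of_bool (i = r') * of_bool (j = p'))" for i j
  have "(\<Sum>i<n. \<Sum>j<n. ((1 + \<i>) / 2 * (of_bool (i = p) * of_bool (j = r)) + (1 - \<i>) / 2 * (of_bool (i = r) * of_bool (j = p))) * g i j)
    = (1 + \<i>) / 2 * (\<Sum>i<n. \<Sum>j<n. of_bool (i = p) * of_bool (j = r) * g i j) + (1 - \<i>) / 2 * (\<Sum>i<n. \<Sum>j<n. of_bool (i = r) * of_bool (j = p) * g i j)"
    by (simp only: sum_distrib_left sum.distrib[symmetric] distrib_right mult.assoc)
  also have "\<dots> = (1 + \<i>) / 2 * g p r + (1 - \<i>) / 2 * g r p"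
    using assms by (simp only: sum_delta2)
  also have "\<dots> = of_bool (p = r' \<and> r = p')"
    by (auto simp: g_def field_simps)
  finally show ?thesis by (simp only: g_def)
qed

lemma sum_triple: "(\<Sum>x\<in>{..<q} \<times> {..<n} \<times> {..<m}. f x) = (\<Sum>c<q. \<Sum>i<n. \<Sum>j<m. f (c, i, j))"
  for q n m :: nat
  by (simp add: sum.cartesian_product case_prod_beta)

lemma hermitian_complete:
  assumes "c < q" "c' < q" "p < n" "r < n" "p' < n" "r' < n"
  shows "(\<Sum>x\<in>{..<q} \<times> {..<n} \<times> {..<n}. hermitian_unit x c p r * hermitian_unit x c' p' r') = of_bool (c = c' \<and> p = r' \<and> r = p')"
proof -
  have "(\<Sum>x\<in>{..<q} \<times> {..<n} \<times> {..<n}. hermitian_unit x c p r * hermitian_unit x c' p' r')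
    = (\<Sum>d<q. of_bool (d = c) * (of_bool (d = c') * (\<Sum>i<n. \<Sum>j<n.
     ((1 + \<i>) / 2 * (of_bool (i = p) * of_bool (j = r)) + (1 - \<i>) / 2 * (of_bool (i = r) * of_bool (j = p))) *
     ((1 + \<i>) / 2 * (of_bool (i = p') * of_bool (j = r')) + (1 - \<i>) / 2 * (of_bool (i = r') * of_bool (j = p'))))))"
    unfolding sum_triple hermitian_unit_def prod.case sum_distrib_left
    by (intro sum.cong refl) (simp only: mult_ac)
  also have "\<dots> = of_bool (c = c' \<and> p = r' \<and> r = p')"
    unfolding hermitian_pair[OF assms(3-6)] using assms(1) by (simp add: sum_delta1 of_bool_conj)
  finally show ?thesis .
qed

lemma hermitian_orthonormal:
  assumes "x \<in> {..<q} \<times> {..<n} \<times> {..<n}" "y \<in> {..<q} \<times> {..<n} \<times> {..<n}"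
  shows "(\<Sum>c<q. \<Sum>p<n. \<Sum>r<n. hermitian_unit x c p r * hermitian_unit y c r p) = of_bool (x = y)"
proof -
  obtain c1 i j c2 k l where xy: "x = (c1, i, j)" "y = (c2, k, l)" by (metis prod.collapse)
  have b: "c1 < q" "c2 < q" "i < n" "j < n" "k < n" "l < n" using assms by (auto simp: xy)
  have "(\<Sum>c<q. \<Sum>p<n. \<Sum>r<n. hermitian_unit x c p r * hermitian_unit y c r p)
    = (\<Sum>d<q. of_bool (d = c1) * (of_bool (d = c2) * (\<Sum>p<n. \<Sum>r<n.
     ((1 + \<i>) / 2 * (of_bool (p = i) * of_bool (r = j)) + (1 - \<i>) / 2 * (of_bool (p = j) * of_bool (r = i))) *
     ((1 + \<i>) / 2 * (of_bool (p = l) * of_bool (r = k)) + (1 - \<i>) / 2 * (of_bool (p = k) * of_bool (r = l))))))"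
    unfolding xy hermitian_unit_def prod.case sum_distrib_left
    by (intro sum.cong refl) (simp only: eq_commute[of c1] eq_commute[of c2] eq_commute[of i] eq_commute[of j] eq_commute[of k] eq_commute[of l] mult_ac)
  also have "\<dots> = of_bool (x = y)"
    unfolding hermitian_pair[OF b(3,4,6,5)] using b(1) by (auto simp: sum_delta1 xy)
  finally show ?thesis .
qed

text \<open>
  The normalized unit has norm one; a reflection moves the given orthonormal basis to one that contains it.
\<close>

lemma matrix_model_exists:
  assumes n: "2 \<le> n" and q: "1 \<le> q" and \<kappa>: "\<kappa>\<^sup>2 * (of_nat q * of_nat n) = 1" "\<kappa> \<noteq> 1"
  shows "\<exists>M. matrix_model ({..<q} \<times> {..<n} \<times> {..<n} - {(0, 0, 0)}) (0, 0, 0) M n q \<kappa>"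
proof -
  let ?I = "{..<q} \<times> {..<n} \<times> {..<n}" and ?e = "(0, 0, 0) :: nat \<times> nat \<times> nat"
  \<comment> \<open>the coordinates of the normalized unit; \<open>R\<close> is the reflection that exchanges it with the basis vector \<open>(0, 0, 0)\<close>\<close>
  define d where "d = (\<lambda>x :: nat \<times> nat \<times> nat. \<kappa> * of_bool (fst (snd x) = snd (snd x)))"
  define y where "y = (\<lambda>x. d x - of_bool (x = ?e))"
  define R where "R = (\<lambda>x z. of_bool (x = z) - y x * y z / (1 - \<kappa>))"
  define M where "M = (\<lambda>x c p r. \<Sum>z\<in>?I. R x z * hermitian_unit z c p r)"
  have fin: "finite ?I" by simp
  have e: "?e \<in> ?I" using n q by auto
  have ins: "insert ?e (?I - {?e}) = ?I" using e by auto
  have delta: "(\<Sum>z\<in>?I. of_bool (x = z) * f z) = f x" "(\<Sum>z\<in>?I. of_bool (z = x) * f z) = f x"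
    if "x \<in> ?I" for x and f :: "_ \<Rightarrow> complex"
    using that fin by (simp_all add: of_bool_def if_distrib[of "\<lambda>c. c * _"] cong: if_cong del: mem_Sigma_iff)
  have dd: "(\<Sum>z\<in>?I. d z * d z) = 1"
  proof -
    have "(\<Sum>z\<in>?I. d z * d z) = (\<Sum>c<q. \<Sum>i<n. \<Sum>j<n. of_bool (j = i) * \<kappa>\<^sup>2)"
      unfolding sum_triple by (intro sum.cong refl) (auto simp: d_def power2_eq_square)
    also have "\<dots> = (\<Sum>c<q. \<Sum>i<n. \<kappa>\<^sup>2)"
      by (intro sum.cong refl) (rule sum_delta1, simp)
    also have "\<dots> = \<kappa>\<^sup>2 * (of_nat q * of_nat n)" by (simp add: mult_ac)
    finally show ?thesis using \<kappa>(1) by simp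
  qed
  have yy: "(\<Sum>z\<in>?I. y z * y z) = 2 * (1 - \<kappa>)"
  proof -
    have "(\<Sum>z\<in>?I. y z * y z) = (\<Sum>z\<in>?I. d z * d z) - 2 * (\<Sum>z\<in>?I. of_bool (z = ?e) * d z) + (\<Sum>z\<in>?I. of_bool (z = ?e) * 1)"
      by (simp only: sum_distrib_left sum_subtractf[symmetric] sum.distrib[symmetric])
        (intro sum.cong refl, auto simp: y_def algebra_simps)
    then show ?thesis unfolding dd delta(2)[OF e] by (simp add: d_def)
  qed
  have k1: "1 - \<kappa> \<noteq> 0" using \<kappa>(2) by simp
  have RR: "(\<Sum>x\<in>?I. R x z * R x z') = of_bool (z = z')" if z: "z \<in> ?I" "z' \<in> ?I" for z z'
  proof -
    have "(\<Sum>x\<in>?I. R x z * R x z') = (\<Sum>x\<in>?I. of_bool (x = z) * of_bool (x = z')) - (\<Sum>x\<in>?I. of_bool (x = z) * (y x * y z')) / (1 - \<kappa>)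
      - (\<Sum>x\<in>?I. of_bool (x = z') * (y x * y z)) / (1 - \<kappa>) + (\<Sum>x\<in>?I. y x * y x) * (y z * y z') / (1 - \<kappa>)\<^sup>2"
      by (simp only: sum_divide_distrib sum_distrib_right sum_subtractf[symmetric] sum.distrib[symmetric])
        (intro sum.cong refl, simp add: R_def algebra_simps power2_eq_square)
    also have "\<dots> = of_bool (z = z') - y z * y z' / (1 - \<kappa>) - y z' * y z / (1 - \<kappa>) + 2 * (1 - \<kappa>) * (y z * y z') / (1 - \<kappa>)\<^sup>2"
      unfolding yy using z by (simp only: delta)
    also have "2 * (1 - \<kappa>) * (y z * y z') / (1 - \<kappa>)\<^sup>2 = 2 * (y z * y z') / (1 - \<kappa>)"
      using k1 by (simp only: frac_eq_eq power_eq_0_iff not_False_eq_True simp_thms) (simp add: power2_eq_square algebra_simps)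
    finally show ?thesis by (simp add: algebra_simps add_divide_distrib[symmetric])
  qed
  have Rsym: "R x z = R z x" for x z by (auto simp: R_def)
  have Re: "R ?e z = d z" for z
  proof -
    have ye: "y ?e = - (1 - \<kappa>)" by (simp add: y_def d_def)
    have "y ?e * y z / (1 - \<kappa>) = - y z"
      by (simp only: ye mult_minus_left minus_divide_left[symmetric] nonzero_mult_div_cancel_left[OF k1])
    then show ?thesis by (auto simp: R_def y_def)
  qed
  have prod: "(\<Sum>z\<in>?I. f z) * (\<Sum>z\<in>?I. g z) = (\<Sum>z\<in>?I. \<Sum>z'\<in>?I. f z * g z')" for f g :: "_ \<Rightarrow> complex"
    by (rule sum_product)
  have "matrix_model (?I - {?e}) ?e M n q \<kappa>"
  proof
    show "finite (?I - {?e})" "?e \<notin> ?I - {?e}" using fin by auto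
    show "\<kappa>\<^sup>2 * (of_nat q * of_nat n) = 1" by (fact \<kappa>)
  next
    fix c c' i j i' j' assume b: "c < q" "c' < q" "i < n" "j < n" "i' < n" "j' < n"
    have "(\<Sum>b\<in>?I. M b c i j * M b c' i' j') = (\<Sum>b\<in>?I. \<Sum>z\<in>?I. \<Sum>z'\<in>?I. (R b z * R b z') * (hermitian_unit z c i j * hermitian_unit z' c' i' j'))"
      unfolding M_def prod by (intro sum.cong refl) (simp only: mult_ac)
    also have "\<dots> = (\<Sum>z\<in>?I. \<Sum>z'\<in>?I. \<Sum>b\<in>?I. (R b z * R b z') * (hermitian_unit z c i j * hermitian_unit z' c' i' j'))"
      by (subst sum.swap, rule sum.cong[OF refl], rule sum.swap)
    also have "\<dots> = (\<Sum>z\<in>?I. \<Sum>z'\<in>?I. of_bool (z = z') * (hermitian_unit z c i j * hermitian_unit z' c' i' j'))"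
      by (intro sum.cong refl) (simp only: sum_distrib_right[symmetric] RR)
    also have "\<dots> = (\<Sum>z\<in>?I. hermitian_unit z c i j * hermitian_unit z c' i' j')"
      by (intro sum.cong refl) (rule delta(1))
    also have "\<dots> = of_bool (c = c' \<and> i = j' \<and> j = i')" by (rule hermitian_complete[OF b])
    finally show "(\<Sum>b\<in>insert ?e (?I - {?e}). M b c i j * M b c' i' j') = of_bool (c = c' \<and> i = j' \<and> j = i')"
      unfolding ins .
  next
    fix b b' assume b: "b \<in> insert ?e (?I - {?e})" "b' \<in> insert ?e (?I - {?e})"
    note b = b[unfolded ins]
    have "(\<Sum>c<q. \<Sum>i<n. \<Sum>j<n. M b c i j * M b' c j i)
      = (\<Sum>c<q. \<Sum>i<n. \<Sum>j<n. \<Sum>z\<in>?I. \<Sum>z'\<in>?I. (R b z * R b' z') * (hermitian_unit z c i j * hermitian_unit z' c j i))"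
      unfolding M_def prod by (intro sum.cong refl) (simp only: mult_ac)
    also have "\<dots> = (\<Sum>x\<in>?I. \<Sum>z\<in>?I. \<Sum>z'\<in>?I. (R b z * R b' z') * (hermitian_unit z (fst x) (fst (snd x)) (snd (snd x)) * hermitian_unit z' (fst x) (snd (snd x)) (fst (snd x))))"
      unfolding sum_triple[where f = "\<lambda>x. \<Sum>z\<in>?I. \<Sum>z'\<in>?I. (R b z * R b' z') * (hermitian_unit z (fst x) (fst (snd x)) (snd (snd x)) * hermitian_unit z' (fst x) (snd (snd x)) (fst (snd x)))"]
      by simp
    also have "\<dots> = (\<Sum>z\<in>?I. \<Sum>z'\<in>?I. \<Sum>x\<in>?I. (R b z * R b' z') * (hermitian_unit z (fst x) (fst (snd x)) (snd (snd x)) * hermitian_unit z' (fst x) (snd (snd x)) (fst (snd x))))"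
      by (subst sum.swap, rule sum.cong[OF refl], rule sum.swap)
    also have "\<dots> = (\<Sum>z\<in>?I. \<Sum>z'\<in>?I. of_bool (z = z') * (R b z * R b' z'))"
    proof (intro sum.cong refl)
      fix z z' assume z: "z \<in> ?I" "z' \<in> ?I"
      have "(\<Sum>x\<in>?I. hermitian_unit z (fst x) (fst (snd x)) (snd (snd x)) * hermitian_unit z' (fst x) (snd (snd x)) (fst (snd x))) = of_bool (z = z')"
        unfolding sum_triple[where f = "\<lambda>x. hermitian_unit z (fst x) (fst (snd x)) (snd (snd x)) * hermitian_unit z' (fst x) (snd (snd x)) (fst (snd x))"]
        using hermitian_orthonormal[OF z] by simp
      then show "(\<Sum>x\<in>?I. (R b z * R b' z') * (hermitian_unit z (fst x) (fst (snd x)) (snd (snd x)) * hermitian_unit z' (fst x) (snd (snd x)) (fst (snd x))))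
        = of_bool (z = z') * (R b z * R b' z')"
        by (simp only: sum_distrib_left[symmetric] mult.commute)
    qed
    also have "\<dots> = (\<Sum>z\<in>?I. R b z * R b' z)"
      by (intro sum.cong refl) (rule delta(1))
    also have "\<dots> = of_bool (b = b')"
      using RR[OF b] by (simp only: Rsym[of b] Rsym[of b'])
    finally show "(\<Sum>c<q. \<Sum>i<n. \<Sum>j<n. M b c i j * M b' c j i) = of_bool (b = b')" .
  next
    fix c i j assume b: "c < q" "i < n" "j < n"
    have "M ?e c i j = (\<Sum>c'<q. \<Sum>k<n. \<Sum>l<n. of_bool (l = k) * (\<kappa> * hermitian_unit (c', k, l) c i j))"
      unfolding M_def Re sum_triple by (intro sum.cong refl) (auto simp: d_def)
    also have "\<dots> = (\<Sum>c'<q. \<Sum>k<n. \<kappa> * hermitian_unit (c', k, k) c i j)"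
      by (intro sum.cong refl) (rule sum_delta1, simp)
    also have "\<dots> = (\<Sum>c'<q. of_bool (c' = c) * (\<Sum>k<n. of_bool (k = i) * (\<kappa> * of_bool (k = j))))"
      unfolding hermitian_unit_def sum_distrib_left by (intro sum.cong refl) (auto simp: field_simps)
    also have "\<dots> = \<kappa> * of_bool (i = j)"
      unfolding sum_delta1[OF b(1)] by (rule sum_delta1[OF b(2)])
    finally show "M ?e c i j = \<kappa> * of_bool (i = j)" .
  qed
  then show ?thesis by blast
qed

section \<open>Laurent polynomials and their values\<close>

abbreviation keys :: "laurent \<Rightarrow> (int \<times> int) set" where "keys \<equiv> Poly_Mapping.keys"
abbreviation coefficient :: "laurent \<Rightarrow> int \<times> int \<Rightarrow> int" where "coefficient \<equiv> Poly_Mapping.lookup"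

definition evaluate :: "complex \<Rightarrow> complex \<Rightarrow> laurent \<Rightarrow> complex" where
  "evaluate a x p = (\<Sum>k\<in>keys p. of_int (coefficient p k) * (a powi fst k * x powi snd k))"

lemma evaluate_superset:
  "finite A \<Longrightarrow> keys p \<subseteq> A \<Longrightarrow> evaluate a x p = (\<Sum>k\<in>A. of_int (coefficient p k) * (a powi fst k * x powi snd k))"
  unfolding evaluate_def by (rule sum.mono_neutral_left) (auto simp: in_keys_iff)

lemma evaluate_add: "evaluate a x (p + p') = evaluate a x p + evaluate a x p'"
proof -
  let ?A = "keys p \<union> keys p'"
  have A: "finite ?A" "keys p \<subseteq> ?A" "keys p' \<subseteq> ?A" "keys (p + p') \<subseteq> ?A" by (auto simp: Poly_Mapping.keys_add)
  show ?thesis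
    unfolding evaluate_superset[OF A(1,2)] evaluate_superset[OF A(1,3)] evaluate_superset[OF A(1,4)]
    by (simp add: lookup_add ring_distribs sum.distrib)
qed

lemma evaluate_0: "evaluate a x 0 = 0"
  by (simp add: evaluate_def)

lemma evaluate_uminus: "evaluate a x (- p) = - evaluate a x p"
  using evaluate_add[of a x p "- p"] by (simp add: evaluate_0 eq_neg_iff_add_eq_0 add.commute)

lemma evaluate_diff: "evaluate a x (p - p') = evaluate a x p - evaluate a x p'"
  using evaluate_add[of a x p "- p'"] by (simp add: evaluate_uminus)

lemma evaluate_single: "evaluate a x (Poly_Mapping.single k c) = of_int c * (a powi fst k * x powi snd k)"
  by (cases "c = 0") (simp_all add: evaluate_def)

lemma laurent_induct [case_names single add]:
  assumes "\<And>k c. P (Poly_Mapping.single k c)" "\<And>p p'. P p \<Longrightarrow> P p' \<Longrightarrow> P (p + p')"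
  shows "P (p :: laurent)"
proof (induction p rule: update_induct)
  case const
  show ?case using assms(1)[of undefined 0] by simp
next
  case (update f k b)
  have "Poly_Mapping.update k b f = f + Poly_Mapping.single k b"
    using update(1) by (intro poly_mapping_eqI) (auto simp: lookup_update lookup_add lookup_single in_keys_iff)
  then show ?case using assms update by metis
qed

lemma evaluate_mult:
  assumes "a \<noteq> 0" "x \<noteq> 0"
  shows "evaluate a x (p * p') = evaluate a x p * evaluate a x p'"
proof (induction p rule: laurent_induct)
  case (single k c)
  show ?case
  proof (induction p' rule: laurent_induct)
    case (single l d)
    then show ?case using assms by (simp add: mult_single evaluate_single power_int_add)
  qed (simp add: ring_distribs evaluate_add)
qed (simp add: ring_distribs evaluate_add)

lemma evaluate_monomial: "evaluate a x (monomial i j) = a powi i * x powi j"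
  by (simp add: monomial_def evaluate_single)

lemma evaluate_one: "evaluate a x 1 = 1"
  using evaluate_single[of a x 0 1] by simp

lemma evaluate_numeral: "evaluate a x (numeral k) = numeral k"
  using evaluate_single[of a x 0 "numeral k"] by simp

lemma evaluate_power: "a \<noteq> 0 \<Longrightarrow> x \<noteq> 0 \<Longrightarrow> evaluate a x (p ^ k) = evaluate a x p ^ k"
  by (induction k) (simp_all add: evaluate_one evaluate_mult)

lemma evaluate_neg_alpha_power: "evaluate a x (neg_alpha_power i) = (- a) powi i"
  by (simp add: neg_alpha_power_def evaluate_uminus evaluate_monomial power_int_minus_left)

lemma evaluate_neg_x_power: "evaluate a x (neg_x_power i) = (- x) powi i"
  by (simp add: neg_x_power_def evaluate_uminus evaluate_monomial power_int_minus_left)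

lemma powi_decay: "i < 0 \<Longrightarrow> (\<lambda>m. real m powi i) \<longlonglongrightarrow> 0"
proof -
  assume "i < 0"
  then obtain r where r: "i = - int (Suc r)"
    by (metis negD)
  have "(\<lambda>m. inverse (real m) ^ Suc r) \<longlonglongrightarrow> 0 ^ Suc r"
    by (intro tendsto_power lim_inverse_n)
  then show ?thesis unfolding r power_int_minus power_int_of_nat by (simp add: power_inverse[symmetric] del: power_Suc)
qed

text \<open>
  Dividing by the highest power of the variable leaves only the terms of highest degree in the limit.
\<close>

lemma leading_terms_vanish:
  fixes h :: "'a \<Rightarrow> nat \<Rightarrow> real"
  assumes A: "finite A" "\<And>k. k \<in> A \<Longrightarrow> d k \<le> D"
    and lim: "\<And>k. k \<in> A \<Longrightarrow> h k \<longlonglongrightarrow> L k"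
    and zero: "\<And>m. m \<ge> from_here \<Longrightarrow> (\<Sum>k\<in>A. h k m * real m powi d k) = 0"
  shows "(\<Sum>k\<in>{k \<in> A. d k = D}. L k) = 0"
proof -
  have t: "(\<lambda>m. h k m * real m powi (d k - D)) \<longlonglongrightarrow> (if d k = D then L k else 0)" if k: "k \<in> A" for k
  proof (cases "d k = D")
    case False
    then have "d k - D < 0" using A(2)[OF k] by simp
    from tendsto_mult[OF lim[OF k] powi_decay[OF this]] show ?thesis using False by simp
  qed (use lim[OF k] in simp)
  have "(\<lambda>m. \<Sum>k\<in>A. h k m * real m powi (d k - D)) \<longlonglongrightarrow> (\<Sum>k\<in>A. if d k = D then L k else 0)"
    by (rule tendsto_sum) (rule t)
  moreover have "\<forall>\<^sub>F m in sequentially. (\<Sum>k\<in>A. h k m * real m powi (d k - D)) = 0"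
  proof (rule eventually_sequentiallyI[of "max 1 from_here"])
    fix m assume m: "max 1 from_here \<le> m"
    then have "(\<Sum>k\<in>A. h k m * real m powi (d k - D)) = (\<Sum>k\<in>A. h k m * real m powi d k) / real m powi D"
      by (simp add: sum_divide_distrib power_int_diff)
    then show "(\<Sum>k\<in>A. h k m * real m powi (d k - D)) = 0" using zero[of m] m by simp
  qed
  ultimately have "(\<lambda>m. 0 :: real) \<longlonglongrightarrow> (\<Sum>k\<in>A. if d k = D then L k else 0)"
    using tendsto_cong by fastforce
  then have "(\<Sum>k\<in>A. if d k = D then L k else 0) = 0" by (simp add: tendsto_const_iff)
  then show ?thesis using A(1) by (simp add: sum.inter_filter)
qed

lemma loop_parameter:
  fixes s :: real
  assumes "4 \<le> s"
  shows "\<exists>a. a \<noteq> 0 \<and> a + 1 / a + 2 = s \<and> s - 3 \<le> a \<and> a \<le> s"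
proof -
  define c where "c = s / 2 - 1"
  define a where "a = c + sqrt (c\<^sup>2 - 1)"
  have c: "1 \<le> c" using assms by (simp add: c_def)
  then have c2: "1 \<le> c\<^sup>2" by (simp add: one_le_power)
  have a1: "1 \<le> a" using c c2 by (simp add: a_def add_increasing2)
  have "a * (c - sqrt (c\<^sup>2 - 1)) = 1"
    using c2 by (simp add: a_def algebra_simps power2_eq_square[symmetric])
  then have "1 / a = c - sqrt (c\<^sup>2 - 1)" using a1 by (simp add: field_simps)
  then have "a + 1 / a + 2 = s" by (simp add: a_def c_def)
  moreover have "0 < 1 / a" "1 / a \<le> 1" using a1 by auto
  ultimately show ?thesis using a1 by (intro exI[of _ a]) auto
qed

text \<open>
  For fixed \<open>n\<close> the parameter \<open>a\<close> grows like \<open>n\<^sup>2 * q\<close>. The limit for large \<open>q\<close> isolates the terms in which the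
  difference of the two exponents is maximal; among these all exponents of \<open>n\<close> are distinct, and the limit for large \<open>n\<close> isolates one
  coefficient.
\<close>

lemma laurent_eqI:
  assumes "\<And>n q a. 2 \<le> n \<Longrightarrow> 1 \<le> q \<Longrightarrow> a \<noteq> 0 \<Longrightarrow> a + 1 / a + 2 = of_nat n * (of_nat q * of_nat n) \<Longrightarrow>
    evaluate a (- 1 / (of_nat q * of_nat n)) p = evaluate a (- 1 / (of_nat q * of_nat n)) p'"
  shows "p = p'"
proof (rule ccontr)
  assume "p \<noteq> p'"
  define r where "r = p - p'"
  have "r \<noteq> 0" using \<open>p \<noteq> p'\<close> by (simp add: r_def)
  then have ne: "keys r \<noteq> {}" by simp
  have r0: "(\<Sum>k\<in>keys r. of_int (coefficient r k) * (a powi fst k * (- 1 / (real q * real n)) powi snd k)) = (0 :: real)"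
    if *: "2 \<le> n" "1 \<le> q" "a \<noteq> 0" "a + 1 / a + 2 = real n * (real q * real n)" for n q a
  proof -
    have "complex_of_real a + 1 / complex_of_real a + 2 = of_nat n * (of_nat q * of_nat n)"
      using arg_cong[OF *(4), of complex_of_real] by simp
    then have "evaluate (of_real a) (- 1 / (of_nat q * of_nat n)) r = 0"
      using assms[OF *(1,2), of "of_real a"] *(3) by (simp add: r_def evaluate_diff)
    moreover have "evaluate (of_real a) (- 1 / (of_nat q * of_nat n)) r
      = of_real (\<Sum>k\<in>keys r. of_int (coefficient r k) * (a powi fst k * (- 1 / (real q * real n)) powi snd k))"
      by (simp add: evaluate_def of_real_power_int)
    ultimately show ?thesis by (simp only: of_real_eq_0_iff)
  qed
  define a where "a = (\<lambda>n q. SOME a :: real. a \<noteq> 0 \<and> a + 1 / a + 2 = real n * (real q * real n) \<and>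
    real n * (real q * real n) - 3 \<le> a \<and> a \<le> real n * (real q * real n))"
  have a: "a n q \<noteq> 0" "a n q + 1 / a n q + 2 = real n * (real q * real n)"
    "real n * (real q * real n) - 3 \<le> a n q" "a n q \<le> real n * (real q * real n)" if "2 \<le> n" "1 \<le> q" for n q
  proof -
    have "2 * (1 * 2) \<le> real n * (real q * real n)" using that by (intro mult_mono) auto
    from someI_ex[OF loop_parameter[of "real n * (real q * real n)"]] this
    show "a n q \<noteq> 0" "a n q + 1 / a n q + 2 = real n * (real q * real n)"
      "real n * (real q * real n) - 3 \<le> a n q" "a n q \<le> real n * (real q * real n)"
      unfolding a_def by simp_all
  qed
  have lim: "(\<lambda>q. a n q / real q) \<longlonglongrightarrow> (real n)\<^sup>2" if n: "2 \<le> n" for n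
  proof (rule tendsto_sandwich)
    show "\<forall>\<^sub>F q in sequentially. (real n)\<^sup>2 - 3 * inverse (real q) \<le> a n q / real q"
    proof (rule eventually_sequentiallyI)
      fix q :: nat assume q: "1 \<le> q"
      then have "((real n)\<^sup>2 - 3 * inverse (real q)) * real q = real n * (real q * real n) - 3"
        by (simp add: algebra_simps power2_eq_square)
      then show "(real n)\<^sup>2 - 3 * inverse (real q) \<le> a n q / real q"
        using a(3)[OF n q] q by (simp add: pos_le_divide_eq)
    qed
    show "\<forall>\<^sub>F q in sequentially. a n q / real q \<le> (real n)\<^sup>2"
    proof (rule eventually_sequentiallyI)
      fix q :: nat assume q: "1 \<le> q"
      then show "a n q / real q \<le> (real n)\<^sup>2"
        using a(4)[OF n q] by (simp add: pos_divide_le_eq algebra_simps power2_eq_square)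
    qed
    have "(\<lambda>q. (real n)\<^sup>2 - 3 * inverse (real q)) \<longlonglongrightarrow> (real n)\<^sup>2 - 3 * 0"
      by (intro tendsto_intros lim_inverse_n)
    then show "(\<lambda>q. (real n)\<^sup>2 - 3 * inverse (real q)) \<longlonglongrightarrow> (real n)\<^sup>2" by simp
  qed simp
  define D where "D = Max ((\<lambda>k. fst k - snd k) ` keys r)"
  define A where "A = {k \<in> keys r. fst k - snd k = D}"
  have AD: "fst k - snd k \<le> D" if "k \<in> keys r" for k using that by (simp add: D_def)
  have "D \<in> (\<lambda>k. fst k - snd k) ` keys r" unfolding D_def using ne by (intro Max_in) auto
  then have Ane: "A \<noteq> {}" unfolding A_def by blast
  \<comment> \<open>the limit for large \<open>q\<close>\<close>
  have top: "(\<Sum>k\<in>A. (of_int (coefficient r k) * (- 1) powi snd k) * real n powi (2 * fst k - snd k)) = 0" if n: "2 \<le> n" for n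
  proof -
    have "(\<Sum>k\<in>{k \<in> keys r. fst k - snd k = D}. of_int (coefficient r k) * (((real n)\<^sup>2) powi fst k * (- 1 / real n) powi snd k)) = 0"
    proof (rule leading_terms_vanish[where from_here = 1])
      show "(\<lambda>q. of_int (coefficient r k) * ((a n q / real q) powi fst k * (- 1 / real n) powi snd k))
          \<longlonglongrightarrow> of_int (coefficient r k) * (((real n)\<^sup>2) powi fst k * (- 1 / real n) powi snd k)" for k
        using n by (intro tendsto_intros lim) simp_all
      fix q :: nat assume q: "1 \<le> q"
      have eq: "of_int (coefficient r k) * ((a n q / real q) powi fst k * (- 1 / real n) powi snd k) * real q powi (fst k - snd k)
        = of_int (coefficient r k) * (a n q powi fst k * (- 1 / (real q * real n)) powi snd k)" for k
      proof -
        have "- 1 / (real q * real n) = (- 1 / real n) / real q" by simp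
        then have "(- 1 / (real q * real n)) powi snd k = (- 1 / real n) powi snd k / real q powi snd k"
          by (simp only: power_int_divide_distrib)
        then show ?thesis
          using q n by (simp only: power_int_diff power_int_divide_distrib) (simp add: power_int_diff)
      qed
      show "(\<Sum>k\<in>keys r. of_int (coefficient r k) * ((a n q / real q) powi fst k * (- 1 / real n) powi snd k) * real q powi (fst k - snd k)) = 0"
        unfolding eq by (rule r0[OF n q a(1,2)[OF n q]])
    qed (use AD in auto)
    moreover have "((real n)\<^sup>2) powi fst k * (- 1 / real n) powi snd k = (- 1) powi snd k * real n powi (2 * fst k - snd k)" for k
    proof -
      have "((real n)\<^sup>2) powi fst k = real n powi (2 * fst k)"
        using power_int_mult[of "real n" 2 "fst k"] by simp
      moreover have "(- 1 / real n) powi snd k = (- 1) powi snd k / real n powi snd k"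
        by (rule power_int_divide_distrib)
      moreover have "real n powi (2 * fst k - snd k) = real n powi (2 * fst k) / real n powi snd k"
        using n by (intro power_int_diff) auto
      ultimately show ?thesis by (simp only: times_divide_eq_right mult.commute)
    qed
    ultimately show ?thesis by (simp only: A_def mult.assoc)
  qed
  have finA: "finite A" by (simp add: A_def)
  \<comment> \<open>the limit for large \<open>n\<close>\<close>
  define E where "E = Max ((\<lambda>k. 2 * fst k - snd k) ` A)"
  have "E \<in> (\<lambda>k. 2 * fst k - snd k) ` A" unfolding E_def using finA Ane by (intro Max_in) auto
  then obtain k where k: "k \<in> A" "2 * fst k - snd k = E" by blast
  have "(\<Sum>k\<in>{k \<in> A. 2 * fst k - snd k = E}. of_int (coefficient r k) * (- 1) powi snd k :: real) = 0"
    by (rule leading_terms_vanish[where from_here = 2 and h = "\<lambda>k _. of_int (coefficient r k) * (- 1) powi snd k"])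
      (use finA top in \<open>auto simp: E_def\<close>)
  moreover have "{k \<in> A. 2 * fst k - snd k = E} = {k}"
    using k by (auto simp: A_def prod_eq_iff)
  ultimately have "coefficient r k = 0" by simp
  then show False using k(1) by (simp add: A_def in_keys_iff)
qed

text \<open>
  With these parameters a boundary component counts \<open>n\<close> and a component counts \<open>q\<close>.
\<close>

lemma rule_four_value:
  fixes n q :: nat
  assumes n: "2 \<le> n" and q: "1 \<le> q" and a: "a \<noteq> 0" "a + 1 / a + 2 = of_nat n * (of_nat q * of_nat n)"
    and le: "k \<le> bc"
  shows "evaluate a (- 1 / (of_nat q * of_nat n)) (neg_x_power (int bc - 2 * int k)
      * (monomial 1 0 + monomial (- 1) 0 + 2) ^ (bc - k)) = of_nat q ^ k * of_nat n ^ bc"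
proof -
  obtain r where r: "bc = k + r" using le le_Suc_ex by blast
  define N :: complex where "N = of_nat n"
  define Q :: complex where "Q = of_nat q"
  have nz: "N \<noteq> 0" "Q \<noteq> 0" using n q by (auto simp: N_def Q_def)
  have "evaluate a (- 1 / (Q * N)) (neg_x_power (int bc - 2 * int k) * (monomial 1 0 + monomial (- 1) 0 + 2) ^ (bc - k))
    = (1 / (Q * N)) powi (int r - int k) * (N * (Q * N)) ^ r"
    using nz a by (simp add: evaluate_mult evaluate_power evaluate_add evaluate_neg_x_power evaluate_monomial evaluate_numeral r
      power_int_minus divide_inverse N_def[symmetric] Q_def[symmetric])
  also have "\<dots> = Q ^ k * N ^ bc"
    using nz by (simp add: power_int_diff r power_add power_mult_distrib field_simps)
  finally show ?thesis by (simp add: N_def Q_def)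
qed

section \<open>The polynomial determined by the rules\<close>

definition classical :: "layer \<Rightarrow> bool" where
  "classical l \<longleftrightarrow> (\<exists>c i. l = Cross c i \<and> c \<noteq> Virtual)"

text \<open>
  A minimum counts more than the vertex of degree two by which it is replaced.
\<close>

fun cost :: "layer \<Rightarrow> nat" where
  "cost (Cup i) = 3"
| "cost (Vertex i m n) = m + n"
| "cost l = 0"

definition crossings :: "layer list \<Rightarrow> nat" where "crossings w = length (filter classical w)"
definition total_cost :: "layer list \<Rightarrow> nat" where "total_cost w = sum_list (map cost w)"
text \<open>
  The number of unmarked strands; a layer \<open>Mark\<close> only contributes a marked one.
\<close>

definition falses :: "(layer \<times> bool list) list \<Rightarrow> nat" where
  "falses A = sum_list (map (\<lambda>x. length (filter Not (snd x))) A)"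

lemma total_cost_simps [simp]: "total_cost [] = 0" "total_cost (l # w) = cost l + total_cost w"
  "total_cost (u @ v) = total_cost u + total_cost v"
  by (simp_all add: total_cost_def)

lemma crossings_simps [simp]: "crossings [] = 0" "crossings (l # w) = of_bool (classical l) + crossings w"
  "crossings (u @ v) = crossings u + crossings v"
  by (simp_all add: crossings_def)

lemma falses_simps [simp]: "falses [] = 0" "falses ((l, g) # A) = length (filter Not g) + falses A"
  "falses (A @ A') = falses A + falses A'"
  by (simp_all add: falses_def)

lemma filter_Not_mono:
  assumes "\<And>x. m' x \<Longrightarrow> m x"
  shows "length (filter Not (map m xs)) \<le> length (filter Not (map m' xs))"
    and "length (filter Not (map m xs)) = length (filter Not (map m' xs)) \<Longrightarrow> map m xs = map m' xs"
proof -
  define S where "S f = {k. k < length xs \<and> \<not> f (xs ! k)}" for f :: "'a \<Rightarrow> bool"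
  have L: "length (filter Not (map f xs)) = card (S f)" for f
    unfolding length_filter_conv_card S_def by (rule arg_cong[where f = card]) auto
  have sub: "S m \<subseteq> S m'" and fin: "finite (S m')" using assms by (auto simp: S_def)
  show "length (filter Not (map m xs)) \<le> length (filter Not (map m' xs))"
    unfolding L by (rule card_mono[OF fin sub])
  show "map m xs = map m' xs" if "length (filter Not (map m xs)) = length (filter Not (map m' xs))"
  proof -
    have "S m = S m'" using that unfolding L by (rule card_subset_eq[OF fin sub])
    then show ?thesis by (intro nth_equalityI) (auto simp: S_def set_eq_iff)
  qed
qed

lemma falses_annot:
  assumes m: "\<And>x. m' x \<Longrightarrow> m x"
  shows "falses (annot m t w) \<le> falses (annot m' t w) \<and>
    (falses (annot m t w) = falses (annot m' t w) \<longrightarrow> annot m t w = annot m' t w)"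
proof (induction w arbitrary: t)
  case (Cons l w)
  let ?g = "\<lambda>m. map (\<lambda>q. m (Suc t, offset l + q)) [0..<outs l]"
  have 1: "length (filter Not (?g m)) \<le> length (filter Not (?g m'))"
    "length (filter Not (?g m)) = length (filter Not (?g m')) \<longrightarrow> ?g m = ?g m'"
    using filter_Not_mono[of "\<lambda>q. m' (Suc t, offset l + q)" "\<lambda>q. m (Suc t, offset l + q)"] m by blast+
  note ih = Cons[of "Suc t"]
  show ?case
    unfolding annot.simps falses_simps
  proof (intro conjI impI)
    show "length (filter Not (?g m)) + falses (annot m (Suc t) w) \<le> length (filter Not (?g m')) + falses (annot m' (Suc t) w)"
      using 1(1) ih by linarith
    assume "length (filter Not (?g m)) + falses (annot m (Suc t) w) = length (filter Not (?g m')) + falses (annot m' (Suc t) w)"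
    then have "length (filter Not (?g m)) = length (filter Not (?g m'))" "falses (annot m (Suc t) w) = falses (annot m' (Suc t) w)"
      using 1(1) ih by linarith+
    then have "?g m = ?g m'" "annot m (Suc t) w = annot m' (Suc t) w" using 1(2) ih by blast+
    then show "(l, ?g m) # annot m (Suc t) w = (l, ?g m') # annot m' (Suc t) w" by (simp only:)
  qed
qed simp

lemma falses_mark:
  assumes D: "fits 0 (u @ v)" and P: "(length u, i) \<in> points (u @ v)" "\<not> marked (u @ v) (length u, i)"
  shows "falses (flagged (u @ [Mark i] @ v)) < falses (flagged (u @ v))"
proof -
  let ?D = "u @ v" and ?P = "(length u, i)"
  define m where "m = (\<lambda>Q. marked ?D Q \<or> same_edge ?D ?P Q)"
  have m: "m Q = m Q'" if "strand ?D Q Q'" for Q Q'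
    unfolding m_def marked_strand[OF that] same_edge_strand[OF that] ..
  have le: "falses (annot m 0 ?D) \<le> falses (flagged ?D)"
    and eq: "falses (annot m 0 ?D) = falses (flagged ?D) \<longrightarrow> annot m 0 ?D = flagged ?D"
    using falses_annot[of "marked ?D" m 0 ?D] by (auto simp: m_def flagged_def)
  have "annot m 0 ?D \<noteq> flagged ?D"
  proof
    assume "annot m 0 ?D = flagged ?D"
    then have "entry (annot m 0 ?D) ?P = entry (annot (marked ?D) 0 ?D) ?P" by (simp add: flagged_def)
    moreover have "entry (annot m 0 ?D) ?P = m ?P" by (rule entry_annot[OF D m P(1)])
    moreover have "entry (annot (marked ?D) 0 ?D) ?P = marked ?D ?P"
      by (rule entry_annot[OF D marked_strand P(1)])
    ultimately show False using P(2) same_edge_equiv(1) by (simp add: m_def)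
  qed
  then have "falses (annot m 0 ?D) < falses (flagged ?D)" using le eq by linarith
  moreover have "falses (flagged (u @ [Mark i] @ v)) = falses (annot m 0 ?D)"
    unfolding flagged_mark(1)[OF D P(1), folded m_def] annot_append by simp
  ultimately show ?thesis by simp
qed

lemma marked_diagram_mark:
  assumes D: "marked_diagram (u @ v)" and P: "(length u, i) \<in> points (u @ v)" "\<not> carries_classical (u @ v) (length u, i)"
  shows "marked_diagram (u @ [Mark i] @ v)"
proof -
  let ?D = "u @ v" and ?P = "(length u, i)"
  have pl: "planar_word ?D" and f: "fits 0 ?D" using D by (simp_all add: marked_diagram_def planar_word_iff)
  define m where "m = (\<lambda>Q. marked ?D Q \<or> same_edge ?D ?P Q)"
  note M = flagged_mark[OF f P(1), folded m_def]
  have m: "m Q = m Q'" if "strand ?D Q Q'" for Q Q'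
    unfolding m_def marked_strand[OF that] same_edge_strand[OF that] ..
  let ?A = "annot m 0 ?D"
  have sz: "along sized [] ?A" by (rule consistent_sized[OF consistent_annot[OF f m]])
  have mA: "map fst ?A = ?D" by simp
  have nm: "\<not> marked ?D (t, j) \<and> \<not> marked ?D (t, Suc j)" if "t < length ?D" "?D ! t = Cross c j" "c \<noteq> Virtual" for t c j
    using D marked_diagram_points[OF f] that unfolding marked_diagram_def by blast
  have "along clear [] ?A"
    unfolding along_nth
  proof (intro allI impI)
    fix t assume "t < length ?A"
    then have t: "t < length ?D" by simp
    have fst: "fst (?A ! t) = ?D ! t" using t by (simp add: annot_nth)
    show "clear (fst (?A ! t)) (inputs (fst (?A ! t)) (run [] (take t ?A))) (snd (?A ! t))"
      unfolding fst clear_def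
    proof (intro allI impI)
      fix c j assume c: "?D ! t = Cross c j" "c \<noteq> Virtual"
      have pt: "(t, j) \<in> points ?D" "(t, Suc j) \<in> points ?D"
        using fits_layer[OF f t] t c by (auto simp: points_def)
      have nP: "\<not> same_edge ?D ?P (t, j)" "\<not> same_edge ?D ?P (t, Suc j)"
        using P(2) t c unfolding carries_classical_def by blast+
      note el = entry_layer(4)[OF sz f mA t]
      have i: "inputs (?D ! t) (run [] (take t ?A)) ! 0 = m (t, j)" "inputs (?D ! t) (run [] (take t ?A)) ! 1 = m (t, Suc j)"
        using el[of 0] el[of 1] entry_annot[OF f m pt(1)] entry_annot[OF f m pt(2)] c by simp_all
      show "\<not> inputs (?D ! t) (run [] (take t ?A)) ! 0 \<and> \<not> inputs (?D ! t) (run [] (take t ?A)) ! 1"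
      proof -
        have "\<not> m (t, j) \<and> \<not> m (t, Suc j)" unfolding m_def using nm[OF t c] nP by blast
        then show ?thesis unfolding i .
      qed
    qed
  qed
  moreover have "update (Mark i) [True] (run [] (annot m 0 u)) = run [] (annot m 0 u)"
    using id_take_nth_drop[of i "run [] (annot m 0 u)"] M(4,5) by (simp add: update_def)
  ultimately have "along clear [] (flagged (u @ [Mark i] @ v))"
    unfolding M(1) by (simp add: annot_append clear_def)
  then show ?thesis
    using pl M(2,3) by (simp add: marked_diagram_clear planar_word_iff)
qed

lemma surviving_le: "finite A \<Longrightarrow> surviving S t A \<le> card A"
  unfolding surviving_def by (rule card_mono) auto

lemma surviving_less: "finite A \<Longrightarrow> p \<in> A \<Longrightarrow> (t, p) \<in> S \<Longrightarrow> surviving S t A < card A"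
  unfolding surviving_def by (rule psubset_card_mono) auto

lemma total_cost_delete_layer: "total_cost (delete_layer S t l) \<le> cost l"
  using surviving_le[of "{i..<i + m}" S t for i m] by (cases l) (auto intro!: add_mono order_trans[OF surviving_le])

lemma total_cost_delete_layers: "total_cost (delete_layers S t w) \<le> total_cost w"
  by (induction w arbitrary: t) (auto intro!: add_mono total_cost_delete_layer)

lemma total_cost_delete_less:
  assumes "k < length w" "total_cost (delete_layer S (t + k) (w ! k)) < cost (w ! k)"
  shows "total_cost (delete_layers S t w) < total_cost w"
  using assms
proof (induction w arbitrary: t k)
  case (Cons l w)
  show ?case
  proof (cases k)
    case 0
    then show ?thesis using Cons.prems total_cost_delete_layers[of S "Suc t" w] by simp
  next
    case (Suc k')
    then have "total_cost (delete_layers S (Suc t) w) < total_cost w"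
      using Cons.prems by (intro Cons.IH) auto
    then show ?thesis using total_cost_delete_layer[of S t l] by simp
  qed
qed simp

lemma crossings_delete_layers: "crossings w = 0 \<Longrightarrow> crossings (delete_layers S t w) = 0"
proof (induction w arbitrary: t)
  case (Cons l w)
  then have "crossings (delete_layer S t l) = 0"
    by (cases l) (auto simp: classical_def)
  with Cons show ?case by simp
qed simp

lemma total_cost_delete_edge:
  assumes "\<not> on_circle D P"
  shows "total_cost (delete_edge P D) < total_cost D"
proof -
  obtain h where h: "h \<in> diagram_half_edges D" "same_edge D P (leg D h)"
    using assms by (auto simp: on_circle_def)
  obtain t j where tj: "h = (t, j)" by (cases h)
  obtain i m n where t: "t < length D" and V: "D ! t = Vertex i m n" and j: "j < m + n"
    using h(1) by (auto simp: tj diagram_half_edges_def diagram_vertices_def)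
  let ?S = "Collect (same_edge D P)"
  have le: "surviving ?S t {i..<i + m} \<le> m" "surviving ?S (Suc t) {i..<i + n} \<le> n"
    using surviving_le[of "{i..<i + m}" ?S t] surviving_le[of "{i..<i + n}" ?S "Suc t"] by simp_all
  have "surviving ?S t {i..<i + m} + surviving ?S (Suc t) {i..<i + n} < m + n"
  proof (cases "j < m")
    case True
    then have "surviving ?S t {i..<i + m} < m"
      using h(2) V surviving_less[of "{i..<i + m}" "i + j" t ?S] by (simp add: tj leg_def)
    then show ?thesis using le by simp
  next
    case False
    then have "i \<le> i + (m + n) - Suc j \<and> i + (m + n) - Suc j < i + n" using j by linarith
    then have "surviving ?S (Suc t) {i..<i + n} < n"
      using False h(2) V j surviving_less[of "{i..<i + n}" "i + (m + n - 1 - j)" "Suc t" ?S] by (simp add: tj leg_def)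
    then show ?thesis using le by simp
  qed
  then show ?thesis
    unfolding delete_edge_def using t V by (intro total_cost_delete_less[of t]) simp_all
qed

text \<open>
  The lowest point of a circle component cannot be continued downwards.
\<close>

lemma circle_has_cup:
  assumes D: "planar_word D" and Q: "Q \<in> points D" "on_circle D Q"
  obtains t i where "t < length D" "D ! t = Cup i" "same_edge D Q (Suc t, i)"
proof -
  have f: "fits 0 D" using D by (simp add: planar_word_iff)
  define lev where "lev = (\<lambda>k. \<exists>p. (k, p) \<in> points D \<and> same_edge D Q (k, p))"
  have "lev (fst Q)" using Q(1) same_edge_equiv(1)[of D Q] by (cases Q) (auto simp: lev_def)
  then have "lev (LEAST k. lev k)" by (rule LeastI)
  then obtain k p where k: "k = (LEAST k. lev k)" and p: "(k, p) \<in> points D" "same_edge D Q (k, p)"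
    by (auto simp: lev_def)
  have low: "\<not> ((k', p') \<in> points D \<and> same_edge D Q (k', p'))" if "k' < k" for k' p'
    using not_less_Least[of k' lev] that unfolding k lev_def by blast
  have "k \<noteq> 0" using p(1) by (cases k) (auto simp: points_def width_def)
  then obtain t where kt: "k = Suc t" by (cases k) auto
  have t: "t < length D" and pw: "p < width (take t D) - ins (D ! t) + outs (D ! t)"
    using p(1) width_Suc[of t D] by (auto simp: points_def kt)
  have fl: "offset (D ! t) + ins (D ! t) \<le> width (take t D)" by (rule fits_layer[OF f t])
  have down: "False" if "strand D (t, p') (Suc t, p)" "p' < width (take t D)" for p'
  proof -
    have "same_edge D Q (t, p')" using p(2) same_edge_equiv(2-4) that(1) kt by blast
    moreover have "(t, p') \<in> points D" using that(2) t by (simp add: points_def)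
    ultimately show False using low[of t p'] kt by simp
  qed
  have "\<exists>i. D ! t = Cup i \<and> same_edge D Q (Suc t, i)"
  proof (cases "p < offset (D ! t)")
    case True
    then show ?thesis using down[OF strand.left[OF t True]] fl by simp
  next
    case False
    show ?thesis
    proof (cases "offset (D ! t) + outs (D ! t) \<le> p")
      case True
      define p' where "p' = p - outs (D ! t) + ins (D ! t)"
      have p': "offset (D ! t) + ins (D ! t) \<le> p'" "p' < width (take t D)" "p' - ins (D ! t) + outs (D ! t) = p"
        using True pw fl by (auto simp: p'_def)
      then show ?thesis using down[of p'] strand.right[OF t p'(1,2)] by simp
    next
      case q: False
      show ?thesis
      proof (cases "D ! t")
        case (Cup i)
        then have "p = i \<or> p = Suc i" using False q by auto
        then show ?thesis
          using p(2) Cup same_edge_equiv(4)[OF strand.cup[OF t Cup]] same_edge_equiv(2,3) unfolding kt by blast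
      next
        case (Cap i)
        then show ?thesis using False q by simp
      next
        case (Cross c i)
        then have "p = i \<or> p = Suc i" using False q by auto
        then show ?thesis
          using down[of i] down[of "Suc i"] strand.cross_rising[OF t Cross] strand.cross_falling[OF t Cross] fl Cross by auto
      next
        case (Vertex i m n)
        then have pi: "i \<le> p" "p < i + n" using False q by auto
        define j where "j = m + n - 1 - (p - i)"
        have "(t, j) \<in> diagram_half_edges D"
          using t Vertex pi by (auto simp: diagram_half_edges_def diagram_vertices_def j_def)
        moreover have "leg D (t, j) = (Suc t, p)"
          using Vertex pi by (auto simp: leg_def j_def)
        ultimately show ?thesis using Q(2) p(2) unfolding on_circle_def kt by metis
      next
        case (Mark i)
        then have "p = i" using False q by auto
        then show ?thesis using down[of i] strand.mark[OF t Mark] fl Mark by simp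
      qed
    qed
  qed
  then show ?thesis using t that by blast
qed

text \<open>
  Cutting a circle at a minimum by a vertex removes connections and adds none. The edge at the new vertex has two ends, and the
  circle met no other vertex, so that both ends are at the new one.
\<close>

lemma circle_vertex:
  assumes D: "marked_diagram (u @ [Cup i] @ v)" and c: "on_circle (u @ [Cup i] @ v) (Suc (length u), i)"
  shows "marked_diagram (u @ [Vertex i 0 2] @ v)"
    and "same_edge (u @ [Vertex i 0 2] @ v) (leg (u @ [Vertex i 0 2] @ v) (length u, 0)) (leg (u @ [Vertex i 0 2] @ v) (length u, 1))"
proof -
  let ?D = "u @ [Cup i] @ v" and ?D' = "u @ [Vertex i 0 2] @ v" and ?t = "length u"
  have nth: "s \<noteq> ?t \<Longrightarrow> ?D' ! s = ?D ! s" for s by (auto simp: nth_append nth_Cons split: nat.splits)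
  have at_t: "?D' ! ?t = Vertex i 0 2" "?D ! ?t = Cup i" by simp_all
  have io: "offset (?D' ! s) = offset (?D ! s) \<and> ins (?D' ! s) = ins (?D ! s) \<and> outs (?D' ! s) = outs (?D ! s)" for s
    using nth[of s] at_t by (cases "s = ?t") auto
  have len: "length ?D' = length ?D" by simp
  have w: "width (take s ?D') = width (take s ?D)" for s
  proof (induction s)
    case (Suc s)
    show ?case
    proof (cases "s < length ?D")
      case True
      then show ?thesis using Suc io[of s] width_Suc[of s ?D] width_Suc[of s ?D'] by (simp only: len)
    next
      case False
      then have "take (Suc s) ?D' = take s ?D'" "take (Suc s) ?D = take s ?D" by simp_all
      then show ?thesis using Suc by (simp only:)
    qed
  qed simp
  have pts: "points ?D' = points ?D" unfolding points_def w len ..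
  have str: "strand ?D P Q" if "strand ?D' P Q" for P Q
    using that
  proof (cases rule: strand.cases)
    case (left t p)
    then show ?thesis using strand.left[of t ?D p] io[of t] by simp
  next
    case (right t p)
    then show ?thesis using strand.right[of t ?D p] io[of t] w[of t] by simp
  next
    case (cup t j)
    then have "t \<noteq> ?t" using at_t by auto
    then show ?thesis using cup strand.cup[of t ?D j] nth[of t] by simp
  next
    case (cap t j)
    then have "t \<noteq> ?t" using at_t by auto
    then show ?thesis using cap strand.cap[of t ?D j] nth[of t] by simp
  next
    case (cross_rising t c j)
    then have "t \<noteq> ?t" using at_t by auto
    then show ?thesis using cross_rising strand.cross_rising[of t ?D c j] nth[of t] by simp
  next
    case (cross_falling t c j)
    then have "t \<noteq> ?t" using at_t by auto
    then show ?thesis using cross_falling strand.cross_falling[of t ?D c j] nth[of t] by simp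
  next
    case (mark t j)
    then have "t \<noteq> ?t" using at_t by auto
    then show ?thesis using mark strand.mark[of t ?D j] nth[of t] by simp
  qed
  have se: "same_edge ?D P Q" if "same_edge ?D' P Q" for P Q
    using that unfolding same_edge_def by (rule equivclp_mono') (use str in blast)
  have mk: "marked ?D P" if mP: "marked ?D' P" for P
  proof -
    obtain t j where t: "t < length ?D" "?D' ! t = Mark j" "same_edge ?D' P (t, j)"
      using mP unfolding marked_def len by blast
    then have "t \<noteq> ?t" using at_t by auto
    then show ?thesis using t(1,2) se[OF t(3)] nth[of t] unfolding marked_def by metis
  qed
  have cc: "carries_classical ?D P" if cP: "carries_classical ?D' P" for P
  proof -
    obtain t c j where t: "t < length ?D" "?D' ! t = Cross c j" "c \<noteq> Virtual" "same_edge ?D' P (t, j) \<or> same_edge ?D' P (t, Suc j)"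
      using cP unfolding carries_classical_def len by blast
    then have "t \<noteq> ?t" using at_t by auto
    then have "?D ! t = Cross c j" using t(2) nth[of t] by simp
    then show ?thesis using t(1,3,4) se unfolding carries_classical_def by blast
  qed
  have pl: "planar_word ?D" using D by (simp add: marked_diagram_def)
  have "width ?D' = width (take (length ?D') ?D')" by simp
  also have "\<dots> = width (take (length ?D) ?D)" unfolding w len ..
  finally have wd: "width ?D' = width ?D" by simp
  have off: "offset (?D' ! s) = offset (?D ! s)" "ins (?D' ! s) = ins (?D ! s)" for s using io by blast+
  have "planar_word ?D'"
    unfolding planar_word_def len w off wd using pl[unfolded planar_word_def] .
  then show md: "marked_diagram ?D'"
    using D mk cc unfolding marked_diagram_def pts by blast
  have pl': "planar_word ?D'" using md by (simp add: marked_diagram_def)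
  have dv: "diagram_vertices ?D' = insert ?t (diagram_vertices ?D)"
  proof (rule set_eqI)
    fix s
    show "s \<in> diagram_vertices ?D' \<longleftrightarrow> s \<in> insert ?t (diagram_vertices ?D)"
    proof (cases "s = ?t")
      case True
      have "?t < length ?D'" by simp
      moreover have "\<exists>j m n. ?D' ! ?t = Vertex j m n" using at_t(1) by blast
      ultimately have "?t \<in> diagram_vertices ?D'" unfolding diagram_vertices_def mem_Collect_eq by (rule conjI)
      then show ?thesis unfolding True by (simp only: insertI1)
    next
      case False
      then show ?thesis unfolding diagram_vertices_def mem_Collect_eq insert_iff nth[OF False] len by blast
    qed
  qed
  have "?t \<in> diagram_vertices ?D'" unfolding dv by (rule insertI1)
  then have h0: "(?t, 0) \<in> diagram_half_edges ?D'" unfolding diagram_half_edges_def by simp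
  obtain t j where h: "(t, j) \<in> diagram_half_edges ?D'" "(t, j) \<noteq> (?t, 0)"
    and s: "same_edge ?D' (leg ?D' (?t, 0)) (leg ?D' (t, j))"
    using other_half_edge[OF pl' h0] by (auto simp: Ex1_def)
  have l0: "leg ?D' (?t, 0) = (Suc ?t, Suc i)" by (simp add: leg_def)
  have "t = ?t"
  proof (rule ccontr)
    assume t: "t \<noteq> ?t"
    have "t \<in> diagram_vertices ?D'" and j: "j < ins (?D' ! t) + outs (?D' ! t)"
      using h(1) unfolding diagram_half_edges_def by blast+
    then have "t \<in> diagram_vertices ?D" using t unfolding dv by blast
    then have "(t, j) \<in> diagram_half_edges ?D"
      using j unfolding nth[OF t] diagram_half_edges_def by blast
    moreover have leg: "leg ?D' (t, j) = leg ?D (t, j)" using nth[OF t] by (simp add: leg_def)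
    moreover have "same_edge ?D (Suc ?t, i) (leg ?D (t, j))"
    proof (rule same_edge_equiv(3))
      show "same_edge ?D (Suc ?t, i) (Suc ?t, Suc i)"
        by (rule same_edge_equiv(4)) (rule strand.cup, simp_all)
      show "same_edge ?D (Suc ?t, Suc i) (leg ?D (t, j))" using se[OF s] unfolding l0 leg .
    qed
    ultimately show False using c unfolding on_circle_def by blast
  qed
  then have "j = 1" using h by (auto simp: diagram_half_edges_def)
  then show "same_edge ?D' (leg ?D' (?t, 0)) (leg ?D' (?t, 1))" using s \<open>t = ?t\<close> by simp
qed

text \<open>
  The rules as a recursion: they remove crossings, turn circles into loops, and delete or mark edges, until all edges of a diagram
  without crossings are marked. The number of crossings, the total cost and the number of unmarked strands decrease lexicographically.
\<close>

lemma marked_diagram_induct [consumes 1, case_names crossing circle edge states]: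
  assumes "marked_diagram D"
    and crossing: "\<And>u c i v. \<lbrakk>marked_diagram (u @ [Cross c i] @ v); c \<noteq> Virtual; marked_diagram (u @ A_smoothing c i @ v);
      marked_diagram (u @ B_smoothing c i @ v); marked_diagram (u @ [Vertex i 2 2] @ v);
      P (u @ A_smoothing c i @ v); P (u @ B_smoothing c i @ v); P (u @ [Vertex i 2 2] @ v)\<rbrakk> \<Longrightarrow> P (u @ [Cross c i] @ v)"
    and circle: "\<And>u i v. \<lbrakk>marked_diagram (u @ [Cup i] @ v); marked_diagram (u @ [Vertex i 0 2] @ v);
      marked (u @ [Vertex i 0 2] @ v) (leg (u @ [Vertex i 0 2] @ v) (length u, 0)) =
        marked (u @ [Vertex i 0 2] @ v) (leg (u @ [Vertex i 0 2] @ v) (length u, 1));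
      P (u @ [Vertex i 0 2] @ v)\<rbrakk> \<Longrightarrow> P (u @ [Cup i] @ v)"
    and edge: "\<And>u v i. \<lbrakk>marked_diagram (u @ v); (length u, i) \<in> points (u @ v); \<not> on_circle (u @ v) (length u, i);
      \<not> marked (u @ v) (length u, i); \<not> carries_classical (u @ v) (length u, i);
      P (delete_edge (length u, i) (u @ v)); P (u @ [Mark i] @ v)\<rbrakk> \<Longrightarrow> P (u @ v)"
    and states: "\<And>D. \<lbrakk>marked_diagram D; \<forall>c i. Cross c i \<in> set D \<longrightarrow> c = Virtual;
      \<forall>P \<in> points D. marked D P \<and> \<not> on_circle D P\<rbrakk> \<Longrightarrow> P D"
  shows "P D"
  using assms(1)
proof (induction D rule: wf_induct_rule[OF wf_measures[of "[crossings, total_cost, \<lambda>D. falses (flagged D)]"]])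
  case (1 D)
  note IH = 1(1) and D = 1(2)
  have pl: "planar_word D" and f: "fits 0 D" using D by (simp_all add: marked_diagram_def planar_word_iff)
  show ?case
  proof (cases "\<exists>l\<in>set D. classical l")
    case True
    then obtain u c i v where Duv: "D = u @ [Cross c i] @ v" and c: "c \<noteq> Virtual"
      unfolding classical_def by (metis append_Cons append_Nil split_list)
    have cl: "classical (Cross c i)" using c by (auto simp: classical_def)
    have md: "marked_diagram (u @ v)" "marked_diagram (u @ [Cap i, Cup i] @ v)" "marked_diagram (u @ [Vertex i 2 2] @ v)"
      using crossing_replaced[OF D[unfolded Duv] c] by blast+
    have ncl: "\<not> classical (Cap i)" "\<not> classical (Cup i)" "\<not> classical (Vertex i 2 2)" by (simp_all add: classical_def)
    have less: "crossings (u @ v) < crossings D" "crossings (u @ [Cap i, Cup i] @ v) < crossings D"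
      "crossings (u @ [Vertex i 2 2] @ v) < crossings D"
      using cl ncl by (simp_all add: Duv)
    have P: "P (u @ v)" "P (u @ [Cap i, Cup i] @ v)" "P (u @ [Vertex i 2 2] @ v)"
      by (rule IH[OF _ md(1)] IH[OF _ md(2)] IH[OF _ md(3)], use less in simp)+
    show ?thesis
      unfolding Duv using c P md by (intro crossing[OF D[unfolded Duv] c]) (cases c; simp)+
  next
    case False
    then have virt: "\<forall>c i. Cross c i \<in> set D \<longrightarrow> c = Virtual" by (auto simp: classical_def)
    have cr: "crossings D = 0" using False by (auto simp: crossings_def)
    show ?thesis
    proof (cases "\<exists>Q \<in> points D. on_circle D Q")
      case True
      then obtain Q where Q: "Q \<in> points D" "on_circle D Q" by blast
      obtain t i where t: "t < length D" "D ! t = Cup i" "same_edge D Q (Suc t, i)"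
        using circle_has_cup[OF pl Q] by blast
      define u v where "u = take t D" and "v = drop (Suc t) D"
      have Duv: "D = u @ [Cup i] @ v" using id_take_nth_drop[OF t(1)] t(2) by (simp add: u_def v_def)
      have lu: "length u = t" using t(1) by (simp add: u_def)
      have oc: "on_circle D (Suc (length u), i)"
        using Q(2) t(3) same_edge_equiv(3) unfolding on_circle_def lu by blast
      note cv = circle_vertex[OF D[unfolded Duv] oc[unfolded Duv]]
      have "P (u @ [Vertex i 0 2] @ v)"
        by (rule IH[OF _ cv(1)]) (simp add: Duv classical_def)
      then show ?thesis
        unfolding Duv using circle[OF D[unfolded Duv] cv(1) marked_same_edge[OF cv(2)]] by blast
    next
      case nc: False
      show ?thesis
      proof (cases "\<exists>Q \<in> points D. \<not> marked D Q")
        case True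
        then obtain t i where ti: "(t, i) \<in> points D" "\<not> marked D (t, i)" by auto
        define u v where "u = take t D" and "v = drop t D"
        have Duv: "D = u @ v" by (simp add: u_def v_def)
        have lu: "length u = t" using ti(1) by (simp add: u_def points_def)
        have oc: "\<not> on_circle D (t, i)" using nc ti(1) by blast
        have ncc: "\<not> carries_classical D (t, i)"
          using virt nth_mem unfolding carries_classical_def by metis
        have P1: "P (delete_edge (t, i) D)"
        proof (rule IH)
          show "marked_diagram (delete_edge (t, i) D)" by (rule flagged_delete(2)[OF D ti(2) ncc])
          show "(delete_edge (t, i) D, D) \<in> measures [crossings, total_cost, \<lambda>D. falses (flagged D)]"
            using total_cost_delete_edge[OF oc] crossings_delete_layers[OF cr] cr by (simp add: delete_edge_def)
        qed
        have P2: "P (u @ [Mark i] @ v)"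
        proof (rule IH)
          show "marked_diagram (u @ [Mark i] @ v)"
            by (rule marked_diagram_mark) (use D ti ncc Duv lu in auto)
          have "falses (flagged (u @ [Mark i] @ v)) < falses (flagged D)"
            unfolding Duv by (rule falses_mark) (use f ti Duv lu in auto)
          then show "(u @ [Mark i] @ v, D) \<in> measures [crossings, total_cost, \<lambda>D. falses (flagged D)]"
            by (simp add: Duv classical_def)
        qed
        show ?thesis
          unfolding Duv by (rule edge) (use D ti oc ncc P1 P2 Duv lu in auto)
      next
        case False
        show ?thesis by (rule states[OF D virt]) (use False nc in blast)
      qed
    qed
  qed
qed

lemma yamada_rules_unique:
  assumes "yamada_rules R" "yamada_rules R'"
  shows "R = R'"
proof
  fix D
  note c = iffD1[OF yamada_rules_def assms(1)] iffD1[OF yamada_rules_def assms(2)]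
  note absorb = conjunct1[OF c(1), rule_format] conjunct1[OF c(2), rule_format]
  note c = conjunct2[OF c(1)] conjunct2[OF c(2)]
  note skein = conjunct1[OF c(1), rule_format] conjunct1[OF c(2), rule_format]
  note c = conjunct2[OF c(1)] conjunct2[OF c(2)]
  note edges = conjunct1[OF c(1), rule_format] conjunct1[OF c(2), rule_format]
  note c = conjunct2[OF c(1)] conjunct2[OF c(2)]
  note full = conjunct1[OF c(1), rule_format] conjunct1[OF c(2), rule_format]
  note none = conjunct2[OF c(1), rule_format] conjunct2[OF c(2), rule_format]
  show "R D = R' D"
  proof (cases "marked_diagram D")
    case True
    then show ?thesis
    proof (induction D rule: marked_diagram_induct)
      case (crossing u c i v)
      show ?case unfolding skein(1)[OF crossing(2,1)] skein(2)[OF crossing(2,1)] crossing(6-8) ..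
    next
      case (circle u i v)
      have T: "([Vertex i 0 2], [Cup i]) \<in> {([Vertex i 1 1], []), ([Vertex i 0 2], [Cup i]), ([Vertex i 2 0], [Cap i])}"
        by simp
      show ?case using absorb(1)[OF T circle(2,1,3)] absorb(2)[OF T circle(2,1,3)] circle(4) by (simp only:)
    next
      case (edge u v i)
      show ?case unfolding edges(1)[OF edge(1-5)] edges(2)[OF edge(1-5)] edge(6,7) ..
    next
      case (states D)
      show ?case
        by (rule trans[OF full(1) full(2)[symmetric]]) (use states in blast)+
    qed
  next
    case False
    then show ?thesis using none by metis
  qed
qed

text \<open>
  A polynomial that has the value of the diagram in all matrix models. Colours of a fixed type suffice, because a model
  exists for all \<open>n\<close> and \<open>q\<close> over this type.
\<close>

definition represents :: "laurent \<Rightarrow> layer list \<Rightarrow> bool" where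
  "represents r D \<longleftrightarrow> (\<forall>(B0 :: (nat \<times> nat \<times> nat) set) e M n q \<kappa> \<alpha>.
     2 \<le> n \<longrightarrow> 1 \<le> q \<longrightarrow> matrix_colour_model B0 e M n q \<kappa> \<alpha> \<longrightarrow>
     evaluate \<alpha> (- 1 / (of_nat q * of_nat n)) r =
       colour_model.F B0 e (matrix_model.trace M n q) (of_nat q * of_nat n) \<alpha> D)"

lemma model_exists:
  assumes n: "2 \<le> n" and q: "1 \<le> q" and a: "a \<noteq> 0" "a + 1 / a + 2 = of_nat n * (of_nat q * of_nat n)"
  shows "\<exists>(B0 :: (nat \<times> nat \<times> nat) set) e M \<kappa>. matrix_colour_model B0 e M n q \<kappa> a"
proof -
  define \<kappa> where "\<kappa> = complex_of_real (1 / sqrt (real q * real n))"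
  have "1 * 2 \<le> real q * real n" using n q by (intro mult_mono) auto
  then have pos: "1 < real q * real n" by simp
  have "\<kappa>\<^sup>2 = complex_of_real (1 / (real q * real n))"
    using pos by (simp only: \<kappa>_def of_real_power[symmetric]) (simp add: power_divide)
  then have 1: "\<kappa>\<^sup>2 * (of_nat q * of_nat n) = 1" using n q by simp
  have "1 / sqrt (real q * real n) < 1" using pos by simp
  from less_imp_neq[OF this] have 2: "\<kappa> \<noteq> 1" unfolding \<kappa>_def of_real_eq_1_iff .
  obtain M where "matrix_model ({..<q} \<times> {..<n} \<times> {..<n} - {(0, 0, 0)}) (0, 0, 0) M n q \<kappa>"
    using matrix_model_exists[OF n q 1 2] by blast
  then have "matrix_colour_model ({..<q} \<times> {..<n} \<times> {..<n} - {(0, 0, 0)}) (0, 0, 0) M n q \<kappa> a"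
    using a by (simp add: matrix_colour_model_def matrix_colour_model_axioms_def)
  then show ?thesis by blast
qed

lemma represents_unique: "represents r D \<Longrightarrow> represents r' D \<Longrightarrow> r = r'"
proof (rule laurent_eqI)
  fix n q :: nat and a :: complex
  assume r: "represents r D" "represents r' D"
    and *: "2 \<le> n" "1 \<le> q" "a \<noteq> 0" "a + 1 / a + 2 = of_nat n * (of_nat q * of_nat n)"
  show "evaluate a (- 1 / (of_nat q * of_nat n)) r = evaluate a (- 1 / (of_nat q * of_nat n)) r'"
    using model_exists[OF *] r *(1,2) unfolding represents_def by metis
qed

lemma representsI:
  assumes "\<And>(B0 :: (nat \<times> nat \<times> nat) set) e M n q \<kappa> \<alpha>. \<lbrakk>2 \<le> n; 1 \<le> q; matrix_colour_model B0 e M n q \<kappa> \<alpha>\<rbrakk> \<Longrightarrow>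
     evaluate \<alpha> (- 1 / (of_nat q * of_nat n)) r = colour_model.F B0 e (matrix_model.trace M n q) (of_nat q * of_nat n) \<alpha> D"
  shows "represents r D"
  using assms unfolding represents_def by blast

lemma representsD:
  assumes "represents r D" "2 \<le> n" "1 \<le> q" "matrix_colour_model (B0 :: (nat \<times> nat \<times> nat) set) e M n q \<kappa> \<alpha>"
  shows "colour_model.F B0 e (matrix_model.trace M n q) (of_nat q * of_nat n) \<alpha> D = evaluate \<alpha> (- 1 / (of_nat q * of_nat n)) r"
  using assms unfolding represents_def by metis

lemma represents_crossing:
  assumes D: "marked_diagram (u @ [Cross c i] @ v)" "c \<noteq> Virtual"
    and r: "represents r1 (u @ A_smoothing c i @ v)" "represents r2 (u @ B_smoothing c i @ v)" "represents r3 (u @ [Vertex i 2 2] @ v)"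
  shows "represents (monomial 1 0 * r1 + monomial (- 1) 0 * r2 + monomial 0 (- 1) * r3) (u @ [Cross c i] @ v)"
proof (rule representsI)
  fix B0 :: "(nat \<times> nat \<times> nat) set" and e M n q \<kappa> \<alpha>
  assume m: "2 \<le> n" "1 \<le> q" "matrix_colour_model B0 e M n q \<kappa> \<alpha>"
  interpret matrix_colour_model B0 e M n q \<kappa> \<alpha> by fact
  have x: "- 1 / (of_nat q * of_nat n :: complex) \<noteq> 0" using m by simp
  show "evaluate \<alpha> (- 1 / (of_nat q * of_nat n)) (monomial 1 0 * r1 + monomial (- 1) 0 * r2 + monomial 0 (- 1) * r3) = F (u @ [Cross c i] @ v)"
    unfolding F_skein[OF D] evaluate_add evaluate_mult[OF alpha_n(1) x] evaluate_monomial
      representsD[OF r(1) m] representsD[OF r(2) m] representsD[OF r(3) m]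
    by (simp add: power_int_minus divide_inverse)
qed

lemma represents_edge:
  assumes D: "marked_diagram (u @ v)" "(length u, i) \<in> points (u @ v)" "\<not> on_circle (u @ v) (length u, i)"
    "\<not> marked (u @ v) (length u, i)" "\<not> carries_classical (u @ v) (length u, i)"
    and r: "represents r1 (delete_edge (length u, i) (u @ v))" "represents r2 (u @ [Mark i] @ v)"
  shows "represents (monomial 0 1 * r1 + r2) (u @ v)"
proof (rule representsI)
  fix B0 :: "(nat \<times> nat \<times> nat) set" and e M n q \<kappa> \<alpha>
  assume m: "2 \<le> n" "1 \<le> q" "matrix_colour_model B0 e M n q \<kappa> \<alpha>"
  interpret matrix_colour_model B0 e M n q \<kappa> \<alpha> by fact
  have nz: "(of_nat q * of_nat n :: complex) \<noteq> 0" using m by simp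
  then have x: "- 1 / (of_nat q * of_nat n :: complex) \<noteq> 0" by simp
  have k: "- \<kappa>\<^sup>2 = - 1 / (of_nat q * of_nat n)" using kappa nz by (simp add: eq_divide_eq)
  show "evaluate \<alpha> (- 1 / (of_nat q * of_nat n)) (monomial 0 1 * r1 + r2) = F (u @ v)"
    unfolding F_delete[OF D] evaluate_add evaluate_mult[OF alpha_n(1) x] evaluate_monomial
      representsD[OF r(1) m] representsD[OF r(2) m] k
    by simp
qed

lemma represents_states:
  assumes D: "marked_diagram D" "\<forall>c i. Cross c i \<in> set D \<longrightarrow> c = Virtual" "\<forall>P \<in> points D. marked D P \<and> \<not> on_circle D P"
  defines "bc \<equiv> boundary_components (cyclic_graph_of D)" and "k \<equiv> components (cyclic_graph_of D)"
  shows "represents (neg_x_power (int bc - 2 * int k) * (monomial 1 0 + monomial (- 1) 0 + 2) ^ (bc - k)) D"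
proof (rule representsI)
  fix B0 :: "(nat \<times> nat \<times> nat) set" and e M n q \<kappa> \<alpha>
  assume m: "2 \<le> n" "1 \<le> q" "matrix_colour_model B0 e M n q \<kappa> \<alpha>"
  interpret matrix_colour_model B0 e M n q \<kappa> \<alpha> by fact
  have D': "Cross c i \<in> set D \<Longrightarrow> c = Virtual" "P \<in> points D \<Longrightarrow> marked D P \<and> \<not> on_circle D P" for c i P
    using D(2,3) by blast+
  have F: "F D = of_nat q ^ k * of_nat n ^ bc" and le: "k \<le> bc"
    unfolding bc_def k_def by (rule F_cyclic_graph[OF D(1) D'], assumption+)+
  show "evaluate \<alpha> (- 1 / (of_nat q * of_nat n)) (neg_x_power (int bc - 2 * int k) * (monomial 1 0 + monomial (- 1) 0 + 2) ^ (bc - k)) = F D"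
    unfolding F by (rule rule_four_value[OF m(1,2) alpha_n le])
qed

lemma represents_absorb:
  assumes T: "(T, T') \<in> {([Vertex i 1 1], []), ([Vertex i 0 2], [Cup i]), ([Vertex i 2 0], [Cap i])}"
    and D: "marked_diagram (u @ T @ v)" "marked_diagram (u @ T' @ v)"
    and m: "marked (u @ T @ v) (leg (u @ T @ v) (length u, 0)) = marked (u @ T @ v) (leg (u @ T @ v) (length u, 1))"
  shows "represents r (u @ T @ v) \<longleftrightarrow> represents r (u @ T' @ v)"
proof -
  have "colour_model.F B0 e (matrix_model.trace M n q) (of_nat q * of_nat n) \<alpha> (u @ T @ v)
    = colour_model.F B0 e (matrix_model.trace M n q) (of_nat q * of_nat n) \<alpha> (u @ T' @ v)"
    if M: "matrix_colour_model B0 e M n q \<kappa> \<alpha>"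
    for B0 :: "(nat \<times> nat \<times> nat) set" and e M n q \<kappa> \<alpha>
  proof -
    interpret matrix_colour_model B0 e M n q \<kappa> \<alpha> by fact
    from T consider "T = [Vertex i 1 1]" "T' = []" | "T = [Vertex i 0 2]" "T' = [Cup i]" | "T = [Vertex i 2 0]" "T' = [Cap i]"
      by auto
    then show ?thesis
    proof cases
      case 1
      then show ?thesis using F_absorb_through[of u i v] D m by (simp add: leg_def)
    next
      case 2
      then show ?thesis using F_absorb_cup[of u i v] D m by (simp add: leg_def)
    next
      case 3
      then show ?thesis using F_absorb_cap[of u i v] D m by (simp add: leg_def)
    qed
  qed
  then show ?thesis unfolding represents_def by metis
qed

text \<open>
  The rules express the value of a diagram through values of simpler ones, with coefficients that are values of Laurent polynomials.
\<close>

lemma represents_exists: "marked_diagram D \<Longrightarrow> \<exists>r. represents r D"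
proof (induction D rule: marked_diagram_induct)
  case (crossing u c i v)
  then show ?case using represents_crossing by blast
next
  case (circle u i v)
  then show ?case using represents_absorb[of "[Vertex i 0 2]" "[Cup i]" i u v] by blast
next
  case (edge u v i)
  then show ?case using represents_edge by blast
next
  case (states D)
  then show ?case using represents_states by blast
qed

text \<open>
  The values in the models do not depend on an order in which the rules are applied. Hence the represented polynomial satisfies
  all rules, and it is the only function that does.
\<close>

theorem yamada_represents:
  shows "yamada_rules yamada" and "marked_diagram D \<Longrightarrow> represents (yamada D) D"
proof -
  define R where "R = (\<lambda>D. if marked_diagram D then THE r. represents r D else 0)"
  have R: "represents (R D) D" if "marked_diagram D" for D
    unfolding R_def using that represents_exists[OF that] represents_unique by (auto intro!: theI2[of "\<lambda>r. represents r D"])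
  have Req: "R D = r" if "marked_diagram D" "represents r D" for D r
    by (rule represents_unique[OF R[OF that(1)] that(2)])
  have "yamada_rules R"
    unfolding yamada_rules_def
  proof (intro conjI allI impI)
    fix u v i T T'
    assume T: "(T, T') \<in> {([Vertex i 1 1], []), ([Vertex i 0 2], [Cup i]), ([Vertex i 2 0], [Cap i])}"
      and D: "marked_diagram (u @ T @ v)" "marked_diagram (u @ T' @ v)"
      and m: "marked (u @ T @ v) (leg (u @ T @ v) (length u, 0)) = marked (u @ T @ v) (leg (u @ T @ v) (length u, 1))"
    show "R (u @ T @ v) = R (u @ T' @ v)"
      by (rule Req[OF D(1)]) (use represents_absorb[OF T D m] R[OF D(2)] in blast)
  next
    fix u v c i
    assume c: "c \<noteq> Virtual" and D: "marked_diagram (u @ [Cross c i] @ v)"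
    have md: "marked_diagram (u @ v)" "marked_diagram (u @ [Cap i, Cup i] @ v)" "marked_diagram (u @ [Vertex i 2 2] @ v)"
      using crossing_replaced[OF D c] by blast+
    then have "marked_diagram (u @ A_smoothing c i @ v)" "marked_diagram (u @ B_smoothing c i @ v)"
      using c by (cases c; simp)+
    then show "R (u @ [Cross c i] @ v) = monomial 1 0 * R (u @ A_smoothing c i @ v)
        + monomial (- 1) 0 * R (u @ B_smoothing c i @ v) + monomial 0 (- 1) * R (u @ [Vertex i 2 2] @ v)"
      by (intro Req[OF D] represents_crossing[OF D c] R md)
  next
    fix u v i
    assume D: "marked_diagram (u @ v)" "(length u, i) \<in> points (u @ v)" "\<not> on_circle (u @ v) (length u, i)"
      "\<not> marked (u @ v) (length u, i)" "\<not> carries_classical (u @ v) (length u, i)"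
    show "R (u @ v) = monomial 0 1 * R (delete_edge (length u, i) (u @ v)) + R (u @ [Mark i] @ v)"
      by (intro Req[OF D(1)] represents_edge[OF D] R flagged_delete(2)[OF D(1,4,5)] marked_diagram_mark[OF D(1,2,5)])
  next
    fix D bc k
    assume D: "marked_diagram D" "\<forall>c i. Cross c i \<in> set D \<longrightarrow> c = Virtual" "\<forall>P \<in> points D. marked D P \<and> \<not> on_circle D P"
      and bk: "bc = boundary_components (cyclic_graph_of D)" "k = components (cyclic_graph_of D)"
    show "R D = neg_x_power (int bc - 2 * int k) * (monomial 1 0 + monomial (- 1) 0 + 2) ^ (bc - k)"
      unfolding bk by (intro Req[OF D(1)] represents_states[OF D])
  next
    fix D assume "\<not> marked_diagram D"
    then show "R D = 0" by (simp add: R_def)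
  qed
  moreover have "yamada = R"
    unfolding yamada_def using \<open>yamada_rules R\<close> yamada_rules_unique by blast
  ultimately show "yamada_rules yamada" "marked_diagram D \<Longrightarrow> represents (yamada D) D"
    using R by simp_all
qed

section \<open>Invariance\<close>

text \<open>
  The exponent of \<open>\<alpha>\<close> in the weight of the crossing.
\<close>

fun writhe :: "crossing \<Rightarrow> int" where
  "writhe Rising = 1"
| "writhe Falling = - 1"
| "writhe Virtual = 0"

lemma (in colour_model) par_writhe:
  assumes "c \<noteq> Virtual"
  shows "- par c = (- \<alpha>) powi writhe c"
    and "(par c)\<^sup>2 = (- \<alpha>) powi (writhe c * 2)"
    and "(1 / par c)\<^sup>2 = (- \<alpha>) powi (- writhe c * 2)"
    and "- 1 / par c = (- \<alpha>) powi (- writhe c)"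
    and "(- 1 / par c) ^ n = (- \<alpha>) powi (- writhe c * int n)"
proof -
  show 1: "- par c = (- \<alpha>) powi writhe c"
    using assms by (cases c) (simp_all add: par_def power_int_minus divide_inverse)
  show 2: "- 1 / par c = (- \<alpha>) powi (- writhe c)"
    unfolding power_int_minus 1[symmetric] by (simp add: divide_inverse)
  show "(par c)\<^sup>2 = (- \<alpha>) powi (writhe c * 2)"
    unfolding power_int_mult 1[symmetric] by simp
  show "(1 / par c)\<^sup>2 = (- \<alpha>) powi (- writhe c * 2)"
    unfolding power_int_mult 2[symmetric] by (simp add: power_divide)
  show "(- 1 / par c) ^ n = (- \<alpha>) powi (- writhe c * int n)"
    unfolding power_int_mult 2[symmetric] by simp
qed

text \<open>
  The exponent does not depend on the model, so that the factor is the value of a Laurent polynomial.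
\<close>

definition scales :: "layer list \<Rightarrow> layer list \<Rightarrow> int \<Rightarrow> bool" where
  "scales T T' k \<longleftrightarrow> (\<forall>(B0 :: (nat \<times> nat \<times> nat) set) e tr \<kappa> N K \<alpha>. colour_model B0 e tr \<kappa> N K \<alpha> \<longrightarrow>
     colour_model.proportional B0 e tr K \<alpha> T T' ((- \<alpha>) powi k))"

lemma scalesI:
  assumes "\<And>(B0 :: (nat \<times> nat \<times> nat) set) e tr \<kappa> N K \<alpha>. colour_model B0 e tr \<kappa> N K \<alpha> \<Longrightarrow>
     colour_model.proportional B0 e tr K \<alpha> T T' ((- \<alpha>) powi k)"
  shows "\<exists>k. scales T T' k"
  using assms unfolding scales_def by blast

lemma scalesI_one:
  assumes "\<And>(B0 :: (nat \<times> nat \<times> nat) set) e tr \<kappa> N K \<alpha>. colour_model B0 e tr \<kappa> N K \<alpha> \<Longrightarrow>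
     colour_model.proportional B0 e tr K \<alpha> T T' 1"
  shows "\<exists>k. scales T T' k"
  by (rule scalesI[where k = 0]) (simp add: assms)

lemma rigid_move_scales: "rigid_move T T' \<Longrightarrow> \<exists>k. scales T T' k"
proof (induction rule: rigid_move.induct)
  case (planar T T')
  then show ?case by (intro scalesI_one colour_model.planar_proportional)
next
  case (I_right c)
  show ?case
  proof (rule scalesI[where k = "writhe c * 2"])
    fix B0 :: "(nat \<times> nat \<times> nat) set" and e tr \<kappa> N K \<alpha>
    assume "colour_model B0 e tr \<kappa> N K \<alpha>"
    then interpret colour_model B0 e tr \<kappa> N K \<alpha> .
    show "proportional [Cup 1, Cross c 0, Cap 1] [] ((- \<alpha>) powi (writhe c * 2))"
      using kink_right_proportional[OF I_right] unfolding par_writhe(2)[OF I_right] .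
  qed
next
  case (I_left c)
  show ?case
  proof (rule scalesI[where k = "writhe c * 2"])
    fix B0 :: "(nat \<times> nat \<times> nat) set" and e tr \<kappa> N K \<alpha>
    assume "colour_model B0 e tr \<kappa> N K \<alpha>"
    then interpret colour_model B0 e tr \<kappa> N K \<alpha> .
    show "proportional [Cup 0, Cross c 1, Cap 0] [] ((- \<alpha>) powi (writhe c * 2))"
      using kink_left_proportional[OF I_left] unfolding par_writhe(2)[OF I_left] .
  qed
next
  case (II c)
  then show ?case by (intro scalesI_one colour_model.II_proportional)
next
  case (III a b c)
  then show ?case by (intro scalesI_one colour_model.III_proportional)
next
  case (IV_right c m n)
  show ?case by (intro scalesI_one colour_model.sweep_vertex_proportional)
next
  case (IV_left c m n)
  show ?case by (intro scalesI_one colour_model.sweep_left_vertex_proportional)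
next
  case (V c n)
  show ?case
  proof (rule scalesI[where k = "- writhe c * int n"])
    fix B0 :: "(nat \<times> nat \<times> nat) set" and e tr \<kappa> N K \<alpha>
    assume "colour_model B0 e tr \<kappa> N K \<alpha>"
    then interpret colour_model B0 e tr \<kappa> N K \<alpha> .
    show "proportional (Vertex 0 0 n # half_twist c n) [Vertex 0 0 n] ((- \<alpha>) powi (- writhe c * int n))"
      using V_proportional[OF V, of n] unfolding par_writhe(5)[OF V] .
  qed
next
  case I_star_right
  show ?case by (intro scalesI_one colour_model.virtual_proportional(1))
next
  case I_star_left
  show ?case by (intro scalesI_one colour_model.virtual_proportional(2))
next
  case II_star
  show ?case by (intro scalesI_one colour_model.virtual_proportional(3))
next
  case III_star
  show ?case by (intro scalesI_one colour_model.virtual_proportional(4))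
next
  case (IV_star_1 c)
  then show ?case by (intro scalesI_one colour_model.virtual_proportional(5))
next
  case (IV_star_2 c)
  then show ?case by (intro scalesI_one colour_model.virtual_proportional(6))
next
  case (IV_star_3 c)
  then show ?case by (intro scalesI_one colour_model.virtual_proportional(7))
next
  case (V_star_right m n)
  show ?case by (intro scalesI_one colour_model.sweep_vertex_proportional)
next
  case (V_star_left m n)
  show ?case by (intro scalesI_one colour_model.sweep_left_vertex_proportional)
qed

fun layer_degrees :: "layer \<Rightarrow> nat set" where
  "layer_degrees (Vertex i m n) = {m + n}"
| "layer_degrees l = {}"

text \<open>
  Unlike the maximum, the set of degrees is compatible with composing words.
\<close>

definition degrees :: "layer list \<Rightarrow> nat set" where
  "degrees w = (\<Union>l\<in>set w. layer_degrees l)"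

lemma degrees_simps [simp]: "degrees [] = {}" "degrees (l # w) = layer_degrees l \<union> degrees w"
  "degrees (u @ v) = degrees u \<union> degrees v"
  by (auto simp: degrees_def)

lemma layer_degrees_place [simp]: "layer_degrees (place j l) = layer_degrees l"
  by (cases l) auto

lemma degrees_shift [simp]: "degrees (shift d w) = degrees w"
  by (induction w) simp_all

lemma degrees_crossings [simp]: "degrees (sweep_right c m) = {}" "degrees (sweep_left c m) = {}" "degrees (half_twist c m) = {}"
proof -
  show 1: "degrees (sweep_right c m) = {}" for m by (auto simp: degrees_def sweep_right_def)
  show "degrees (sweep_left c m) = {}" by (auto simp: degrees_def sweep_left_def)
  show "degrees (half_twist c m) = {}" by (induction m) (simp_all add: 1)
qed

lemma finite_degrees: "finite (degrees w)"
proof -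
  have "finite (layer_degrees l)" for l by (cases l) auto
  then show ?thesis by (simp add: degrees_def)
qed

lemma max_degree_degrees: "max_degree D = Max (insert 0 (degrees D))"
proof -
  have "x \<in> degrees D \<longleftrightarrow> (\<exists>i m n. x = m + n \<and> Vertex i m n \<in> set D)" for x
  proof
    assume "x \<in> degrees D"
    then obtain l where "l \<in> set D" "x \<in> layer_degrees l" by (auto simp: degrees_def)
    then show "\<exists>i m n. x = m + n \<and> Vertex i m n \<in> set D" by (cases l rule: layer.exhaust) auto
  next
    assume "\<exists>i m n. x = m + n \<and> Vertex i m n \<in> set D"
    then show "x \<in> degrees D" by (force simp: degrees_def)
  qed
  then have "degrees D = {m + n | i m n. Vertex i m n \<in> set D}" by blast
  then show ?thesis by (simp add: max_degree_def)
qed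

lemma move_degrees: "pliable_move T T' \<Longrightarrow> degrees T = degrees T'"
proof (induction rule: pliable_move.induct)
  case (rigid T T')
  then show ?case
  proof (induction rule: rigid_move.induct)
    case (planar T T')
    then show ?case by (induction rule: planar_move.induct) auto
  qed auto
qed auto

lemma move_nonempty: "pliable_move T T' \<Longrightarrow> T \<noteq> [] \<or> T' \<noteq> []"
proof (induction rule: pliable_move.induct)
  case (rigid T T')
  then show ?case
  proof (induction rule: rigid_move.induct)
    case (planar T T')
    then show ?case by (induction rule: planar_move.induct) auto
  qed auto
qed auto

lemma pliable_move_scales:
  assumes "pliable_move T T'" "\<And>x. x \<in> degrees T \<Longrightarrow> x \<le> 3"
  shows "\<exists>k. scales T T' k"
  using assms
proof (induction rule: pliable_move.induct)
  case (rigid T T')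
  then show ?case by (intro rigid_move_scales)
next
  case (VI c j n m)
  have le: "m + n \<le> 3" using VI(3)[of "m + n"] by simp
  show ?case
  proof (rule scalesI[where k = "if m + n = 2 then - writhe c * 2 else - writhe c"])
    fix B0 :: "(nat \<times> nat \<times> nat) set" and e tr \<kappa> N K \<alpha>
    assume "colour_model B0 e tr \<kappa> N K \<alpha>"
    then interpret colour_model B0 e tr \<kappa> N K \<alpha> .
    have "(if m + n = 2 then (1 / par c)\<^sup>2 else - 1 / par c) = (- \<alpha>) powi (if m + n = 2 then - writhe c * 2 else - writhe c)"
      using par_writhe(3,4)[OF VI(1)] by (simp only: if_split) simp
    then show "proportional [Vertex 0 m n, Cross c j] [Vertex 0 m n] ((- \<alpha>) powi (if m + n = 2 then - writhe c * 2 else - writhe c))"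
      using VI_proportional[OF VI(1,2) le] by (simp only:)
  qed
qed

lemma neg_alpha_power_mult: "neg_alpha_power j * neg_alpha_power k = neg_alpha_power (j + k)"
proof -
  have "monomial j 0 * monomial k 0 = monomial (j + k) 0" by (simp add: monomial_def mult_single)
  then show ?thesis by (simp add: neg_alpha_power_def)
qed

lemma neg_alpha_power_0: "neg_alpha_power 0 = 1"
  using single_one[where 'a = "int \<times> int" and 'b = int] by (simp add: neg_alpha_power_def monomial_def zero_prod_def)

lemma neg_alpha_power_inverse: "neg_alpha_power (- k) * (neg_alpha_power k * r) = r"
  by (simp add: mult.assoc[symmetric] neg_alpha_power_mult neg_alpha_power_0)

lemma keys_neg_alpha_power_mult: "keys (neg_alpha_power k * r) = (\<lambda>(a, b). (k + a, b)) ` keys r"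
proof -
  have sub: "keys (neg_alpha_power k * r) \<subseteq> (\<lambda>(a, b). (k + a, b)) ` keys r" for k r
  proof
    fix x assume "x \<in> keys (neg_alpha_power k * r)"
    then obtain y z where x: "x = y + z" "y \<in> keys (neg_alpha_power k)" "z \<in> keys r"
      using keys_mult[of "neg_alpha_power k" r] by blast
    have "y = (k, 0)" using x(2) by (auto simp: neg_alpha_power_def monomial_def split: if_splits)
    then show "x \<in> (\<lambda>(a, b). (k + a, b)) ` keys r" using x(1,3) by (cases z) force
  qed
  have "keys r \<subseteq> (\<lambda>(a, b). (- k + a, b)) ` keys (neg_alpha_power k * r)"
    using sub[of "- k" "neg_alpha_power k * r"] by (simp only: neg_alpha_power_inverse)
  then have "(\<lambda>(a, b). (k + a, b)) ` keys r \<subseteq> keys (neg_alpha_power k * r)" by force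
  with sub show ?thesis by blast
qed

text \<open>
  The factor shifts the lowest exponent of \<open>\<alpha>\<close> by \<open>k\<close>, which the normalization undoes, including the sign.
\<close>

lemma normalized_yamada_eqI:
  assumes "yamada D = neg_alpha_power k * yamada D'"
  shows "normalized_yamada D = normalized_yamada D'"
proof (cases "yamada D' = 0")
  case True
  then show ?thesis using assms by (simp add: normalized_yamada_def)
next
  case False
  have ne: "keys (yamada D') \<noteq> {}" using False by simp
  have "yamada D' = neg_alpha_power (- k) * yamada D" by (simp add: assms neg_alpha_power_inverse)
  then have D: "yamada D \<noteq> 0" using False by auto
  have "fst ` keys (yamada D) = (\<lambda>x. k + x) ` (fst ` keys (yamada D'))"
    unfolding assms keys_neg_alpha_power_mult by force
  moreover have "k + Min (fst ` keys (yamada D')) = Min ((\<lambda>x. k + x) ` (fst ` keys (yamada D')))"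
    by (rule mono_Min_commute) (use ne in \<open>auto simp: mono_def\<close>)
  ultimately have "min_degree (yamada D) = k + min_degree (yamada D')"
    by (simp only: min_degree_def)
  then show ?thesis
    using False D by (simp add: normalized_yamada_def assms mult.assoc[symmetric] neg_alpha_power_mult)
qed

lemma not_marked_diagram: "diagram D \<Longrightarrow> marked D = (\<lambda>_. False)"
  using nth_mem[of _ D] unfolding marked_def diagram_def by fastforce

lemma diagram_marked_diagram: "diagram D \<Longrightarrow> marked_diagram D"
  using not_marked_diagram[of D] by (simp add: marked_diagram_def diagram_def)

lemma (in colour_model) F_diagram:
  assumes "diagram D" shows "F D = val D (\<lambda>_. 1) []"
proof -
  have "annot (\<lambda>_. False) t w = map (\<lambda>l. (l, replicate (outs l) False)) w" for t w
    by (induction w arbitrary: t) (simp_all add: map_replicate_const)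
  then show ?thesis by (simp add: F_def flagged_def not_marked_diagram[OF assms] val_def)
qed

text \<open>
  Both sides represent the first diagram.
\<close>

lemma scales_yamada:
  assumes D: "diagram (u @ shift d T @ v)" "diagram (u @ shift d T' @ v)" and T: "scales T T' k" "T \<noteq> [] \<or> T' \<noteq> []"
  shows "yamada (u @ shift d T @ v) = neg_alpha_power k * yamada (u @ shift d T' @ v)"
proof (rule represents_unique)
  let ?D = "u @ shift d T @ v" and ?D' = "u @ shift d T' @ v"
  show "represents (yamada ?D) ?D" by (rule yamada_represents(2)[OF diagram_marked_diagram[OF D(1)]])
  have r: "represents (yamada ?D') ?D'" by (rule yamada_represents(2)[OF diagram_marked_diagram[OF D(2)]])
  have f: "fits 0 ?D" "fits 0 ?D'" using D by (simp_all only: diagram_def planar_word_iff)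
  show "represents (neg_alpha_power k * yamada ?D') ?D"
  proof (rule representsI)
    fix B0 :: "(nat \<times> nat \<times> nat) set" and e M n q \<kappa> \<alpha>
    assume m: "2 \<le> n" "1 \<le> q" "matrix_colour_model B0 e M n q \<kappa> \<alpha>"
    interpret matrix_colour_model B0 e M n q \<kappa> \<alpha> by fact
    have x: "- 1 / (of_nat q * of_nat n :: complex) \<noteq> 0" using m by simp
    have "proportional T T' ((- \<alpha>) powi k)"
      using T(1) colour_model_axioms unfolding scales_def by blast
    then have "F ?D = (- \<alpha>) powi k * F ?D'"
      unfolding F_diagram[OF D(1)] F_diagram[OF D(2)] using proportional_context[OF _ f T(2)] by blast
    then show "evaluate \<alpha> (- 1 / (of_nat q * of_nat n)) (neg_alpha_power k * yamada ?D') = F ?D"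
      unfolding evaluate_mult[OF alpha_n(1) x] evaluate_neg_alpha_power representsD[OF r m] by (simp only:)
  qed
qed

lemma locally_normalized_yamada:
  assumes "locally r D D'" "\<And>T T'. r T T' \<Longrightarrow> pliable_move T T'"
    and "\<And>T T'. r T T' \<Longrightarrow> degrees T \<subseteq> degrees D \<Longrightarrow> \<exists>k. scales T T' k"
  shows "normalized_yamada D = normalized_yamada D'" and "degrees D = degrees D'"
proof -
  obtain u v d T T' where m: "r T T'" and eq: "D = u @ shift d T @ v" "D' = u @ shift d T' @ v"
    and D: "diagram D" "diagram D'"
    using assms(1) unfolding locally_def by blast
  obtain k where k: "scales T T' k" using assms(3)[OF m] by (auto simp: eq)
  show "normalized_yamada D = normalized_yamada D'"
    unfolding eq
    by (rule normalized_yamada_eqI[OF scales_yamada[OF D[unfolded eq] k move_nonempty[OF assms(2)[OF m]]]])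
  show "degrees D = degrees D'" by (simp add: eq move_degrees[OF assms(2)[OF m]])
qed

lemma rigid_isotopic_normalized_yamada: "rigid_isotopic D D' \<Longrightarrow> normalized_yamada D = normalized_yamada D'"
  unfolding rigid_isotopic_def
proof (rule equivclp_invariant[where f = normalized_yamada])
  fix D D' assume "locally rigid_move D D'"
  then show "normalized_yamada D = normalized_yamada D'"
    by (rule locally_normalized_yamada(1)) (auto intro: pliable_move.rigid rigid_move_scales)
qed

text \<open>
  Moves preserve vertex degrees, so that all diagrams in a chain of moves have the same maximal degree, and every sixth move in
  the chain takes place at a vertex of degree at most three.
\<close>

lemma pliable_isotopic_normalized_yamada:
  assumes "pliable_isotopic D D'"
  shows "max_degree D = max_degree D'" and "max_degree D \<le> 3 \<Longrightarrow> normalized_yamada D = normalized_yamada D'"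
proof -
  define f where "f = (\<lambda>D. (degrees D, if max_degree D \<le> 3 then normalized_yamada D else 0))"
  have "f D = f D'"
    using assms unfolding pliable_isotopic_def
  proof (rule equivclp_invariant)
    fix D D' assume m: "locally pliable_move D D'"
    obtain u v d T T' where "pliable_move T T'" "D = u @ shift d T @ v" "D' = u @ shift d T' @ v"
      using m unfolding locally_def by blast
    then have deg: "degrees D = degrees D'" using move_degrees by simp
    then have md: "max_degree D = max_degree D'" by (simp add: max_degree_degrees)
    have "normalized_yamada D = normalized_yamada D'" if le: "max_degree D \<le> 3"
    proof (rule locally_normalized_yamada(1)[OF m])
      fix T T' assume T: "pliable_move T T'" "degrees T \<subseteq> degrees D"
      have "x \<le> 3" if "x \<in> degrees T" for x
      proof -
        have "x \<le> max_degree D"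
          unfolding max_degree_degrees using T(2) that finite_degrees by (intro Max_ge) auto
        then show ?thesis using le by simp
      qed
      then show "\<exists>k. scales T T' k" by (rule pliable_move_scales[OF T(1)])
    qed
    then show "f D = f D'" using deg md by (simp add: f_def)
  qed
  then show md: "max_degree D = max_degree D'" by (simp add: f_def max_degree_degrees)
  show "normalized_yamada D = normalized_yamada D'" if "max_degree D \<le> 3"
    using \<open>f D = f D'\<close> that md by (simp add: f_def)
qed

theorem theorem3p10:
  shows "(\<forall>G \<in> rigid_virtual_spatial_graphs. \<forall>D \<in> G. \<forall>D' \<in> G.
            normalized_yamada D = normalized_yamada D') \<and>
         (\<forall>G \<in> pliable_virtual_spatial_graphs. \<forall>D \<in> G. \<forall>D' \<in> G.
            max_degree D \<le> 3 \<longrightarrow> normalized_yamada D = normalized_yamada D')"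
proof (intro conjI ballI impI)
  fix G D D' assume G: "G \<in> rigid_virtual_spatial_graphs" "D \<in> G" "D' \<in> G"
  then obtain C where "rigid_isotopic C D" "rigid_isotopic C D'"
    unfolding rigid_virtual_spatial_graphs_def by (elim quotientE) auto
  then show "normalized_yamada D = normalized_yamada D'"
    using rigid_isotopic_normalized_yamada by metis
next
  fix G D D' assume G: "G \<in> pliable_virtual_spatial_graphs" "D \<in> G" "D' \<in> G" and le: "max_degree D \<le> 3"
  then obtain C where C: "pliable_isotopic C D" "pliable_isotopic C D'"
    unfolding pliable_virtual_spatial_graphs_def by (elim quotientE) auto
  then have "max_degree C \<le> 3" using le pliable_isotopic_normalized_yamada(1) by metis
  then show "normalized_yamada D = normalized_yamada D'"
    using C pliable_isotopic_normalized_yamada(2) by metis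
qed

end
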